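(* Let $\mu\leq\nu\leq\kappa$ be uncountable regular cardinals and $\lambda$ a cardinal with $\lambda^{<\kappa}=\lambda$. Let $c\in\omega^\omega$ with $c\geq2$ and $c$ converging to infinity, let $P=\{a_i\}_{i<\omega}$ be a partition of $\omega$ into nonempty finite sets, and let $\mathcal{I}=\mathcal{I}_c(P)$; assume $\mathcal{I}$ is non-trivial. Then there is a ccc poset forcing $\mathrm{add}(\mathcal{N})=\mu$, $\mathfrak{b}(\mathcal{I})=\nu$, $\mathfrak{b}=\kappa$ and $\mathfrak{c}=\lambda$.
   Context: $\mathcal{I}_c(P)=\{x\subseteq\omega: \{\log_{c(i)}(|x\cap a_i|+1)\}_{i<\omega}\text{ is bounded}\}$; it is non-trivial iff for every $k$ there are infinitely many $i$ with $|a_i|\geq c(i)^k$. $\mathrm{add}(\mathcal{N})$ is the additivity of the Lebesgue null ideal, $\mathfrak{b}$ the bounding number, $\mathfrak{c}=2^{\aleph_0}$. For an ideal $\mathcal{I}$ and $A,B\subseteq\omega$, $A\subseteq_{\mathcal{I}}B$ iff $A\smallsetminus B\in\mathcal{I}$. A pair $\langle\mathcal{A},\mathcal{B}\rangle$ is $\mathcal{I}$-orthogonal if $A\cap B\in\mathcal{I}$ for all $A\in\mathcal{A},B\in\mathcal{B}$; $C$ separates it if $A\cap C\in\mathcal{I}$ for all $A\in\mathcal{A}$ and $B\subseteq_{\mathcal{I}}C$ for all $B\in\mathcal{B}$; an $\mathcal{I}$-gap is an unseparated $\mathcal{I}$-orthogonal pair. $\mathfrak{b}(\mathcal{I})$ is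 the least $\lambda$ such that there is an $\mathcal{I}$-gap $\langle\mathcal{A},\mathcal{B}\rangle$ with $|\mathcal{A}|=\aleph_0$, $|\mathcal{B}|=\lambda$. *)

theory Defs
  imports "HOL-Analysis.Analysis" "HOL-Library.Countable" "HOL-Library.Infinite_Set"
begin

unbundle cardinal_syntax

section \<open>Cardinals of the ground model\<close>

text \<open>
  Cardinals are cardinal orders on subsets of some type. \<open>pow_less \<lambda> \<kappa>\<close> is the cardinality of the set
  of all sequences of length less than \<open>\<kappa>\<close> with values in \<open>\<lambda>\<close>; the length is recorded explicitly, as
  \<^const>\<open>Func\<close> consists of total functions that are \<^const>\<open>undefined\<close> off their domain.
\<close>

definition pow_less :: "'u rel \<Rightarrow> 'u rel \<Rightarrow> ('u \<times> ('u \<Rightarrow> 'u)) rel" where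
  "pow_less l k = |SIGMA b : Field k. Func (underS k b) (Field l)|"

section \<open>The ideal\<close>

definition index_partition :: "(nat \<Rightarrow> nat set) \<Rightarrow> bool" where
  "index_partition a \<longleftrightarrow>
     disjoint_family a \<and> (\<Union>i. a i) = UNIV \<and> (\<forall>i. finite (a i) \<and> a i \<noteq> {})"

definition Ic :: "(nat \<Rightarrow> nat) \<Rightarrow> (nat \<Rightarrow> nat set) \<Rightarrow> nat set set" where
  "Ic c a = {x. bounded (range (\<lambda>i. log (real (c i)) (real (card (x \<inter> a i)) + 1)))}"

definition Ic_nontrivial :: "(nat \<Rightarrow> nat) \<Rightarrow> (nat \<Rightarrow> nat set) \<Rightarrow> bool" where
  "Ic_nontrivial c a \<longleftrightarrow> (\<forall>k. \<exists>\<^sub>\<infinity>i. c i ^ k \<le> card (a i))"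

lemma Ic_iff:
  assumes "\<And>i. 2 \<le> c i"
  shows "x \<in> Ic c a \<longleftrightarrow> (\<exists>k::nat. \<forall>i. log (real (c i)) (real (card (x \<inter> a i)) + 1) \<le> real k)"
proof -
  have c: "1 < real (c i)" for i using assms[of i] by simp
  have nonneg: "0 \<le> log (real (c i)) (real m + 1)" for i m
    using c[of i] by (simp add: zero_le_log_cancel_iff)
  show ?thesis
  proof
    assume "x \<in> Ic c a"
    then obtain b where b: "\<And>i. \<bar>log (real (c i)) (real (card (x \<inter> a i)) + 1)\<bar> \<le> b"
      unfolding Ic_def bounded_iff by (auto simp only: mem_Collect_eq ball_simps real_norm_def)
    obtain k :: nat where k: "b \<le> real k" using real_arch_simple by blast
    have "log (real (c i)) (real (card (x \<inter> a i)) + 1) \<le> real k" for i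
      using b[of i] k by linarith
    then show "\<exists>k::nat. \<forall>i. log (real (c i)) (real (card (x \<inter> a i)) + 1) \<le> real k"
      by blast
  next
    assume "\<exists>k::nat. \<forall>i. log (real (c i)) (real (card (x \<inter> a i)) + 1) \<le> real k"
    then obtain k :: nat
      where k: "\<And>i. log (real (c i)) (real (card (x \<inter> a i)) + 1) \<le> real k"
      by blast
    have "norm (log (real (c i)) (real (card (x \<inter> a i)) + 1)) \<le> real k" for i
      using k[of i] nonneg[of i "card (x \<inter> a i)"] by (simp only: real_norm_def abs_of_nonneg)
    then have "bounded (range (\<lambda>i. log (real (c i)) (real (card (x \<inter> a i)) + 1)))"
      by (intro boundedI[of _ "real k"]) (erule rangeE, simp only:)
    then show "x \<in> Ic c a" by (simp only: Ic_def mem_Collect_eq)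
  qed
qed

text \<open>Non-triviality says that the ideal is proper.\<close>

lemma Ic_nontrivial_iff:
  assumes c: "\<And>i. 2 \<le> c i"
  shows "Ic_nontrivial c a \<longleftrightarrow> UNIV \<notin> Ic c a"
proof -
  have le_iff: "log (real (c i)) (real m + 1) \<le> real k \<longleftrightarrow> m < c i ^ k" for i m k
  proof -
    have "log (real (c i)) (real m + 1) \<le> real k \<longleftrightarrow> real m + 1 \<le> real (c i) powr real k"
      using c[of i] by (subst log_le_iff) auto
    also have "\<dots> \<longleftrightarrow> real (m + 1) \<le> real (c i ^ k)"
      using c[of i] by (subst powr_realpow) auto
    finally show ?thesis unfolding of_nat_le_iff by auto
  qed
  have in_iff: "UNIV \<in> Ic c a \<longleftrightarrow> (\<exists>k. \<forall>i. card (a i) < c i ^ k)"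
    using Ic_iff[OF c] by (simp add: le_iff)
  show ?thesis
  proof
    assume "Ic_nontrivial c a"
    then have "\<exists>i. c i ^ k \<le> card (a i)" for k
      unfolding Ic_nontrivial_def by (blast dest: INFM_EX)
    then show "UNIV \<notin> Ic c a" unfolding in_iff by (meson not_le)
  next
    assume notin: "UNIV \<notin> Ic c a"
    show "Ic_nontrivial c a"
    proof (rule ccontr)
      assume "\<not> Ic_nontrivial c a"
      then obtain k where "finite {i. c i ^ k \<le> card (a i)}"
        unfolding Ic_nontrivial_def INFM_iff_infinite by auto
      then have "finite ((\<lambda>i. card (a i)) ` {i. c i ^ k \<le> card (a i)})"
        by (rule finite_imageI)
      then obtain b where "\<forall>m \<in> (\<lambda>i. card (a i)) ` {i. c i ^ k \<le> card (a i)}. m \<le> b"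
        unfolding finite_nat_set_iff_bounded_le by blast
      then have b: "\<And>i. c i ^ k \<le> card (a i) \<Longrightarrow> card (a i) \<le> b"
        by blast
      have "card (a i) < c i ^ (k + b + 1)" for i
      proof (cases "c i ^ k \<le> card (a i)")
        case True
        have "card (a i) < 2 ^ (b + 1)"
          using b[OF True] less_exp[of "b + 1"] by linarith
        also have "\<dots> \<le> c i ^ (b + 1)" using c[of i] by (rule power_mono) simp
        also have "\<dots> \<le> c i ^ (k + b + 1)" using c[of i] by (intro power_increasing) auto
        finally show ?thesis .
      next
        case False
        then have "card (a i) < c i ^ k" by simp
        also have "\<dots> \<le> c i ^ (k + b + 1)" using c[of i] by (intro power_increasing) auto
        finally show ?thesis .
      qed
      then show False using notin in_iff by blast
    qed
  qed
qed

section \<open>Names\<close>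

text \<open>
  A name is a set of pairs of names and conditions. For the names to form a type, their size has to be
  bounded; the bound is the cardinality of the double power set of the type of conditions. Let \<open>\<theta>\<close> be the
  successor of this cardinal, and assume the type of conditions to be infinite. Then these names are, up to
  encoding, those of hereditary cardinality less than \<open>\<theta>\<close>, and they denote the elements of \<open>H(\<theta>)\<close> of the
  extension. All sets of reals of the extension, all families of such sets, and all functions between these
  and ordinals of cardinality at most that of the type of conditions belong to this \<open>H(\<theta>)\<close>; the formulas below
  mention nothing beyond that, so they are absolute between \<open>H(\<theta>)\<close> and the extension.
\<close>

datatype 'p name = Name "'p set set \<Rightarrow> ('p name \<times> 'p) option"

primrec elems :: "'p name \<Rightarrow> ('p name \<times> 'p) set" where
  "elems (Name f) = ran f"

lemma wf_elems: "wf {(\<pi>, \<sigma>). \<exists>s. (\<pi>, s) \<in> elems \<sigma>}"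
proof (rule wfUNIVI)
  fix Q :: "'a name \<Rightarrow> bool" and x
  assume hyp: "\<forall>x. (\<forall>y. (y, x) \<in> {(\<pi>, \<sigma>). \<exists>s. (\<pi>, s) \<in> elems \<sigma>} \<longrightarrow> Q y) \<longrightarrow> Q x"
  show "Q x"
  proof (induction x)
    case (Name f)
    have "Q y" if y: "(y, s) \<in> ran f" for y s
    proof -
      obtain i where "f i = Some (y, s)" using y by (auto simp: ran_def)
      then have "Some (y, s) \<in> range f" by (metis rangeI)
      then show ?thesis
        by (rule Name[of _ "(y, s)"]) (auto simp: prod_set_defs)
    qed
    then have "\<forall>y. (y, Name f) \<in> {(\<pi>, \<sigma>). \<exists>s. (\<pi>, s) \<in> elems \<sigma>} \<longrightarrow> Q y"
      by simp blast
    with hyp show ?case by blast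
  qed
qed

definition mk_name :: "('p name \<times> 'p) set \<Rightarrow> 'p name" where
  "mk_name S = (SOME \<tau>. elems \<tau> = S)"

lemma elems_mk_name:
  fixes S :: "('p name \<times> 'p) set"
  assumes "|S| \<le>o |UNIV :: 'p set set set|"
  shows "elems (mk_name S) = S"
proof -
  obtain g :: "('p name \<times> 'p) \<Rightarrow> 'p set set" where g: "inj_on g S"
    using assms card_of_ordLeq[of S "UNIV :: 'p set set set"] by blast
  define f where "f i = (if i \<in> g ` S then Some (the_inv_into S g i) else None)" for i
  have "ran f = S"
  proof (intro equalityI subsetI)
    fix x assume "x \<in> ran f"
    then obtain i where "f i = Some x" by (auto simp only: ran_def mem_Collect_eq)
    then show "x \<in> S"
      using the_inv_into_into[OF g, of i S] by (simp add: f_def split: if_splits)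
  next
    fix x assume "x \<in> S"
    then have "f (g x) = Some x" by (simp add: f_def the_inv_into_f_f[OF g])
    then show "x \<in> ran f" by (rule ranI)
  qed
  then have "elems (Name f) = S" by simp
  then show ?thesis unfolding mk_name_def by (rule someI)
qed

text \<open>
  In check names every element carries all conditions; this avoids a largest condition. Conditions
  outside the forcing have no influence on the forcing relation.
\<close>

definition check_set :: "'p name set \<Rightarrow> 'p name" where
  "check_set S = mk_name (S \<times> UNIV)"

definition check_pair :: "'p name \<Rightarrow> 'p name \<Rightarrow> 'p name" where
  "check_pair \<sigma> \<tau> = check_set {check_set {\<sigma>}, check_set {\<sigma>, \<tau>}}"

text \<open>
  \<open>check_elt r b\<close> is the check name of the von Neumann ordinal that is the order type of the proper initial
  segment of the well-order \<open>r\<close> below \<open>b\<close>, and \<open>check_ord r\<close> that of the order type of \<open>r\<close>.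
\<close>

definition check_elt :: "'a rel \<Rightarrow> 'a \<Rightarrow> 'p name" where
  "check_elt r = wfrec (r - Id) (\<lambda>F b. check_set (F ` underS r b))"

definition check_ord :: "'a rel \<Rightarrow> 'p name" where
  "check_ord r = check_set (check_elt r ` Field r)"

abbreviation check_omega :: "'p name" where
  "check_omega \<equiv> check_ord natLeq"

abbreviation check_nat :: "nat \<Rightarrow> 'p name" where
  "check_nat \<equiv> check_elt natLeq"

definition check_rel :: "(nat \<times> nat) set \<Rightarrow> 'p name" where
  "check_rel R = check_set ((\<lambda>(m, n). check_pair (check_nat m) (check_nat n)) ` R)"

definition check_rel3 :: "(nat \<times> nat \<times> nat) set \<Rightarrow> 'p name" where
  "check_rel3 R =
     check_set ((\<lambda>(l, m, n). check_pair (check_pair (check_nat l) (check_nat m)) (check_nat n)) ` R)"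

section \<open>The forcing relation\<close>

text \<open>
  A forcing is a partial order \<open>P\<close> on the set \<^term>\<open>Field P\<close>; \<open>(q, p) \<in> P\<close> means that \<open>q\<close> is the stronger
  condition.
\<close>

definition ccc :: "'p rel \<Rightarrow> bool" where
  "ccc P \<longleftrightarrow> (\<forall>A \<subseteq> Field P.
     (\<forall>p\<in>A. \<forall>q\<in>A. p \<noteq> q \<longrightarrow> \<not> (\<exists>r. (r, p) \<in> P \<and> (r, q) \<in> P)) \<longrightarrow> countable A)"

function forces_eq :: "'p rel \<Rightarrow> 'p \<Rightarrow> 'p name \<Rightarrow> 'p name \<Rightarrow> bool" where
  "forces_eq P p \<sigma> \<tau> \<longleftrightarrow>
     (\<forall>(\<pi>, s) \<in> elems \<sigma>. \<forall>q. (q, p) \<in> P \<and> (q, s) \<in> P \<longrightarrow>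
        (\<exists>r. (r, q) \<in> P \<and> (\<exists>(\<rho>, t) \<in> elems \<tau>. (r, t) \<in> P \<and> forces_eq P r \<pi> \<rho>))) \<and>
     (\<forall>(\<rho>, t) \<in> elems \<tau>. \<forall>q. (q, p) \<in> P \<and> (q, t) \<in> P \<longrightarrow>
        (\<exists>r. (r, q) \<in> P \<and> (\<exists>(\<pi>, s) \<in> elems \<sigma>. (r, s) \<in> P \<and> forces_eq P r \<pi> \<rho>)))"
  by pat_completeness auto
termination
  by (relation "inv_image {(\<pi>, \<sigma>). \<exists>s. (\<pi>, s) \<in> elems \<sigma>} (\<lambda>(P, p, \<sigma>, \<tau>). \<sigma>)")
    (auto simp: wf_elems)

definition forces_mem :: "'p rel \<Rightarrow> 'p \<Rightarrow> 'p name \<Rightarrow> 'p name \<Rightarrow> bool" where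
  "forces_mem P p \<pi> \<tau> \<longleftrightarrow>
     (\<forall>q. (q, p) \<in> P \<longrightarrow>
        (\<exists>r. (r, q) \<in> P \<and> (\<exists>(\<sigma>, s) \<in> elems \<tau>. (r, s) \<in> P \<and> forces_eq P r \<pi> \<sigma>)))"

text \<open>Formulas of the language of set theory with parameters from \<open>'n\<close>, with quantification over \<open>'n\<close>.\<close>

datatype 'n fm =
    Mem 'n 'n  (infix "\<^bold>\<in>" 50)
  | Eq 'n 'n  (infix "\<^bold>=" 50)
  | Neg "'n fm"  ("\<^bold>\<not> _" [40] 40)
  | Conj "'n fm" "'n fm"  (infixr "\<^bold>\<and>" 35)
  | All "'n \<Rightarrow> 'n fm"  (binder "\<^bold>\<forall>" 10)

primrec forces :: "'p rel \<Rightarrow> 'p name fm \<Rightarrow> 'p \<Rightarrow> bool" where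
  "forces P (x \<^bold>\<in> y) = (\<lambda>p. forces_mem P p x y)"
| "forces P (x \<^bold>= y) = (\<lambda>p. forces_eq P p x y)"
| "forces P (\<^bold>\<not> \<phi>) = (\<lambda>p. \<forall>q. (q, p) \<in> P \<longrightarrow> \<not> forces P \<phi> q)"
| "forces P (\<phi> \<^bold>\<and> \<psi>) = (\<lambda>p. forces P \<phi> p \<and> forces P \<psi> p)"
| "forces P (All \<phi>) = (\<lambda>p. \<forall>\<tau>. forces P (\<phi> \<tau>) p)"

definition all_force :: "'p rel \<Rightarrow> 'p name fm \<Rightarrow> bool"  (infix "\<tturnstile>" 50) where
  "P \<tturnstile> \<phi> \<longleftrightarrow> (\<forall>p \<in> Field P. forces P \<phi> p)"

section \<open>Formulas\<close>

abbreviation Disj :: "'n fm \<Rightarrow> 'n fm \<Rightarrow> 'n fm"  (infixr "\<^bold>\<or>" 30) where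
  "\<phi> \<^bold>\<or> \<psi> \<equiv> \<^bold>\<not> (\<^bold>\<not> \<phi> \<^bold>\<and> \<^bold>\<not> \<psi>)"

abbreviation Imp :: "'n fm \<Rightarrow> 'n fm \<Rightarrow> 'n fm"  (infixr "\<^bold>\<longrightarrow>" 25) where
  "\<phi> \<^bold>\<longrightarrow> \<psi> \<equiv> \<^bold>\<not> (\<phi> \<^bold>\<and> \<^bold>\<not> \<psi>)"

abbreviation Iff :: "'n fm \<Rightarrow> 'n fm \<Rightarrow> 'n fm"  (infixr "\<^bold>\<longleftrightarrow>" 25) where
  "\<phi> \<^bold>\<longleftrightarrow> \<psi> \<equiv> (\<phi> \<^bold>\<longrightarrow> \<psi>) \<^bold>\<and> (\<psi> \<^bold>\<longrightarrow> \<phi>)"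

definition Ex :: "('n \<Rightarrow> 'n fm) \<Rightarrow> 'n fm"  (binder "\<^bold>\<exists>" 10) where
  "Ex \<phi> = (\<^bold>\<not> (\<^bold>\<forall>x. \<^bold>\<not> \<phi> x))"

definition BAll :: "'n \<Rightarrow> ('n \<Rightarrow> 'n fm) \<Rightarrow> 'n fm" where
  "BAll A \<phi> = (\<^bold>\<forall>x. x \<^bold>\<in> A \<^bold>\<longrightarrow> \<phi> x)"

definition BEx :: "'n \<Rightarrow> ('n \<Rightarrow> 'n fm) \<Rightarrow> 'n fm" where
  "BEx A \<phi> = (\<^bold>\<exists>x. x \<^bold>\<in> A \<^bold>\<and> \<phi> x)"

syntax
  "_BAll" :: "pttrn \<Rightarrow> 'n \<Rightarrow> 'n fm \<Rightarrow> 'n fm"  ("(3\<^bold>\<forall>_\<in>_./ _)" [0, 0, 10] 10)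
  "_BEx" :: "pttrn \<Rightarrow> 'n \<Rightarrow> 'n fm \<Rightarrow> 'n fm"  ("(3\<^bold>\<exists>_\<in>_./ _)" [0, 0, 10] 10)
translations
  "\<^bold>\<forall>x\<in>A. \<phi>" \<rightleftharpoons> "CONST BAll A (\<lambda>x. \<phi>)"
  "\<^bold>\<exists>x\<in>A. \<phi>" \<rightleftharpoons> "CONST BEx A (\<lambda>x. \<phi>)"

definition Subset :: "'n \<Rightarrow> 'n \<Rightarrow> 'n fm"  (infix "\<^bold>\<subseteq>" 50) where
  "(A \<^bold>\<subseteq> B) = (\<^bold>\<forall>x\<in>A. x \<^bold>\<in> B)"

definition is_inter :: "'n \<Rightarrow> 'n \<Rightarrow> 'n \<Rightarrow> 'n fm" where
  "is_inter z A B = (\<^bold>\<forall>x. x \<^bold>\<in> z \<^bold>\<longleftrightarrow> x \<^bold>\<in> A \<^bold>\<and> x \<^bold>\<in> B)"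

definition is_diff :: "'n \<Rightarrow> 'n \<Rightarrow> 'n \<Rightarrow> 'n fm" where
  "is_diff z A B = (\<^bold>\<forall>x. x \<^bold>\<in> z \<^bold>\<longleftrightarrow> x \<^bold>\<in> A \<^bold>\<and> \<^bold>\<not> x \<^bold>\<in> B)"

definition is_Union :: "'n \<Rightarrow> 'n \<Rightarrow> 'n fm" where
  "is_Union U F = (\<^bold>\<forall>x. x \<^bold>\<in> U \<^bold>\<longleftrightarrow> (\<^bold>\<exists>X\<in>F. x \<^bold>\<in> X))"

definition is_Pow :: "'n \<Rightarrow> 'n \<Rightarrow> 'n fm" where
  "is_Pow Y A = (\<^bold>\<forall>x. x \<^bold>\<in> Y \<^bold>\<longleftrightarrow> x \<^bold>\<subseteq> A)"

definition is_upair :: "'n \<Rightarrow> 'n \<Rightarrow> 'n \<Rightarrow> 'n fm" where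
  "is_upair z x y = (\<^bold>\<forall>u. u \<^bold>\<in> z \<^bold>\<longleftrightarrow> u \<^bold>= x \<^bold>\<or> u \<^bold>= y)"

definition is_pair :: "'n \<Rightarrow> 'n \<Rightarrow> 'n \<Rightarrow> 'n fm" where
  "is_pair z x y = (\<^bold>\<forall>w. w \<^bold>\<in> z \<^bold>\<longleftrightarrow> is_upair w x x \<^bold>\<or> is_upair w x y)"

definition rel2 :: "'n \<Rightarrow> 'n \<Rightarrow> 'n \<Rightarrow> 'n fm" where
  "rel2 R x y = (\<^bold>\<exists>z. is_pair z x y \<^bold>\<and> z \<^bold>\<in> R)"

definition rel3 :: "'n \<Rightarrow> 'n \<Rightarrow> 'n \<Rightarrow> 'n \<Rightarrow> 'n fm" where
  "rel3 R x y z = (\<^bold>\<exists>w. is_pair w x y \<^bold>\<and> rel2 R w z)"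

definition is_fun :: "'n \<Rightarrow> 'n \<Rightarrow> 'n \<Rightarrow> 'n fm" where
  "is_fun f A B =
     ((\<^bold>\<forall>z\<in>f. \<^bold>\<exists>x\<in>A. \<^bold>\<exists>y\<in>B. is_pair z x y) \<^bold>\<and>
      (\<^bold>\<forall>x\<in>A. \<^bold>\<exists>y. rel2 f x y \<^bold>\<and> (\<^bold>\<forall>y'. rel2 f x y' \<^bold>\<longrightarrow> y' \<^bold>= y)))"

definition is_bij :: "'n \<Rightarrow> 'n \<Rightarrow> 'n \<Rightarrow> 'n fm" where
  "is_bij f A B =
     (is_fun f A B \<^bold>\<and> (\<^bold>\<forall>y\<in>B. \<^bold>\<exists>x. rel2 f x y \<^bold>\<and> (\<^bold>\<forall>x'. rel2 f x' y \<^bold>\<longrightarrow> x' \<^bold>= x)))"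

definition equinumerous :: "'n \<Rightarrow> 'n \<Rightarrow> 'n fm" where
  "equinumerous A B = (\<^bold>\<exists>f. is_bij f A B)"

text \<open>
  For an ordinal \<open>k\<close>: the least cardinality of a set satisfying \<open>\<Phi>\<close> exists and equals \<open>k\<close>
  (which is then a cardinal).
\<close>

definition least_card :: "('n \<Rightarrow> 'n fm) \<Rightarrow> 'n \<Rightarrow> 'n fm" where
  "least_card \<Phi> k =
     ((\<^bold>\<exists>X. \<Phi> X \<^bold>\<and> equinumerous X k) \<^bold>\<and>
      (\<^bold>\<forall>x\<in>k. \<^bold>\<not> (\<^bold>\<exists>X. \<Phi> X \<^bold>\<and> equinumerous X x)))"

subsection \<open>The continuum and the bounding number\<close>

definition continuum_eq :: "'p name \<Rightarrow> 'p name fm" where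
  "continuum_eq = least_card (\<lambda>Y. is_Pow Y check_omega)"

definition le_star :: "'p name \<Rightarrow> 'p name \<Rightarrow> 'p name fm" where
  "le_star f g =
     (\<^bold>\<exists>m\<in>check_omega. \<^bold>\<forall>n\<in>check_omega. m \<^bold>\<in> n \<^bold>\<longrightarrow>
        (\<^bold>\<exists>u. \<^bold>\<exists>v. rel2 f n u \<^bold>\<and> rel2 g n v \<^bold>\<and> (u \<^bold>\<in> v \<^bold>\<or> u \<^bold>= v)))"

definition unbounded :: "'p name \<Rightarrow> 'p name fm" where
  "unbounded B =
     ((\<^bold>\<forall>f\<in>B. is_fun f check_omega check_omega) \<^bold>\<and>
      \<^bold>\<not> (\<^bold>\<exists>g. is_fun g check_omega check_omega \<^bold>\<and> (\<^bold>\<forall>f\<in>B. le_star f g)))"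

definition bounding_eq :: "'p name \<Rightarrow> 'p name fm" where
  "bounding_eq = least_card unbounded"

subsection \<open>Lebesgue null sets\<close>

text \<open>
  Natural numbers code rationals and pairs of rationals by the surjections below; a pair stands for an open
  interval. A real of the extension is a Dedekind cut, namely the set of all codes of rationals below it.
  A set of reals is null if for every rational \<open>e > 0\<close> it is covered by a sequence of open rational intervals
  such that all partial sums of their lengths are at most \<open>e\<close>. The arithmetic of codes is that of
  the ground model.
\<close>

definition rat_of :: "nat \<Rightarrow> rat" where
  "rat_of = from_nat"

definition ival_of :: "nat \<Rightarrow> rat \<times> rat" where
  "ival_of = from_nat"

definition check_rat :: "rat \<Rightarrow> 'p name" where
  "check_rat q = check_nat (to_nat q)"

lemma surj_rat_of: "surj rat_of" and surj_ival_of: "surj ival_of"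
  and rat_of_to_nat: "rat_of (to_nat q) = q"
  by (simp_all add: rat_of_def ival_of_def)

definition rat_less :: "'p name \<Rightarrow> 'p name \<Rightarrow> 'p name fm" where
  "rat_less = rel2 (check_rel {(m, n). rat_of m < rat_of n})"

definition rat_le :: "'p name \<Rightarrow> 'p name \<Rightarrow> 'p name fm" where
  "rat_le = rel2 (check_rel {(m, n). rat_of m \<le> rat_of n})"

definition left_end_less :: "'p name \<Rightarrow> 'p name \<Rightarrow> 'p name fm" where
  "left_end_less = rel2 (check_rel {(j, m). fst (ival_of j) < rat_of m})"

definition right_end_greater :: "'p name \<Rightarrow> 'p name \<Rightarrow> 'p name fm" where
  "right_end_greater = rel2 (check_rel {(j, m). rat_of m < snd (ival_of j)})"

definition add_length :: "'p name \<Rightarrow> 'p name \<Rightarrow> 'p name \<Rightarrow> 'p name fm" where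
  "add_length = rel3 (check_rel3
     {(u, j, v). rat_of v = rat_of u + max 0 (snd (ival_of j) - fst (ival_of j))})"

definition is_suc :: "'p name \<Rightarrow> 'p name \<Rightarrow> 'p name fm" where
  "is_suc = rel2 (check_rel {(m, n). n = Suc m})"

definition is_real :: "'p name \<Rightarrow> 'p name fm" where
  "is_real x =
     (x \<^bold>\<subseteq> check_omega \<^bold>\<and> (\<^bold>\<exists>m. m \<^bold>\<in> x) \<^bold>\<and> (\<^bold>\<exists>m\<in>check_omega. \<^bold>\<not> m \<^bold>\<in> x) \<^bold>\<and>
      (\<^bold>\<forall>m\<in>x. \<^bold>\<forall>n\<in>check_omega. rat_less n m \<^bold>\<longrightarrow> n \<^bold>\<in> x) \<^bold>\<and>
      (\<^bold>\<forall>m\<in>x. \<^bold>\<exists>n\<in>x. rat_less m n))"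

definition in_interval :: "'p name \<Rightarrow> 'p name \<Rightarrow> 'p name fm" where
  "in_interval x j =
     ((\<^bold>\<exists>m\<in>x. left_end_less j m) \<^bold>\<and>
      (\<^bold>\<exists>m\<in>check_omega. \<^bold>\<not> m \<^bold>\<in> x \<^bold>\<and> right_end_greater j m))"

definition partial_sums :: "'p name \<Rightarrow> 'p name \<Rightarrow> 'p name fm" where
  "partial_sums s f =
     (is_fun s check_omega check_omega \<^bold>\<and>
      rel2 s (check_nat 0) (check_rat 0) \<^bold>\<and>
      (\<^bold>\<forall>n\<in>check_omega. \<^bold>\<exists>n'. \<^bold>\<exists>u. \<^bold>\<exists>j. \<^bold>\<exists>v.
         is_suc n n' \<^bold>\<and> rel2 s n u \<^bold>\<and> rel2 f n j \<^bold>\<and> rel2 s n' v \<^bold>\<and> add_length u j v))"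

definition is_null :: "'p name \<Rightarrow> 'p name fm" where
  "is_null X =
     ((\<^bold>\<forall>x\<in>X. is_real x) \<^bold>\<and>
      (\<^bold>\<forall>e\<in>check_omega. rat_less (check_rat 0) e \<^bold>\<longrightarrow>
         (\<^bold>\<exists>f. \<^bold>\<exists>s. is_fun f check_omega check_omega \<^bold>\<and> partial_sums s f \<^bold>\<and>
            (\<^bold>\<forall>n\<in>check_omega. \<^bold>\<exists>v. rel2 s n v \<^bold>\<and> rat_le v e) \<^bold>\<and>
            (\<^bold>\<forall>x\<in>X. \<^bold>\<exists>n\<in>check_omega. \<^bold>\<exists>j. rel2 f n j \<^bold>\<and> in_interval x j))))"

definition add_null_eq :: "'p name \<Rightarrow> 'p name fm" where
  "add_null_eq = least_card (\<lambda>F.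
     (\<^bold>\<forall>X\<in>F. is_null X) \<^bold>\<and> \<^bold>\<not> (\<^bold>\<exists>U. is_Union U F \<^bold>\<and> is_null U))"

subsection \<open>The ideal in the extension and its gaps\<close>

text \<open>
  This is the definition of \<^const>\<open>Ic\<close> interpreted in the extension: a sequence of nonnegative
  reals is bounded iff some natural number \<open>k\<close> bounds it, and the intersection of \<open>x\<close> with \<open>a i\<close> has some
  natural number \<open>m\<close> as its cardinality. Only the relation between \<open>i\<close>, \<open>k\<close> and \<open>m\<close> is
  taken from the ground model.
\<close>

definition in_Ic :: "(nat \<Rightarrow> nat) \<Rightarrow> (nat \<Rightarrow> nat set) \<Rightarrow> 'p name \<Rightarrow> 'p name fm" where
  "in_Ic c a x =
     (x \<^bold>\<subseteq> check_omega \<^bold>\<and>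
      (\<^bold>\<exists>k\<in>check_omega. \<^bold>\<forall>i\<in>check_omega. \<^bold>\<exists>y. \<^bold>\<exists>m\<in>check_omega.
         (\<^bold>\<forall>n. n \<^bold>\<in> y \<^bold>\<longleftrightarrow> n \<^bold>\<in> x \<^bold>\<and> rel2 (check_rel {(i, n). n \<in> a i}) i n) \<^bold>\<and>
         equinumerous y m \<^bold>\<and>
         rel3 (check_rel3 {(i, k, m). log (real (c i)) (real m + 1) \<le> real k}) i k m))"

text \<open>In the following, \<open>J\<close> is a formula defining an ideal on \<open>\<omega>\<close>.\<close>

definition orthogonal :: "('p name \<Rightarrow> 'p name fm) \<Rightarrow> 'p name \<Rightarrow> 'p name \<Rightarrow> 'p name fm" where
  "orthogonal J \<A> \<B> = (\<^bold>\<forall>A\<in>\<A>. \<^bold>\<forall>B\<in>\<B>. \<^bold>\<exists>z. is_inter z A B \<^bold>\<and> J z)"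

definition separates ::
    "('p name \<Rightarrow> 'p name fm) \<Rightarrow> 'p name \<Rightarrow> 'p name \<Rightarrow> 'p name \<Rightarrow> 'p name fm" where
  "separates J C \<A> \<B> =
     (C \<^bold>\<subseteq> check_omega \<^bold>\<and>
      (\<^bold>\<forall>A\<in>\<A>. \<^bold>\<exists>z. is_inter z A C \<^bold>\<and> J z) \<^bold>\<and>
      (\<^bold>\<forall>B\<in>\<B>. \<^bold>\<exists>z. is_diff z B C \<^bold>\<and> J z))"

definition gap :: "('p name \<Rightarrow> 'p name fm) \<Rightarrow> 'p name \<Rightarrow> 'p name \<Rightarrow> 'p name fm" where
  "gap J \<A> \<B> =
     ((\<^bold>\<forall>A\<in>\<A>. A \<^bold>\<subseteq> check_omega) \<^bold>\<and> (\<^bold>\<forall>B\<in>\<B>. B \<^bold>\<subseteq> check_omega) \<^bold>\<and>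
      orthogonal J \<A> \<B> \<^bold>\<and> \<^bold>\<not> (\<^bold>\<exists>C. separates J C \<A> \<B>))"

definition b_ideal_eq :: "('p name \<Rightarrow> 'p name fm) \<Rightarrow> 'p name \<Rightarrow> 'p name fm" where
  "b_ideal_eq J = least_card (\<lambda>\<B>. \<^bold>\<exists>\<A>. equinumerous \<A> check_omega \<^bold>\<and> gap J \<A> \<B>)"

end

theory Submission
 imports Defs
begin

text \<open>
  The poset is a finite support iteration along \<open>\<Lambda>\<close>, described directly: a condition is a finite function on
  coordinates, and each coordinate adds a Cohen real, a real dominating fewer than \<open>\<kappa>\<close> given ones, or a slalom
  capturing fewer than \<open>\<mu>\<close> given reals, or fewer than \<open>\<nu>\<close> reals below the fixed bound \<open>n \<mapsto> \<close> code of \<open>a n\<close>.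
  As \<open>\<Lambda>\<close> is its own \<open><\<kappa>\<close>-th power, every small family is handled at some coordinate. Slaloms capture blocks of
  covers of null sets, so unions of fewer than \<open>\<mu>\<close> null sets are null; dominating reals and bounded slaloms together
  separate fewer than \<open>\<nu>\<close> sets from a countable family. For the other inequalities take Cohen reals indexed by
  \<open>\<theta> \<in> {\<mu>, \<nu>, \<kappa>}\<close> and conditions \<open>p \<xi>\<close>, \<open>\<xi> < \<theta>\<close>: a Delta-system argument yields many of them that have a common
  extension in which the Cohen reals take prescribed values at a given place. For \<open>\<theta> = \<mu>\<close>, where bounded slaloms may
  have many promises, only a large part of the conditions survives, which suffices.
\<close>

section \<open>The forcing relation\<close>

text \<open>No iterand is ever named. A promise refers to a code, which lists for each argument and
  value countably many conditions, and the order demands that the part of a condition below the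
  coordinate decides the values concerned. There are only \<open>|\<Lambda>|\<close> codes, so all
  tasks are listed before any coordinate is interpreted; coordinates whose codes fail to denote
  total functions are then excluded by recursion, and since fewer than \<open>\<kappa>\<close>
  elements of \<open>\<Lambda>\<close> are bounded, some later coordinate serves each small family
  of reals. Forcing is handled through filters: countable antichains make every formula a measurable
  property of the filter, and forcing it means that it holds for all filters that contain the
  condition and meet countably many suitable dense sets. Sums, measures and cardinalities are then
  computed for a single filter. The width of the slaloms comes from \<open>c\<close>. Being at most
  \<open>c\<close>, it lets a union of captured candidates cost one factor \<open>c j\<close> only;
  tending to infinity, it makes room for further promises and for joining conditions. The bound on
  the larger slaloms keeps them from capturing Cohen reals, which could raise the additivity above
  \<open>\<mu>\<close>.\<close>

declare forces_eq.simps [simp del]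

lemma small_times:
 fixes A :: "'a set" and B :: "'b set" and C :: "'c set"
 assumes "|A| \<le>o |C|" "|B| \<le>o |C|" "infinite C"
 shows "|A \<times> B| \<le>o |C|"
 using card_of_Times_ordLeq_infinite_Field[OF _ assms(1,2)] assms(3)
 by (simp add: Field_card_of card_of_card_order_on)

text \<open>Infinity of the type makes the bound on the size of names closed under products and puts
  every countable set below it.\<close>

locale forcing =
 fixes P :: "'p rel"
 assumes po: "Partial_order P" and ne: "Field P ~= {}"
  and inf: "infinite (UNIV :: 'p set)" and ccc: "ccc P"
begin

abbreviation le :: "'p => 'p => bool"  (infix "<<" 50) where "q << p \<equiv> (q, p) \<in> P"
abbreviation om :: "'p name" where "om \<equiv> check_omega"
abbreviation nm :: "nat => 'p name" where "nm \<equiv> check_nat"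
abbreviation "feq \<equiv> forces_eq P"
abbreviation "fmem \<equiv> forces_mem P"
abbreviation "fo p \<phi> \<equiv> forces P \<phi> p"

lemma le_refl [simp]: "p \<in> Field P ==> p << p"
 using po by (auto simp: partial_order_on_def preorder_on_def refl_on_def)

lemma le_trans [trans]: "r << q ==> q << p ==> r << p"
 using po unfolding partial_order_on_def preorder_on_def trans_def by blast

lemma le_field: "q << p ==> q \<in> Field P" "q << p ==> p \<in> Field P"
 by (auto simp: Field_def)

lemma le_refl1 [simp]: "q << p ==> q << q" "q << p ==> p << p"
 using le_field le_refl by blast+

lemma feqD1: "feq p \<sigma> \<tau> ==> (\<pi>, s) \<in> elems \<sigma> ==> q << p ==> q << s ==>
  \<exists>r \<rho> t. r << q \<and> (\<rho>, t) \<in> elems \<tau> \<and> r << t \<and> feq r \<pi> \<rho>"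
 by (subst (asm) forces_eq.simps) blast

lemma feqD2: "feq p \<sigma> \<tau> ==> (\<rho>, t) \<in> elems \<tau> ==> q << p ==> q << t ==>
  \<exists>r \<pi> s. r << q \<and> (\<pi>, s) \<in> elems \<sigma> \<and> r << s \<and> feq r \<pi> \<rho>"
 by (subst (asm) forces_eq.simps) blast

lemma feqI:
 assumes "!!\<pi> s q. (\<pi>, s) \<in> elems \<sigma> ==> q << p ==> q << s ==>
   \<exists>r \<rho> t. r << q \<and> (\<rho>, t) \<in> elems \<tau> \<and> r << t \<and> feq r \<pi> \<rho>"
  and "!!\<rho> t q. (\<rho>, t) \<in> elems \<tau> ==> q << p ==> q << t ==>
   \<exists>r \<pi> s. r << q \<and> (\<pi>, s) \<in> elems \<sigma> \<and> r << s \<and> feq r \<pi> \<rho>"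
 shows "feq p \<sigma> \<tau>"
 using assms by (subst forces_eq.simps) (clarsimp, blast)

lemma feq_mono: "feq p \<sigma> \<tau> ==> q << p ==> feq q \<sigma> \<tau>"
 by (rule feqI) (meson feqD1 feqD2 le_trans)+

lemma elems_induct [case_names elems]:
 assumes "!!\<sigma>. (!!\<pi> s. (\<pi>, s) \<in> elems \<sigma> ==> Q \<pi>) ==> Q \<sigma>"
 shows "Q (\<sigma> :: 'x name)"
 using wf_elems[where 'a = 'x] by (induction \<sigma> rule: wf_induct_rule) (use assms in blast)

lemma feq_refl: "feq p \<sigma> \<sigma>"
proof (induction \<sigma> arbitrary: p rule: elems_induct)
 case (elems \<sigma>)
 show ?case by (rule feqI) (use elems le_refl1 in blast)+
qed

text \<open>Both clauses of the recursion descend with the element of the left name in the first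
  place, so symmetry needs the induction; the other name is arbitrary in it.\<close>

lemma feq_sym: "feq p \<sigma> \<tau> \<longleftrightarrow> feq p \<tau> \<sigma>"
proof (induction \<sigma> arbitrary: p \<tau> rule: elems_induct)
 case (elems \<sigma>)
 show ?case
 proof
  assume h: "feq p \<sigma> \<tau>"
  show "feq p \<tau> \<sigma>"
   by (rule feqI) (use elems feqD1[OF h] feqD2[OF h] in blast)+
 next
  assume h: "feq p \<tau> \<sigma>"
  show "feq p \<sigma> \<tau>"
   by (rule feqI) (use elems feqD1[OF h] feqD2[OF h] in blast)+
 qed
qed

lemma feq_trans: "feq p \<sigma> \<tau> ==> feq p \<tau> \<upsilon> ==> feq p \<sigma> \<upsilon>"
proof (induction \<sigma> arbitrary: p \<tau> \<upsilon> rule: elems_induct)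
 case (elems \<sigma>)
 show ?case
 proof (rule feqI)
  fix \<pi> s q assume a: "(\<pi>, s) \<in> elems \<sigma>" "q << p" "q << s"
  obtain r \<rho> t where r: "r << q" "(\<rho>, t) \<in> elems \<tau>" "r << t" "feq r \<pi> \<rho>"
   using feqD1[OF elems.prems(1) a] by blast
  obtain r' \<zeta> u where r': "r' << r" "(\<zeta>, u) \<in> elems \<upsilon>" "r' << u" "feq r' \<rho> \<zeta>"
   using feqD1[OF elems.prems(2) r(2) le_trans[OF r(1) a(2)] r(3)] by blast
  have "feq r' \<pi> \<zeta>" using elems.IH[OF a(1)] feq_mono[OF r(4) r'(1)] r'(4) by blast
  then show "\<exists>r \<zeta> u. r << q \<and> (\<zeta>, u) \<in> elems \<upsilon> \<and> r << u \<and> feq r \<pi> \<zeta>"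
   using r' r le_trans by blast
 next
  fix \<zeta> u q assume a: "(\<zeta>, u) \<in> elems \<upsilon>" "q << p" "q << u"
  obtain r \<rho> t where r: "r << q" "(\<rho>, t) \<in> elems \<tau>" "r << t" "feq r \<rho> \<zeta>"
   using feqD2[OF elems.prems(2) a] by blast
  obtain r' \<pi> s where r': "r' << r" "(\<pi>, s) \<in> elems \<sigma>" "r' << s" "feq r' \<pi> \<rho>"
   using feqD2[OF elems.prems(1) r(2) le_trans[OF r(1) a(2)] r(3)] by blast
  have "feq r' \<pi> \<zeta>" using elems.IH[OF r'(2)] feq_mono[OF r(4) r'(1)] r'(4) by blast
  then show "\<exists>r \<pi> s. r << q \<and> (\<pi>, s) \<in> elems \<sigma> \<and> r << s \<and> feq r \<pi> \<zeta>"
   using r' r le_trans by blast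
 qed
qed

lemma feq_dense: "(!!q. q << p ==> \<exists>r. r << q \<and> feq r \<sigma> \<tau>) ==> feq p \<sigma> \<tau>"
proof (rule feqI, goal_cases)
 case (1 \<pi> s q)
 then obtain r where "r << q" "feq r \<sigma> \<tau>" by blast
 then show ?case using feqD1[of r \<sigma> \<tau> \<pi> s r] 1 le_trans le_refl1 by (metis (no_types, lifting))
next
 case (2 \<rho> t q)
 then obtain r where "r << q" "feq r \<sigma> \<tau>" by blast
 then show ?case using feqD2[of r \<sigma> \<tau> \<rho> t r] 2 le_trans le_refl1 by (metis (no_types, lifting))
qed

lemma fmem_iff: "fmem p \<pi> \<tau> \<longleftrightarrow>
  (\<forall>q. q << p --> (\<exists>r \<sigma> s. r << q \<and> (\<sigma>, s) \<in> elems \<tau> \<and> r << s \<and> feq r \<pi> \<sigma>))"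
 unfolding forces_mem_def by blast

lemma fmem_mono: "fmem p \<pi> \<tau> ==> q << p ==> fmem q \<pi> \<tau>"
 unfolding fmem_iff using le_trans by blast

lemma fmem_dense: "(!!q. q << p ==> \<exists>r. r << q \<and> fmem r \<pi> \<tau>) ==> fmem p \<pi> \<tau>"
 unfolding fmem_iff by (meson le_refl1 le_trans)

lemma fmem_elem: "(\<sigma>, s) \<in> elems \<tau> ==> p << s ==> fmem p \<sigma> \<tau>"
 unfolding fmem_iff using feq_refl le_trans le_refl1 by blast

lemma fmem_cong1: "feq p \<pi> \<pi>' ==> fmem p \<pi> \<tau> ==> fmem p \<pi>' \<tau>"
 unfolding fmem_iff by (meson feq_mono feq_sym feq_trans le_trans)

lemma fmem_cong2: assumes e: "feq p \<tau> \<tau>'" and m: "fmem p \<pi> \<tau>" shows "fmem p \<pi> \<tau>'"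
 unfolding fmem_iff
proof (intro allI impI)
 fix q assume q: "q << p"
 obtain r \<sigma> s where r: "r << q" "(\<sigma>, s) \<in> elems \<tau>" "r << s" "feq r \<pi> \<sigma>"
  using m q unfolding fmem_iff by blast
 obtain r' \<rho> t where r': "r' << r" "(\<rho>, t) \<in> elems \<tau>'" "r' << t" "feq r' \<sigma> \<rho>"
  using feqD1[OF e r(2) le_trans[OF r(1) q] r(3)] by blast
 show "\<exists>r \<sigma> s. r << q \<and> (\<sigma>, s) \<in> elems \<tau>' \<and> r << s \<and> feq r \<pi> \<sigma>"
  using r r' feq_mono feq_trans le_trans by meson
qed

lemma feq_ext:
 assumes "!!\<pi> q. q << p ==> fmem q \<pi> \<sigma> \<longleftrightarrow> fmem q \<pi> \<tau>"
 shows "feq p \<sigma> \<tau>"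
proof (rule feqI)
 fix \<pi> s q assume "(\<pi>, s) \<in> elems \<sigma>" "q << p" "q << s"
 then have "fmem q \<pi> \<tau>" using assms fmem_elem by blast
 then show "\<exists>r \<rho> t. r << q \<and> (\<rho>, t) \<in> elems \<tau> \<and> r << t \<and> feq r \<pi> \<rho>"
  unfolding fmem_iff using \<open>q << p\<close> le_refl1 by blast
next
 fix \<pi> s q assume "(\<pi>, s) \<in> elems \<tau>" "q << p" "q << s"
 then have "fmem q \<pi> \<sigma>" using assms fmem_elem by blast
 then show "\<exists>r \<rho> t. r << q \<and> (\<rho>, t) \<in> elems \<sigma> \<and> r << t \<and> feq r \<rho> \<pi>"
  unfolding fmem_iff using \<open>q << p\<close> le_refl1 feq_sym by blast
qed

lemma fo_mono: "fo p \<phi> ==> q << p ==> fo q \<phi>"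
 by (induction \<phi> arbitrary: p q) (auto intro: feq_mono fmem_mono le_trans, blast)

text \<open>The clauses for atoms and negation are density statements already, and conjunction and
  quantification preserve this. It follows that a formula that is not forced has its negation forced
  by some stronger condition.\<close>

lemma fo_dense: "(!!q. q << p ==> \<exists>r. r << q \<and> fo r \<phi>) ==> fo p \<phi>"
proof (induction \<phi> arbitrary: p)
 case (Mem x y) then show ?case using fmem_dense by simp
next
 case (Eq x y) then show ?case using feq_dense by simp
next
 case (Neg \<phi>) then show ?case
  by simp (meson fo_mono le_trans le_refl1)
next
 case (Conj \<phi> \<psi>) then show ?case by simp blast
next
 case (All f)
 show ?case by simp (use All(1)[OF rangeI] All(2) in fastforce)
qed

lemma fo_refute: "p \<in> Field P ==> \<not> fo p \<phi> ==> \<exists>q. q << p \<and> fo q (Neg \<phi>)"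
 using fo_dense[of p \<phi>] by auto

text \<open>Implication abbreviates a negated conjunction; density removes the double negation that
  this leaves in front of the conclusion.\<close>

lemma fo_imp: "fo p (Imp \<phi> \<psi>) \<longleftrightarrow> (\<forall>q. q << p --> fo q \<phi> --> fo q \<psi>)"
proof
 assume h: "fo p (Imp \<phi> \<psi>)"
 show "\<forall>q. q << p --> fo q \<phi> --> fo q \<psi>"
 proof (intro allI impI)
  fix q assume q: "q << p" "fo q \<phi>"
  show "fo q \<psi>"
  proof (rule fo_dense)
   fix r assume r: "r << q"
   then have "fo r \<phi>" "r << p" using q fo_mono le_trans by blast+
   then have "\<not> fo r (Neg \<psi>)" using h by auto
   then show "\<exists>s. s << r \<and> fo s \<psi>" by auto
  qed
 qed
next
 assume "\<forall>q. q << p --> fo q \<phi> --> fo q \<psi>"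
 then show "fo p (Imp \<phi> \<psi>)" using le_refl1 by (simp del: le_refl1) blast
qed

lemma fo_disj: "fo p (Disj \<phi> \<psi>) \<longleftrightarrow> (\<forall>q. q << p --> (\<exists>r. r << q \<and> (fo r \<phi> \<or> fo r \<psi>)))"
proof
 assume "fo p (Disj \<phi> \<psi>)"
 then show "\<forall>q. q << p --> (\<exists>r. r << q \<and> (fo r \<phi> \<or> fo r \<psi>))" by auto
next
 assume h: "\<forall>q. q << p --> (\<exists>r. r << q \<and> (fo r \<phi> \<or> fo r \<psi>))"
 show "fo p (Disj \<phi> \<psi>)"
  by simp (use h in blast)
qed

lemma fo_iff: "fo p (Iff \<phi> \<psi>) \<longleftrightarrow> (\<forall>q. q << p --> fo q \<phi> = fo q \<psi>)"
 unfolding forces.simps(4)[of P "Imp \<phi> \<psi>" "Imp \<psi> \<phi>"] fo_imp by blast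

lemma fo_ex: "fo p (Ex \<phi>) \<longleftrightarrow> (\<forall>q. q << p --> (\<exists>r x. r << q \<and> fo r (\<phi> x)))"
 unfolding Ex_def by simp (meson le_refl1 le_trans)

lemma fo_exI: "fo p (\<phi> x) ==> fo p (Ex \<phi>)"
 unfolding fo_ex using fo_mono le_refl1 by blast

lemma fo_exE:
 assumes "fo p (Ex \<phi>)" and "!!q x. q << p ==> fo q (\<phi> x) ==> fo q \<psi>"
 shows "fo p \<psi>"
 using assms by (intro fo_dense) (meson fo_ex le_trans)

lemma fo_ball: "fo p (BAll A \<phi>) \<longleftrightarrow> (\<forall>x q. q << p --> fmem q x A --> fo q (\<phi> x))"
 unfolding BAll_def forces.simps(5) fo_imp by simp

lemma fo_bex: "fo p (BEx A \<phi>) \<longleftrightarrow> (\<forall>q. q << p --> (\<exists>r x. r << q \<and> fmem r x A \<and> fo r (\<phi> x)))"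
 unfolding BEx_def fo_ex by simp

lemma fo_conj: "fo p (Conj \<phi> \<psi>) \<longleftrightarrow> fo p \<phi> \<and> fo p \<psi>" by simp

lemma fo_neg: "fo p (Neg \<phi>) \<longleftrightarrow> (\<forall>q. q << p --> \<not> fo q \<phi>)" by simp

lemma fo_subset: "fo p (Subset A B) \<longleftrightarrow> (\<forall>x q. q << p --> fmem q x A --> fmem q x B)"
 unfolding Subset_def fo_ball by simp

text \<open>Names that are forced to be equal can be different names, so a formula has to respect
  forced equality before a witness may be replaced by, say, a check name.\<close>

definition cong :: "('p name => 'p name fm) => bool" where
 "cong \<phi> \<longleftrightarrow> (\<forall>p x y. p \<in> Field P --> feq p x y --> fo p (\<phi> x) --> fo p (\<phi> y))"

lemma congI: "(!!p x y. p \<in> Field P ==> feq p x y ==> fo p (\<phi> x) ==> fo p (\<phi> y)) ==> cong \<phi>"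
 unfolding cong_def by blast

lemma cong_fo: "cong \<phi> ==> feq p x y ==> p \<in> Field P ==> fo p (\<phi> x) \<longleftrightarrow> fo p (\<phi> y)"
 unfolding cong_def using feq_sym by blast

lemma cong_const: "cong (%x. \<phi>)" by (rule congI)

lemma cong_mem1: "cong (%x. Mem x A)" by (rule congI) (use fmem_cong1 in auto)

lemma cong_mem2: "cong (%x. Mem A x)" by (rule congI) (use fmem_cong2 in auto)

lemma cong_eq1: "cong (%x. Eq x A)" by (rule congI) (use feq_trans feq_sym in \<open>simp; blast\<close>)

lemma cong_eq2: "cong (%x. Eq A x)" by (rule congI) (use feq_trans in \<open>simp; blast\<close>)

lemma cong_neg: assumes "cong \<phi>" shows "cong (%x. Neg (\<phi> x))"
proof (rule congI)
 fix p x y assume h: "feq p x y" "fo p (Neg (\<phi> x))"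
 show "fo p (Neg (\<phi> y))" unfolding fo_neg
 proof (intro allI impI)
  fix q assume q: "q << p"
  then have "\<not> fo q (\<phi> x)" using h(2) unfolding fo_neg by blast
  then show "\<not> fo q (\<phi> y)" using cong_fo[OF assms feq_mono[OF h(1) q] le_field(1)[OF q]] by blast
 qed
qed

lemma cong_conj: "cong \<phi> ==> cong \<psi> ==> cong (%x. Conj (\<phi> x) (\<psi> x))"
 unfolding cong_def by simp

lemma cong_all: "(!!z. cong (%x. \<phi> x z)) ==> cong (%x. All (\<phi> x))"
 unfolding cong_def by simp

lemma cong_ex: "(!!z. cong (%x. \<phi> x z)) ==> cong (%x. Ex (\<phi> x))"
 unfolding Ex_def by (intro cong_neg cong_all)

lemma cong_ball: "(!!z. cong (%x. \<phi> x z)) ==> cong (%x. BAll A (\<phi> x))"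
 unfolding BAll_def by (intro cong_neg cong_all cong_conj cong_const)

lemma cong_ball2: "cong (%x. BAll x \<phi>)"
 unfolding BAll_def by (intro cong_neg cong_all cong_conj cong_const cong_mem2)

lemma cong_bex: "(!!z. cong (%x. \<phi> x z)) ==> cong (%x. BEx A (\<phi> x))"
 unfolding BEx_def by (intro cong_ex cong_conj cong_const)

lemma cong_bex2: "cong (%x. BEx x \<phi>)"
 unfolding BEx_def by (intro cong_ex cong_conj cong_const cong_mem2)

lemma cong_subset1: "cong (%x. Subset x A)" and cong_subset2: "cong (%x. Subset A x)"
 unfolding Subset_def by (rule cong_ball2) (intro cong_ball cong_mem2)

lemmas cong_intros = cong_const cong_mem1 cong_mem2 cong_eq1 cong_eq2 cong_neg cong_conj cong_all
 cong_ex cong_ball2 cong_bex2 cong_ball cong_bex cong_subset1 cong_subset2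

section \<open>Antichains, sizes of names and the choice of witnesses\<close>

definition maxanti :: "'p set => 'p set => bool" where
 "maxanti D A \<longleftrightarrow> A \<subseteq> D \<and> countable A \<and>
  (\<forall>p\<in>A. \<forall>q\<in>A. \<forall>r. r << p --> r << q --> p = q) \<and>
  (\<forall>d\<in>D. \<exists>a\<in>A. \<exists>r. r << a \<and> r << d)"

lemma maxantiD:
 assumes "maxanti D A"
 shows "A \<subseteq> D" "countable A" "!!p q r. p \<in> A ==> q \<in> A ==> r << p ==> r << q ==> p = q"
  "!!d. d \<in> D ==> \<exists>a\<in>A. \<exists>r. r << a \<and> r << d"
 using assms unfolding maxanti_def by blast+

text \<open>Zorn's lemma gives the maximal family; its countability is the chain condition.\<close>

lemma maxanti_ex:
 assumes "D \<subseteq> Field P"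
 shows "\<exists>A. maxanti D A"
proof -
 define C where "C = {A. A \<subseteq> D \<and> (\<forall>p\<in>A. \<forall>q\<in>A. \<forall>r. r << p --> r << q --> p = q)}"
 have "\<exists>M\<in>C. \<forall>X\<in>C. M \<subseteq> X --> X = M"
 proof (rule subset_Zorn_nonempty)
  show "C ~= {}" unfolding C_def by blast
 next
  fix \<C> assume c: "\<C> ~= {}" "subset.chain C \<C>"
  have "p = q" if "p \<in> A" "A \<in> \<C>" "q \<in> B" "B \<in> \<C>" "r << p" "r << q" for p q r A B
  proof -
   have "A \<in> C" "B \<in> C" "A \<subseteq> B \<or> B \<subseteq> A" using c(2) that by (auto simp: subset_chain_def)
   then show ?thesis using that unfolding C_def by blast
  qed
  moreover have "\<Union>\<C> \<subseteq> D" using c(2) unfolding subset_chain_def C_def by blast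
  ultimately show "\<Union>\<C> \<in> C" unfolding C_def by blast
 qed
 then obtain A where A: "A \<in> C" "\<forall>X\<in>C. A \<subseteq> X --> X = A" by (rule bexE)
 have A1: "A \<subseteq> D" "!!p q r. p \<in> A ==> q \<in> A ==> r << p ==> r << q ==> p = q"
  using A(1) unfolding C_def by auto
 have "countable A"
 proof -
  have "A \<subseteq> Field P" using A1(1) assms by blast
  moreover have "\<forall>p\<in>A. \<forall>q\<in>A. p ~= q --> \<not> (\<exists>r. r << p \<and> r << q)" using A1(2) by blast
  ultimately show ?thesis using ccc[unfolded ccc_def, rule_format, of A] by blast
 qed
 moreover have "\<forall>d\<in>D. \<exists>a\<in>A. \<exists>r. r << a \<and> r << d"
 proof (rule ballI, rule ccontr)
  fix d assume d: "d \<in> D" and n: "\<not> (\<exists>a\<in>A. \<exists>r. r << a \<and> r << d)"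
  then have "insert d A \<in> C" using A1 d unfolding C_def by blast
  then have "d \<in> A" using A(2) by blast
  moreover have "d << d" using d assms le_refl by blast
  ultimately show False using n by blast
 qed
 moreover have "\<forall>p\<in>A. \<forall>q\<in>A. \<forall>r. r << p --> r << q --> p = q" using A1(2) by blast
 ultimately have "maxanti D A" using A1(1) by (simp only: maxanti_def simp_thms)
 then show ?thesis by (rule exI)
qed

abbreviation "big \<equiv> UNIV :: 'p set set set"

lemma big_ordLeq: "|UNIV :: 'p set| \<le>o |big|" "|UNIV :: 'p set set| \<le>o |big|"
proof -
 have "|UNIV :: 'p set| \<le>o |UNIV :: 'p set set|" "|UNIV :: 'p set set| \<le>o |big|"
  using card_of_Pow[of "UNIV :: 'p set"] card_of_Pow[of "UNIV :: 'p set set"]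
  by (simp_all add: ordLess_imp_ordLeq)
 then show "|UNIV :: 'p set| \<le>o |big|" "|UNIV :: 'p set set| \<le>o |big|"
  using ordLeq_transitive by blast+
qed

lemma inf_sets: "infinite (UNIV :: 'p set set)" and inf_big: "infinite big"
 using inf by (auto simp: Finite_Set.finite_set)

lemma nat_big: "|A :: nat set| \<le>o |UNIV :: 'p set|"
 using infinite_iff_card_of_nat inf card_of_mono1[of A UNIV] ordLeq_transitive by blast

text \<open>The bound is the one under which \<open>mk_name\<close> realizes a set of pairs as the
  elements of a name.\<close>

definition small :: "'x set => bool" where "small A \<longleftrightarrow> |A| \<le>o |big|"

lemma small_image: "small A ==> small (f ` A)"
 unfolding small_def using card_of_image ordLeq_transitive by blast

lemma small_sub: "small A ==> B \<subseteq> A ==> small B"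
 unfolding small_def using card_of_mono1 ordLeq_transitive by blast

lemma small_prod: "small A ==> small B ==> small (A \<times> B)"
 unfolding small_def using small_times inf_big by blast

lemma small_p: "small (A :: 'p set)"
 unfolding small_def using big_ordLeq(1) card_of_mono1[of A UNIV] ordLeq_transitive by blast

lemma small_nat: "small (A :: nat set)"
 unfolding small_def using nat_big big_ordLeq(1) ordLeq_transitive by blast

lemma small_countable: assumes "countable A" shows "small A"
proof -
 obtain f :: "_ => nat" where "inj_on f A" using assms unfolding countable_def by blast
 then have "|A| \<le>o |UNIV :: nat set|" using card_of_ordLeq[of A "UNIV :: nat set"] by blast
 moreover have "|UNIV :: nat set| \<le>o |big|" using small_nat small_def by blast
 ultimately show ?thesis unfolding small_def by (rule ordLeq_transitive)
qed

lemma small_pss: "small (A :: 'p set set set)"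
 unfolding small_def by (rule card_of_mono1) simp

lemma small_elems: "small (elems (\<tau> :: 'p name))"
proof -
 obtain f where \<tau>: "\<tau> = Name f" by (cases \<tau>)
 have "elems \<tau> \<subseteq> (%i. the (f i)) ` UNIV"
 proof
  fix x assume "x \<in> elems \<tau>"
  then obtain i where "f i = Some x" by (cases x) (auto simp: \<tau> ran_def)
  then show "x \<in> (%i. the (f i)) ` UNIV" by (metis option.sel rangeI)
 qed
 then show ?thesis using small_image[OF small_pss] small_sub by blast
qed

lemma elems_mk: "small (S :: ('p name \<times> 'p) set) ==> elems (mk_name S) = S"
 unfolding small_def by (rule elems_mk_name)

lemma elems_check_set: "small (S :: 'p name set) ==> elems (check_set S) = S \<times> (UNIV :: 'p set)"
 unfolding check_set_def using elems_mk small_prod small_p by blast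

lemma fmem_check_set: "small (S :: 'p name set) ==> fmem p \<pi> (check_set S) \<longleftrightarrow>
  (\<forall>q. q << p --> (\<exists>r. r << q \<and> (\<exists>\<sigma>\<in>S. feq r \<pi> \<sigma>)))"
 unfolding fmem_iff elems_check_set by (simp, meson le_refl1)

text \<open>Mixing along an antichain: below \<open>a\<close> only the pairs inherited from
  \<open>\<tau> a\<close> can matter, because a condition below two members of \<open>A\<close>
  identifies them.\<close>

lemma mix:
 assumes A: "!!p q r. p \<in> A ==> q \<in> A ==> r << p ==> r << q ==> p = q"
 obtains \<sigma> where "!!a. a \<in> A ==> feq a \<sigma> (\<tau> a)"
proof -
 let ?S = "{(\<pi>, q). \<exists>a\<in>A. q << a \<and> (\<exists>s. (\<pi>, s) \<in> elems (\<tau> a) \<and> q << s)}"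
 have "?S \<subseteq> (%((a, q), x). (fst x, q)) ` (SIGMA aq : (A \<times> UNIV). elems (\<tau> (fst aq)))"
  by (force simp: image_iff)
 moreover have "small (SIGMA aq : (A \<times> (UNIV :: 'p set)). elems (\<tau> (fst aq)))"
  unfolding small_def
 proof (rule card_of_Sigma_ordLeq_infinite[OF inf_big])
  show "|A \<times> (UNIV :: 'p set)| \<le>o |big|" using small_prod[OF small_p small_p] unfolding small_def .
  show "\<forall>aq\<in>A \<times> (UNIV :: 'p set). |elems (\<tau> (fst aq))| \<le>o |big|"
   using small_elems unfolding small_def by blast
 qed
 ultimately have "small ?S" using small_image small_sub by blast
 then have el: "elems (mk_name ?S) = ?S" by (rule elems_mk)
 show ?thesis
 proof (rule that[of "mk_name ?S"], rule feq_ext)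
  fix a \<pi> q assume a: "a \<in> A" and q: "q << a"
  show "fmem q \<pi> (mk_name ?S) = fmem q \<pi> (\<tau> a)"
  proof
   assume h: "fmem q \<pi> (mk_name ?S)"
   show "fmem q \<pi> (\<tau> a)" unfolding fmem_iff
   proof (intro allI impI)
    fix r assume r: "r << q"
    then obtain r' \<sigma> s where r': "r' << r" "(\<sigma>, s) \<in> ?S" "r' << s" "feq r' \<pi> \<sigma>"
     using h unfolding fmem_iff el by blast
    then obtain b t where b: "b \<in> A" "s << b" "(\<sigma>, t) \<in> elems (\<tau> b)" "s << t" by blast
    have "b = a" using A[OF b(1) a] b(2) r' r q le_trans by meson
    then show "\<exists>r' \<sigma> s. r' << r \<and> (\<sigma>, s) \<in> elems (\<tau> a) \<and> r' << s \<and> feq r' \<pi> \<sigma>"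
     using r' b le_trans by meson
   qed
  next
   assume h: "fmem q \<pi> (\<tau> a)"
   show "fmem q \<pi> (mk_name ?S)" unfolding fmem_iff el
   proof (intro allI impI)
    fix r assume r: "r << q"
    then obtain r' \<sigma> s where r': "r' << r" "(\<sigma>, s) \<in> elems (\<tau> a)" "r' << s" "feq r' \<pi> \<sigma>"
     using h unfolding fmem_iff by blast
    have "r' << a" using r' r q le_trans by meson
    then have "(\<sigma>, r') \<in> ?S" using a r' by blast
    then show "\<exists>r' \<sigma> s. r' << r \<and> (\<sigma>, s) \<in> ?S \<and> r' << s \<and> feq r' \<pi> \<sigma>"
     using r' le_refl1 by blast
   qed
  qed
 qed
qed

text \<open>The maximal principle: witnesses are mixed along a maximal antichain of conditions that
  have one, so a single name works for \<open>p\<close> itself and not just densely below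
  it.\<close>

lemma fo_ex_witness:
 assumes "fo p (Ex \<phi>)" "cong \<phi>"
 obtains x where "fo p (\<phi> x)"
proof -
 let ?D = "{r. r << p \<and> (\<exists>x. fo r (\<phi> x))}"
 have "?D \<subseteq> Field P" using le_field by blast
 then obtain A where m: "maxanti ?D A" using maxanti_ex by blast
 note A = maxantiD(1,3,4)[OF m]
 obtain \<tau> where \<tau>: "!!a. a \<in> A ==> fo a (\<phi> (\<tau> a))" using A(1)
 proof -
  have "\<forall>a\<in>A. \<exists>x. fo a (\<phi> x)" using A(1) by auto
  then obtain f where "\<forall>a\<in>A. fo a (\<phi> (f a))" by (rule bchoice[THEN exE])
  then show ?thesis using that by blast
 qed
 obtain \<sigma> where \<sigma>: "!!a. a \<in> A ==> feq a \<sigma> (\<tau> a)" using mix[of A \<tau>] A(2) by metis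
 have "fo p (\<phi> \<sigma>)"
 proof (rule fo_dense)
  fix q assume q: "q << p"
  then obtain r x where "r << q" "fo r (\<phi> x)" using assms(1) unfolding fo_ex by blast
  then obtain a t where a: "a \<in> A" "t << a" "t << r" using A(3)[of r] q le_trans by blast
  have "fo a (\<phi> \<sigma>)" using cong_fo[OF assms(2) \<sigma>[OF a(1)]] \<tau>[OF a(1)] a le_field by blast
  then show "\<exists>r. r << q \<and> fo r (\<phi> \<sigma>)" using a \<open>r << q\<close> fo_mono le_trans by blast
 qed
 then show ?thesis by (rule that)
qed

section \<open>Sufficiently generic filters and their measurable properties\<close>

definition dns :: "'p set => bool" where
 "dns D \<longleftrightarrow> (\<forall>p\<in>Field P. \<exists>q\<in>D. q << p)"

definition filt :: "'p set => bool" where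
 "filt G \<longleftrightarrow> G \<subseteq> Field P \<and> (\<forall>p\<in>G. \<forall>q. p << q --> q \<in> G) \<and>
   (\<forall>p\<in>G. \<forall>q\<in>G. \<exists>r\<in>G. r << p \<and> r << q)"

text \<open>
 A property of filters holds eventually in \<open>gen p\<close> iff it holds for all filters that contain \<open>p\<close> and
 meet countably many dense sets, which may depend on the property.
\<close>

definition gev :: "'p => ('p set => bool) => bool" where
 "gev p \<Phi> \<longleftrightarrow> (\<exists>D :: nat => 'p set. (\<forall>n. dns (D n)) \<and>
   (\<forall>G. filt G --> p \<in> G --> (\<forall>n. G \<inter> D n ~= {}) --> \<Phi> G))"

definition gen :: "'p => 'p set filter" where
 "gen p = Abs_filter (gev p)"

abbreviation "ev p \<Phi> \<equiv> eventually \<Phi> (gen p)"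

text \<open>Countably many sequences of dense sets are merged into one by the pairing function, so
  generic truth is closed under countable conjunctions.\<close>

lemma gev_all: assumes "!!n::nat. gev p (\<Phi> n)" shows "gev p (%G. \<forall>n. \<Phi> n G)"
proof -
 obtain D where D: "!!n k. dns (D n k)"
  "!!n G. filt G ==> p \<in> G ==> (\<forall>k::nat. G \<inter> D n k ~= {}) ==> \<Phi> n G"
  using assms unfolding gev_def by metis
 define E where "E k = D (fst (prod_decode k)) (snd (prod_decode k))" for k
 have "G \<inter> D n k ~= {}" if "\<forall>k. G \<inter> E k ~= {}" for G n k
  using spec[OF that, of "prod_encode (n, k)"] by (simp add: E_def)
 then show ?thesis unfolding gev_def using D by (intro exI[of _ E]) (auto simp: E_def)
qed

lemma gev_mono: "gev p \<Phi> ==> (!!G. \<Phi> G ==> \<Psi> G) ==> gev p \<Psi>"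
 unfolding gev_def by meson

lemma gev_trans:
 assumes "gev p \<Phi>" "!!G. filt G ==> q \<in> G ==> (p \<in> G --> \<Phi> G) ==> \<Psi> G"
 shows "gev q \<Psi>"
proof -
 obtain D :: "nat => 'p set" where "\<forall>n. dns (D n)"
  "\<forall>G. filt G --> p \<in> G --> (\<forall>n. G \<inter> D n ~= {}) --> \<Phi> G"
  using assms(1) unfolding gev_def by (elim exE conjE)
 then show ?thesis unfolding gev_def using assms(2) by (intro exI[of _ D]) simp
qed

lemma dns_Field: "dns (Field P)" unfolding dns_def using le_refl by blast

lemma eventually_gen: "ev p \<Phi> \<longleftrightarrow> gev p \<Phi>"
 unfolding gen_def
proof (rule eventually_Abs_filter, unfold_locales)
 show "gev p (%x. True)" unfolding gev_def using dns_Field by auto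
 fix \<Phi> \<Psi>
 show "gev p (%x. \<Phi> x \<and> \<Psi> x)" if "gev p \<Phi>" "gev p \<Psi>"
 proof -
  have "gev p (if n = 0 then \<Phi> else \<Psi>)" for n :: nat using that by simp
  then have "gev p (%G. \<forall>n::nat. (if n = 0 then \<Phi> else \<Psi>) G)" by (rule gev_all)
  then show ?thesis by (rule gev_mono) (metis zero_neq_one)
 qed
 show "\<forall>x. \<Phi> x --> \<Psi> x ==> gev p \<Phi> ==> gev p \<Psi>" using gev_mono by blast
qed

lemma ev_all: "(!!n::nat. ev p (\<Phi> n)) ==> ev p (%G. \<forall>n. \<Phi> n G)"
 unfolding eventually_gen by (rule gev_all)

lemma ev_all_countable:
 assumes "!!x. x \<in> X ==> ev p (\<Phi> x)" "countable X"
 shows "ev p (%G. \<forall>x\<in>X. \<Phi> x G)"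
proof (cases "X = {}")
 case False
 then have "ev p (%G. \<forall>n. \<Phi> (from_nat_into X n) G)"
  using assms(1) from_nat_into[OF False] by (intro ev_all) simp
 then show ?thesis
  by (rule eventually_mono) (metis assms(2) from_nat_into_surj)
qed simp

lemma ev_dns: "dns D ==> ev p (%G. \<exists>q\<in>D. q \<in> G)"
 unfolding eventually_gen gev_def by (intro exI[of _ "%_. D"]) auto

lemma ev_filt: "ev p (%G. filt G \<and> p \<in> G)"
 unfolding eventually_gen gev_def by (rule exI[of _ "%_. Field P"]) (simp add: dns_Field)

text \<open>The Rasiowa-Sikorski construction: a descending sequence through the given dense sets
  starts at \<open>p\<close>, and the conditions above its terms form the filter.\<close>

lemma gen_nontriv: assumes "p \<in> Field P" shows "\<not> ev p (%G. False)"
proof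
 assume "ev p (%G. False)"
 then obtain D :: "nat => 'p set" where D: "!!n. dns (D n)"
  "!!G. filt G ==> p \<in> G ==> \<exists>n. G \<inter> D n = {}"
  unfolding eventually_gen gev_def by (elim exE conjE) auto
 define f where "f n q = (SOME r. r \<in> D n \<and> r << q)" for n q
 have f: "f n q \<in> D n" "f n q << q" if "q \<in> Field P" for n q
  using someI_ex[of "%r. r \<in> D n \<and> r << q"] D(1)[of n] that unfolding f_def dns_def by blast+
 define s where "s = rec_nat p f"
 have s: "s 0 = p" "s (Suc n) = f n (s n)" for n by (simp_all add: s_def)
 have sF: "s n \<in> Field P" for n
  by (induction n) (use assms s f(2) le_field(1) in force)+
 have dec: "s (m + n) << s m" for m n
 proof (induction n)
  case 0 then show ?case using sF by simp
 next
  case (Suc n) then show ?case using s(2) f(2)[OF sF] le_trans by (metis add_Suc_right)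
 qed
 define G where "G = {q. \<exists>n. s n << q}"
 have "filt G" unfolding filt_def
 proof (intro conjI ballI allI impI)
  show "G \<subseteq> Field P" unfolding G_def using le_field by blast
  show "q \<in> G" if "p \<in> G" "p << q" for p q using that unfolding G_def using le_trans by blast
  fix q q' assume "q \<in> G" "q' \<in> G"
  then obtain n n' where n: "s n << q" "s n' << q'" unfolding G_def by blast
  have "s (n + n') << s n" "s (n + n') << s n'" using dec[of n n'] dec[of n' n] by (simp_all add: add.commute)
  then show "\<exists>r\<in>G. r << q \<and> r << q'" unfolding G_def using n le_trans sF le_refl by blast
 qed
 moreover have "p \<in> G" unfolding G_def using s(1) assms le_refl by (metis mem_Collect_eq)
 ultimately obtain n where "G \<inter> D n = {}" using D(2) by blast
 moreover have "s (Suc n) \<in> G" unfolding G_def using le_refl[OF sF[of "Suc n"]] by blast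
 then have "s (Suc n) \<in> G \<inter> D n" using f(1)[OF sF] s(2) by simp
 ultimately show False by blast
qed

lemma ev_not_both: "p \<in> Field P ==> ev p \<Phi> ==> ev p (%G. \<not> \<Phi> G) ==> False"
 using eventually_conj[of \<Phi> "gen p" "%G. \<not> \<Phi> G"] gen_nontriv by simp

lemma ev_const: "p \<in> Field P ==> ev p (%G. b) \<longleftrightarrow> b"
 using gen_nontriv by (cases b) auto

lemma ev_gen_le: assumes "ev p \<Phi>" "q << p" shows "ev q \<Phi>"
 unfolding eventually_gen
proof (rule gev_trans[OF assms(1)[unfolded eventually_gen]])
 fix G assume "filt G" "q \<in> G" "p \<in> G --> \<Phi> G"
 then show "\<Phi> G" using assms(2) unfolding filt_def by blast
qed

text \<open>This is where the chain condition enters: a maximal antichain of conditions at which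
  \<open>\<Phi>\<close> is generically true is countable, so the dense sets belonging to its members
  can be used together, and one further dense set makes the filter meet the antichain.\<close>

lemma ev_gen_dense:
 assumes p: "p \<in> Field P" and d: "!!q. q << p ==> \<exists>r. r << q \<and> ev r \<Phi>"
 shows "ev p \<Phi>"
proof -
 let ?D = "{r. r << p \<and> ev r \<Phi>}"
 have "?D \<subseteq> Field P" using le_field by blast
 then obtain A where m: "maxanti ?D A" using maxanti_ex by blast
 note A = maxantiD[OF m]
 \<comment> \<open>Conditions incompatible with \<open>p\<close> are added to make the set dense; a
   filter that contains \<open>p\<close> contains none of them.\<close>
 let ?E = "{r. (\<exists>a\<in>A. r << a) \<or> (\<forall>s. s << r --> \<not> s << p)}"
 have "dns ?E" unfolding dns_def
 proof
  fix q assume q: "q \<in> Field P"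
  show "\<exists>r\<in>?E. r << q"
  proof (cases "\<exists>s. s << q \<and> s << p")
   case True
   then obtain s where s: "s << q" "s << p" by blast
   then obtain r where r: "r << s" "ev r \<Phi>" using d by blast
   then have "r \<in> ?D" using s le_trans by blast
   then obtain a t where "a \<in> A" "t << a" "t << r" using A(4) by blast
   then show ?thesis using s r le_trans by blast
  next
   case False then show ?thesis using q le_refl by blast
  qed
 qed
 then have "ev p (%G. \<exists>q\<in>?E. q \<in> G)" by (rule ev_dns)
 then have A_meets: "ev p (%G. \<exists>a\<in>A. a \<in> G)" using ev_filt
 proof eventually_elim
  case (elim G)
  then obtain q where q: "q \<in> ?E" "q \<in> G" by blast
  then have "\<exists>s\<in>G. s << q \<and> s << p" using elim(2) unfolding filt_def by blast
  then obtain a where "a \<in> A" "q << a" using q(1) by blast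
  then show ?case using q(2) elim(2) unfolding filt_def by blast
 qed
 have "ev p (%G. \<forall>a\<in>A. a \<in> G --> \<Phi> G)"
 proof (rule ev_all_countable[OF _ A(2)])
  fix a assume "a \<in> A"
  then have "gev a \<Phi>" using A(1) unfolding eventually_gen by blast
  then show "ev p (%G. a \<in> G --> \<Phi> G)" unfolding eventually_gen by (rule gev_trans)
 qed
 then show ?thesis using A_meets by eventually_elim blast
qed

text \<open>The basic events are that a condition belongs to the filter; the sets generated from
  them play the role of Borel codes.\<close>

definition M :: "'p set measure" where
 "M = sigma UNIV (range (%q. {G. q \<in> G}))"

abbreviation "mpred \<equiv> Measurable.pred M"

lemma space_M [simp]: "space M = UNIV" unfolding M_def by (simp add: space_measure_of_conv)

lemma sets_M: "sets M = sigma_sets UNIV (range (%q. {G. q \<in> G}))"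
 unfolding M_def by (rule sets_measure_of) auto

lemma pred_in [measurable]: "mpred (%G. q \<in> G)"
 unfolding pred_def sets_M by (rule sigma_sets.Basic) auto

text \<open>Induction over the sigma-algebra. For a countable union, if no stronger condition puts
  the filter into some member, each member is avoided densely, hence generically, and so is the
  union.\<close>

lemma ev_dec:
 assumes "mpred \<Phi>" "p \<in> Field P"
 shows "\<exists>q. q << p \<and> (ev q \<Phi> \<or> ev q (%G. \<not> \<Phi> G))"
proof -
 have "\<forall>p\<in>Field P. \<exists>q. q << p \<and> (ev q (%G. G \<in> X) \<or> ev q (%G. G \<notin> X))"
  if "X \<in> sets M" for X
  using that unfolding sets_M
 proof (induction rule: sigma_sets.induct)
  case (Basic X)
  then obtain x where X: "X = {G. x \<in> G}" by blast
  show ?case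
  proof
   fix p assume p: "p \<in> Field P"
   show "\<exists>q. q << p \<and> (ev q (%G. G \<in> X) \<or> ev q (%G. G \<notin> X))"
   proof (cases "\<exists>s. s << p \<and> s << x")
    case True
    then obtain s where s: "s << p" "s << x" by blast
    have "ev s (%G. x \<in> G)"
     using ev_filt[of s] by eventually_elim (use s in \<open>auto simp: filt_def\<close>)
    then show ?thesis using s X by auto
   next
    case False
    have "ev p (%G. x \<notin> G)"
     using ev_filt[of p] by eventually_elim (use False in \<open>auto simp: filt_def; blast\<close>)
    then show ?thesis using p X by auto
   qed
  qed
 next
  case Empty
  then show ?case using le_refl by fastforce
 next
  case (Compl X) then show ?case by simp blast
 next
  case (Union X)
  show ?case
  proof
   fix p assume p: "p \<in> Field P"
   show "\<exists>q. q << p \<and> (ev q (%G. G \<in> \<Union>(range X)) \<or> ev q (%G. G \<notin> \<Union>(range X)))"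
   proof (cases "\<exists>q n. q << p \<and> ev q (%G. G \<in> X n)")
    case True
    then obtain q n where q: "q << p" "ev q (%G. G \<in> X n)" by blast
    then have "ev q (%G. G \<in> \<Union>(range X))"
     by (elim eventually_mono) blast
    then show ?thesis using q by blast
   next
    case False
    have "ev p (%G. G \<notin> X n)" for n
     by (rule ev_gen_dense[OF p]) (use Union.IH[of n] False le_field(1) le_trans in meson)
    then have "ev p (%G. \<forall>n. G \<notin> X n)" by (rule ev_all)
    then have "ev p (%G. G \<notin> \<Union>(range X))" by (elim eventually_mono) blast
    then show ?thesis using p le_refl by blast
   qed
  qed
 qed
 from this[of "{G. \<Phi> G}"] show ?thesis using assms by (auto simp: pred_def)
qed

lemma ev_refute:
 assumes "mpred \<Phi>" "p \<in> Field P" "\<not> ev p \<Phi>"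
 shows "\<exists>q. q << p \<and> ev q (%G. \<not> \<Phi> G)"
proof (rule ccontr)
 assume n: "\<not> ?thesis"
 have "ev p \<Phi>"
  by (rule ev_gen_dense[OF assms(2)]) (use ev_dec[OF assms(1)] n le_field(1) le_trans in meson)
 then show False using assms(3) by blast
qed

lemma ev_ex_nat:
 assumes "!!n::nat. mpred (\<Phi> n)" "p \<in> Field P" "ev p (%G. \<exists>n. \<Phi> n G)"
 shows "\<exists>q n. q << p \<and> ev q (\<Phi> n)"
proof (rule ccontr)
 assume n: "\<not> ?thesis"
 have "ev p (%G. \<not> \<Phi> n G)" for n
  by (rule ev_gen_dense[OF assms(2)]) (use ev_dec[OF assms(1)] n le_field(1) le_trans in meson)
 then have "ev p (%G. \<forall>n. \<not> \<Phi> n G)" by (rule ev_all)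
 then show False using ev_not_both[OF assms(2,3)] by simp
qed

definition wit :: "'p name fm => 'p set" where
 "wit \<phi> = (SOME A. maxanti {q \<in> Field P. fo q \<phi>} A)"

lemma maxanti_wit: "maxanti {q \<in> Field P. fo q \<phi>} (wit \<phi>)"
 unfolding wit_def by (rule someI_ex, rule maxanti_ex) auto

text \<open>Truth of \<open>\<phi>\<close> in the extension. Meeting a countable antichain is a
  measurable event, which meeting the set of all conditions forcing \<open>\<phi>\<close> need not
  be.\<close>

definition Holds :: "'p name fm => 'p set => bool" where
 "Holds \<phi> G \<longleftrightarrow> (\<exists>q\<in>wit \<phi>. q \<in> G)"

lemma pred_Holds [measurable]: "mpred (Holds \<phi>)"
 unfolding Holds_def using maxantiD(2)[OF maxanti_wit] by measurable

lemma fo_Holds: assumes "p \<in> Field P" shows "fo p \<phi> \<longleftrightarrow> ev p (Holds \<phi>)"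
proof
 note A = maxantiD[OF maxanti_wit[of \<phi>]]
 assume f: "fo p \<phi>"
 show "ev p (Holds \<phi>)"
 proof (rule ev_gen_dense[OF assms])
  fix q assume q: "q << p"
  then have "q \<in> {q \<in> Field P. fo q \<phi>}" using f fo_mono le_field by blast
  then obtain a r where r: "a \<in> wit \<phi>" "r << a" "r << q" using A(4) by blast
  have "ev r (Holds \<phi>)"
   using ev_filt[of r] unfolding Holds_def by eventually_elim (use r in \<open>auto simp: filt_def\<close>)
  then show "\<exists>r. r << q \<and> ev r (Holds \<phi>)" using r by blast
 qed
next
 assume e: "ev p (Holds \<phi>)"
 show "fo p \<phi>"
 proof (rule ccontr)
  assume "\<not> fo p \<phi>"
  then obtain q where q: "q << p" "fo q (Neg \<phi>)" using fo_refute assms by blast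
  have "ev q (%G. \<not> Holds \<phi> G)"
   using ev_filt[of q]
  proof eventually_elim
   case (elim G)
   show ?case
   proof
    assume "Holds \<phi> G"
    then obtain a where a: "a \<in> wit \<phi>" "a \<in> G" unfolding Holds_def by blast
    then obtain r where "r << a" "r << q" using elim unfolding filt_def by blast
    moreover have "fo a \<phi>" using a(1) maxantiD(1)[OF maxanti_wit] by blast
    ultimately show False using q(2) fo_mono by (auto simp: fo_neg)
   qed
  qed
  then show False using ev_not_both ev_gen_le[OF e q(1)] q(1) le_field(1) by blast
 qed
qed

text \<open>The interface between formulas and mathematics: once a formula is translated into an
  event, statements about the extension are proved by arguing about a single filter.\<close>

definition Tr :: "'p => 'p name fm => ('p set => bool) => bool" where
 "Tr p \<phi> \<Phi> \<longleftrightarrow> mpred \<Phi> \<and> (\<forall>q. q << p --> fo q \<phi> \<longleftrightarrow> ev q \<Phi>)"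

lemma Tr_pred: "Tr p \<phi> \<Phi> ==> mpred \<Phi>" unfolding Tr_def by blast

lemma TrD: "Tr p \<phi> \<Phi> ==> q << p ==> fo q \<phi> \<longleftrightarrow> ev q \<Phi>" unfolding Tr_def by blast

lemma TrD': "Tr p \<phi> \<Phi> ==> p \<in> Field P ==> fo p \<phi> \<longleftrightarrow> ev p \<Phi>" unfolding Tr_def by simp

lemma Tr_Holds: "Tr p \<phi> (Holds \<phi>)"
 unfolding Tr_def using fo_Holds le_field(1) by auto

lemma Tr_conj: "Tr p \<phi> \<Phi> ==> Tr p \<psi> \<Psi> ==> Tr p (Conj \<phi> \<psi>) (%G. \<Phi> G \<and> \<Psi> G)"
 unfolding Tr_def by (auto simp: eventually_conj_iff)

text \<open>Measurability does the work: because \<open>\<Phi>\<close> can be decided, its failure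
  to hold generically yields a stronger condition with its negation.\<close>

lemma Tr_neg: assumes "Tr p \<phi> \<Phi>" shows "Tr p (Neg \<phi>) (%G. \<not> \<Phi> G)"
proof -
 have [measurable]: "mpred \<Phi>" using assms by (rule Tr_pred)
 have "fo q (Neg \<phi>) \<longleftrightarrow> ev q (%G. \<not> \<Phi> G)" if q: "q << p" for q
 proof
  assume h: "fo q (Neg \<phi>)"
  show "ev q (%G. \<not> \<Phi> G)"
  proof (rule ccontr)
   assume "\<not> ?thesis"
   then obtain r where r: "r << q" "ev r \<Phi>"
    using ev_refute[of "%G. \<not> \<Phi> G" q] q le_field(1) by auto
   then show False using h TrD[OF assms] q le_trans by (auto simp: fo_neg)
  qed
 next
  assume h: "ev q (%G. \<not> \<Phi> G)"
  have "\<not> fo r \<phi>" if "r << q" for r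
   using TrD[OF assms, of r] that q le_trans ev_gen_le[OF h that] ev_not_both le_field(1) by blast
  then show "fo q (Neg \<phi>)" by (simp add: fo_neg)
 qed
 then show ?thesis unfolding Tr_def by simp
qed

lemma Tr_imp: "Tr p \<phi> \<Phi> ==> Tr p \<psi> \<Psi> ==> Tr p (Imp \<phi> \<psi>) (%G. \<Phi> G --> \<Psi> G)"
 using Tr_neg[OF Tr_conj[OF _ Tr_neg]] by simp

lemma Tr_disj: "Tr p \<phi> \<Phi> ==> Tr p \<psi> \<Psi> ==> Tr p (Disj \<phi> \<psi>) (%G. \<Phi> G \<or> \<Psi> G)"
 using Tr_neg[OF Tr_conj[OF Tr_neg Tr_neg]] by simp

lemma Tr_const: "p \<in> Field P ==> (b ==> fo p \<phi>) ==> (\<not> b ==> fo p (Neg \<phi>)) ==> Tr p \<phi> (%G. b)"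
 unfolding Tr_def using fo_mono ev_const le_field(1) by (auto simp: fo_neg)

lemma Tr_cong: assumes "Tr p \<phi> \<Phi>" "!!G. \<Phi> G \<longleftrightarrow> \<Psi> G" shows "Tr p \<phi> \<Psi>"
proof -
 have "\<Phi> = \<Psi>" using assms(2) by (rule ext)
 then show ?thesis using assms(1) by simp
qed

lemma Tr_ev_cong:
 assumes "Tr p \<phi> \<Phi>" "ev p (%G. \<Phi> G \<longleftrightarrow> \<Psi> G)" "mpred \<Psi>"
 shows "Tr p \<phi> \<Psi>"
 unfolding Tr_def
proof (intro conjI allI impI assms(3))
 fix q assume "q << p"
 then have e: "ev q (%G. \<Phi> G \<longleftrightarrow> \<Psi> G)" using assms(2) ev_gen_le by blast
 have "ev q \<Phi> \<longleftrightarrow> ev q \<Psi>"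
  using e by (rule eventually_subst)
 then show "fo q \<phi> \<longleftrightarrow> ev q \<Psi>" using TrD[OF assms(1) \<open>q << p\<close>] by simp
qed

end

section \<open>Check names of ordinals, pairs and relations\<close>

lemma underS_sub: "underS r b \<subseteq> Field r"
 by (auto simp: underS_def Field_def)

lemma underS_cases:
 assumes "Well_order r" "a \<in> Field r" "b \<in> Field r"
 shows "a = b \<or> a \<in> underS r b \<or> b \<in> underS r a"
proof -
 have "Total r" using assms(1) unfolding well_order_on_def linear_order_on_def by blast
 then show ?thesis using assms unfolding total_on_def underS_def by blast
qed

lemma underS_trans:
 assumes "Well_order r" "a \<in> underS r b" "b \<in> underS r c" shows "a \<in> underS r c"
proof -
 have "trans r" "antisym r"
  using assms(1) unfolding well_order_on_def linear_order_on_def partial_order_on_def preorder_on_def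
  by blast+
 then show ?thesis using assms(2,3) unfolding underS_def trans_def antisym_def by blast
qed

context forcing
begin

lemma check_elt_unfold:
 assumes "Well_order r"
 shows "(check_elt r b :: 'p name) = check_set (check_elt r ` underS r b)"
proof -
 have wf: "wf (r - Id)" using assms unfolding well_order_on_def by blast
 have "cut (check_elt r :: _ => 'p name) (r - Id) b ` underS r b = check_elt r ` underS r b"
  by (rule image_cong) (auto simp: cut_apply underS_def)
 then show ?thesis
  unfolding check_elt_def by (subst wfrec[OF wf]) simp
qed

definition smallwo :: "'a rel => bool" where
 "smallwo r \<longleftrightarrow> Well_order r \<and> small (Field r)"

lemma smallwoD:
 assumes "smallwo r"
 shows "Well_order r" "small (Field r)" "small (underS r b)"
proof -
 show "Well_order r" and s: "small (Field r)" using assms unfolding smallwo_def by blast+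
 show "small (underS r b)" by (rule small_sub[OF s underS_sub])
qed

lemma fmem_check_elt:
 assumes "smallwo r"
 shows "fmem p x (check_elt r b) \<longleftrightarrow>
  (\<forall>q. q << p --> (\<exists>r'. r' << q \<and> (\<exists>a\<in>underS r b. feq r' x (check_elt r a))))"
 using fmem_check_set[OF small_image[OF smallwoD(3)[OF assms]]]
 by (subst check_elt_unfold[OF smallwoD(1)[OF assms]]) auto

lemma fmem_check_ord:
 assumes "smallwo r"
 shows "fmem p x (check_ord r) \<longleftrightarrow>
  (\<forall>q. q << p --> (\<exists>r'. r' << q \<and> (\<exists>a\<in>Field r. feq r' x (check_elt r a))))"
 unfolding check_ord_def
 using fmem_check_set[OF small_image[OF smallwoD(2)[OF assms]]] by auto

lemma fmem_check_eltI: "smallwo r ==> a \<in> underS r b ==> fmem p (check_elt r a) (check_elt r b)"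
 unfolding fmem_check_elt using feq_refl le_refl1 by blast

lemma fmem_check_ordI: "smallwo r ==> a \<in> Field r ==> fmem p (check_elt r a) (check_ord r)"
 unfolding fmem_check_ord using feq_refl le_refl1 by blast

text \<open>A check name forced into itself would be forced equal to one of its elements, which
  would then be forced into itself in turn; well-foundedness excludes this.\<close>

lemma check_elt_irrefl:
 assumes r: "smallwo r"
 shows "p \<in> Field P ==> \<not> fmem p (check_elt r a) (check_elt r a)"
proof -
 have wf: "wf (r - Id)" using smallwoD(1)[OF r] unfolding well_order_on_def by blast
 show "p \<in> Field P ==> \<not> fmem p (check_elt r a) (check_elt r a)"
  using wf
 proof (induction a arbitrary: p rule: wf_induct_rule)
  case (less a)
  show ?case
  proof
   assume h: "fmem p (check_elt r a) (check_elt r a)"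
   then obtain q a' where q: "q << p" "a' \<in> underS r a" "feq q (check_elt r a) (check_elt r a')"
    unfolding fmem_check_elt[OF r] using le_refl[OF less.prems] by blast
   have "fmem q (check_elt r a') (check_elt r a)" using fmem_check_eltI[OF r q(2)] .
   then have "fmem q (check_elt r a') (check_elt r a')" using fmem_cong2 q(3) by blast
   moreover have "(a', a) \<in> r - Id" using q(2) by (auto simp: underS_def)
   ultimately show False using less.IH q(1) le_field(1) by blast
  qed
 qed
qed

lemma check_elt_inj:
 assumes r: "smallwo r" and p: "p \<in> Field P" and ab: "a \<in> Field r" "b \<in> Field r"
  and e: "feq p (check_elt r a) (check_elt r b)"
 shows "a = b"
proof (rule ccontr)
 assume "a ~= b"
 then consider "a \<in> underS r b" | "b \<in> underS r a" using underS_cases[OF smallwoD(1)[OF r] ab] by blast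
 then show False
 proof cases
  case 1
  then show False using fmem_check_eltI[OF r 1, of p] check_elt_irrefl[OF r p] fmem_cong2 e feq_sym by blast
 next
  case 2
  then show False using fmem_check_eltI[OF r 2, of p] check_elt_irrefl[OF r p] fmem_cong2 e by blast
 qed
qed

lemma check_elt_mem:
 assumes r: "smallwo r" and p: "p \<in> Field P" and ab: "a \<in> Field r" "b \<in> Field r"
  and e: "fmem p (check_elt r a) (check_elt r b)"
 shows "a \<in> underS r b"
proof -
 obtain q a' where q: "q << p" "a' \<in> underS r b" "feq q (check_elt r a) (check_elt r a')"
  using e le_refl[OF p] unfolding fmem_check_elt[OF r] by blast
 have "a = a'" using check_elt_inj[OF r le_field(1)[OF q(1)] ab(1) _ q(3)] q(2) underS_sub[of r b] by blast
 then show ?thesis using q(2) by simp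
qed

lemma fo_ball_check:
 assumes r: "smallwo r" and c: "cong \<phi>"
 shows "fo p (BAll (check_ord r) \<phi>) \<longleftrightarrow> (\<forall>a\<in>Field r. \<forall>q. q << p --> fo q (\<phi> (check_elt r a)))"
proof
 assume h: "fo p (BAll (check_ord r) \<phi>)"
 show "\<forall>a\<in>Field r. \<forall>q. q << p --> fo q (\<phi> (check_elt r a))"
  using h fmem_check_ordI[OF r] unfolding fo_ball by blast
next
 assume h: "\<forall>a\<in>Field r. \<forall>q. q << p --> fo q (\<phi> (check_elt r a))"
 show "fo p (BAll (check_ord r) \<phi>)" unfolding fo_ball
 proof (intro allI impI)
  fix x q assume q: "q << p" and x: "fmem q x (check_ord r)"
  show "fo q (\<phi> x)"
  proof (rule fo_dense)
   fix s assume s: "s << q"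
   then obtain t a where t: "t << s" "a \<in> Field r" "feq t x (check_elt r a)"
    using x unfolding fmem_check_ord[OF r] by blast
   have "t << p" using t s q le_trans by blast
   then have "fo t (\<phi> x)" using h t cong_fo[OF c t(3)] le_field(1) by blast
   then show "\<exists>t. t << s \<and> fo t (\<phi> x)" using t(1) by blast
  qed
 qed
qed

lemma smallwo_nat [simp]: "smallwo natLeq"
 unfolding smallwo_def using natLeq_Well_order small_nat by blast

lemma underS_nat [simp]: "underS natLeq n = {..<n}"
 by (auto simp: underS_def natLeq_def)

lemma Field_nat [simp]: "Field natLeq = UNIV" by (rule Field_natLeq)

lemma fmem_om: "fmem p x om \<longleftrightarrow> (\<forall>q. q << p --> (\<exists>r. r << q \<and> (\<exists>n. feq r x (nm n))))"
 by (simp add: fmem_check_ord)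

lemma fmem_omI [simp]: "fmem p (nm n) om"
 by (rule fmem_check_ordI) simp_all

lemma small_finite: "finite S ==> small S"
 by (rule small_countable) (rule countable_finite)

lemma fmem_upair: "fmem p w (check_set {x, y}) \<longleftrightarrow>
  (\<forall>q. q << p --> (\<exists>r. r << q \<and> (feq r w x \<or> feq r w (y :: 'p name))))"
 by (subst fmem_check_set) (auto intro: small_finite)

lemma fmem_upairI: "fmem p x (check_set {x, y :: 'p name})" "fmem p y (check_set {x, y})"
 unfolding fmem_upair using feq_refl le_refl1 by blast+

lemma upair_feqD:
 assumes "feq p (check_set {x, y}) (check_set {u, v :: 'p name})" "q << p"
 shows "\<exists>r. r << q \<and> (feq r x u \<or> feq r x v)" "\<exists>r. r << q \<and> (feq r y u \<or> feq r y v)"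
 using fmem_cong2[OF assms(1) fmem_upairI(1)] fmem_cong2[OF assms(1) fmem_upairI(2)] assms(2)
 unfolding fmem_upair by blast+

lemma upair_cong:
 assumes "feq p x x'" "feq p y y'"
 shows "feq p (check_set {x, y}) (check_set {x', y' :: 'p name})"
proof (rule feq_ext)
 fix w q assume q: "q << p"
 have *: "fmem q w (check_set {x', y'})"
  if e: "feq q x x'" "feq q y y'" and m: "fmem q w (check_set {x, y})" for x x' y y' :: "'p name"
  unfolding fmem_upair
 proof (intro allI impI)
  fix r assume r: "r << q"
  then obtain s where s: "s << r" "feq s w x \<or> feq s w y" using m unfolding fmem_upair by blast
  have "feq s x x'" "feq s y y'" using e feq_mono le_trans[OF s(1) r] by blast+
  then show "\<exists>s. s << r \<and> (feq s w x' \<or> feq s w y')" using s feq_trans by blast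
 qed
 have e: "feq q x x'" "feq q y y'" using assms feq_mono q by blast+
 then have "feq q x' x" "feq q y' y" using feq_sym by blast+
 then show "fmem q w (check_set {x, y}) = fmem q w (check_set {x', y'})" using * e by blast
qed

lemma fo_is_upair: "fo p (is_upair z x y) \<longleftrightarrow> feq p z (check_set {x, y})"
proof
 assume h: "fo p (is_upair z x y)"
 show "feq p z (check_set {x, y})"
 proof (rule feq_ext)
  fix w q assume "q << p"
  then have "fo q (Mem w z) = fo q (Disj (Eq w x) (Eq w y))"
   using h unfolding is_upair_def forces.simps(5) fo_iff by blast
  then show "fmem q w z = fmem q w (check_set {x, y})"
   unfolding fo_disj fmem_upair by simp
 qed
next
 assume h: "feq p z (check_set {x, y})"
 have "fmem q w z = fmem q w (check_set {x, y})" if "q << p" for q w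
  using feq_mono[OF h that] fmem_cong2 feq_sym by blast
 then show "fo p (is_upair z x y)"
  unfolding is_upair_def forces.simps(5) fo_iff fo_disj by (simp add: fmem_upair)
qed

text \<open>With the singleton written as an unordered pair, the facts on unordered pairs serve both
  components.\<close>

lemma check_pair_eq: "check_pair x y = check_set {check_set {x, x}, check_set {x, y :: 'p name}}"
 unfolding check_pair_def by simp

lemma fo_is_pair: "fo p (is_pair z x y) \<longleftrightarrow> feq p z (check_pair x y)"
proof -
 have "fo p (is_pair z x y) \<longleftrightarrow> (\<forall>w q. q << p --> fmem q w z = fmem q w (check_pair x y))"
  unfolding is_pair_def forces.simps(5) fo_iff fo_disj fo_is_upair check_pair_eq fmem_upair by simp
 also have "\<dots> \<longleftrightarrow> feq p z (check_pair x y)"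
  using feq_ext fmem_cong2 feq_mono feq_sym by metis
 finally show ?thesis .
qed

lemma check_pair_cong: "feq p x x' ==> feq p y y' ==> feq p (check_pair x y) (check_pair x' y')"
 unfolding check_pair_eq by (intro upair_cong)

text \<open>Kuratowski's argument carried out densely: each alternative is settled only by a
  stronger condition, so the conditions descend along the case distinctions.\<close>

lemma check_pair_inj:
 assumes e: "feq p (check_pair x y) (check_pair x' y')"
 shows "feq p x x'" "feq p y y'"
proof -
 have tr: "feq q a c" if "feq q a b" "feq q b c" for q a b c using feq_trans that by blast
 show xx: "feq p x x'"
 proof (rule feq_dense)
  fix q assume q: "q << p"
  obtain r where r: "r << q" "feq r (check_set {x, x}) (check_set {x', x'}) \<or>
    feq r (check_set {x, x}) (check_set {x', y'})"
   using upair_feqD(1)[OF e[unfolded check_pair_eq] q] by blast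
  then consider "feq r (check_set {x, x}) (check_set {x', x'})" |
   "feq r (check_set {x', y'}) (check_set {x, x})" using feq_sym by blast
  then show "\<exists>r. r << q \<and> feq r x x'"
  proof cases
   case 1 then show ?thesis using upair_feqD(1)[OF 1, of r] r(1) le_refl1 le_trans by meson
  next
   case 2 then show ?thesis using upair_feqD(1)[OF 2, of r] r(1) le_refl1 le_trans feq_sym by meson
  qed
 qed
 show "feq p y y'"
 proof (rule feq_dense)
  fix q assume q: "q << p"
  have e': "feq p (check_pair x' y') (check_pair x y)" using e feq_sym by blast
  obtain r where r: "r << q" "feq r (check_set {x, y}) (check_set {x', x'}) \<or>
    feq r (check_set {x, y}) (check_set {x', y'})"
   using upair_feqD(2)[OF e[unfolded check_pair_eq] q] by blast
  then obtain s where s: "s << r" "feq s y x' \<or> feq s y y'"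
   using upair_feqD(2)[of r x y] le_refl1 by meson
  have sp: "s << p" using s r q le_trans by blast
  \<comment> \<open>The reversed equality is needed when \<open>y\<close> turned out to equal
    \<open>x'\<close>: then \<open>y'\<close> has to be found among \<open>x\<close> and
    \<open>y\<close>.\<close>
  obtain t where t: "t << s" "feq t (check_set {x', y'}) (check_set {x, x}) \<or>
    feq t (check_set {x', y'}) (check_set {x, y})"
   using upair_feqD(2)[OF e'[unfolded check_pair_eq] sp] by blast
  then obtain u where u: "u << t" "feq u y' x \<or> feq u y' y"
   using upair_feqD(2)[of t x' y'] le_refl1 by meson
  have us: "u << s" "u << q" "u << p" using u t s r q le_trans by meson+
  have "feq u x x'" using feq_mono xx us by blast
  moreover have "feq u y x' \<or> feq u y y'" using s(2) feq_mono us by blast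
  ultimately have "feq u y y'" using u(2) tr feq_sym by meson
  then show "\<exists>r. r << q \<and> feq r y y'" using us by blast
 qed
qed

lemma fo_rel2: "fo p (rel2 R x y) \<longleftrightarrow> fmem p (check_pair x y) R"
proof
 assume h: "fo p (rel2 R x y)"
 show "fmem p (check_pair x y) R"
  using fo_exE[OF h[unfolded rel2_def], of "Mem (check_pair x y) R"]
  by (simp add: fo_is_pair) (metis fmem_cong1)
next
 assume h: "fmem p (check_pair x y) R"
 show "fo p (rel2 R x y)" unfolding rel2_def
  by (rule fo_exI[of _ "check_pair x y"]) (simp add: fo_is_pair feq_refl h)
qed

lemma fo_rel3: "fo p (rel3 R x y z) \<longleftrightarrow> fmem p (check_pair (check_pair x y) z) R"
proof
 assume h: "fo p (rel3 R x y z)"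
 show "fmem p (check_pair (check_pair x y) z) R"
  using fo_exE[OF h[unfolded rel3_def], of "Mem (check_pair (check_pair x y) z) R"]
  by (simp add: fo_is_pair fo_rel2) (metis fmem_cong1 check_pair_cong feq_refl)
next
 assume h: "fmem p (check_pair (check_pair x y) z) R"
 show "fo p (rel3 R x y z)" unfolding rel3_def
  by (rule fo_exI[of _ "check_pair x y"]) (simp add: fo_is_pair fo_rel2 feq_refl h)
qed

lemma cong_rel2: "cong (%x. rel2 R x y)" "cong (%y. rel2 R x y)" "cong (%R. rel2 R x y)"
 by (rule congI, unfold fo_rel2, metis check_pair_cong feq_refl fmem_cong1 fmem_cong2)+

lemma cong_rel3: "cong (%x. rel3 R x y z)" "cong (%y. rel3 R x y z)" "cong (%z. rel3 R x y z)"
 by (rule congI, unfold fo_rel3, metis check_pair_cong feq_refl fmem_cong1)+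

lemma cong_pair: "cong (%x. is_pair z x y)" "cong (%y. is_pair z x y)" "cong (%z. is_pair z x y)"
 by (rule congI, unfold fo_is_pair, metis check_pair_cong feq_refl feq_trans feq_sym)+

lemmas congs = cong_intros cong_rel2 cong_rel3 cong_pair

text \<open>The quantifier ranges over all names, but every witness is forced into \<omega>; it
  densely equals some check name, so the quantifier becomes one over natural numbers.\<close>

lemma Tr_ex:
 assumes c: "cong \<phi>" and om: "!!q x. q << p ==> fo q (\<phi> x) ==> fmem q x om"
  and tr: "!!n. Tr p (\<phi> (nm n)) (\<Phi> n)"
 shows "Tr p (Ex \<phi>) (%G. \<exists>n. \<Phi> n G)"
proof -
 note [measurable] = Tr_pred[OF tr]
 have "fo q (Ex \<phi>) \<longleftrightarrow> ev q (%G. \<exists>n. \<Phi> n G)" if q: "q << p" for q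
 proof
  assume h: "fo q (Ex \<phi>)"
  show "ev q (%G. \<exists>n. \<Phi> n G)"
  proof (rule ev_gen_dense[OF le_field(1)[OF q]])
   fix r assume r: "r << q"
   then obtain s x where s: "s << r" "fo s (\<phi> x)" using h unfolding fo_ex by blast
   have sp: "s << p" using s r q le_trans by blast
   obtain t n where t: "t << s" "feq t x (nm n)"
    using om[OF sp s(2)] s(1) le_refl1(1) unfolding fmem_om by blast
   have "fo t (\<phi> (nm n))"
    using cong_fo[OF c t(2) le_field(1)[OF t(1)]] fo_mono[OF s(2) t(1)] by blast
   then have "ev t (\<Phi> n)" using TrD[OF tr le_trans[OF t(1) sp]] by blast
   then have "ev t (%G. \<exists>n. \<Phi> n G)" by (rule eventually_mono) blast
   then show "\<exists>t. t << r \<and> ev t (%G. \<exists>n. \<Phi> n G)" using t s le_trans by blast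
  qed
 next
  assume h: "ev q (%G. \<exists>n. \<Phi> n G)"
  show "fo q (Ex \<phi>)" unfolding fo_ex
  proof (intro allI impI)
   fix r assume r: "r << q"
   obtain s n where s: "s << r" "ev s (\<Phi> n)"
    using ev_ex_nat[of \<Phi> r] ev_gen_le[OF h r] r le_field(1) Tr_pred[OF tr] by blast
   then have "fo s (\<phi> (nm n))" using TrD[OF tr] q r le_trans by meson
   then show "\<exists>s x. s << r \<and> fo s (\<phi> x)" using s by blast
  qed
 qed
 then show ?thesis unfolding Tr_def by simp
qed

lemma Tr_in_om: "Tr p (Mem (nm n) om) (%G. True)"
 unfolding Tr_def by simp

lemma Tr_bex_om:
 assumes c: "cong \<phi>" and tr: "!!n. Tr p (\<phi> (nm n)) (\<Phi> n)"
 shows "Tr p (BEx om \<phi>) (%G. \<exists>n. \<Phi> n G)"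
proof -
 have c': "cong (%x. Conj (Mem x om) (\<phi> x))"
  by (intro cong_intros c)
 have "Tr p (Ex (%x. Conj (Mem x om) (\<phi> x))) (%G. \<exists>n. True \<and> \<Phi> n G)"
  by (rule Tr_ex[OF c']) (simp, intro Tr_conj Tr_in_om tr)
 then show ?thesis unfolding BEx_def by simp
qed

lemma Tr_ball_om:
 assumes c: "cong \<phi>" and tr: "!!n. Tr p (\<phi> (nm n)) (\<Phi> n)"
 shows "Tr p (BAll om \<phi>) (%G. \<forall>n. \<Phi> n G)"
proof -
 note [measurable] = Tr_pred[OF tr]
 have "fo q (BAll om \<phi>) \<longleftrightarrow> ev q (%G. \<forall>n. \<Phi> n G)" if q: "q << p" for q
 proof
  assume h: "fo q (BAll om \<phi>)"
  have "ev q (\<Phi> n)" for n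
   using h TrD[OF tr q] q le_refl1 unfolding fo_ball_check[OF smallwo_nat c] by simp
  then show "ev q (%G. \<forall>n. \<Phi> n G)" by (rule ev_all)
 next
  assume h: "ev q (%G. \<forall>n. \<Phi> n G)"
  show "fo q (BAll om \<phi>)" unfolding fo_ball_check[OF smallwo_nat c]
  proof (intro ballI allI impI)
   fix n r assume r: "r << q"
   have "ev r (\<Phi> n)" using ev_gen_le[OF h r] by (rule eventually_mono) blast
   then show "fo r (\<phi> (nm n))" using TrD[OF tr] r q le_trans by blast
  qed
 qed
 then show ?thesis unfolding Tr_def by simp
qed

lemma nat_feq: "p \<in> Field P ==> feq p (nm m) (nm n) \<longleftrightarrow> m = n"
 using check_elt_inj[OF smallwo_nat] feq_refl by auto

lemma nat_fmem: "p \<in> Field P ==> fmem p (nm m) (nm n) \<longleftrightarrow> m < n"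
 using check_elt_mem[OF smallwo_nat, of p m n] fmem_check_eltI[OF smallwo_nat, of m n] by auto

lemma Tr_nat_eq: "p \<in> Field P ==> Tr p (Eq (nm m) (nm n)) (%G. m = n)"
 by (rule Tr_const) (auto simp: fo_neg nat_feq le_field(1))

lemma Tr_nat_mem: "p \<in> Field P ==> Tr p (Mem (nm m) (nm n)) (%G. m < n)"
 by (rule Tr_const) (auto simp: fo_neg nat_fmem le_field(1))

lemma fmem_check_rel: "fmem p (check_pair x y) (check_rel R) \<longleftrightarrow> (\<forall>q. q << p -->
  (\<exists>r m n. r << q \<and> (m, n) \<in> R \<and> feq r x (nm m) \<and> feq r y (nm n)))"
proof -
 have s: "small ((%(m, n). check_pair (nm m) (nm n) :: 'p name) ` R)"
  by (intro small_image small_countable) simp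
 have eq: "feq r (check_pair x y) (check_pair u v) \<longleftrightarrow> feq r x u \<and> feq r y v" for r u v
  using check_pair_inj check_pair_cong by blast
 show ?thesis unfolding check_rel_def fmem_check_set[OF s] by (simp add: eq Bex_def split_beta; blast)
qed

lemma fmem_check_rel3: "fmem p (check_pair (check_pair x y) z) (check_rel3 R) \<longleftrightarrow> (\<forall>q. q << p -->
  (\<exists>r l m n. r << q \<and> (l, m, n) \<in> R \<and> feq r x (nm l) \<and> feq r y (nm m) \<and> feq r z (nm n)))"
proof -
 have s: "small ((%(l, m, n). check_pair (check_pair (nm l) (nm m)) (nm n) :: 'p name) ` R)"
  by (intro small_image small_countable) simp
 have eq: "feq r (check_pair x y) (check_pair u v) \<longleftrightarrow> feq r x u \<and> feq r y v" for r x y u v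
  using check_pair_inj check_pair_cong by blast
 show ?thesis unfolding check_rel3_def fmem_check_set[OF s] by (simp add: eq Bex_def split_beta; blast)
qed

lemma Tr_rel2_check: "p \<in> Field P ==> Tr p (rel2 (check_rel R) (nm m) (nm n)) (%G. (m, n) \<in> R)"
proof (rule Tr_const)
 show "(m, n) \<in> R ==> fo p (rel2 (check_rel R) (nm m) (nm n))"
  unfolding fo_rel2 fmem_check_rel using feq_refl le_refl1 by blast
 show "(m, n) \<notin> R ==> fo p (Neg (rel2 (check_rel R) (nm m) (nm n)))"
  unfolding fo_neg fo_rel2 fmem_check_rel using nat_feq le_field(1) le_refl1(1) by metis
qed

lemma Tr_rel3_check: "p \<in> Field P ==>
 Tr p (rel3 (check_rel3 R) (nm l) (nm m) (nm n)) (%G. (l, m, n) \<in> R)"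
proof (rule Tr_const)
 show "(l, m, n) \<in> R ==> fo p (rel3 (check_rel3 R) (nm l) (nm m) (nm n))"
  unfolding fo_rel3 fmem_check_rel3 using feq_refl le_refl1 by blast
 show "(l, m, n) \<notin> R ==> fo p (Neg (rel3 (check_rel3 R) (nm l) (nm m) (nm n)))"
  unfolding fo_neg fo_rel3 fmem_check_rel3 using nat_feq le_field(1) le_refl1(1) by metis
qed

lemma rel2_check_om:
 "fo p (rel2 (check_rel R) x y) ==> fmem p x om"
 "fo p (rel2 (check_rel R) x y) ==> fmem p y om"
 unfolding fo_rel2 fmem_check_rel fmem_om by blast+

lemma rel3_check_om:
 "fo p (rel3 (check_rel3 R) x y z) ==> fmem p x om"
 "fo p (rel3 (check_rel3 R) x y z) ==> fmem p y om"
 "fo p (rel3 (check_rel3 R) x y z) ==> fmem p z om"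
 unfolding fo_rel3 fmem_check_rel3 fmem_om by blast+

lemma cong_is_fun: "cong (%f. is_fun f A B)" "cong (%A. is_fun f A B)" "cong (%B. is_fun f A B)"
 unfolding is_fun_def by (intro congs)+

lemma cong_is_bij: "cong (%f. is_bij f A B)" "cong (%A. is_bij f A B)" "cong (%B. is_bij f A B)"
 unfolding is_bij_def by (intro congs cong_is_fun)+

lemma cong_equinumerous: "cong (%A. equinumerous A B)" "cong (%B. equinumerous A B)"
 unfolding equinumerous_def by (intro congs cong_is_bij)+

text \<open>Below a condition where the two disagree the first can be decided; then the formula or
  its negation is forced, which gives the second the same truth value.\<close>

lemma Tr_unique:
 assumes "Tr p \<phi> \<Phi>" "Tr p \<phi> \<Psi>" "p \<in> Field P"
 shows "ev p (%G. \<Phi> G \<longleftrightarrow> \<Psi> G)"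
proof (rule ccontr)
 note [measurable] = Tr_pred[OF assms(1)] Tr_pred[OF assms(2)]
 assume "\<not> ?thesis"
 then obtain q where q: "q << p" "ev q (%G. \<not> (\<Phi> G \<longleftrightarrow> \<Psi> G))"
  using ev_refute[of "%G. \<Phi> G \<longleftrightarrow> \<Psi> G" p] assms(3) by auto
 obtain r where r: "r << q" "ev r \<Phi> \<or> ev r (%G. \<not> \<Phi> G)"
  using ev_dec[of \<Phi> q] Tr_pred[OF assms(1)] le_field(1)[OF q(1)] by blast
 have rp: "r << p" using r q le_trans by blast
 have "ev r (%G. \<Phi> G \<longleftrightarrow> \<Psi> G)"
  using r(2)
 proof
  assume h: "ev r \<Phi>"
  then have "ev r \<Psi>" using TrD[OF assms(1) rp] TrD[OF assms(2) rp] by blast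
  then show ?thesis using h by eventually_elim blast
 next
  assume h: "ev r (%G. \<not> \<Phi> G)"
  then have "ev r (%G. \<not> \<Psi> G)"
   using TrD[OF Tr_neg[OF assms(1)] rp] TrD[OF Tr_neg[OF assms(2)] rp] by blast
  then show ?thesis using h by eventually_elim blast
 qed
 then show False using ev_not_both[OF le_field(1)[OF r(1)]] ev_gen_le[OF q(2) r(1)] by blast
qed

lemma fmem_check_setI: "small S ==> \<sigma> \<in> S ==> fmem p \<sigma> (check_set S)"
 unfolding fmem_check_set using feq_refl le_refl1(1) by blast

subsection \<open>Functions\<close>

lemma is_funD1:
 assumes f: "fo p (is_fun f A B)" and m: "fmem p (check_pair x y) f"
 shows "fmem p x A" "fmem p y B"
proof -
 have "\<exists>r. r << q \<and> fmem r x A \<and> fmem r y B" if q: "q << p" for q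
 proof -
  have 1: "fo q (BEx A (%x'. BEx B (%y'. is_pair (check_pair x y) x' y')))"
   using f fmem_mono[OF m q] q unfolding is_fun_def by (simp add: fo_ball)
  then obtain r x' where r: "r << q" "fmem r x' A" "fo r (BEx B (%y'. is_pair (check_pair x y) x' y'))"
   using q le_refl1(1) unfolding fo_bex[of A] by blast
  then obtain s y' where s: "s << r" "fmem s y' B" "feq s (check_pair x y) (check_pair x' y')"
   unfolding fo_bex fo_is_pair using le_refl1(1) by blast
  have "fmem s x A" "fmem s y B"
   using check_pair_inj[OF s(3)] s(2) fmem_mono[OF r(2) s(1)] fmem_cong1 feq_sym by blast+
  then show ?thesis using s(1) r(1) le_trans by blast
 qed
 then show "fmem p x A" "fmem p y B" using fmem_dense by blast+
qed

lemma is_funD2: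
 assumes f: "fo p (is_fun f A B)"
  and m: "fmem p (check_pair x y) f" "fmem p (check_pair x y') f"
 shows "feq p y y'"
proof (rule feq_dense)
 fix q assume q: "q << p"
 have "fmem q x A" using is_funD1(1)[OF f m(1)] fmem_mono q by blast
 then have "fo q (Ex (%y. Conj (rel2 f x y) (All (%y'. Imp (rel2 f x y') (Eq y' y)))))"
  using f q unfolding is_fun_def fo_conj fo_ball by blast
 then obtain r z where r: "r << q" "fo r (All (%y'. Imp (rel2 f x y') (Eq y' z)))"
  unfolding fo_ex fo_conj using le_refl1(1)[OF q] by blast
 have *: "fo r (Imp (rel2 f x v) (Eq v z))" for v using r(2) by (simp only: forces.simps(5))
 have "r << p" using r(1) q le_trans by blast
 then have "feq r y z" "feq r y' z"
  using *[unfolded fo_imp fo_rel2] m fmem_mono le_refl1(1)[OF r(1)] by simp_all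
 then show "\<exists>r. r << q \<and> feq r y y'" using r(1) feq_trans feq_sym by blast
qed

lemma is_funD3:
 assumes f: "fo p (is_fun f A B)" and m: "fmem p x A" and q: "q << p"
 shows "\<exists>r y. r << q \<and> fmem r (check_pair x y) f"
proof -
 have "fo q (Ex (%y. Conj (rel2 f x y) (All (%y'. Imp (rel2 f x y') (Eq y' y)))))"
  using f q fmem_mono[OF m q] unfolding is_fun_def fo_conj fo_ball by blast
 then show ?thesis unfolding fo_ex fo_conj fo_rel2 using le_refl1(1)[OF q] by blast
qed

lemma is_funI:
 assumes 1: "!!q z. q << p ==> fmem q z f ==> \<exists>r x y. r << q \<and> fmem r x A \<and> fmem r y B \<and> feq r z (check_pair x y)"
  and 2: "!!q x. q << p ==> fmem q x A ==> \<exists>r y. r << q \<and> fmem r (check_pair x y) f"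
  and 3: "!!q x y y'. q << p ==> fmem q (check_pair x y) f ==> fmem q (check_pair x y') f ==> feq q y y'"
 shows "fo p (is_fun f A B)"
 unfolding is_fun_def fo_conj
proof (intro conjI)
 show "fo p (BAll f (%z. BEx A (%x. BEx B (is_pair z x))))"
  unfolding fo_ball
 proof (intro allI impI, rule fo_dense)
  fix z q r assume q: "q << p" "fmem q z f" and r: "r << q"
  obtain s x y where s: "s << r" "fmem s x A" "fmem s y B" "feq s z (check_pair x y)"
   using 1[OF le_trans[OF r q(1)] fmem_mono[OF q(2) r]] by blast
  have "fo s (BEx B (is_pair z x))"
   unfolding BEx_def by (rule fo_exI[of _ y]) (simp add: fo_is_pair s)
  then have "fo s (BEx A (%x. BEx B (is_pair z x)))"
   unfolding BEx_def[of A] by (intro fo_exI[of _ x]) (simp add: s)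
  then show "\<exists>s. s << r \<and> fo s (BEx A (%x. BEx B (is_pair z x)))" using s by blast
 qed
 show "fo p (BAll A (%x. Ex (%y. Conj (rel2 f x y) (All (%y'. Imp (rel2 f x y') (Eq y' y))))))"
  unfolding fo_ball
 proof (intro allI impI, rule fo_dense)
  fix x q r assume q: "q << p" "fmem q x A" and r: "r << q"
  obtain s y where s: "s << r" "fmem s (check_pair x y) f"
   using 2[OF le_trans[OF r q(1)] fmem_mono[OF q(2) r]] by blast
  have sp: "s << p" using s(1) r q(1) le_trans by blast
  have "feq t y' y" if "t << s" "fmem t (check_pair x y') f" for t y'
   using 3[OF le_trans[OF that(1) sp] that(2) fmem_mono[OF s(2) that(1)]] .
  then have "fo s (All (%y'. Imp (rel2 f x y') (Eq y' y)))"
   unfolding forces.simps(5) fo_imp fo_rel2 by simp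
  then have "fo s (Ex (%y. Conj (rel2 f x y) (All (%y'. Imp (rel2 f x y') (Eq y' y)))))"
   by (intro fo_exI[of _ y]) (simp only: fo_conj fo_rel2 s)
  then show "\<exists>s. s << r \<and> fo s (Ex (%y. Conj (rel2 f x y) (All (%y'. Imp (rel2 f x y') (Eq y' y)))))"
   using s by blast
 qed
qed

lemma is_bijD:
 assumes f: "fo p (is_bij f A B)"
 shows "fo p (is_fun f A B)"
  and "fmem p (check_pair x y) f ==> fmem p (check_pair x' y) f ==> feq p x x'"
  and "fmem p y B ==> q << p ==> \<exists>r x. r << q \<and> fmem r (check_pair x y) f"
proof -
 show fn: "fo p (is_fun f A B)" using f unfolding is_bij_def fo_conj by blast
 have ex: "fo q (Ex (%x. Conj (rel2 f x y) (All (%x'. Imp (rel2 f x' y) (Eq x' x)))))"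
  if "fmem p y B" "q << p" for q y
  using f that fmem_mono unfolding is_bij_def fo_conj fo_ball by blast
 show "\<exists>r x. r << q \<and> fmem r (check_pair x y) f" if "fmem p y B" "q << p"
  using ex[OF that] unfolding fo_ex fo_conj fo_rel2 using le_refl1(1)[OF that(2)] by blast
 show "feq p x x'" if m: "fmem p (check_pair x y) f" "fmem p (check_pair x' y) f"
 proof (rule feq_dense)
  fix q assume q: "q << p"
  have "fmem p y B" using is_funD1(2)[OF fn m(1)] .
  then obtain r z where r: "r << q" "fo r (All (%x'. Imp (rel2 f x' y) (Eq x' z)))"
   using ex[OF _ q] unfolding fo_ex fo_conj using le_refl1(1)[OF q] by blast
  have *: "fo r (Imp (rel2 f v y) (Eq v z))" for v using r(2) by (simp only: forces.simps(5))
  have "r << p" using r(1) q le_trans by blast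
  then have "feq r x z" "feq r x' z"
   using *[unfolded fo_imp fo_rel2] m fmem_mono le_refl1(1)[OF r(1)] by simp_all
  then show "\<exists>r. r << q \<and> feq r x x'" using r(1) feq_trans feq_sym by blast
 qed
qed

lemma is_bijI:
 assumes f: "fo p (is_fun f A B)"
  and 2: "!!q y. q << p ==> fmem q y B ==> \<exists>r x. r << q \<and> fmem r (check_pair x y) f"
  and 3: "!!q x y x'. q << p ==> fmem q (check_pair x y) f ==> fmem q (check_pair x' y) f ==> feq q x x'"
 shows "fo p (is_bij f A B)"
 unfolding is_bij_def fo_conj
proof (intro conjI f)
 show "fo p (BAll B (%y. Ex (%x. Conj (rel2 f x y) (All (%x'. Imp (rel2 f x' y) (Eq x' x))))))"
  unfolding fo_ball
 proof (intro allI impI, rule fo_dense)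
  fix y q r assume q: "q << p" "fmem q y B" and r: "r << q"
  obtain s x where s: "s << r" "fmem s (check_pair x y) f"
   using 2[OF le_trans[OF r q(1)] fmem_mono[OF q(2) r]] by blast
  have sp: "s << p" using s(1) r q(1) le_trans by blast
  have "feq t x' x" if "t << s" "fmem t (check_pair x' y) f" for t x'
   using 3[OF le_trans[OF that(1) sp] that(2) fmem_mono[OF s(2) that(1)]] .
  then have "fo s (All (%x'. Imp (rel2 f x' y) (Eq x' x)))"
   unfolding forces.simps(5) fo_imp fo_rel2 by simp
  then have "fo s (Ex (%x. Conj (rel2 f x y) (All (%x'. Imp (rel2 f x' y) (Eq x' x)))))"
   by (intro fo_exI[of _ x]) (simp only: fo_conj fo_rel2 s)
  then show "\<exists>s. s << r \<and> fo s (Ex (%x. Conj (rel2 f x y) (All (%x'. Imp (rel2 f x' y) (Eq x' x)))))"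
   using s by blast
 qed
qed

text \<open>The pairs of \<open>x a\<close> and \<open>t a\<close> form the bijection. That no
  condition below \<open>p\<close> identifies names with different indices makes it a function and
  injective.\<close>

lemma bij_name:
 fixes x t :: "'a => 'p name"
 assumes U: "small U"
  and x: "!!a b q. a \<in> U ==> b \<in> U ==> q << p ==> feq q (x a) (x b) ==> a = b"
  and t: "!!a b q. a \<in> U ==> b \<in> U ==> q << p ==> feq q (t a) (t b) ==> a = b"
 shows "fo p (equinumerous (check_set (x ` U)) (check_set (t ` U)))"
proof -
 let ?f = "check_set ((%a. check_pair (x a) (t a)) ` U) :: 'p name"
 note s = fmem_check_set[OF small_image[OF U]]
 have mem: "fmem q (check_pair u v) ?f ==> q' << q ==> \<exists>r. r << q' \<and> (\<exists>a\<in>U. feq r u (x a) \<and> feq r v (t a))"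
  for q q' u v
 proof -
  assume "fmem q (check_pair u v) ?f" "q' << q"
  then obtain r a where "r << q'" "a \<in> U" "feq r (check_pair u v) (check_pair (x a) (t a))" unfolding s by auto
  then show ?thesis using check_pair_inj[of r u v "x a" "t a"] by blast
 qed
 have memI: "a \<in> U ==> fmem q (check_pair (x a) (t a)) ?f" for a q
  by (intro fmem_check_setI small_image U imageI)
 have xU: "a \<in> U ==> fmem q (x a) (check_set (x ` U))" and tU: "a \<in> U ==> fmem q (t a) (check_set (t ` U))" for a q
  by (intro fmem_check_setI small_image U imageI; assumption)+
 have fn: "fo p (is_fun ?f (check_set (x ` U)) (check_set (t ` U)))"
 proof (rule is_funI)
  fix q z assume q: "q << p" "fmem q z ?f"
  then obtain r a where "r << q" "a \<in> U" "feq r z (check_pair (x a) (t a))"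
   unfolding s using le_refl1(1)[OF q(1)] by blast
  then show "\<exists>r u v. r << q \<and> fmem r u (check_set (x ` U)) \<and> fmem r v (check_set (t ` U)) \<and> feq r z (check_pair u v)"
   using xU tU by blast
 next
  fix q u assume q: "q << p" "fmem q u (check_set (x ` U))"
  then obtain r a where r: "r << q" "a \<in> U" "feq r u (x a)"
   unfolding s using le_refl1(1)[OF q(1)] by blast
  have "feq r (check_pair (x a) (t a)) (check_pair u (t a))"
   using check_pair_cong[OF _ feq_refl] r(3) feq_sym by blast
  then have "fmem r (check_pair u (t a)) ?f" using memI[OF r(2)] fmem_cong1 by blast
  then show "\<exists>r y. r << q \<and> fmem r (check_pair u y) ?f" using r(1) by blast
 next
  fix q u v v' assume q: "q << p" and m: "fmem q (check_pair u v) ?f" "fmem q (check_pair u v') ?f"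
  show "feq q v v'"
  proof (rule feq_dense)
   fix q' assume q': "q' << q"
   obtain r a where r: "r << q'" "a \<in> U" "feq r u (x a)" "feq r v (t a)" using mem[OF m(1) q'] by blast
   obtain r' b where r': "r' << r" "b \<in> U" "feq r' u (x b)" "feq r' v' (t b)"
    using mem[OF m(2) le_trans[OF r(1) q']] by blast
   have "feq r' (x a) (x b)" using r'(3) feq_mono[OF r(3) r'(1)] feq_trans feq_sym by blast
   then have "a = b" using x[OF r(2) r'(2)] r'(1) r(1) q' q le_trans by blast
   then have "feq r' v v'" using r'(4) feq_mono[OF r(4) r'(1)] feq_trans feq_sym by blast
   then show "\<exists>r. r << q' \<and> feq r v v'" using r' r le_trans by blast
  qed
 qed
 have "fo p (is_bij ?f (check_set (x ` U)) (check_set (t ` U)))"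
 proof (rule is_bijI[OF fn])
  fix q v assume q: "q << p" "fmem q v (check_set (t ` U))"
  then obtain r a where r: "r << q" "a \<in> U" "feq r v (t a)"
   unfolding s using le_refl1(1)[OF q(1)] by blast
  have "feq r (check_pair (x a) (t a)) (check_pair (x a) v)"
   using check_pair_cong[OF feq_refl] r(3) feq_sym by blast
  then have "fmem r (check_pair (x a) v) ?f" using memI[OF r(2)] fmem_cong1 by blast
  then show "\<exists>r y. r << q \<and> fmem r (check_pair y v) ?f" using r(1) by blast
 next
  fix q u v u' assume q: "q << p" and m: "fmem q (check_pair u v) ?f" "fmem q (check_pair u' v) ?f"
  show "feq q u u'"
  proof (rule feq_dense)
   fix q' assume q': "q' << q"
   obtain r a where r: "r << q'" "a \<in> U" "feq r u (x a)" "feq r v (t a)" using mem[OF m(1) q'] by blast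
   obtain r' b where r': "r' << r" "b \<in> U" "feq r' u' (x b)" "feq r' v (t b)"
    using mem[OF m(2) le_trans[OF r(1) q']] by blast
   have "feq r' (t a) (t b)" using r'(4) feq_mono[OF r(4) r'(1)] feq_trans feq_sym by blast
   then have "a = b" using t[OF r(2) r'(2)] r'(1) r(1) q' q le_trans by blast
   then have "feq r' u u'" using r'(3) feq_mono[OF r(3) r'(1)] feq_trans feq_sym by blast
   then show "\<exists>r. r << q' \<and> feq r u u'" using r' r le_trans by blast
  qed
 qed
 then show ?thesis unfolding equinumerous_def by (rule fo_exI)
qed

text \<open>The preimage of each \<open>t a\<close> is forced to exist, so the maximal principle
  names it. This indexes the elements of \<open>X\<close> by a set of the ground model.\<close>

lemma bij_unpack:
 fixes t :: "'a => 'p name"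
 assumes U: "small U" and b: "fo p (equinumerous X (check_set (t ` U)))" and p: "p \<in> Field P"
 obtains x where "!!a. a \<in> U ==> fmem p (x a) X"
  "!!z q. q << p ==> fmem q z X ==> \<exists>r. r << q \<and> (\<exists>a\<in>U. feq r z (x a))"
  "!!a b q. a \<in> U ==> b \<in> U ==> q << p ==> feq q (x a) (x b) ==> feq q (t a) (t b)"
proof -
 obtain f where f: "fo p (is_bij f X (check_set (t ` U)))"
  using b unfolding equinumerous_def by (rule fo_ex_witness) (rule cong_is_bij)
 note fn = is_bijD(1)[OF f]
 note s = fmem_check_set[OF small_image[OF U]]
 have "\<exists>x. fo p (rel2 f x (t a))" if a: "a \<in> U" for a
 proof -
  have "fmem p (t a) (check_set (t ` U))" by (intro fmem_check_setI small_image U imageI a)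
  then have "fo p (Ex (%x. rel2 f x (t a)))" unfolding fo_ex fo_rel2 using is_bijD(3)[OF f] by blast
  then obtain x where "fo p (rel2 f x (t a))" by (rule fo_ex_witness) (rule cong_rel2)
  then show ?thesis by blast
 qed
 then obtain x where x: "!!a. a \<in> U ==> fmem p (check_pair (x a) (t a)) f"
  unfolding fo_rel2 by metis
 show ?thesis
 proof (rule that[of x])
  show "fmem p (x a) X" if "a \<in> U" for a using is_funD1(1)[OF fn x[OF that]] .
 next
  fix z q assume q: "q << p" and z: "fmem q z X"
  obtain r y where r: "r << q" "fmem r (check_pair z y) f"
   using is_funD3[OF fo_mono[OF fn q] z le_refl1(1)[OF q]] by blast
  have rp: "r << p" using r q le_trans by blast
  have "fmem r y (check_set (t ` U))" using is_funD1(2)[OF fo_mono[OF fn rp] r(2)] .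
  then obtain u a where u: "u << r" "a \<in> U" "feq u y (t a)"
   unfolding s using le_refl1(1)[OF r(1)] by blast
  have up: "u << p" using u(1) rp le_trans by blast
  have "fmem u (check_pair z (t a)) f"
   using fmem_mono[OF r(2) u(1)] check_pair_cong[OF feq_refl u(3)] fmem_cong1 by blast
  then have "feq u z (x a)" using is_bijD(2)[OF fo_mono[OF f up]] fmem_mono[OF x[OF u(2)] up] by blast
  then show "\<exists>r. r << q \<and> (\<exists>a\<in>U. feq r z (x a))" using u r le_trans by blast
 next
  fix a b q assume ab: "a \<in> U" "b \<in> U" and q: "q << p" and e: "feq q (x a) (x b)"
  have "fmem q (check_pair (x b) (t a)) f"
   using fmem_mono[OF x[OF ab(1)] q] check_pair_cong[OF e feq_refl] fmem_cong1 by blast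
  then show "feq q (t a) (t b)"
   using is_funD2[OF fo_mono[OF fn q]] fmem_mono[OF x[OF ab(2)] q] by blast
 qed
qed

subsection \<open>Names for reals\<close>

text \<open>\<open>\<tau> i\<close> is an element as soon as the filter contains a condition with
  \<open>Q i\<close>; the index set has to obey the bound on names.\<close>

definition coll :: "'i set => ('i => 'p name) => ('i => 'p => bool) => 'p name" where
 "coll I \<tau> Q = mk_name {(\<tau> i, q) |i q. i \<in> I \<and> Q i q}"

lemma fmem_coll:
 assumes "small I" and Q: "!!i r s. Q i s ==> r << s ==> Q i r"
 shows "fmem p x (coll I \<tau> Q) \<longleftrightarrow> (\<forall>q. q << p --> (\<exists>r. r << q \<and> (\<exists>i\<in>I. Q i r \<and> feq r x (\<tau> i))))"
proof -
 have "{(\<tau> i, q) |i q. i \<in> I \<and> Q i q} \<subseteq> (%(i, q). (\<tau> i, q)) ` (I \<times> UNIV)" by auto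
 then have "small {(\<tau> i, q) |i q. i \<in> I \<and> Q i q}"
  by (rule small_sub[OF small_image[OF small_prod[OF assms(1) small_p]]])
 then have e: "elems (coll I \<tau> Q) = {(\<tau> i, q) |i q. i \<in> I \<and> Q i q}" unfolding coll_def by (rule elems_mk)
 have "(\<exists>r \<sigma> s. r << q \<and> (\<sigma>, s) \<in> elems (coll I \<tau> Q) \<and> r << s \<and> feq r x \<sigma>) \<longleftrightarrow>
   (\<exists>r. r << q \<and> (\<exists>i\<in>I. Q i r \<and> feq r x (\<tau> i)))" for q
 proof
  assume "\<exists>r \<sigma> s. r << q \<and> (\<sigma>, s) \<in> elems (coll I \<tau> Q) \<and> r << s \<and> feq r x \<sigma>"
  then show "\<exists>r. r << q \<and> (\<exists>i\<in>I. Q i r \<and> feq r x (\<tau> i))" unfolding e using Q by blast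
 next
  assume "\<exists>r. r << q \<and> (\<exists>i\<in>I. Q i r \<and> feq r x (\<tau> i))"
  then obtain r i where "r << q" "i \<in> I" "Q i r" "feq r x (\<tau> i)" by blast
  then have "r << q \<and> (\<tau> i, r) \<in> elems (coll I \<tau> Q) \<and> r << r \<and> feq r x (\<tau> i)"
   unfolding e using le_refl1(1) by auto
  then show "\<exists>r \<sigma> s. r << q \<and> (\<sigma>, s) \<in> elems (coll I \<tau> Q) \<and> r << s \<and> feq r x \<sigma>" by blast
 qed
 then show ?thesis unfolding fmem_iff by simp
qed

text \<open>Measurable functions of the filter stand for reals of the extension;
  \<open>sname\<close> and \<open>fname\<close> turn them into names, \<open>sval\<close> and
  \<open>val\<close> recover them from names.\<close>

definition mset :: "('p set => nat set) => bool" where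
 "mset Z \<longleftrightarrow> (\<forall>n. mpred (%G. n \<in> Z G))"

definition mfun :: "('p set => nat => nat) => bool" where
 "mfun Z \<longleftrightarrow> (\<forall>n. (%G. Z G n) \<in> measurable M (count_space UNIV))"

lemma mfunD [measurable_dest]: "mfun Z ==> (%G. Z G n) \<in> measurable M (count_space UNIV)"
 unfolding mfun_def by blast

lemma msetD [measurable_dest]: "mset Z ==> mpred (%G. n \<in> Z G)"
 unfolding mset_def by blast

definition sname :: "('p set => nat set) => 'p name" where
 "sname Z = coll UNIV nm (%n q. ev q (%G. n \<in> Z G))"

definition fname :: "('p set => nat => nat) => 'p name" where
 "fname Z = coll UNIV (%(n, m). check_pair (nm n) (nm m))
   (%(n, m) q. ev q (%G. Z G n = m))"

definition sval :: "'p name => 'p set => nat set" where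
 "sval x G = {n. Holds (Mem (nm n) x) G}"

text \<open>\<open>LEAST\<close> keeps the value total and measurable; it is the actual value at all
  sufficiently generic filters when \<open>f\<close> is forced to be a function.\<close>

definition val :: "'p name => 'p set => nat => nat" where
 "val f G n = (LEAST m. Holds (rel2 f (nm n) (nm m)) G)"

lemma fmem_sname: "fmem p x (sname Z) \<longleftrightarrow> (\<forall>q. q << p -->
  (\<exists>r. r << q \<and> (\<exists>n. ev r (%G. n \<in> Z G) \<and> feq r x (nm n))))"
 unfolding sname_def by (subst fmem_coll) (auto intro: small_nat ev_gen_le)

lemma fmem_fname: "fmem p x (fname Z) \<longleftrightarrow> (\<forall>q. q << p -->
  (\<exists>r. r << q \<and> (\<exists>n m. ev r (%G. Z G n = m) \<and> feq r x (check_pair (nm n) (nm m)))))"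
 unfolding fname_def by (subst fmem_coll) (auto intro: small_countable ev_gen_le)

lemma mset_sval [simp]: "mset (sval x)" unfolding mset_def sval_def by simp

lemma mfun_val [simp]: "mfun (val f)" unfolding mfun_def val_def by measurable

lemma Tr_sval: "Tr p (Mem (nm n) x) (%G. n \<in> sval x G)"
 unfolding sval_def mem_Collect_eq by (rule Tr_Holds)

lemma Tr_sname: assumes "mset Z" shows "Tr p (Mem (nm n) (sname Z)) (%G. n \<in> Z G)"
 unfolding Tr_def
proof (intro conjI allI impI)
 show "mpred (%G. n \<in> Z G)" using assms unfolding mset_def by blast
 fix q assume q: "q << p"
 show "fo q (Mem (nm n) (sname Z)) \<longleftrightarrow> ev q (%G. n \<in> Z G)"
 proof
  assume h: "fo q (Mem (nm n) (sname Z))"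
  show "ev q (%G. n \<in> Z G)"
   by (rule ev_gen_dense[OF le_field(1)[OF q]])
    (use h nat_feq le_field(1) in \<open>simp add: fmem_sname; metis\<close>)
 next
  assume "ev q (%G. n \<in> Z G)"
  then show "fo q (Mem (nm n) (sname Z))"
   using ev_gen_le feq_refl le_refl1(1) by (simp add: fmem_sname; blast)
 qed
qed

lemma sname_sub: "fo p (Subset (sname Z) om)"
 unfolding fo_subset fmem_sname fmem_om by blast

lemma sval_sname: assumes "mset Z" "p \<in> Field P" shows "ev p (%G. sval (sname Z) G = Z G)"
proof -
 have "ev p (%G. \<forall>n. n \<in> sval (sname Z) G \<longleftrightarrow> n \<in> Z G)"
  by (rule ev_all) (rule Tr_unique[OF Tr_sval Tr_sname[OF assms(1)] assms(2)])
 then show ?thesis by eventually_elim blast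
qed

lemma fmem_sub_om:
 assumes "fo p (Subset x om)" "q << p"
 shows "fmem q y x \<longleftrightarrow> (\<forall>r. r << q --> (\<exists>s n. s << r \<and> feq s y (nm n) \<and> fmem s (nm n) x))"
proof
 assume h: "fmem q y x"
 show "\<forall>r. r << q --> (\<exists>s n. s << r \<and> feq s y (nm n) \<and> fmem s (nm n) x)"
 proof (intro allI impI)
  fix r assume r: "r << q"
  have "fmem q y om" using assms h unfolding fo_subset by blast
  then obtain s n where s: "s << r" "feq s y (nm n)" using r unfolding fmem_om by blast
  moreover have "fmem s y x" using fmem_mono[OF h] s(1) r le_trans by blast
  ultimately show "\<exists>s n. s << r \<and> feq s y (nm n) \<and> fmem s (nm n) x"
   using fmem_cong1 by blast
 qed
next
 assume h: "\<forall>r. r << q --> (\<exists>s n. s << r \<and> feq s y (nm n) \<and> fmem s (nm n) x)"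
 show "fmem q y x" by (rule fmem_dense) (use h fmem_cong1 feq_sym in blast)
qed

lemma sub_om_ev:
 assumes "feq p x y" "p \<in> Field P"
 shows "ev p (%G. sval x G = sval y G)"
proof -
 have "fo q (Mem (nm n) x) \<longleftrightarrow> fo q (Mem (nm n) y)" if "q << p" for q n
  using cong_fo[OF cong_mem2 feq_mono[OF assms(1) that] le_field(1)[OF that]] .
 then have "Tr p (Mem (nm n) x) (%G. n \<in> sval y G)" for n
  using Tr_sval[of p n y] unfolding Tr_def by simp
 then have "ev p (%G. \<forall>n. n \<in> sval x G \<longleftrightarrow> n \<in> sval y G)"
  by (intro ev_all Tr_unique[OF Tr_sval _ assms(2)])
 then show ?thesis by eventually_elim blast
qed

lemma Tr_fname: assumes "mfun Z" shows "Tr p (rel2 (fname Z) (nm n) (nm m)) (%G. Z G n = m)"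
 unfolding Tr_def
proof (intro conjI allI impI)
 note [measurable] = mfunD[OF assms]
 show "mpred (%G. Z G n = m)" by measurable
 fix q assume q: "q << p"
 show "fo q (rel2 (fname Z) (nm n) (nm m)) \<longleftrightarrow> ev q (%G. Z G n = m)"
 proof
  assume h: "fo q (rel2 (fname Z) (nm n) (nm m))"
  show "ev q (%G. Z G n = m)"
  proof (rule ev_gen_dense[OF le_field(1)[OF q]])
   fix r assume "r << q"
   then obtain s n' m' where s: "s << r" "ev s (%G. Z G n' = m')"
    "feq s (check_pair (nm n) (nm m)) (check_pair (nm n') (nm m'))"
    using h unfolding fo_rel2 fmem_fname by blast
   then have "n = n'" "m = m'" using check_pair_inj[OF s(3)] nat_feq le_field(1) by blast+
   then show "\<exists>s. s << r \<and> ev s (%G. Z G n = m)" using s by blast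
  qed
 next
  assume "ev q (%G. Z G n = m)"
  then show "fo q (rel2 (fname Z) (nm n) (nm m))"
   using ev_gen_le feq_refl le_refl1(1) by (simp add: fo_rel2 fmem_fname; blast)
 qed
qed

lemma fname_fun: assumes Z: "mfun Z" shows "fo p (is_fun (fname Z) om om)"
proof (rule is_funI)
 note [measurable] = mfunD[OF Z]
 show "\<exists>r x y. r << q \<and> fmem r x om \<and> fmem r y om \<and> feq r z (check_pair x y)"
  if t: "q << p" "fmem q z (fname Z)" for q z
 proof -
  obtain r n m where "r << q" "feq r z (check_pair (nm n) (nm m))"
   using t(2) le_refl1(1)[OF t(1)] unfolding fmem_fname by blast
  then show ?thesis using fmem_omI by blast
 qed
next
 fix q x assume q: "q << p" and x: "fmem q x om"
 note [measurable] = mfunD[OF Z]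
 obtain r n where r: "r << q" "feq r x (nm n)" using x le_refl1(1)[OF q] unfolding fmem_om by blast
 have "ev r (%G. \<exists>m. Z G n = m)" by simp
 then obtain s m where s: "s << r" "ev s (%G. Z G n = m)"
  using ev_ex_nat[of "%m G. Z G n = m" r] le_field(1)[OF r(1)] by auto
 then have "fmem s (check_pair (nm n) (nm m)) (fname Z)"
  using TrD[OF Tr_fname[OF Z], of s s] le_refl1(1) unfolding fo_rel2 by blast
 then have "fmem s (check_pair x (nm m)) (fname Z)"
  using check_pair_cong[OF feq_mono[OF r(2) s(1)] feq_refl] feq_sym fmem_cong1 by blast
 then show "\<exists>r y. r << q \<and> fmem r (check_pair x y) (fname Z)" using s r le_trans by blast
next
 fix q x y y' assume q: "q << p" and m: "fmem q (check_pair x y) (fname Z)" "fmem q (check_pair x y') (fname Z)"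
 show "feq q y y'"
 proof (rule feq_dense)
  fix r assume r: "r << q"
  obtain s a b where s: "s << r" "ev s (%G. Z G a = b)"
   "feq s (check_pair x y) (check_pair (nm a) (nm b))"
   using m(1) r unfolding fmem_fname by blast
  obtain t a' b' where t: "t << s" "ev t (%G. Z G a' = b')"
   "feq t (check_pair x y') (check_pair (nm a') (nm b'))"
   using m(2) le_trans[OF s(1) r] unfolding fmem_fname by blast
  note e = check_pair_inj[OF feq_mono[OF s(3) t(1)]] check_pair_inj[OF t(3)]
  have tF: "t \<in> Field P" using t(1) le_field(1) by blast
  have "a = a'" using e(1,3) feq_trans feq_sym nat_feq[OF tF] by blast
  moreover have "ev t (%G. b = b')"
   using ev_gen_le[OF s(2) t(1)] t(2) by eventually_elim (use \<open>a = a'\<close> in simp)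
  then have "b = b'" using ev_const[OF tF] by blast
  ultimately have "feq t y y'" using e(2,4) feq_trans feq_sym by blast
  then show "\<exists>r'. r' << r \<and> feq r' y y'" using t s le_trans by blast
 qed
qed

lemma rel2_fun_om: "fo p (is_fun f om om) ==> q << p ==> fo q (rel2 f x y) ==> fmem q y om"
 unfolding fo_rel2 using is_funD1(2) fo_mono by blast

lemma Tr_val:
 assumes f: "fo p (is_fun f om om)" and p: "p \<in> Field P"
 shows "Tr p (rel2 f (nm n) (nm m)) (%G. val f G n = m)"
proof -
 let ?R = "%m. rel2 f (nm n) (nm m)"
 have "Tr p (Ex (rel2 f (nm n))) (%G. \<exists>m. Holds (?R m) G)"
  by (rule Tr_ex[OF cong_rel2(2)]) (auto intro: rel2_fun_om[OF f] Tr_Holds)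
 moreover have "fo p (Ex (rel2 f (nm n)))"
  unfolding fo_ex fo_rel2 using is_funD3[OF f fmem_omI] by blast
 ultimately have 1: "ev p (%G. \<exists>m. Holds (?R m) G)" using TrD' p by blast
 have "ev p (%G. \<forall>k. \<not> (Holds (?R k) G \<and> Holds (?R (fst m)) G \<and> k ~= fst m))" for m :: "nat \<times> nat"
 proof (rule ev_all)
  fix k
  show "ev p (%G. \<not> (Holds (?R k) G \<and> Holds (?R (fst m)) G \<and> k ~= fst m))"
  proof (cases "k = fst m")
   case False
   have "fo p (Neg (Conj (?R k) (?R (fst m))))"
    unfolding fo_neg fo_conj fo_rel2
    using is_funD2[OF fo_mono[OF f]] nat_feq False le_field(1) by metis
   then have "ev p (%G. \<not> (Holds (?R k) G \<and> Holds (?R (fst m)) G))"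
    using TrD'[OF Tr_neg[OF Tr_conj[OF Tr_Holds Tr_Holds]] p] by blast
   then show ?thesis by eventually_elim blast
  qed simp
 qed
 from this[of "(m, m)"] have "ev p (%G. Holds (?R m) G \<longleftrightarrow> val f G n = m)"
  using 1
 proof eventually_elim
  case (elim G)
  then have "Holds (?R (val f G n)) G" unfolding val_def by (auto intro: LeastI)
  then show ?case using elim(1) by auto
 qed
 moreover have "mpred (%G. val f G n = m)"
  using mfunD[OF mfun_val[of f]] by measurable
 ultimately show ?thesis by (intro Tr_ev_cong[OF Tr_Holds])
qed

lemma val_fname: assumes "mfun Z" "p \<in> Field P" shows "ev p (%G. val (fname Z) G = Z G)"
proof -
 have "ev p (%G. \<forall>n m. val (fname Z) G n = m \<longleftrightarrow> Z G n = m)"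
  by (intro ev_all Tr_unique[OF Tr_val[OF fname_fun[OF assms(1)] assms(2)] Tr_fname[OF assms(1)] assms(2)])
 then show ?thesis by eventually_elim auto
qed

end

section \<open>Cardinals survive under the countable chain condition\<close>

lemma countable_ordLeq_natLeq: "countable A ==> |A| \<le>o natLeq"
proof -
 assume "countable A"
 then obtain f :: "_ => nat" where "inj_on f A" unfolding countable_def by blast
 then have "|A| \<le>o |UNIV :: nat set|" using card_of_ordLeq[of A "UNIV :: nat set"] by blast
 then show "|A| \<le>o natLeq" using card_of_nat ordLeq_ordIso_trans by blast
qed

lemma inf_Field: assumes "Card_order k" "natLeq <o k" shows "infinite (Field k)"
proof -
 have "|UNIV :: nat set| \<le>o natLeq" using card_of_nat ordIso_imp_ordLeq by blast
 also have "natLeq \<le>o k" using assms(2) ordLess_imp_ordLeq by blast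
 also have "k \<le>o |Field k|" using card_of_Field_ordIso[OF assms(1)] ordIso_symmetric ordIso_imp_ordLeq by blast
 finally show ?thesis using card_of_ordLeq_infinite by blast
qed

lemma card_fibres:
 assumes k: "Card_order k" "natLeq <o k" and B: "|B| <o k"
  and h: "!!i. i \<in> I ==> h i \<in> B" and fib: "!!b. b \<in> B ==> countable {i \<in> I. h i = b}"
 shows "|I| <o k"
proof -
 \<comment> \<open>Adding the natural numbers makes the bound infinite without reaching
   \<open>k\<close>, as \<open>k\<close> is uncountable.\<close>
 let ?C = "B <+> (UNIV :: nat set)"
 have infk: "infinite (Field k)" by (rule inf_Field[OF k])
 have N: "|UNIV :: nat set| <o k" using card_of_nat k(2) ordIso_ordLess_trans by blast
 have C: "|?C| <o k" using card_of_Plus_ordLess_infinite_Field[OF infk k(1) B N] .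
 have infC: "infinite ?C" by simp
 have "|{i \<in> I. h i = b}| \<le>o |?C|" if "b \<in> B" for b
 proof -
  have "|{i \<in> I. h i = b}| \<le>o natLeq" using fib[OF that] by (rule countable_ordLeq_natLeq)
  also have "natLeq =o |UNIV :: nat set|" using card_of_nat ordIso_symmetric by blast
  also have "|UNIV :: nat set| \<le>o |?C|" by (rule card_of_Plus2)
  finally show ?thesis .
 qed
 then have "|\<Union>b\<in>B. {i \<in> I. h i = b}| \<le>o |?C|"
  by (intro card_of_UNION_ordLeq_infinite[OF infC card_of_Plus1]) blast
 moreover have "(\<Union>b\<in>B. {i \<in> I. h i = b}) = I" using h by blast
 ultimately show ?thesis using C ordLeq_ordLess_trans by metis
qed

lemma Card_order_limit:
 assumes "Card_order k" "natLeq <o k" "a \<in> Field k"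
 obtains b where "b \<in> Field k" "{x. (x, a) \<in> k} \<subseteq> underS k b" "a \<in> underS k b"
proof -
 have infk: "infinite (Field k)" by (rule inf_Field[OF assms(1,2)])
 obtain b where b: "b \<in> Field k" "a ~= b" "(a, b) \<in> k"
  using infinite_Card_order_limit[OF assms(1) infk assms(3)] by blast
 have "trans k" "antisym k"
  using assms(1) unfolding card_order_on_def well_order_on_def linear_order_on_def
   partial_order_on_def preorder_on_def by blast+
 then have "{x. (x, a) \<in> k} \<subseteq> underS k b"
  using b unfolding trans_def antisym_def underS_def by blast
 then show ?thesis using that b by (auto simp: underS_def)
qed

context forcing
begin

lemma countable_incompat:
 assumes "!!i. i \<in> I ==> q i \<in> Field P"
  and "!!i j r. i \<in> I ==> j \<in> I ==> r << q i ==> r << q j ==> i = j"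
 shows "countable I"
proof -
 have "q ` I \<subseteq> Field P" using assms(1) by blast
 moreover have "\<forall>p\<in>q ` I. \<forall>q'\<in>q ` I. p ~= q' --> \<not> (\<exists>r. r << p \<and> r << q')"
  using assms(2) by blast
 ultimately have "countable (q ` I)" using ccc[unfolded ccc_def, rule_format, of "q ` I"] by blast
 moreover have "inj_on q I" using assms by (intro inj_onI) (metis le_refl)
 ultimately show ?thesis by (rule countable_image_inj_on)
qed

text \<open>Choose one condition for each \<open>i\<close>: those that share a value are pairwise
  incompatible, so each of the fewer than \<open>k\<close> values is taken countably often, and
  \<open>k\<close> would be smaller than itself. This is the form in which preservation of cardinals
  is applied.\<close>

lemma no_ccc_collapse:
 assumes k: "Card_order k" "natLeq <o k" and b: "b \<in> Field k"
  and ex: "!!i. i \<in> Field k ==> \<exists>q\<in>Field P. \<exists>\<beta>\<in>underS k b. R i \<beta> q"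
  and inc: "!!i j \<beta> q q' r. i \<in> Field k ==> j \<in> Field k ==> R i \<beta> q ==> R j \<beta> q' ==>
    r << q ==> r << q' ==> i = j"
 shows False
proof -
 have "\<forall>i\<in>Field k. \<exists>x. fst x \<in> Field P \<and> snd x \<in> underS k b \<and> R i (snd x) (fst x)" using ex by force
 then obtain f where f: "\<forall>i\<in>Field k. fst (f i) \<in> Field P \<and> snd (f i) \<in> underS k b \<and> R i (snd (f i)) (fst (f i))"
  by (rule bchoice[THEN exE])
 have "|Field k| <o k"
 proof (rule card_fibres[OF k, where h = "%i. snd (f i)" and B = "underS k b"])
  show "|underS k b| <o k" using card_of_underS[OF k(1) b] .
  show "snd (f i) \<in> underS k b" if "i \<in> Field k" for i using f that by blast
  fix \<beta>
  show "countable {i \<in> Field k. snd (f i) = \<beta>}"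
  proof (rule countable_incompat[where q = "%i. fst (f i)"])
   show "fst (f i) \<in> Field P" if "i \<in> {i \<in> Field k. snd (f i) = \<beta>}" for i using f that by blast
   fix i j r assume "i \<in> {i \<in> Field k. snd (f i) = \<beta>}" "j \<in> {i \<in> Field k. snd (f i) = \<beta>}"
    and r: "r << fst (f i)" "r << fst (f j)"
   then have "i \<in> Field k" "j \<in> Field k" "R i \<beta> (fst (f i))" "R j \<beta> (fst (f j))" using f by auto
   then show "i = j" using inc r by blast
  qed
 qed
 then have "k <o k" using card_of_Field_ordIso[OF k(1)] ordIso_symmetric ordIso_ordLess_trans by blast
 then show False using ordLess_irreflexive by blast
qed

text \<open>
 If the set with elements \<open>y \<xi>\<close>, \<open>\<xi> < k\<close>, has at no stage been exhausted, then listing it without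
 repetitions takes exactly \<open>k\<close> steps, because \<open>k\<close> remains a cardinal.
\<close>

lemma equinumerous_ord:
 fixes k :: "'a rel"
 assumes k: "Card_order k" "natLeq <o k" and sm: "small (Field k)"
  and less: "!!b p. b \<in> Field k ==> p \<in> Field P ==>
   \<not> fo p (equinumerous (check_set (y ` Field k)) (check_elt k b))"
  and p0: "p0 \<in> Field P"
 shows "fo p0 (equinumerous (check_set (y ` Field k)) (check_ord k))"
proof -
 let ?Y = "check_set (y ` Field k) :: 'p name"
 have wo: "smallwo k" using k(1) sm unfolding smallwo_def card_order_on_def by blast
 have WO: "Well_order k" using smallwoD(1)[OF wo] .
 have wf: "wf (k - Id)" using WO unfolding well_order_on_def by blast
 \<comment> \<open>\<open>z\<close> is a suitable next element after the \<open>F j\<close>: it lies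
   in the set, is new, and has an index no later than that of any \<open>y \<xi>\<close> not yet
   listed.\<close>
 define R where "R i F z \<longleftrightarrow> (\<forall>p\<in>Field P. fmem p z ?Y) \<and>
   (\<forall>p\<in>Field P. \<forall>j\<in>underS k i. \<not> feq p z (F j)) \<and>
   (\<forall>p\<in>Field P. \<forall>\<xi>\<in>Field k. \<exists>q. q << p \<and> ((\<exists>j\<in>underS k i. feq q (y \<xi>) (F j)) \<or>
    (\<exists>\<eta>. (\<eta>, \<xi>) \<in> k \<and> feq q z (y \<eta>))))" for i F z
 define x where "x = wfrec (k - Id) (%F i. SOME z. R i F z)"
 have x: "x i = (SOME z. R i x z)" for i
 proof -
  have "R i (cut x (k - Id) i) = R i x"
   unfolding R_def by (rule ext, intro conj_cong ball_cong ex_cong1 disj_cong bex_cong refl)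
    (auto simp: cut_apply underS_def)
  then show ?thesis unfolding x_def by (subst wfrec[OF wf]) (simp add: x_def)
 qed
 have memY: "fmem p z ?Y \<longleftrightarrow> (\<forall>q. q << p --> (\<exists>r. r << q \<and> (\<exists>\<xi>\<in>Field k. feq r z (y \<xi>))))" for p z
  using fmem_check_set[OF small_image[OF sm]] by auto
 have Rx: "R i x (x i)" if "i \<in> Field k" for i
  using wf that
 proof (induction i rule: wf_induct_rule)
  case (less i)
  have IH: "R j x (x j)" if "j \<in> underS k i" for j
   using less.IH[of j] that underS_sub[of k i] by (auto simp: underS_def)
  have dist: "a = b" if ab: "a \<in> underS k i" "b \<in> underS k i" "q \<in> Field P" "feq q (x a) (x b)" for a b q
  proof (rule ccontr)
   assume "a ~= b"
   then consider "a \<in> underS k b" | "b \<in> underS k a"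
    using underS_cases[OF WO] ab(1,2) underS_sub[of k i] by blast
   then show False
    using IH[OF ab(1)] IH[OF ab(2)] ab(3,4) feq_sym unfolding R_def by cases blast+
  qed
  define new where "new p \<xi> \<longleftrightarrow> (\<forall>q. q << p --> \<not> (\<exists>j\<in>underS k i. feq q (y \<xi>) (x j)))" for p \<xi>
  \<comment> \<open>These conditions know the least index of an element not listed so far. They are
    dense by \<open>less\<close>, since otherwise an initial segment would already enumerate the
    whole set.\<close>
  let ?D = "{p \<in> Field P. \<exists>\<xi>\<in>Field k. new p \<xi> \<and> (\<forall>\<eta>\<in>underS k \<xi>. \<forall>q. q << p --> \<not> new q \<eta>)}"
  have D: "\<exists>q\<in>?D. q << p" if p: "p \<in> Field P" for p
  proof -
   have "\<exists>\<xi>\<in>Field k. \<exists>q. q << p \<and> new q \<xi>"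
   proof (rule ccontr)
    assume n: "\<not> ?thesis"
    have "feq p (check_set (x ` underS k i)) ?Y"
    proof (rule feq_ext)
     fix z q assume q: "q << p"
     show "fmem q z (check_set (x ` underS k i)) = fmem q z ?Y"
     proof
      assume h: "fmem q z (check_set (x ` underS k i))"
      show "fmem q z ?Y"
      proof (rule fmem_dense)
       fix r assume "r << q"
       then obtain s j where s: "s << r" "j \<in> underS k i" "feq s z (x j)"
        using h unfolding fmem_check_set[OF small_image[OF smallwoD(3)[OF wo]]] by blast
       have "fmem s (x j) ?Y" using IH[OF s(2)] le_field(1)[OF s(1)] unfolding R_def by blast
       then show "\<exists>s. s << r \<and> fmem s z ?Y" using s fmem_cong1 feq_sym by blast
      qed
     next
      assume h: "fmem q z ?Y"
      show "fmem q z (check_set (x ` underS k i))"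
      proof (rule fmem_dense)
       fix r assume r: "r << q"
       then obtain s \<xi> where s: "s << r" "\<xi> \<in> Field k" "feq s z (y \<xi>)" using h unfolding memY by blast
       have "s << p" using s r q le_trans by blast
       then obtain t j where t: "t << s" "j \<in> underS k i" "feq t (y \<xi>) (x j)"
        using n s(2) unfolding new_def by blast
       have "fmem t (x j) (check_set (x ` underS k i))"
        by (intro fmem_check_setI small_image smallwoD(3)[OF wo] imageI t(2))
       moreover have "feq t z (x j)" using t(3) feq_mono[OF s(3) t(1)] feq_trans by blast
       ultimately show "\<exists>s. s << r \<and> fmem s z (check_set (x ` underS k i))"
        using s(1) t(1) le_trans fmem_cong1 feq_sym by blast
      qed
     qed
    qed
    moreover have "fo p (equinumerous (check_set (x ` underS k i)) (check_elt k i))"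
     unfolding check_elt_unfold[OF WO, of i]
    proof (rule bij_name[OF smallwoD(3)[OF wo]])
     show "a = b" if "a \<in> underS k i" "b \<in> underS k i" "q << p" "feq q (x a) (x b)" for a b q
      using dist that le_field(1) by blast
     show "a = b" if "a \<in> underS k i" "b \<in> underS k i" "q << p" "feq q (check_elt k a) (check_elt k b)" for a b q
      using check_elt_inj[OF wo le_field(1)[OF that(3)] _ _ that(4)] that(1,2) underS_sub[of k i] by blast
    qed
    ultimately have "fo p (equinumerous ?Y (check_elt k i))"
     using cong_fo[OF cong_equinumerous(1)] p by blast
    then show False using assms(4)[OF less.prems p] by blast
   qed
   then obtain \<xi>' where \<xi>': "\<xi>' \<in> {\<xi> \<in> Field k. \<exists>q. q << p \<and> new q \<xi>}" by blast
   obtain \<xi> where \<xi>: "\<xi> \<in> {\<xi> \<in> Field k. \<exists>q. q << p \<and> new q \<xi>}"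
    "!!\<eta>. (\<eta>, \<xi>) \<in> k - Id ==> \<eta> \<notin> {\<xi> \<in> Field k. \<exists>q. q << p \<and> new q \<xi>}"
    by (rule wfE_min[OF wf \<xi>'], rule that, assumption, blast)
   obtain q where q: "q << p" "new q \<xi>" using \<xi>(1) by blast
   have "\<not> new r \<eta>" if "\<eta> \<in> underS k \<xi>" "r << q" for r \<eta>
    using \<xi>(2)[of \<eta>] that q(1) le_trans underS_sub[of k \<xi>] by (auto simp: underS_def)
   then have "q \<in> ?D" using q \<xi>(1) le_field(1) by blast
   then show ?thesis using q(1) by blast
  qed
  have "?D \<subseteq> Field P" by blast
  then obtain A where m: "maxanti ?D A" using maxanti_ex by blast
  note A = maxantiD[OF m]
  have "\<forall>a\<in>A. \<exists>\<xi>. \<xi> \<in> Field k \<and> new a \<xi> \<and> (\<forall>\<eta>\<in>underS k \<xi>. \<forall>q. q << a --> \<not> new q \<eta>)" using A(1) by blast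
  then obtain g where g: "\<forall>a\<in>A. g a \<in> Field k \<and> new a (g a) \<and> (\<forall>\<eta>\<in>underS k (g a). \<forall>q. q << a --> \<not> new q \<eta>)"
   by (rule bchoice[THEN exE])
  obtain z where z: "!!a. a \<in> A ==> feq a z (y (g a))"
   using mix[of A "%a. y (g a)"] A(3) by metis
  have dA: "\<exists>r a. r << p \<and> a \<in> A \<and> r << a \<and> feq r z (y (g a))" if p: "p \<in> Field P" for p
  proof -
   obtain q where "q \<in> ?D" "q << p" using D[OF p] by blast
   then obtain a r where "a \<in> A" "r << a" "r << q" using A(4) by blast
   then show ?thesis using z feq_mono le_trans \<open>q << p\<close> by blast
  qed
  have "R i x z" unfolding R_def
  proof (intro conjI ballI)
   fix p assume p: "p \<in> Field P"
   show "fmem p z ?Y" unfolding memY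
    using dA g le_field(1) by (metis (no_types, lifting))
   show "\<not> feq p z (x j)" if j: "j \<in> underS k i" for j
   proof
    assume h: "feq p z (x j)"
    obtain r a where r: "r << p" "a \<in> A" "r << a" "feq r z (y (g a))" using dA[OF p] by blast
    have "feq r (y (g a)) (x j)" using r(4) feq_mono[OF h r(1)] feq_trans feq_sym by blast
    then show False using g r j unfolding new_def by blast
   qed
   fix \<xi> assume \<xi>: "\<xi> \<in> Field k"
   obtain r a where r: "r << p" "a \<in> A" "r << a" "feq r z (y (g a))" using dA[OF p] by blast
   show "\<exists>q. q << p \<and> ((\<exists>j\<in>underS k i. feq q (y \<xi>) (x j)) \<or> (\<exists>\<eta>. (\<eta>, \<xi>) \<in> k \<and> feq q z (y \<eta>)))"
   proof (cases "\<xi> \<in> underS k (g a)")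
    case True
    then have "\<not> new r \<xi>" using g r by blast
    then show ?thesis unfolding new_def using r(1) le_trans by blast
   next
    case False
    have "g a \<in> Field k" using g r by blast
    then have "g a = \<xi> \<or> g a \<in> underS k \<xi>" using underS_cases[OF WO _ \<xi>] False by blast
    moreover have "(\<xi>, \<xi>) \<in> k"
     using WO \<xi> unfolding well_order_on_def linear_order_on_def partial_order_on_def preorder_on_def refl_on_def
     by blast
    ultimately have "(g a, \<xi>) \<in> k" by (auto simp: underS_def)
    then show ?thesis using r by blast
   qed
  qed
  then show ?case by (subst x) (rule someI)
 qed
 have dist: "a = b" if ab: "a \<in> Field k" "b \<in> Field k" "q \<in> Field P" "feq q (x a) (x b)" for a b q
 proof (rule ccontr)
  assume "a ~= b"
  then consider "a \<in> underS k b" | "b \<in> underS k a" using underS_cases[OF WO ab(1,2)] by blast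
  then show False
   using Rx[OF ab(1)] Rx[OF ab(2)] ab(3,4) feq_sym unfolding R_def by cases blast+
 qed
 \<comment> \<open>An element never listed would bound the indices of all \<open>x i\<close>; as
   these are distinct, \<open>k\<close> would be collapsed to an initial segment.\<close>
 have cover: "\<exists>q. q << p \<and> (\<exists>i\<in>Field k. feq q (y \<xi>) (x i))" if p: "p \<in> Field P" and \<xi>: "\<xi> \<in> Field k" for p \<xi>
 proof (rule ccontr)
  assume n: "\<not> ?thesis"
  obtain b where b: "b \<in> Field k" "{x. (x, \<xi>) \<in> k} \<subseteq> underS k b" using Card_order_limit[OF k \<xi>] by blast
  show False
  proof (rule no_ccc_collapse[OF k b(1), where R = "%i \<eta> q. q \<in> Field P \<and> feq q (x i) (y \<eta>)"])
   fix i assume i: "i \<in> Field k"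
   obtain q where q: "q << p" "(\<exists>j\<in>underS k i. feq q (y \<xi>) (x j)) \<or> (\<exists>\<eta>. (\<eta>, \<xi>) \<in> k \<and> feq q (x i) (y \<eta>))"
    using Rx[OF i] p \<xi> unfolding R_def by blast
   have "\<not> (\<exists>j\<in>underS k i. feq q (y \<xi>) (x j))" using n q(1) underS_sub[of k i] by blast
   then obtain \<eta> where "(\<eta>, \<xi>) \<in> k" "feq q (x i) (y \<eta>)" using q(2) by blast
   then show "\<exists>q\<in>Field P. \<exists>\<beta>\<in>underS k b. q \<in> Field P \<and> feq q (x i) (y \<beta>)"
    using b(2) le_field(1)[OF q(1)] by blast
  next
   fix i j \<beta> q q' r assume "i \<in> Field k" "j \<in> Field k" and h: "q \<in> Field P \<and> feq q (x i) (y \<beta>)"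
    "q' \<in> Field P \<and> feq q' (x j) (y \<beta>)" "r << q" "r << q'"
   moreover have "feq r (x i) (x j)" using h feq_mono feq_trans feq_sym by meson
   ultimately show "i = j" using dist le_field(1) by blast
  qed
 qed
 have "feq p0 (check_set (x ` Field k)) ?Y"
 proof (rule feq_ext)
  fix z q assume q: "q << p0"
  note memX = fmem_check_set[OF small_image[OF sm]]
  show "fmem q z (check_set (x ` Field k)) = fmem q z ?Y"
  proof
   assume h: "fmem q z (check_set (x ` Field k))"
   show "fmem q z ?Y"
   proof (rule fmem_dense)
    fix r assume "r << q"
    then obtain s j where s: "s << r" "j \<in> Field k" "feq s z (x j)"
     using h unfolding memX by blast
    have "fmem s (x j) ?Y" using Rx[OF s(2)] le_field(1)[OF s(1)] unfolding R_def by blast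
    then show "\<exists>s. s << r \<and> fmem s z ?Y" using s fmem_cong1 feq_sym by blast
   qed
  next
   assume h: "fmem q z ?Y"
   show "fmem q z (check_set (x ` Field k))"
   proof (rule fmem_dense)
    fix r assume r: "r << q"
    then obtain s \<xi> where s: "s << r" "\<xi> \<in> Field k" "feq s z (y \<xi>)" using h unfolding memY by blast
    then obtain t j where t: "t << s" "j \<in> Field k" "feq t (y \<xi>) (x j)"
     using cover[OF le_field(1)[OF s(1)] s(2)] by blast
    have "fmem t (x j) (check_set (x ` Field k))" by (intro fmem_check_setI small_image sm imageI t(2))
    moreover have "feq t z (x j)" using t(3) feq_mono[OF s(3) t(1)] feq_trans by blast
    ultimately show "\<exists>s. s << r \<and> fmem s z (check_set (x ` Field k))"
     using s(1) t(1) le_trans fmem_cong1 feq_sym by blast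
   qed
  qed
 qed
 moreover have "fo p0 (equinumerous (check_set (x ` Field k)) (check_ord k))"
  unfolding check_ord_def
 proof (rule bij_name[OF sm])
  show "a = b" if "a \<in> Field k" "b \<in> Field k" "q << p0" "feq q (x a) (x b)" for a b q
   using dist that le_field(1) by blast
  show "a = b" if "a \<in> Field k" "b \<in> Field k" "q << p0" "feq q (check_elt k a) (check_elt k b)" for a b q
   using check_elt_inj[OF wo le_field(1)[OF that(3)] that(1,2,4)] .
 qed
 ultimately show ?thesis using cong_fo[OF cong_equinumerous(1)] p0 by blast
qed

text \<open>The witness may repeat elements: its size is derived from minimality by
  \<open>equinumerous_ord\<close>, so the applications only have to exhibit a family indexed by
  \<open>k\<close>.\<close>

lemma least_card_forced:
 fixes k :: "'a rel"
 assumes k: "Card_order k" "natLeq <o k" and sm: "small (Field k)"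
  and less: "!!b p X. b \<in> Field k ==> p \<in> Field P ==> fo p (\<Phi> X) ==>
   \<not> fo p (equinumerous X (check_elt k b))"
  and Y: "!!p. p \<in> Field P ==> fo p (\<Phi> (check_set (y ` Field k)))"
  and p: "p \<in> Field P"
 shows "fo p (least_card \<Phi> (check_ord k))"
 unfolding least_card_def fo_conj
proof
 have wo: "smallwo k" using k(1) sm unfolding smallwo_def card_order_on_def by blast
 have "fo p (equinumerous (check_set (y ` Field k)) (check_ord k))"
  using equinumerous_ord[OF k sm] less Y p by blast
 then show "fo p (Ex (%X. Conj (\<Phi> X) (equinumerous X (check_ord k))))"
  by (intro fo_exI[of _ "check_set (y ` Field k)"]) (simp add: Y[OF p])
 have c: "cong (%x. Neg (Ex (%X. Conj (\<Phi> X) (equinumerous X x))))"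
  by (intro congs cong_equinumerous)
 show "fo p (BAll (check_ord k) (%x. Neg (Ex (%X. Conj (\<Phi> X) (equinumerous X x)))))"
  unfolding fo_ball_check[OF wo c] fo_neg
 proof (intro ballI allI impI notI)
  fix b q r assume b: "b \<in> Field k" and r: "r << q" "fo r (Ex (%X. Conj (\<Phi> X) (equinumerous X (check_elt k b))))"
  then obtain s X where "s << r" "fo s (\<Phi> X)" "fo s (equinumerous X (check_elt k b))"
   unfolding fo_ex fo_conj using le_refl1(1) by blast
  then show False using less b le_field(1) by blast
 qed
qed

end

section \<open>Families of finite sets\<close>

locale regular_card =
 fixes \<theta> :: "'t rel"
 assumes card: "Card_order \<theta>" and uncountable: "natLeq <o \<theta>" and regular: "regularCard \<theta>"
begin

definition large :: "'x set => bool" where "large A \<longleftrightarrow> \<not> |A| <o \<theta>"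

lemma infF: "infinite (Field \<theta>)" by (rule inf_Field[OF card uncountable])

lemma Cinf: "Cinfinite \<theta>" using infF card unfolding cinfinite_def by blast

lemma countable_less: "countable A ==> |A| <o \<theta>"
 using countable_ordLeq_natLeq uncountable ordLeq_ordLess_trans by blast

lemma finite_less: "finite A ==> |A| <o \<theta>"
 by (rule countable_less) (rule countable_finite)

lemma UNION_less: "|I| <o \<theta> ==> (!!i. i \<in> I ==> |A i| <o \<theta>) ==> |\<Union>i\<in>I. A i| <o \<theta>"
 using card_of_UNION_ordLess_infinite_Field_regularCard[OF regular Cinf] by blast

lemma sub_less: "|A| <o \<theta> ==> B \<subseteq> A ==> |B| <o \<theta>"
 using card_of_mono1 ordLeq_ordLess_trans by blast

lemma large_infinite: "large A ==> infinite A"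
 using finite_less unfolding large_def by blast

lemma pigeonhole:
 assumes "large A" "|f ` A| <o \<theta>"
 obtains b where "large {a \<in> A. f a = b}"
proof (rule ccontr)
 assume "\<not> thesis"
 then have "|{a \<in> A. f a = b}| <o \<theta>" for b using that unfolding large_def by blast
 then have "|\<Union>b\<in>f ` A. {a \<in> A. f a = b}| <o \<theta>" by (intro UNION_less assms(2))
 then have "|A| <o \<theta>" by (rule sub_less) blast
 then show False using assms(1) unfolding large_def by blast
qed

lemma large_two: assumes "large A" obtains x y where "x \<in> A" "y \<in> A" "x ~= y"
proof -
 have "\<not> (\<exists>x. A \<subseteq> {x})" using large_infinite[OF assms] finite_subset by blast
 then show ?thesis using that by (metis insertCI subsetI singletonD singletonI)
qed

text \<open>Either some point lies in a large number of the sets and is removed from these, or a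
  maximal disjoint subfamily is large: a small one would have a small union, whose points lie in few
  sets, and regularity would make the whole family small.\<close>

lemma Delta_card:
 assumes "large \<Xi>" "!!\<xi>. \<xi> \<in> \<Xi> ==> finite (A \<xi>) \<and> card (A \<xi>) = n"
 shows "\<exists>\<Xi>' R. \<Xi>' \<subseteq> \<Xi> \<and> large \<Xi>' \<and> (\<forall>\<xi>\<in>\<Xi>'. \<forall>\<zeta>\<in>\<Xi>'. \<xi> ~= \<zeta> --> A \<xi> \<inter> A \<zeta> = R)"
 using assms
proof (induction n arbitrary: \<Xi> A)
 case 0
 have "A \<xi> = {}" if "\<xi> \<in> \<Xi>" for \<xi> using 0(2)[OF that] card_0_eq by blast
 then show ?case using 0(1) by (intro exI[of _ \<Xi>] exI[of _ "{}"]) auto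
next
 case (Suc n)
 show ?case
 proof (cases "\<exists>x. large {\<xi> \<in> \<Xi>. x \<in> A \<xi>}")
  case True
  then obtain x where x: "large {\<xi> \<in> \<Xi>. x \<in> A \<xi>}" by blast
  obtain \<Xi>' R where "\<Xi>' \<subseteq> {\<xi> \<in> \<Xi>. x \<in> A \<xi>}" "large \<Xi>'"
   "\<forall>\<xi>\<in>\<Xi>'. \<forall>\<zeta>\<in>\<Xi>'. \<xi> ~= \<zeta> --> (A \<xi> - {x}) \<inter> (A \<zeta> - {x}) = R"
   using Suc.IH[OF x, of "%\<xi>. A \<xi> - {x}"] Suc.prems(2) by auto
  then show ?thesis by (intro exI[of _ \<Xi>'] exI[of _ "insert x R"]) blast
 next
  case False
  then have sml: "|{\<xi> \<in> \<Xi>. x \<in> A \<xi>}| <o \<theta>" for x unfolding large_def by blast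
  define C where "C = {Z. Z \<subseteq> \<Xi> \<and> (\<forall>\<xi>\<in>Z. \<forall>\<zeta>\<in>Z. \<xi> ~= \<zeta> --> A \<xi> \<inter> A \<zeta> = {})}"
  have "\<exists>M\<in>C. \<forall>X\<in>C. M \<subseteq> X --> X = M"
  proof (rule subset_Zorn_nonempty)
   show "C ~= {}" unfolding C_def by blast
  next
   fix \<C> assume c: "\<C> ~= {}" "subset.chain C \<C>"
   have "A \<xi> \<inter> A \<zeta> = {}" if "\<xi> \<in> X" "X \<in> \<C>" "\<zeta> \<in> Y" "Y \<in> \<C>" "\<xi> ~= \<zeta>" for \<xi> \<zeta> X Y
   proof -
    have "X \<in> C" "Y \<in> C" "X \<subseteq> Y \<or> Y \<subseteq> X" using c(2) that by (auto simp: subset_chain_def)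
    then show ?thesis using that unfolding C_def by blast
   qed
   moreover have "\<Union>\<C> \<subseteq> \<Xi>" using c(2) unfolding subset_chain_def C_def by blast
   ultimately show "\<Union>\<C> \<in> C" unfolding C_def by blast
  qed
  then obtain Z where Z: "Z \<in> C" "\<forall>X\<in>C. Z \<subseteq> X --> X = Z" by (rule bexE)
  have "large Z" unfolding large_def
  proof
   assume Zs: "|Z| <o \<theta>"
   have "|\<Union>\<xi>\<in>Z. A \<xi>| <o \<theta>"
    using Suc.prems(2) Z(1) unfolding C_def by (intro UNION_less[OF Zs] finite_less) auto
   then have U: "|\<Union>x\<in>(\<Union>\<xi>\<in>Z. A \<xi>). {\<xi> \<in> \<Xi>. x \<in> A \<xi>}| <o \<theta>" by (intro UNION_less[OF _ sml])
   have "\<Xi> \<subseteq> (\<Union>x\<in>(\<Union>\<xi>\<in>Z. A \<xi>). {\<xi> \<in> \<Xi>. x \<in> A \<xi>})"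
   proof
    fix \<xi> assume \<xi>: "\<xi> \<in> \<Xi>"
    have ne: "A \<xi> ~= {}" using Suc.prems(2)[OF \<xi>] by auto
    have "\<exists>\<zeta>\<in>Z. A \<xi> \<inter> A \<zeta> ~= {}"
    proof (rule ccontr)
     assume n: "\<not> ?thesis"
     then have "insert \<xi> Z \<in> C" using Z(1) \<xi> unfolding C_def by blast
     then have "\<xi> \<in> Z" using Z(2) by blast
     then show False using n ne by blast
    qed
    then show "\<xi> \<in> (\<Union>x\<in>(\<Union>\<xi>\<in>Z. A \<xi>). {\<xi> \<in> \<Xi>. x \<in> A \<xi>})" using \<xi> by blast
   qed
   then show False using U Suc.prems(1) sub_less unfolding large_def by blast
  qed
  then show ?thesis using Z(1) unfolding C_def by (intro exI[of _ Z] exI[of _ "{}"]) blast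
 qed
qed

lemma Delta_system:
 assumes "large \<Xi>" "!!\<xi>. \<xi> \<in> \<Xi> ==> finite (A \<xi>)"
 obtains \<Xi>' R where "\<Xi>' \<subseteq> \<Xi>" "large \<Xi>'" "finite R" "!!\<xi>. \<xi> \<in> \<Xi>' ==> R \<subseteq> A \<xi>"
  "!!\<xi> \<zeta>. \<xi> \<in> \<Xi>' ==> \<zeta> \<in> \<Xi>' ==> \<xi> ~= \<zeta> ==> A \<xi> \<inter> A \<zeta> = R"
proof -
 have "|(%\<xi>. card (A \<xi>)) ` \<Xi>| <o \<theta>" by (rule countable_less) simp
 then obtain n where n: "large {\<xi> \<in> \<Xi>. card (A \<xi>) = n}" using pigeonhole[OF assms(1)] by metis
 obtain \<Xi>' R where 1: "\<Xi>' \<subseteq> {\<xi> \<in> \<Xi>. card (A \<xi>) = n}" "large \<Xi>'"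
  "\<forall>\<xi>\<in>\<Xi>'. \<forall>\<zeta>\<in>\<Xi>'. \<xi> ~= \<zeta> --> A \<xi> \<inter> A \<zeta> = R"
  using Delta_card[OF n, of A n] assms(2) by auto
 obtain x y where xy: "x \<in> \<Xi>'" "y \<in> \<Xi>'" "x ~= y" using large_two[OF 1(2)] .
 have "R \<subseteq> A \<xi>" if "\<xi> \<in> \<Xi>'" for \<xi>
  using 1(3) xy that by (cases "\<xi> = x") blast+
 moreover have "finite R" using calculation[OF xy(1)] assms(2)[of x] xy(1) 1(1) finite_subset by blast
 ultimately show ?thesis using that[of \<Xi>' R] 1 by blast
qed

lemma image_less: "|A| <o \<theta> ==> |f ` A| <o \<theta>"
 using card_of_image ordLeq_ordLess_trans by blast

lemma prod_less: assumes "|A| <o \<theta>" "|B| <o \<theta>" shows "|A \<times> B| <o \<theta>"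
proof -
 have "|\<Union>a\<in>A. Pair a ` B| <o \<theta>" by (intro UNION_less assms image_less)
 then show ?thesis by (rule sub_less) blast
qed

lemma Fpow_less: assumes "|A| <o \<theta>" shows "|Fpow A| <o \<theta>"
proof -
 have "|{F. F \<subseteq> A \<and> finite F \<and> card F = n}| <o \<theta>" for n
 proof (induction n)
  case 0
  have "{F. F \<subseteq> A \<and> finite F \<and> card F = 0} = {{}}" by auto
  then show ?case by (simp add: finite_less)
 next
  case (Suc n)
  have "|\<Union>a\<in>A. insert a ` {F. F \<subseteq> A \<and> finite F \<and> card F = n}| <o \<theta>"
   by (intro UNION_less assms image_less Suc)
  moreover have "{F. F \<subseteq> A \<and> finite F \<and> card F = Suc n} \<subseteq>
    (\<Union>a\<in>A. insert a ` {F. F \<subseteq> A \<and> finite F \<and> card F = n})"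
  proof
   fix F assume F: "F \<in> {F. F \<subseteq> A \<and> finite F \<and> card F = Suc n}"
   then obtain a F' where "F = insert a F'" "a \<notin> F'" "card F' = n" by (auto simp: card_Suc_eq)
   then show "F \<in> (\<Union>a\<in>A. insert a ` {F. F \<subseteq> A \<and> finite F \<and> card F = n})" using F by auto
  qed
  ultimately show ?case by (rule sub_less)
 qed
 then have "|\<Union>n::nat. {F. F \<subseteq> A \<and> finite F \<and> card F = n}| <o \<theta>"
  by (intro UNION_less countable_less[of UNIV]) simp_all
 then show ?thesis by (rule sub_less) (auto simp: Fpow_def)
qed

lemma uniformize:
 assumes "finite R" "large \<Xi>" "!!i. i \<in> R ==> |f i ` \<Xi>| <o \<theta>"
 shows "\<exists>\<Xi>' g. \<Xi>' \<subseteq> \<Xi> \<and> large \<Xi>' \<and> (\<forall>i\<in>R. \<forall>\<xi>\<in>\<Xi>'. f i \<xi> = g i)"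
 using assms
proof (induction R arbitrary: \<Xi> rule: finite_induct)
 case empty
 then show ?case by blast
next
 case (insert i R)
 obtain b where b: "large {\<xi> \<in> \<Xi>. f i \<xi> = b}"
  using pigeonhole[OF insert.prems(1) insert.prems(2)[of i]] by blast
 have "|f j ` {\<xi> \<in> \<Xi>. f i \<xi> = b}| <o \<theta>" if "j \<in> R" for j
  by (rule sub_less[OF insert.prems(2)[of j]]) (use that in auto)
 then obtain \<Xi>' g where "\<Xi>' \<subseteq> {\<xi> \<in> \<Xi>. f i \<xi> = b}" "large \<Xi>'" "\<forall>j\<in>R. \<forall>\<xi>\<in>\<Xi>'. f j \<xi> = g j"
  using insert.IH[OF b] by auto
 then show ?case by (intro exI[of _ \<Xi>'] exI[of _ "g(i := b)"]) auto
qed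

end

section \<open>The poset\<close>

type_synonym 'u cond = "'u => (nat list \<times> 'u set) option"

abbreviation st :: "'u cond => 'u => nat list" where "st p i \<equiv> fst (the (p i))"
abbreviation fs :: "'u cond => 'u => 'u set" where "fs p i \<equiv> snd (the (p i))"

text \<open>
 A condition is a finite function that assigns to a coordinate a stem and a finite set of promises. The promise
 \<open>\<eta>\<close> at coordinate \<open>i\<close> refers to the name of a real \<open>X i \<eta>\<close>, where \<open>X i \<eta> n m\<close> is a set of conditions
 forcing that the value at \<open>n\<close> is \<open>m\<close>. Coordinates with \<open>L i\<close> add a slalom of width \<open>w\<close>, the
 others add a dominating real (a Cohen real if \<open>idx i\<close> is empty).
\<close>

locale iter =
 fixes r :: "'u rel" and L :: "'u => bool" and idx :: "'u => 'u set"
  and X :: "'u => 'u => nat => nat => 'u cond set"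
  and w :: "nat => nat" and pre :: "'u => bool"
 assumes WO: "Well_order r" and w_mono: "mono w" and w_unb: "!!k. \<exists>n. k \<le> w n"
begin

definition restr :: "'u => 'u cond => 'u cond" where
 "restr i p = p |` underS r i"

text \<open>For a slalom the value codes a finite set; the width is demanded along with membership,
  so captured values come with the bound.\<close>

definition acc :: "'u => nat => nat => nat => bool" where
 "acc i n y m \<longleftrightarrow> (if L i then m \<in> set_decode y \<and> card (set_decode y) \<le> w n else m \<le> y)"

text \<open>The order occurs in its own clause, as the part of \<open>q\<close> below
  \<open>i\<close> has to decide the promised values. It occurs positively, so an inductive
  definition takes the place of a recursion along the coordinates.\<close>

inductive le :: "'u cond => 'u cond => bool" where
 leI: "dom p \<subseteq> dom q ==> \<forall>i\<in>dom p. fs p i \<subseteq> fs q i \<and> take (length (st p i)) (st q i) = st p i ==>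
  \<forall>i\<in>dom p. \<forall>n. length (st p i) \<le> n --> n < length (st q i) -->
   (\<forall>\<eta>\<in>fs p i. \<exists>m. \<exists>a\<in>X i \<eta> n m. le (restr i q) a \<and> acc i n (st q i ! n) m) ==> le q p"

lemma le_iff: "le q p \<longleftrightarrow> (dom p \<subseteq> dom q \<and> (\<forall>i\<in>dom p. fs p i \<subseteq> fs q i \<and> take (length (st p i)) (st q i) = st p i) \<and>
  (\<forall>i\<in>dom p. \<forall>n. length (st p i) \<le> n --> n < length (st q i) -->
   (\<forall>\<eta>\<in>fs p i. \<exists>m. \<exists>a\<in>X i \<eta> n m. le (restr i q) a \<and> acc i n (st q i ! n) m)))"
 (is "_ \<longleftrightarrow> ?R")
proof
 assume "le q p"
 then show "?R" by cases (intro conjI; assumption)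
next
 assume "?R"
 then show "le q p" by (elim conjE) (rule leI)
qed

lemma leD:
 assumes "le q p"
 shows "dom p \<subseteq> dom q" "i \<in> dom p ==> fs p i \<subseteq> fs q i"
  "i \<in> dom p ==> take (length (st p i)) (st q i) = st p i"
  "i \<in> dom p ==> length (st p i) \<le> n ==> n < length (st q i) ==> \<eta> \<in> fs p i ==>
   \<exists>m. \<exists>a\<in>X i \<eta> n m. le (restr i q) a \<and> acc i n (st q i ! n) m"
 using assms by (auto simp: le_iff[of q p] simp del: not_None_eq)

lemma le_length: assumes "le q p" "i \<in> dom p" shows "length (st p i) \<le> length (st q i)"
 using leD(3)[OF assms] by (metis length_take min.cobounded1)

lemma le_nth: assumes "le q p" "i \<in> dom p" "n < length (st p i)" shows "st q i ! n = st p i ! n"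
 using leD(3)[OF assms(1,2)] assms(3) by (metis nth_take)

lemma le_same:
 assumes "dom p \<subseteq> dom q" "!!i. i \<in> dom p ==> fs p i \<subseteq> fs q i \<and> st q i = st p i"
 shows "le q p"
 using assms by (intro leI) auto

lemma le_refl: "le p p" by (rule le_same) auto

lemma dom_restr [simp]: "dom (restr i p) = dom p \<inter> underS r i" by (simp add: restr_def)

lemma restr_apply [simp]: "j \<in> underS r i ==> restr i p j = p j" by (simp add: restr_def)

lemma restr_restr [simp]: assumes "j \<in> underS r i" shows "restr j (restr i p) = restr j p"
proof -
 have "underS r i \<inter> underS r j = underS r j" using underS_trans[OF WO _ assms] by blast
 then show ?thesis by (simp add: restr_def)
qed

lemma restr_id: "dom p \<subseteq> underS r i ==> restr i p = p"
 unfolding restr_def by (rule ext) (metis domIff restrict_in restrict_out subsetD)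

lemma le_restr1: "le p (restr i p)" by (rule le_same) auto

lemma le_restr: assumes "le q p" shows "le (restr i q) (restr i p)"
 using assms leD[OF assms] by (intro leI) (auto simp: subset_iff simp del: not_None_eq)

text \<open>Induction over the derivation of \<open>le q p\<close>, which supplies transitivity for
  the deciding conditions \<open>a\<close>. Values beyond the stem of \<open>q\<close> are governed
  by the promises of \<open>q\<close>, and these include those of \<open>p\<close>.\<close>

lemma le_trans: "le q p ==> le s q ==> le s p"
proof (induction arbitrary: s rule: le.induct)
 case (leI p q)
 have pq: "le q p" using leI by (intro le.leI) blast+
 show ?case
 proof (intro le.leI ballI allI impI)
  show "dom p \<subseteq> dom s" using leI(1) leD(1)[OF leI.prems] by blast
  fix i assume i: "i \<in> dom p"
  then have iq: "i \<in> dom q" using leI(1) by blast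
  have t: "take (length (st p i)) (st s i) = st p i"
   using leD(3)[OF pq i] leD(3)[OF leI.prems iq] le_length[OF pq i] by (metis min.absorb1 take_take)
  show "fs p i \<subseteq> fs s i \<and> take (length (st p i)) (st s i) = st p i"
   using t leD(2)[OF pq i] leD(2)[OF leI.prems iq] by blast
  fix n \<eta> assume n: "length (st p i) \<le> n" "n < length (st s i)" and \<eta>: "\<eta> \<in> fs p i"
  show "\<exists>m. \<exists>a\<in>X i \<eta> n m. le (restr i s) a \<and> acc i n (st s i ! n) m"
  proof (cases "n < length (st q i)")
   case True
   then obtain m a where ma: "a \<in> X i \<eta> n m" "acc i n (st q i ! n) m" "\<forall>x. le x (restr i q) --> le x a"
    using leI(3) i n(1) \<eta> by blast
   have "st s i ! n = st q i ! n" using le_nth[OF leI.prems iq True] .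
   then show ?thesis using ma le_restr[OF leI.prems] by metis
  next
   case False
   then show ?thesis using leD(4)[OF leI.prems iq _ n(2)] leD(2)[OF pq i] \<eta> by auto
  qed
 qed
qed

lemma le_antisym: assumes "le q p" "le p q" shows "p = q"
proof
 fix i
 have d: "dom p = dom q" using leD(1) assms by blast
 show "p i = q i"
 proof (cases "i \<in> dom p")
  case True
  then have "i \<in> dom q" using d by blast
  then have "fs p i = fs q i" "st p i = st q i"
   using True leD(2,3)[OF assms(1)] leD(2,3)[OF assms(2)] le_length[OF assms(1)] le_length[OF assms(2)]
   by (blast, metis take_all)
  then show ?thesis using True \<open>i \<in> dom q\<close> by (auto simp: prod_eq_iff)
 next
  case False
  then show ?thesis using d by (metis domIff)
 qed
qed

text \<open>A stem that does not change leaves no promise to check, so only the comparison below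
  \<open>i\<close> and the new values at \<open>i\<close> itself remain.\<close>

lemma le_at:
 assumes "le (restr i q) (restr i p)" "dom p \<subseteq> dom q"
  and "!!j. j \<in> dom p ==> j \<notin> underS r i ==> fs p j \<subseteq> fs q j"
  and "!!j. j \<in> dom p ==> j \<notin> underS r i ==> j ~= i ==> st q j = st p j"
  and "i \<in> dom p ==> take (length (st p i)) (st q i) = st p i"
  and "!!n \<eta>. i \<in> dom p ==> length (st p i) \<le> n ==> n < length (st q i) ==> \<eta> \<in> fs p i ==>
   \<exists>m. \<exists>a\<in>X i \<eta> n m. le (restr i q) a \<and> acc i n (st q i ! n) m"
 shows "le q p"
proof (intro leI ballI allI impI assms(2))
 fix j assume j: "j \<in> dom p"
 consider (a) "j \<in> underS r i" | (b) "j = i" | (c) "j \<notin> underS r i" "j ~= i" by blast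
 note cs = this
 show "fs p j \<subseteq> fs q j \<and> take (length (st p j)) (st q j) = st p j"
  using cs
 proof cases
  case a
  then have "j \<in> dom (restr i p)" using j by simp
  from leD(2,3)[OF assms(1) this] show ?thesis using a by simp
 next
  case b then show ?thesis using assms(3,5) j by (auto simp: underS_def)
 next
  case c then show ?thesis using assms(3,4)[OF j] by simp
 qed
 fix n \<eta> assume n: "length (st p j) \<le> n" "n < length (st q j)" "\<eta> \<in> fs p j"
 show "\<exists>m. \<exists>a\<in>X j \<eta> n m. le (restr j q) a \<and> acc j n (st q j ! n) m"
  using cs
 proof cases
  case a
  then have "j \<in> dom (restr i p)" using j by simp
  from leD(4)[OF assms(1) this, of n \<eta>] show ?thesis using a n by simp
 next
  case b then show ?thesis using assms(6) j n by blast
 next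
  case c then show ?thesis using assms(4)[OF j] n by simp
 qed
qed

text \<open>Admissibility of coordinates is a parameter because \<open>good\<close> is defined by
  recursion through conditions of smaller support. The width is taken at the length of the stem, the
  first place where a new value has to respect it.\<close>

definition vld :: "('u => bool) => 'u cond => bool" where
 "vld g p \<longleftrightarrow> finite (dom p) \<and> (\<forall>i\<in>dom p. g i \<and> finite (fs p i) \<and> fs p i \<subseteq> idx i \<and>
   (L i --> card (fs p i) \<le> w (length (st p i))))"

text \<open>The codes at \<open>i\<close> denote total functions already for the forcing restricted
  to coordinates below \<open>i\<close>: each value is decided densely there.\<close>

definition total :: "('u => bool) => 'u => bool" where
 "total g i \<longleftrightarrow> (\<forall>\<eta>\<in>idx i. \<forall>n p. vld g p --> dom p \<subseteq> underS r i -->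
   (\<exists>q. vld g q \<and> dom q \<subseteq> underS r i \<and> le q p \<and> (\<exists>m. \<exists>a\<in>X i \<eta> n m. le q a)))"

definition good :: "'u => bool" where
 "good = wfrec (r - Id) (%g i. i \<in> Field r \<and> pre i \<and> total g i)"

lemma good_iff: "good i \<longleftrightarrow> i \<in> Field r \<and> pre i \<and> total good i"
proof -
 have wf: "wf (r - Id)" using WO unfolding well_order_on_def by blast
 \<comment> \<open>Only coordinates below \<open>i\<close> are consulted, and there the function
   that is cut off at \<open>i\<close> is \<open>good\<close> itself.\<close>
 have "vld (cut good (r - Id) i) p \<longleftrightarrow> vld good p" if "dom p \<subseteq> underS r i" for p
 proof -
  have "cut good (r - Id) i j = good j" if "j \<in> dom p" for j
   using that \<open>dom p \<subseteq> underS r i\<close> by (auto simp: cut_def underS_def)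
  then show ?thesis unfolding vld_def by (metis (no_types, lifting))
 qed
 then have "total (cut good (r - Id) i) i \<longleftrightarrow> total good i"
  unfolding total_def by (metis (no_types, lifting))
 then show ?thesis unfolding good_def by (subst wfrec[OF wf]) (simp add: good_def)
qed

definition valid :: "'u cond => bool" where "valid = vld good"

lemma validI: "finite (dom p) ==> (!!i. i \<in> dom p ==> good i \<and> finite (fs p i) \<and> fs p i \<subseteq> idx i \<and>
   (L i --> card (fs p i) \<le> w (length (st p i)))) ==> valid p"
 unfolding valid_def vld_def by blast

lemma validD:
 assumes "valid p"
 shows "finite (dom p)" "i \<in> dom p ==> good i" "i \<in> dom p ==> finite (fs p i)"
  "i \<in> dom p ==> fs p i \<subseteq> idx i" "i \<in> dom p ==> L i ==> card (fs p i) \<le> w (length (st p i))"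
 using assms unfolding valid_def vld_def by blast+

lemma valid_restrict: "valid p ==> valid (p |` A)"
 by (rule validI) (use validD[of p] in auto)

lemma valid_restr: "valid p ==> valid (restr i p)"
 unfolding restr_def by (rule valid_restrict)

lemma decide:
 assumes i: "good i" and p: "valid p" "dom p \<subseteq> underS r i" and H: "finite H" "H \<subseteq> idx i \<times> UNIV"
 shows "\<exists>q. valid q \<and> dom q \<subseteq> underS r i \<and> le q p \<and> (\<forall>(\<eta>, n)\<in>H. \<exists>m. \<exists>a\<in>X i \<eta> n m. le q a)"
 using H
proof (induction H rule: finite_induct)
 case empty
 then show ?case using p le_refl by blast
next
 case (insert x H)
 then obtain q where q: "valid q" "dom q \<subseteq> underS r i" "le q p" "\<forall>(\<eta>, n)\<in>H. \<exists>m. \<exists>a\<in>X i \<eta> n m. le q a"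
  by blast
 obtain \<eta> n where x: "x = (\<eta>, n)" "\<eta> \<in> idx i" using insert.prems by auto
 have "total good i" using i good_iff by blast
 then obtain q' where q': "valid q'" "dom q' \<subseteq> underS r i" "le q' q" "\<exists>m. \<exists>a\<in>X i \<eta> n m. le q' a"
  using x(2) q(1,2) unfolding total_def valid_def by blast
 have "\<forall>(\<eta>, n)\<in>insert x H. \<exists>m. \<exists>a\<in>X i \<eta> n m. le q' a"
  using q(4) q'(3,4) x(1) le_trans by blast
 then show ?case using q' q le_trans by blast
qed

lemma acc_ex:
 assumes "finite H" "L i ==> card H \<le> w n"
 shows "\<exists>y. \<forall>\<eta>\<in>H. acc i n y (f \<eta>)"
proof (cases "L i")
 case True
 have "card (f ` H) \<le> w n" using assms card_image_le[of H f] True by linarith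
 then show ?thesis using assms(1) True by (intro exI[of _ "set_encode (f ` H)"]) (simp add: acc_def)
next
 case False
 then show ?thesis using assms(1)
  by (intro exI[of _ "sum f H"]) (simp add: acc_def member_le_sum)
qed

definition upd :: "'u => 'u cond => nat list \<times> 'u set => 'u cond => 'u cond" where
 "upd i q0 x p = (%j. if j \<in> underS r i then q0 j else if j = i then Some x else p j)"

lemma underS_irrefl [simp]: "i \<notin> underS r i" by (simp add: underS_def)

lemma restr_at: "dom q0 \<subseteq> underS r i ==> restr i (upd i q0 x p) = q0"
proof
 fix j assume d: "dom q0 \<subseteq> underS r i"
 show "restr i (upd i q0 x p) j = q0 j"
 proof (cases "j \<in> underS r i")
  case True then show ?thesis by (simp add: upd_def)
 next
  case False
  then have "q0 j = None" using d by (metis domIff subsetD)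
  then show ?thesis using False by (simp add: restr_def)
 qed
qed

lemma dom_at: "dom q0 \<subseteq> underS r i ==> dom (upd i q0 x p) = dom q0 \<union> {i} \<union> (dom p - underS r i)"
proof -
 assume "dom q0 \<subseteq> underS r i"
 then have "j \<in> underS r i" if "q0 j ~= None" for j using that by (metis domIff subsetD)
 then show ?thesis by (auto simp: upd_def dom_def)
qed

lemma valid_at:
 assumes "valid q0" "dom q0 \<subseteq> underS r i" "valid p" "good i"
  "finite (snd x)" "snd x \<subseteq> idx i" "L i ==> card (snd x) \<le> w (length (fst x))"
 shows "valid (upd i q0 x p)"
proof (rule validI)
 show "finite (dom (upd i q0 x p))" using assms validD(1) by (simp add: dom_at)
 fix j assume "j \<in> dom (upd i q0 x p)"
 then consider "j \<in> dom q0" "j \<in> underS r i" | "j = i" | "j \<in> dom p" "j \<notin> underS r i" "j ~= i"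
  using assms(2) by (auto simp: dom_at)
 then show "good j \<and> finite (fs (upd i q0 x p) j) \<and> fs (upd i q0 x p) j \<subseteq> idx j \<and>
   (L j --> card (fs (upd i q0 x p) j) \<le> w (length (st (upd i q0 x p) j)))"
  by cases (use assms validD(2-5)[OF assms(1), of j] validD(2-5)[OF assms(3), of j] in \<open>auto simp: upd_def\<close>)
qed

lemma le_at_stem:
 assumes q0: "dom q0 \<subseteq> underS r i" "le q0 (restr i p)"
  and i: "i \<in> dom p ==> take (length (st p i)) s = st p i \<and> fs p i \<subseteq> H"
  and n: "!!n \<eta>. i \<in> dom p ==> length (st p i) \<le> n ==> n < length s ==> \<eta> \<in> fs p i ==>
   \<exists>m. \<exists>a\<in>X i \<eta> n m. le q0 a \<and> acc i n (s ! n) m"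
 shows "le (upd i q0 (s, H) p) p"
proof (rule le_at[of i])
 show "le (restr i (upd i q0 (s, H) p)) (restr i p)" using q0 by (simp add: restr_at)
 show "dom p \<subseteq> dom (upd i q0 (s, H) p)"
  using leD(1)[OF q0(2)] by (auto simp: dom_at[OF q0(1)])
 show "fs p j \<subseteq> fs (upd i q0 (s, H) p) j" if "j \<in> dom p" "j \<notin> underS r i" for j
  using that i by (auto simp: upd_def)
 show "st (upd i q0 (s, H) p) j = st p j" if "j \<in> dom p" "j \<notin> underS r i" "j ~= i" for j
  using that by (simp add: upd_def)
 show "take (length (st p i)) (st (upd i q0 (s, H) p) i) = st p i" if "i \<in> dom p"
  using i[OF that] by (simp add: upd_def)
 show "\<exists>m. \<exists>a\<in>X i \<eta> n m. le (restr i (upd i q0 (s, H) p)) a \<and> acc i n (st (upd i q0 (s, H) p) i ! n) m"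
  if "i \<in> dom p" "length (st p i) \<le> n" "n < length (st (upd i q0 (s, H) p) i)" "\<eta> \<in> fs p i" for n \<eta>
  using n[OF that(1,2) _ that(4)] that(3) by (simp add: restr_at[OF q0(1)]) (simp add: upd_def)
qed

text \<open>All promised values up to the target length are decided below \<open>i\<close> at once;
  finitely many values are then accepted together, by the code of their set or by their sum.\<close>

lemma extend_stem:
 assumes p: "valid p" "i \<in> dom p"
 shows "\<exists>q. valid q \<and> le q p \<and> N \<le> length (st q i) \<and> fs q i = fs p i \<and>
  dom q \<subseteq> underS r i \<union> dom p"
proof -
 let ?N = "max N (length (st p i))"
 note pi = validD[OF p(1)]
 obtain q0 where q0: "valid q0" "dom q0 \<subseteq> underS r i" "le q0 (restr i p)"
  "\<forall>(\<eta>, n)\<in>fs p i \<times> {..<?N}. \<exists>m. \<exists>a\<in>X i \<eta> n m. le q0 a"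

 proof -
  have "finite (fs p i \<times> {..<?N})" "fs p i \<times> {..<?N} \<subseteq> idx i \<times> UNIV" "dom (restr i p) \<subseteq> underS r i"
   using pi(3,4)[OF p(2)] by auto
  from decide[OF pi(2)[OF p(2)] valid_restr[OF p(1)] this(3,1,2)] show ?thesis using that by blast
 qed
 have "\<forall>x\<in>fs p i \<times> {..<?N}. \<exists>m. \<exists>a\<in>X i (fst x) (snd x) m. le q0 a" using q0(4) by (simp add: split_beta)
 then obtain v' where v': "\<forall>x\<in>fs p i \<times> {..<?N}. \<exists>a\<in>X i (fst x) (snd x) (v' x). le q0 a"
  by (rule bchoice[THEN exE])
 define v where "v \<eta> n = v' (\<eta>, n)" for \<eta> n
 have v: "\<exists>a\<in>X i \<eta> n (v \<eta> n). le q0 a" if "\<eta> \<in> fs p i" "n < ?N" for \<eta> n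
  using v'[rule_format, of "(\<eta>, n)"] that unfolding v_def by simp
 have "\<exists>y. length (st p i) \<le> n --> (\<forall>\<eta>\<in>fs p i. acc i n y (v \<eta> n))" for n
 proof (cases "length (st p i) \<le> n")
  case True
  then have "L i ==> card (fs p i) \<le> w n" using pi(5)[OF p(2)] w_mono monoD le_trans by (meson order_trans)
  then show ?thesis using acc_ex[OF pi(3)[OF p(2)], of i n "%\<eta>. v \<eta> n"] by blast
 qed auto
 then obtain y where y: "!!n \<eta>. length (st p i) \<le> n ==> \<eta> \<in> fs p i ==> acc i n (y n) (v \<eta> n)" by metis
 define s where "s = st p i @ map y [length (st p i)..<?N]"
 have ls: "length s = ?N" by (simp add: s_def)
 have sn: "s ! n = y n" if "length (st p i) \<le> n" "n < ?N" for n
  using that by (simp add: s_def nth_append)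
 let ?q = "upd i q0 (s, fs p i) p"
 have "le ?q p"
 proof (rule le_at_stem[OF q0(2,3)])
  show "take (length (st p i)) s = st p i \<and> fs p i \<subseteq> fs p i" by (simp add: s_def)
  show "\<exists>m. \<exists>a\<in>X i \<eta> n m. le q0 a \<and> acc i n (s ! n) m"
   if "length (st p i) \<le> n" "n < length s" "\<eta> \<in> fs p i" for n \<eta>
   using v[OF that(3)] y[OF that(1,3)] sn[OF that(1)] that(2) ls by metis
 qed
 moreover have "valid ?q"
  by (rule valid_at[OF q0(1,2) p(1) pi(2)[OF p(2)]])
   (use pi(3,4,5)[of i] p(2) w_mono ls in \<open>auto dest!: monoD[of w "length (st p i)" ?N]\<close>)
 moreover have "st ?q i = s" "fs ?q i = fs p i" by (simp_all add: upd_def)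
 moreover have "dom ?q \<subseteq> underS r i \<union> dom p" using p(2) q0(2) by (auto simp: dom_at[OF q0(2)])
 ultimately show ?thesis using ls by (intro exI[of _ ?q]) simp
qed

lemma valid_update:
 assumes "valid p" "good i" "finite H" "H \<subseteq> idx i" "L i ==> card H \<le> w (length s)"
 shows "valid (p(i \<mapsto> (s, H)))"
proof (rule validI)
 show "finite (dom (p(i \<mapsto> (s, H))))" using validD(1)[OF assms(1)] by simp
 fix j assume j: "j \<in> dom (p(i \<mapsto> (s, H)))"
 show "good j \<and> finite (fs (p(i \<mapsto> (s, H))) j) \<and> fs (p(i \<mapsto> (s, H))) j \<subseteq> idx j \<and>
   (L j --> card (fs (p(i \<mapsto> (s, H))) j) \<le> w (length (st (p(i \<mapsto> (s, H))) j)))"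
 proof (cases "j = i")
  case True then show ?thesis using assms by simp
 next
  case False
  then have "j \<in> dom p" using j by simp
  then show ?thesis using False validD(2-5)[OF assms(1), of j] by simp
 qed
qed

lemma add_coord:
 assumes "valid p" "good i" "i \<notin> dom p"
 shows "valid (p(i \<mapsto> (s, {})))" "le (p(i \<mapsto> (s, {}))) p"
proof -
 show "valid (p(i \<mapsto> (s, {})))" by (rule valid_update) (use assms in auto)
 show "le (p(i \<mapsto> (s, {}))) p"
 proof (rule le_same)
  fix j assume "j \<in> dom p"
  then have "j ~= i" using assms by blast
  then show "fs p j \<subseteq> fs (p(i \<mapsto> (s, {}))) j \<and> st (p(i \<mapsto> (s, {}))) j = st p j" by simp
 qed auto
qed

lemma valid_single: "good i ==> valid [i \<mapsto> (s, {})]"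
 by (rule validI) (auto split: if_splits)

lemma valid_empty: "valid Map.empty" by (rule validI) auto

lemma le_single: "i \<in> dom p ==> le p [i \<mapsto> (st p i, {})]"
 by (rule le_same) (auto split: if_splits)

text \<open>A slalom needs width for one more promise, so the stem is lengthened until the width
  exceeds the number of promises, and only then is the new one added.\<close>

lemma add_promise:
 assumes p: "valid p" and i: "good i" "\<eta> \<in> idx i"
 shows "\<exists>q. valid q \<and> le q p \<and> i \<in> dom q \<and> \<eta> \<in> fs q i"
proof -
 obtain p1 where p1: "valid p1" "le p1 p" "i \<in> dom p1"
 proof (cases "i \<in> dom p")
  case True then show ?thesis using that p le_refl by blast
 next
  case False then show ?thesis using that[OF add_coord[OF p i(1) False, of "[]"]] by simp
 qed
 obtain N where N: "Suc (card (fs p1 i)) \<le> w N" using w_unb by blast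
 obtain p2 where p2: "valid p2" "le p2 p1" "N \<le> length (st p2 i)" "fs p2 i = fs p1 i"
  using extend_stem[OF p1(1,3)] by blast
 have i2: "i \<in> dom p2" using p1(3) leD(1)[OF p2(2)] by blast
 let ?q = "p2(i \<mapsto> (st p2 i, insert \<eta> (fs p2 i)))"
 have "card (insert \<eta> (fs p2 i)) \<le> Suc (card (fs p1 i))" by (simp add: p2(4) card_insert_le_m1 card_insert_if validD(3)[OF p1(1,3)])
 also have "\<dots> \<le> w (length (st p2 i))" using N p2(3) w_mono by (meson monoD order_trans)
 finally have c: "card (insert \<eta> (fs p2 i)) \<le> w (length (st p2 i))" .
 have "valid ?q"
  by (rule valid_update[OF p2(1) i(1)]) (use validD(3,4)[OF p2(1) i2] i c in auto)
 moreover have "le ?q p2" by (rule le_same) (use i2 in auto)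
 then have "le ?q p" using le_trans[OF le_trans[OF p1(2) p2(2)]] by blast
 ultimately show ?thesis by (intro exI[of _ ?q]) simp
qed

text \<open>Empty \<open>idx i\<close> leaves no promises to honour, so any continuation of the stem
  is allowed.\<close>

lemma extend_cohen:
 assumes p: "valid p" "i \<in> dom p" and i: "idx i = {}"
 shows "valid (p(i \<mapsto> (st p i @ t, {})))" "le (p(i \<mapsto> (st p i @ t, {}))) p"
proof -
 have f: "fs p i = {}" using validD(4)[OF p] i by blast
 show "valid (p(i \<mapsto> (st p i @ t, {})))"
  by (rule valid_update[OF p(1)]) (use validD(2)[OF p] in auto)
 show "le (p(i \<mapsto> (st p i @ t, {}))) p"
  using f p(2) by (intro leI) (auto split: if_splits)
qed

end

section \<open>Amalgamation\<close>

lemma pigeonhole_finite: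
 fixes f :: "'a => 'b"
 assumes "finite T" "finite C" "f ` T \<subseteq> C" "0 < M" "0 < card C" "M * card C \<le> card T"
 shows "\<exists>c\<in>C. M \<le> card {l \<in> T. f l = c}"
proof (rule ccontr)
 assume n: "\<not> ?thesis"
 have "T = (\<Union>c\<in>C. {l \<in> T. f l = c})" using assms(3) by blast
 then have "card T \<le> (\<Sum>c\<in>C. card {l \<in> T. f l = c})" using card_UN_le[OF assms(2)] by metis
 also have "\<dots> \<le> (\<Sum>c\<in>C. M - 1)" using n by (intro sum_mono) force
 also have "\<dots> = card C * (M - 1)" by simp
 also have "\<dots> < card C * M" using assms(4,5) by simp
 finally show False using assms(6) by (simp add: mult.commute)
qed

context iter
begin

lemma restr_idem [simp]: "restr i (restr i p) = restr i p"
 by (simp add: restr_def)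

text \<open>Meant for families whose stems agree wherever supports meet; it does not depend on the
  choice of the stem then.\<close>

definition join :: "'i set => ('i => 'u cond) => 'u cond" where
 "join T pl = (%j. if \<exists>l\<in>T. j \<in> dom (pl l)
   then Some (st (pl (SOME l. l \<in> T \<and> j \<in> dom (pl l))) j, \<Union>l\<in>{l \<in> T. j \<in> dom (pl l)}. fs (pl l) j) else None)"

lemma dom_join: "dom (join T pl) = (\<Union>l\<in>T. dom (pl l))"
proof (rule set_eqI)
 show "j \<in> dom (join T pl) \<longleftrightarrow> j \<in> (\<Union>l\<in>T. dom (pl l))" for j
  by (cases "\<exists>l\<in>T. j \<in> dom (pl l)") (simp_all add: join_def domIff)
qed

lemma fs_join: "j \<in> dom (join T pl) ==> fs (join T pl) j = (\<Union>l\<in>{l \<in> T. j \<in> dom (pl l)}. fs (pl l) j)"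
 unfolding dom_join join_def by auto

lemma st_join:
 assumes "!!l l'. l \<in> T ==> l' \<in> T ==> j \<in> dom (pl l) ==> j \<in> dom (pl l') ==> st (pl l) j = st (pl l') j"
  and l: "l \<in> T" "j \<in> dom (pl l)"
 shows "st (join T pl) j = st (pl l) j"
proof -
 let ?l = "SOME l. l \<in> T \<and> j \<in> dom (pl l)"
 have "?l \<in> T \<and> j \<in> dom (pl ?l)" by (rule someI[of _ l]) (use l in blast)
 then have "st (pl ?l) j = st (pl l) j" using assms(1)[of ?l l] l by blast
 moreover have "\<exists>l\<in>T. j \<in> dom (pl l)" using l by blast
 ultimately show ?thesis unfolding join_def by simp
qed

lemma le_join:
 assumes "!!l l' j. l \<in> T ==> l' \<in> T ==> j \<in> dom (pl l) ==> j \<in> dom (pl l') ==> st (pl l) j = st (pl l') j"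
  and l: "l \<in> T"
 shows "le (join T pl) (pl l)"
proof (rule le_same)
 show "dom (pl l) \<subseteq> dom (join T pl)" unfolding dom_join using l by blast
 fix j assume j: "j \<in> dom (pl l)"
 then have "j \<in> dom (join T pl)" unfolding dom_join using l by blast
 then have "fs (pl l) j \<subseteq> fs (join T pl) j" using l j by (auto simp: fs_join simp del: not_None_eq)
 moreover have "st (join T pl) j = st (pl l) j" by (rule st_join) (use assms j in blast)+
 ultimately show "fs (pl l) j \<subseteq> fs (join T pl) j \<and> st (join T pl) j = st (pl l) j" by blast
qed

lemma valid_join:
 assumes T: "finite T" and v: "!!l. l \<in> T ==> valid (pl l)"
  and s: "!!l l' j. l \<in> T ==> l' \<in> T ==> j \<in> dom (pl l) ==> j \<in> dom (pl l') ==> st (pl l) j = st (pl l') j"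
  and c: "!!l j. l \<in> T ==> j \<in> dom (pl l) ==> L j ==>
   card (\<Union>l\<in>{l \<in> T. j \<in> dom (pl l)}. fs (pl l) j) \<le> w (length (st (pl l) j))"
 shows "valid (join T pl)"
proof (rule validI)
 show "finite (dom (join T pl))" unfolding dom_join using T v validD(1) by blast
 fix j assume j: "j \<in> dom (join T pl)"
 then obtain l where l: "l \<in> T" "j \<in> dom (pl l)" unfolding dom_join by blast
 have "st (join T pl) j = st (pl l) j" by (rule st_join) (use s l in blast)+
 then have "L j --> card (fs (join T pl) j) \<le> w (length (st (join T pl) j))"
  using c[OF l] unfolding fs_join[OF j] by simp
 moreover have "finite (fs (join T pl) j)"
  unfolding fs_join[OF j] by (rule finite_UN_I) (use T validD(3)[OF v] in auto)
 moreover have "fs (join T pl) j \<subseteq> idx j"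
  unfolding fs_join[OF j] using validD(4)[OF v] by blast
 ultimately show "good j \<and> finite (fs (join T pl) j) \<and> fs (join T pl) j \<subseteq> idx j \<and>
   (L j --> card (fs (join T pl) j) \<le> w (length (st (join T pl) j)))"
  using validD(2)[OF v[OF l(1)] l(2)] by blast
qed

lemma valid_join_eq:
 assumes T: "finite T" and v: "!!l. l \<in> T ==> valid (pl l)"
  and s: "!!l l' j. l \<in> T ==> l' \<in> T ==> j \<in> dom (pl l) ==> j \<in> dom (pl l') ==> st (pl l) j = st (pl l') j"
  and f: "!!l l' j. l \<in> T ==> l' \<in> T ==> j \<in> dom (pl l) ==> j \<in> dom (pl l') ==> L j ==> fs (pl l) j = fs (pl l') j"
 shows "valid (join T pl)"
proof (rule valid_join[OF T v s])
 fix l j assume l: "l \<in> T" "j \<in> dom (pl l)" "L j"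
 have "(\<Union>l\<in>{l \<in> T. j \<in> dom (pl l)}. fs (pl l) j) = fs (pl l) j"
  using f l by blast
 then show "card (\<Union>l\<in>{l \<in> T. j \<in> dom (pl l)}. fs (pl l) j) \<le> w (length (st (pl l) j))"
  using validD(5)[OF v[OF l(1)] l(2,3)] by simp
qed

lemma max_coord:
 assumes "finite B" "B ~= {}" "B \<subseteq> Field r"
 shows "\<exists>i\<in>B. \<forall>j\<in>B. j = i \<or> j \<in> underS r i"
 using assms
proof (induction B rule: finite_ne_induct)
 case (singleton x) then show ?case by blast
next
 case (insert x B)
 then obtain i where i: "i \<in> B" "\<forall>j\<in>B. j = i \<or> j \<in> underS r i" by auto
 consider "x = i" | "x \<in> underS r i" | "i \<in> underS r x"
  using underS_cases[OF WO, of x i] insert.prems i(1) by auto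
 then show ?case
 proof cases
  case 3
  then have "j \<in> underS r x" if "j \<in> B" for j
   using i(2)[rule_format, OF that] underS_trans[OF WO, of j i x] by blast
  then show ?thesis by blast
 qed (use i in blast)+
qed

text \<open>
 At a bounded slalom coordinate of \<open>B\<close> only finitely many patterns of promised values occur below a level
 \<open>n'\<close> where the width leaves room for \<open>M\<close> conditions; so among many conditions, \<open>M\<close> have the same
 pattern there, and the stem can be extended by it. The top coordinate is treated last.
\<close>

lemma amalg:
 assumes "finite B" "\<forall>i\<in>B. good i \<and> L i \<and> (\<forall>\<eta> n m. X i \<eta> n m ~= {} --> m \<le> bd n)"
 shows "\<exists>N. (B = {} --> N = M) \<and> (\<forall>(T :: nat set) pl. finite T --> N \<le> card T --> (\<forall>l\<in>T. valid (pl l)) -->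
   (\<forall>l\<in>T. \<forall>l'\<in>T. \<forall>j\<in>dom (pl l) \<inter> dom (pl l'). st (pl l) j = st (pl l') j \<and>
    (L j --> j \<in> B \<or> fs (pl l) j = fs (pl l') j)) -->
   (\<forall>i\<in>B. \<forall>l\<in>T. i \<in> dom (pl l) \<and> st (pl l) i = s i) -->
   (\<exists>T'\<subseteq>T. card T' = M \<and> (\<exists>q. valid q \<and> (\<forall>l\<in>T'. le q (pl l)))))"
 using assms
proof (induction "card B" arbitrary: B M)
 case 0
 then have B: "B = {}" by simp
 show ?case
 proof (intro exI[of _ M] conjI allI impI, goal_cases)
  case (2 T pl)
  then obtain T' where T': "T' \<subseteq> T" "card T' = M" "finite T'" using obtain_subset_with_card_n by metis
  have s: "st (pl l) j = st (pl l') j" "L j ==> fs (pl l) j = fs (pl l') j"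
   if "l \<in> T'" "l' \<in> T'" "j \<in> dom (pl l)" "j \<in> dom (pl l')" for l l' j
   using 2(4) that T'(1) B by blast+
  have v: "valid (pl l)" if "l \<in> T'" for l using 2(3) that T'(1) by blast
  have "valid (join T' pl)" by (rule valid_join_eq[OF T'(3) v s])
  moreover have "le (join T' pl) (pl l)" if "l \<in> T'" for l by (rule le_join[OF s(1) that])
  ultimately show ?case using T' by blast
 qed simp
next
 case (Suc k)
 have Bne: "B ~= {}" using Suc.hyps(2) by auto
 have BF: "B \<subseteq> Field r" using Suc.prems(2) good_iff by blast
 obtain i where i: "i \<in> B" "\<forall>j\<in>B. j = i \<or> j \<in> underS r i"
  using max_coord[OF Suc.prems(1) Bne BF] by blast
 have gi: "good i" "L i" and bdi: "!!\<eta> n m. X i \<eta> n m ~= {} ==> m \<le> bd n" using bspec[OF Suc.prems(2) i(1)] by auto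
 obtain n1 where n1: "M * w (length (s i)) \<le> w n1" using w_unb by blast
 define n' where "n' = max n1 (length (s i))"
 have wn': "M * w (length (s i)) \<le> w n'" using n1 monoD[OF w_mono, of n1 n'] by (simp add: n'_def)
 have ln': "length (s i) \<le> n'" by (simp add: n'_def)
 define b where "b = (\<Sum>n<n'. bd n)"
 define C where "C = {xs. set xs \<subseteq> Pow {..b} \<and> length xs = n' - length (s i)}"
 have finC: "finite C" unfolding C_def by (rule finite_lists_length_eq) simp
 have "replicate (n' - length (s i)) {} \<in> C" unfolding C_def by (auto simp: set_replicate_conv_if)
 then have C0: "0 < card C" using finC card_gt_0_iff by blast
 have k: "k = card (B - {i})" using Suc.hyps(2) i(1) Suc.prems(1) by simp
 have fin: "finite (B - {i})" and cond: "\<forall>j\<in>B - {i}.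
   good j \<and> L j \<and> (\<forall>\<eta> n m. X j \<eta> n m ~= {} --> m \<le> bd n)" using Suc.prems by blast+
 \<comment> \<open>At the lower coordinates \<open>M * card C\<close> survivors are requested, so
   that \<open>M\<close> remain after one pattern at \<open>i\<close> is selected.\<close>
 obtain N where N: "\<forall>(T :: nat set) pl. finite T --> N \<le> card T --> (\<forall>l\<in>T. valid (pl l)) -->
   (\<forall>l\<in>T. \<forall>l'\<in>T. \<forall>j\<in>dom (pl l) \<inter> dom (pl l'). st (pl l) j = st (pl l') j \<and>
    (L j --> j \<in> B - {i} \<or> fs (pl l) j = fs (pl l') j)) -->
   (\<forall>i\<in>B - {i}. \<forall>l\<in>T. i \<in> dom (pl l) \<and> st (pl l) i = s i) -->
   (\<exists>T'\<subseteq>T. card T' = M * card C \<and> (\<exists>q. valid q \<and> (\<forall>l\<in>T'. le q (pl l))))"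
  using Suc.hyps(1)[OF k fin cond, of "M * card C"]
  by (elim exE conjE)
 show ?case
 proof (cases "M = 0")
  case True
  then show ?thesis using Bne valid_empty by (intro exI[of _ 0]) auto
 next
  case False
  show ?thesis
  proof (intro exI[of _ N] conjI allI impI, goal_cases)
   case 1 then show ?case using Bne by blast
  next
   case (2 T pl)
   let ?pr = "%l. restr i (pl l)"
   have "\<exists>T'\<subseteq>T. card T' = M * card C \<and> (\<exists>q. valid q \<and> (\<forall>l\<in>T'. le q (?pr l)))"
   proof (rule N[THEN spec[of _ T], THEN spec[of _ ?pr], THEN mp, THEN mp, THEN mp, THEN mp, THEN mp])
    show "finite T" "N \<le> card T" using 2(1,2) by blast+
    show "\<forall>l\<in>T. valid (?pr l)" using 2(3) valid_restr by blast
    show "\<forall>l\<in>T. \<forall>l'\<in>T. \<forall>j\<in>dom (?pr l) \<inter> dom (?pr l'). st (?pr l) j = st (?pr l') j \<and>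
     (L j --> j \<in> B - {i} \<or> fs (?pr l) j = fs (?pr l') j)"
    proof (intro ballI)
     fix l l' j assume h: "l \<in> T" "l' \<in> T" "j \<in> dom (?pr l) \<inter> dom (?pr l')"
     then have "j \<in> underS r i" "j ~= i" by auto
     then show "st (?pr l) j = st (?pr l') j \<and> (L j --> j \<in> B - {i} \<or> fs (?pr l) j = fs (?pr l') j)"
      using 2(4)[rule_format, OF h(1,2), of j] h(3) by simp
    qed
    show "\<forall>j\<in>B - {i}. \<forall>l\<in>T. j \<in> dom (?pr l) \<and> st (?pr l) j = s j"
     using 2(5) i(2) by auto
   qed
   then obtain T1 q1 where T1: "T1 \<subseteq> T" "card T1 = M * card C" and q1: "valid q1" "!!l. l \<in> T1 ==> le q1 (?pr l)"
    by blast
   have fT1: "finite T1" using T1(1) 2(1) finite_subset by blast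
   have vl: "valid (pl l)" "i \<in> dom (pl l)" "st (pl l) i = s i" if "l \<in> T1" for l
    using 2(3,5) i(1) T1(1) that by blast+
   have q2: "valid (restr i q1)" "!!l. l \<in> T1 ==> le (restr i q1) (?pr l)"
    using valid_restr[OF q1(1)] le_restr[OF q1(2), of _ i] by simp_all
   let ?H = "(\<Union>l\<in>T1. fs (pl l) i) \<times> {..<n'}"
   have H: "finite ?H" "?H \<subseteq> idx i \<times> UNIV" using fT1 validD(3,4)[OF vl(1,2)] by blast+
   have "dom (restr i q1) \<subseteq> underS r i" by simp
   from decide[OF gi(1) q2(1) this H] obtain q0 where q0: "valid q0" "dom q0 \<subseteq> underS r i" "le q0 (restr i q1)"
    "\<forall>(\<eta>, n)\<in>?H. \<exists>m. \<exists>a\<in>X i \<eta> n m. le q0 a" by blast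
   have "\<forall>x\<in>?H. \<exists>m. \<exists>a\<in>X i (fst x) (snd x) m. le q0 a" using q0(4) by (simp add: split_beta)
   then obtain v where v: "\<forall>x\<in>?H. \<exists>a\<in>X i (fst x) (snd x) (v x). le q0 a" by (rule bchoice[THEN exE])
   define V where "V l n = (%\<eta>. v (\<eta>, n)) ` fs (pl l) i" for l n
   define f where "f l = map (V l) [length (s i)..<n']" for l
   have "f ` T1 \<subseteq> C"
   proof
    fix x assume "x \<in> f ` T1"
    then obtain l where l: "l \<in> T1" "x = f l" by blast
    have "v (\<eta>, n) \<le> b" if "\<eta> \<in> fs (pl l) i" "n < n'" for \<eta> n
    proof -
     have "X i \<eta> n (v (\<eta>, n)) ~= {}" using v[rule_format, of "(\<eta>, n)"] that l by auto
     then have "v (\<eta>, n) \<le> bd n" by (rule bdi)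
     also have "\<dots> \<le> b" unfolding b_def using that(2) by (intro member_le_sum) auto
     finally show ?thesis .
    qed
    then show "x \<in> C" unfolding C_def f_def l(2) V_def by auto
   qed
   then obtain c where c: "M \<le> card {l \<in> T1. f l = c}"
    using pigeonhole_finite[OF fT1 finC _ _ C0, of f M] False T1(2) by auto
   obtain T2 where T2: "T2 \<subseteq> {l \<in> T1. f l = c}" "card T2 = M" "finite T2"
    using obtain_subset_with_card_n[OF c] by metis
   have T2ne: "T2 ~= {}" using T2(2) False by auto
   then obtain l0 where l0: "l0 \<in> T2" by blast
   have Veq: "V l n = V l0 n" if "l \<in> T2" "length (s i) \<le> n" "n < n'" for l n
   proof -
    have "f l = c" "f l0 = c" using T2(1) that(1) l0 by blast+
    then have "f l ! (n - length (s i)) = f l0 ! (n - length (s i))" by simp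
    then show ?thesis using that(2,3) by (simp add: f_def)
   qed
   \<comment> \<open>The values up to \<open>n'\<close> record the common pattern, whose size is
     bounded by the promises of a single condition; from \<open>n'\<close> on the width suffices for
     the promises of all of them together.\<close>
   define S where "S = s i @ map (%n. set_encode (V l0 n)) [length (s i)..<n']"
   have lS: "length S = n'" using ln' by (simp add: S_def)
   have Sn: "S ! n = set_encode (V l0 n)" if "length (s i) \<le> n" "n < n'" for n
   proof -
    have "[length (s i)..<n'] ! (n - length (s i)) = n" using that by (subst nth_upt) auto
    then show ?thesis using that by (simp add: S_def nth_append)
   qed
   define H where "H = (\<Union>l\<in>T2. fs (pl l) i)"
   have T21: "T2 \<subseteq> T1" using T2(1) by blast
   have vl2: "valid (pl l)" "i \<in> dom (pl l)" "st (pl l) i = s i" if "l \<in> T2" for l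
    using vl that T21 by blast+
   have H: "finite H" "H \<subseteq> idx i" unfolding H_def using T2(3) validD(3,4)[OF vl2(1,2)] by blast+
   have "card H \<le> (\<Sum>l\<in>T2. card (fs (pl l) i))" unfolding H_def by (rule card_UN_le[OF T2(3)])
   also have "\<dots> \<le> (\<Sum>l\<in>T2. w (length (s i)))"
    by (rule sum_mono) (use validD(5)[OF vl2(1,2) gi(2)] vl2(3) in metis)
   also have "\<dots> = M * w (length (s i))" using T2(2) by simp
   finally have cH: "card H \<le> w (length S)" using wn' lS by simp
   have s: "st (pl l) j = st (pl l') j" "j \<notin> underS r i ==> j ~= i ==> L j ==> fs (pl l) j = fs (pl l') j"
    if "l \<in> T2" "l' \<in> T2" "j \<in> dom (pl l)" "j \<in> dom (pl l')" for l l' j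
    using 2(4)[rule_format, of l l' j] that T21 T1(1) i(2) by blast+
   \<comment> \<open>Beyond \<open>i\<close> the survivors agree on stems and on the promises of
     slaloms and are simply joined.\<close>
   define pj where "pj l = pl l |` (- insert i (underS r i))" for l
   have pj: "pj l j = pl l j \<and> j \<in> dom (pl l) \<and> j \<notin> underS r i \<and> j ~= i" if "j \<in> dom (pj l)" for l j
    using that unfolding pj_def by auto
   have spj: "st (pj l) j = st (pj l') j" "L j ==> fs (pj l) j = fs (pj l') j"
    if h: "l \<in> T2" "l' \<in> T2" "j \<in> dom (pj l)" "j \<in> dom (pj l')" for l l' j
    using s[OF h(1,2), of j] pj[OF h(3)] pj[OF h(4)] by metis+
   let ?J = "join T2 pj"
   have vJ: "valid ?J"
   proof (rule valid_join_eq[OF T2(3)])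
    show "valid (pj l)" if "l \<in> T2" for l unfolding pj_def using valid_restrict vl2(1)[OF that] .
   qed (use spj in blast)+
   let ?q = "upd i q0 (S, H) ?J"
   have "valid ?q" by (rule valid_at[OF q0(1,2) vJ gi(1)]) (use H cH in simp_all)
   moreover have "le ?q (pl l)" if l: "l \<in> T2" for l
   proof (rule le_at[of i])
    have lT: "l \<in> T1" using l T21 by blast
    have q0l: "le q0 (?pr l)" using le_trans[OF q2(2)[OF lT] q0(3)] .
    then show "le (restr i ?q) (restr i (pl l))" by (simp add: restr_at[OF q0(2)])
    have J: "j \<in> dom ?J \<and> fs (pl l) j \<subseteq> fs ?J j \<and> st ?J j = st (pl l) j"
     if j: "j \<in> dom (pl l)" "j \<notin> underS r i" "j ~= i" for j
    proof -
     have jd: "j \<in> dom (pj l)" "pj l j = pl l j" using j unfolding pj_def by auto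
     have "le ?J (pj l)" by (rule le_join[OF _ l]) (rule spj(1))
     then have "j \<in> dom ?J" "fs (pl l) j \<subseteq> fs ?J j" using leD(1)[of ?J "pj l"] leD(2)[of ?J "pj l" j] jd by auto
     moreover have "st ?J j = st (pj l) j" by (rule st_join[where T = T2 and pl = pj, OF _ l jd(1)]) (rule spj(1))
     ultimately show ?thesis using jd(2) by simp
    qed
    show "dom (pl l) \<subseteq> dom ?q"
     using leD(1)[OF q0l] J by (auto simp: dom_at[OF q0(2)] simp del: not_None_eq)
    show "fs (pl l) j \<subseteq> fs ?q j" if "j \<in> dom (pl l)" "j \<notin> underS r i" for j
     using J[OF that] that l by (cases "j = i") (auto simp: upd_def H_def)
    show "st ?q j = st (pl l) j" if "j \<in> dom (pl l)" "j \<notin> underS r i" "j ~= i" for j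
     using J[OF that] that by (simp add: upd_def)
    show "take (length (st (pl l) i)) (st ?q i) = st (pl l) i"
     using vl2(3)[OF l] by (simp add: upd_def S_def)
    show "\<exists>m. \<exists>a\<in>X i \<eta> n m. le (restr i ?q) a \<and> acc i n (st ?q i ! n) m"
     if h: "length (st (pl l) i) \<le> n" "n < length (st ?q i)" "\<eta> \<in> fs (pl l) i" for n \<eta>
    proof -
     have n: "length (s i) \<le> n" "n < n'" using h(1,2) vl2(3)[OF l] lS by (simp_all add: upd_def)
     have "(\<eta>, n) \<in> ?H" using h(3) n(2) lT by blast
     then obtain a where a: "a \<in> X i \<eta> n (v (\<eta>, n))" "le q0 a" using v by force
     have fin: "finite (fs (pl l) i)" using validD(3)[OF vl2(1)[OF l] vl2(2)[OF l]] .
     have "card (V l n) \<le> card (fs (pl l) i)" unfolding V_def by (rule card_image_le[OF fin])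
     also have "\<dots> \<le> w (length (s i))" using validD(5)[OF vl2(1)[OF l] vl2(2)[OF l] gi(2)] vl2(3)[OF l] by simp
     also have "\<dots> \<le> w n" using monoD[OF w_mono n(1)] .
     finally have "card (V l n) \<le> w n" .
     moreover have "v (\<eta>, n) \<in> V l n" "finite (V l n)" unfolding V_def using h(3) fin by auto
     ultimately have "acc i n (S ! n) (v (\<eta>, n))"
      unfolding acc_def Sn[OF n] using gi(2) Veq[OF l n] by simp
     then show ?thesis using a by (auto simp: restr_at[OF q0(2)]) (auto simp: upd_def)
    qed
   qed
   ultimately show ?case using T2(2) T21 T1(1) by blast
  qed
 qed
qed

text \<open>On the finite root there are countably many stems and, where \<open>idx i\<close> is
  smaller than \<open>\<theta>\<close>, fewer than \<open>\<theta>\<close> finite sets of promises,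
  so these can be made constant; at other coordinates only the stem can.\<close>

lemma unif:
 assumes \<theta>: "regular_card \<theta>" and big: "regular_card.large \<theta> \<Xi>" and p: "!!\<xi>. \<xi> \<in> \<Xi> ==> valid (p \<xi>)"
  and lab: "countable (lab ` \<Xi>)"
 obtains \<Xi>' R g k where "\<Xi>' \<subseteq> \<Xi>" "regular_card.large \<theta> \<Xi>'" "finite R"
  "!!\<xi>. \<xi> \<in> \<Xi>' ==> lab \<xi> = k \<and> R \<subseteq> dom (p \<xi>)"
  "!!\<xi> i. \<xi> \<in> \<Xi>' ==> i \<in> R ==> st (p \<xi>) i = fst (g i) \<and> ( |idx i| <o \<theta> --> fs (p \<xi>) i = snd (g i))"
  "!!\<xi> \<zeta>. \<xi> \<in> \<Xi>' ==> \<zeta> \<in> \<Xi>' ==> \<xi> ~= \<zeta> ==> dom (p \<xi>) \<inter> dom (p \<zeta>) = R"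
proof -
 interpret regular_card \<theta> by (rule \<theta>)
 obtain k where k: "large {\<xi> \<in> \<Xi>. lab \<xi> = k}" using pigeonhole[OF big countable_less[OF lab]] by blast
 obtain \<Xi>1 R where X1: "\<Xi>1 \<subseteq> {\<xi> \<in> \<Xi>. lab \<xi> = k}" "large \<Xi>1" "finite R" "!!\<xi>. \<xi> \<in> \<Xi>1 ==> R \<subseteq> dom (p \<xi>)"
  "!!\<xi> \<zeta>. \<xi> \<in> \<Xi>1 ==> \<zeta> \<in> \<Xi>1 ==> \<xi> ~= \<zeta> ==> dom (p \<xi>) \<inter> dom (p \<zeta>) = R"
  using Delta_system[OF k, of "%\<xi>. dom (p \<xi>)"] validD(1)[OF p] by (metis (no_types, lifting) mem_Collect_eq)
 define f where "f i \<xi> = (st (p \<xi>) i, if |idx i| <o \<theta> then fs (p \<xi>) i else {})" for i \<xi>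
 have "|f i ` \<Xi>1| <o \<theta>" if i: "i \<in> R" for i
 proof -
  let ?F = "if |idx i| <o \<theta> then Fpow (idx i) else {{}}"
  have "|UNIV \<times> ?F :: (nat list \<times> 'u set) set| <o \<theta>"
   by (rule prod_less) (auto intro: countable_less Fpow_less finite_less)
  moreover have "f i ` \<Xi>1 \<subseteq> UNIV \<times> ?F"
  proof
   fix x assume "x \<in> f i ` \<Xi>1"
   then obtain \<xi> where \<xi>: "\<xi> \<in> \<Xi>1" "x = f i \<xi>" by blast
   then have "valid (p \<xi>)" "i \<in> dom (p \<xi>)" using p X1(1,4) i by blast+
   then show "x \<in> UNIV \<times> ?F" using validD(3,4) \<xi>(2) by (auto simp: f_def Fpow_def)
  qed
  ultimately show ?thesis by (rule sub_less)
 qed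
 then obtain \<Xi>2 g where X2: "\<Xi>2 \<subseteq> \<Xi>1" "large \<Xi>2" "\<forall>i\<in>R. \<forall>\<xi>\<in>\<Xi>2. f i \<xi> = g i"
  using uniformize[OF X1(3,2)] by metis
 show ?thesis
 proof (rule that[of \<Xi>2 R k g])
  show "\<Xi>2 \<subseteq> \<Xi>" using X2(1) X1(1) by blast
  show "large \<Xi>2" "finite R" by fact+
  show "lab \<xi> = k \<and> R \<subseteq> dom (p \<xi>)" if "\<xi> \<in> \<Xi>2" for \<xi> using that X1(1,4) X2(1) by blast
  show "st (p \<xi>) i = fst (g i) \<and> ( |idx i| <o \<theta> --> fs (p \<xi>) i = snd (g i))" if "\<xi> \<in> \<Xi>2" "i \<in> R" for \<xi> i
  proof -
   have "f i \<xi> = g i" using X2(3) that by blast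
   then show ?thesis unfolding f_def by (metis fst_conv snd_conv)
  qed
  show "dom (p \<xi>) \<inter> dom (p \<zeta>) = R" if "\<xi> \<in> \<Xi>2" "\<zeta> \<in> \<Xi>2" "\<xi> ~= \<zeta>" for \<xi> \<zeta> using X1(5) X2(1) that by blast
 qed
qed

text \<open>Adding the Cohen coordinate beforehand lets its stem length be fixed together with the
  label. As \<open>ch\<close> is injective, it hits the finite root only finitely often; after
  discarding these indices, the Cohen coordinate of a condition lies outside the supports of the
  others.\<close>

lemma prep:
 assumes \<theta>: "regular_card \<theta>" and big: "regular_card.large \<theta> \<Xi>" and p: "!!\<xi>. \<xi> \<in> \<Xi> ==> valid (p \<xi>)"
  and ch: "inj_on ch \<Xi>" "!!\<xi>. \<xi> \<in> \<Xi> ==> good (ch \<xi>) \<and> idx (ch \<xi>) = {}"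
 obtains \<Xi>' R g p1 k n0 where "\<Xi>' \<subseteq> \<Xi>" "infinite \<Xi>'" "finite R"
  "!!\<xi>. \<xi> \<in> \<Xi>' ==> valid (p1 \<xi>) \<and> le (p1 \<xi>) (p \<xi>) \<and> ch \<xi> \<in> dom (p1 \<xi>) \<and> ch \<xi> \<notin> R \<and> R \<subseteq> dom (p1 \<xi>) \<and>
   (lab \<xi> :: nat) = k \<and> length (st (p1 \<xi>) (ch \<xi>)) = n0"
  "!!\<xi> i. \<xi> \<in> \<Xi>' ==> i \<in> R ==> st (p1 \<xi>) i = fst (g i) \<and> ( |idx i| <o \<theta> --> fs (p1 \<xi>) i = snd (g i))"
  "!!\<xi> \<zeta>. \<xi> \<in> \<Xi>' ==> \<zeta> \<in> \<Xi>' ==> \<xi> ~= \<zeta> ==> dom (p1 \<xi>) \<inter> dom (p1 \<zeta>) = R"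
proof -
 interpret regular_card \<theta> by (rule \<theta>)
 define p1 where "p1 \<xi> = (if ch \<xi> \<in> dom (p \<xi>) then p \<xi> else (p \<xi>)(ch \<xi> \<mapsto> ([], {})))" for \<xi>
 have p1: "valid (p1 \<xi>)" "le (p1 \<xi>) (p \<xi>)" "ch \<xi> \<in> dom (p1 \<xi>)" if "\<xi> \<in> \<Xi>" for \<xi>
  using p[OF that] ch(2)[OF that] add_coord[of "p \<xi>" "ch \<xi>" "[]"] le_refl by (simp_all add: p1_def del: not_None_eq)
 let ?lab = "%\<xi>. (lab \<xi>, length (st (p1 \<xi>) (ch \<xi>)))"
 obtain \<Xi>1 R g k where X1: "\<Xi>1 \<subseteq> \<Xi>" "large \<Xi>1" "finite R"
  "!!\<xi>. \<xi> \<in> \<Xi>1 ==> ?lab \<xi> = k \<and> R \<subseteq> dom (p1 \<xi>)"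
  "!!\<xi> i. \<xi> \<in> \<Xi>1 ==> i \<in> R ==> st (p1 \<xi>) i = fst (g i) \<and> ( |idx i| <o \<theta> --> fs (p1 \<xi>) i = snd (g i))"
  "!!\<xi> \<zeta>. \<xi> \<in> \<Xi>1 ==> \<zeta> \<in> \<Xi>1 ==> \<xi> ~= \<zeta> ==> dom (p1 \<xi>) \<inter> dom (p1 \<zeta>) = R"
  by (rule unif[OF \<theta> big p1(1), where lab = ?lab]) (assumption | rule that countableI_type)+
 have "inj_on ch \<Xi>1" using ch(1) X1(1) inj_on_subset by blast
 then have "finite {\<xi> \<in> \<Xi>1. ch \<xi> \<in> R}"
  using finite_imageD[of ch "{\<xi> \<in> \<Xi>1. ch \<xi> \<in> R}"] X1(3)
  by (metis (mono_tags, lifting) finite_subset image_subsetI inj_on_subset mem_Collect_eq subsetI)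
 then have "infinite (\<Xi>1 - {\<xi> \<in> \<Xi>1. ch \<xi> \<in> R})" using large_infinite[OF X1(2)] by simp
 then have infX: "infinite (\<Xi>1 - {\<xi> \<in> \<Xi>1. ch \<xi> \<in> R})" (is "infinite ?X") .
 have lk: "lab \<xi> = fst k" "length (st (p1 \<xi>) (ch \<xi>)) = snd k" "R \<subseteq> dom (p1 \<xi>)" if "\<xi> \<in> \<Xi>1" for \<xi>
  using X1(4)[OF that] by auto
 show ?thesis
 proof (rule that[of ?X R p1 "fst k" "snd k" g])
  show "?X \<subseteq> \<Xi>" using X1(1) by blast
  show "valid (p1 \<xi>) \<and> le (p1 \<xi>) (p \<xi>) \<and> ch \<xi> \<in> dom (p1 \<xi>) \<and> ch \<xi> \<notin> R \<and> R \<subseteq> dom (p1 \<xi>) \<and>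
   lab \<xi> = fst k \<and> length (st (p1 \<xi>) (ch \<xi>)) = snd k" if "\<xi> \<in> ?X" for \<xi>
  proof -
   have "\<xi> \<in> \<Xi>1" "\<xi> \<in> \<Xi>" "ch \<xi> \<notin> R" using that X1(1) by blast+
   then show ?thesis using p1 lk by blast
  qed
  show "st (p1 \<xi>) i = fst (g i) \<and> ( |idx i| <o \<theta> --> fs (p1 \<xi>) i = snd (g i))" if "\<xi> \<in> ?X" "i \<in> R" for \<xi> i
   using X1(5) that by blast
  show "dom (p1 \<xi>) \<inter> dom (p1 \<zeta>) = R" if "\<xi> \<in> ?X" "\<zeta> \<in> ?X" "\<xi> ~= \<zeta>" for \<xi> \<zeta>
   using X1(6) that by blast
 qed (fact infX X1(3))+
qed

text \<open>\<open>lossy\<close> says whether slaloms with index sets of size at least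
  \<open>\<theta>\<close> may lie on the root. Their promises cannot be made constant, and then just
  \<open>M\<close> out of \<open>N\<close> conditions are amalgamated; otherwise none is lost. The
  label carries whatever was decided for an index as one number.\<close>

lemma upper_bound:
 assumes \<theta>: "regular_card \<theta>" and big: "regular_card.large \<theta> \<Xi>" and p: "!!\<xi>. \<xi> \<in> \<Xi> ==> valid (p \<xi>)"
  and ch: "inj_on ch \<Xi>" "!!\<xi>. \<xi> \<in> \<Xi> ==> good (ch \<xi>) \<and> idx (ch \<xi>) = {}"
  and sml: "!!i. good i ==> L i ==> |idx i| <o \<theta> \<or> lossy \<and> (\<forall>\<eta> n m. X i \<eta> n m ~= {} --> m \<le> bd n)"
 shows "\<exists>n0 k. \<forall>n\<ge>n0. \<forall>M. \<exists>N. (\<not> lossy --> N = M) \<and> (\<forall>v :: nat => nat. \<exists>\<xi>. inj_on \<xi> {..<N} \<and>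
  (\<exists>T\<subseteq>{..<N}. card T = M \<and> (\<exists>q. valid q \<and> (\<forall>l\<in>T. \<xi> l \<in> \<Xi> \<and> (lab (\<xi> l) :: nat) = k \<and> le q (p (\<xi> l)) \<and>
    ch (\<xi> l) \<in> dom q \<and> n < length (st q (ch (\<xi> l))) \<and> st q (ch (\<xi> l)) ! n = v l))))"
proof -
 obtain \<Xi>' R g p1 k n0 where X: "\<Xi>' \<subseteq> \<Xi>" "infinite \<Xi>'" "finite R"
  and p1: "!!\<xi>. \<xi> \<in> \<Xi>' ==> valid (p1 \<xi>) \<and> le (p1 \<xi>) (p \<xi>) \<and> ch \<xi> \<in> dom (p1 \<xi>) \<and> ch \<xi> \<notin> R \<and> R \<subseteq> dom (p1 \<xi>) \<and>
   lab \<xi> = k \<and> length (st (p1 \<xi>) (ch \<xi>)) = n0"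
  and g: "!!\<xi> i. \<xi> \<in> \<Xi>' ==> i \<in> R ==> st (p1 \<xi>) i = fst (g i) \<and> ( |idx i| <o \<theta> --> fs (p1 \<xi>) i = snd (g i))"
  and R: "!!\<xi> \<zeta>. \<xi> \<in> \<Xi>' ==> \<zeta> \<in> \<Xi>' ==> \<xi> ~= \<zeta> ==> dom (p1 \<xi>) \<inter> dom (p1 \<zeta>) = R"
  by (rule prep[OF \<theta> big p ch, where lab = lab]) (assumption | rule that)+
 obtain \<xi>0 where \<xi>0: "\<xi>0 \<in> \<Xi>'" using X(2) by fastforce
 define B where "B = {i \<in> R. L i \<and> \<not> |idx i| <o \<theta>}"
 have Rg: "good i" if "i \<in> R" for i using p1[OF \<xi>0] that validD(2) by blast
 have B: "finite B" "\<forall>i\<in>B. good i \<and> L i \<and> (\<forall>\<eta> n m. X i \<eta> n m ~= {} --> m \<le> bd n)"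
  using X(3) Rg sml unfolding B_def by auto blast
 have Bl: "\<not> lossy ==> B = {}" using Rg sml unfolding B_def by auto
 show ?thesis
 proof (rule exI[of _ n0], rule exI[of _ k], intro allI impI)
  fix n M assume n: "n0 \<le> n"
  obtain N where N: "B = {} --> N = M" "\<forall>(T :: nat set) pl. finite T --> N \<le> card T --> (\<forall>l\<in>T. valid (pl l)) -->
   (\<forall>l\<in>T. \<forall>l'\<in>T. \<forall>j\<in>dom (pl l) \<inter> dom (pl l'). st (pl l) j = st (pl l') j \<and>
    (L j --> j \<in> B \<or> fs (pl l) j = fs (pl l') j)) -->
   (\<forall>i\<in>B. \<forall>l\<in>T. i \<in> dom (pl l) \<and> st (pl l) i = fst (g i)) -->
   (\<exists>T'\<subseteq>T. card T' = M \<and> (\<exists>q. valid q \<and> (\<forall>l\<in>T'. le q (pl l))))"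
   using amalg[OF B, of M "%i. fst (g i)"] by (elim exE conjE)
  show "\<exists>N. (\<not> lossy --> N = M) \<and> (\<forall>v :: nat => nat. \<exists>\<xi>. inj_on \<xi> {..<N} \<and>
  (\<exists>T\<subseteq>{..<N}. card T = M \<and> (\<exists>q. valid q \<and> (\<forall>l\<in>T. \<xi> l \<in> \<Xi> \<and> lab (\<xi> l) = k \<and> le q (p (\<xi> l)) \<and>
    ch (\<xi> l) \<in> dom q \<and> n < length (st q (ch (\<xi> l))) \<and> st q (ch (\<xi> l)) ! n = v l))))"
  proof (intro exI[of _ N] conjI allI impI)
   show "\<not> lossy ==> N = M" using N(1) Bl by blast
   fix v :: "nat => nat"
   obtain \<xi> :: "nat => _" where \<xi>: "inj \<xi>" "range \<xi> \<subseteq> \<Xi>'" using infinite_countable_subset[OF X(2)] by blast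
   have xi: "\<xi> l \<in> \<Xi>'" for l using \<xi>(2) by blast
   define c where "c l = ch (\<xi> l)" for l
   \<comment> \<open>The stem is padded with zeros up to place \<open>n\<close>, which takes the
     prescribed value.\<close>
   define s where "s l = st (p1 (\<xi> l)) (c l) @ (replicate (n - n0) 0 @ [v l])" for l
   define pl where "pl l = (p1 (\<xi> l))(c l \<mapsto> (s l, {}))" for l
   have cl: "c l \<in> dom (p1 (\<xi> l))" "idx (c l) = {}" "c l \<notin> R" "valid (p1 (\<xi> l))" for l
    using p1[OF xi] ch(2) X(1) xi unfolding c_def by blast+
   have vpl: "valid (pl l)" "le (pl l) (p1 (\<xi> l))" for l
    unfolding pl_def s_def by (rule extend_cohen[OF cl(4,1,2)])+
   have dpl: "dom (pl l) = dom (p1 (\<xi> l))" for l unfolding pl_def using cl(1)[of l] by auto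
   have sl: "length (s l) = Suc n" "s l ! n = v l" for l
    using p1[OF xi[of l]] n unfolding s_def c_def by (simp_all add: nth_append)
   have inR: "st (pl l) j = fst (g j) \<and> ( |idx j| <o \<theta> --> fs (pl l) j = snd (g j))" if "j \<in> R" for j l
   proof -
    have "j ~= c l" using cl(3) that by blast
    then show ?thesis using g[OF xi that, of l] unfolding pl_def by simp
   qed
   have agree: "st (pl l) j = st (pl l') j \<and> (L j --> j \<in> B \<or> fs (pl l) j = fs (pl l') j)"
    if "j \<in> dom (pl l)" "j \<in> dom (pl l')" for l l' j
   proof (cases "l = l'")
    case False
    then have "\<xi> l ~= \<xi> l'" using \<xi>(1) by (auto dest: injD)
    then have "j \<in> R" using R[OF xi[of l] xi[of l']] that dpl by blast
    then show ?thesis using inR[of j l] inR[of j l'] unfolding B_def by auto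
   qed simp
   have "\<exists>T'\<subseteq>{..<N}. card T' = M \<and> (\<exists>q. valid q \<and> (\<forall>l\<in>T'. le q (pl l)))"
   proof (rule N(2)[THEN spec[of _ "{..<N}"], THEN spec[of _ pl], THEN mp, THEN mp, THEN mp, THEN mp, THEN mp])
    show "finite {..<N}" "N \<le> card {..<N}" by simp_all
    show "\<forall>l\<in>{..<N}. valid (pl l)" using vpl by blast
    show "\<forall>l\<in>{..<N}. \<forall>l'\<in>{..<N}. \<forall>j\<in>dom (pl l) \<inter> dom (pl l'). st (pl l) j = st (pl l') j \<and>
     (L j --> j \<in> B \<or> fs (pl l) j = fs (pl l') j)" using agree by blast
    show "\<forall>i\<in>B. \<forall>l\<in>{..<N}. i \<in> dom (pl l) \<and> st (pl l) i = fst (g i)"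
     using inR dpl p1[OF xi] unfolding B_def by blast
   qed
   then obtain T q where T: "T \<subseteq> {..<N}" "card T = M" "valid q" "!!l. l \<in> T ==> le q (pl l)" by blast
   have "\<xi> l \<in> \<Xi> \<and> lab (\<xi> l) = k \<and> le q (p (\<xi> l)) \<and>
    ch (\<xi> l) \<in> dom q \<and> n < length (st q (ch (\<xi> l))) \<and> st q (ch (\<xi> l)) ! n = v l" if l: "l \<in> T" for l
   proof -
    have 1: "le (p1 (\<xi> l)) (p (\<xi> l))" "lab (\<xi> l) = k" using p1[OF xi] by blast+
    have 2: "c l \<in> dom (pl l)" "st (pl l) (c l) = s l" unfolding pl_def by auto
    have "le q (p (\<xi> l))" using le_trans[OF le_trans[OF 1(1) vpl(2)] T(4)[OF l]] .
    moreover have "c l \<in> dom q" using leD(1)[OF T(4)[OF l]] 2(1) by blast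
    moreover have "n < length (st q (c l))" "st q (c l) ! n = v l"
     using le_length[OF T(4)[OF l] 2(1)] le_nth[OF T(4)[OF l] 2(1), of n] 2(2) sl[of l] by simp_all
    ultimately show ?thesis using 1(2) xi X(1) unfolding c_def by blast
   qed
   then show "\<exists>\<xi>. inj_on \<xi> {..<N} \<and>
  (\<exists>T\<subseteq>{..<N}. card T = M \<and> (\<exists>q. valid q \<and> (\<forall>l\<in>T. \<xi> l \<in> \<Xi> \<and> lab (\<xi> l) = k \<and> le q (p (\<xi> l)) \<and>
    ch (\<xi> l) \<in> dom q \<and> n < length (st q (ch (\<xi> l))) \<and> st q (ch (\<xi> l)) ! n = v l)))"
    using T(1,2,3) \<xi>(1) by (intro exI[of _ \<xi>] conjI exI[of _ T] exI[of _ q]) (auto intro: inj_on_subset)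
  qed
 qed
qed

text \<open>The value is decided instead of prescribed: some \<open>q\<close> below the common root
  decides \<open>v\<close>, and as its support is finite, some condition of the family meets it on
  the root only. The Cohen real of that one can still be made larger than \<open>v\<close>.\<close>

lemma upper_bound_decide:
 assumes \<theta>: "regular_card \<theta>" and big: "regular_card.large \<theta> \<Xi>" and p: "!!\<xi>. \<xi> \<in> \<Xi> ==> valid (p \<xi>)"
  and ch: "inj_on ch \<Xi>" "!!\<xi>. \<xi> \<in> \<Xi> ==> good (ch \<xi>) \<and> idx (ch \<xi>) = {}"
  and sml: "!!i. good i ==> |idx i| <o \<theta>"
  and Q: "!!n q. valid q ==> \<exists>q' v. valid q' \<and> le q' q \<and> Q n q' v"
   "!!n q q' v. Q n q v ==> valid q' ==> le q' q ==> Q n q' v"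
 shows "\<exists>n0 k. \<forall>n\<ge>n0. \<exists>\<xi>\<in>\<Xi>. \<exists>q v. (lab \<xi> :: nat) = k \<and> valid q \<and> le q (p \<xi>) \<and> Q n q v \<and>
  ch \<xi> \<in> dom q \<and> n < length (st q (ch \<xi>)) \<and> st q (ch \<xi>) ! n = Suc v"
proof -
 obtain \<Xi>' R g p1 k n0 where X: "\<Xi>' \<subseteq> \<Xi>" "infinite \<Xi>'" "finite R"
  and p1: "!!\<xi>. \<xi> \<in> \<Xi>' ==> valid (p1 \<xi>) \<and> le (p1 \<xi>) (p \<xi>) \<and> ch \<xi> \<in> dom (p1 \<xi>) \<and> ch \<xi> \<notin> R \<and> R \<subseteq> dom (p1 \<xi>) \<and>
   lab \<xi> = k \<and> length (st (p1 \<xi>) (ch \<xi>)) = n0"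
  and g: "!!\<xi> i. \<xi> \<in> \<Xi>' ==> i \<in> R ==> st (p1 \<xi>) i = fst (g i) \<and> ( |idx i| <o \<theta> --> fs (p1 \<xi>) i = snd (g i))"
  and R: "!!\<xi> \<zeta>. \<xi> \<in> \<Xi>' ==> \<zeta> \<in> \<Xi>' ==> \<xi> ~= \<zeta> ==> dom (p1 \<xi>) \<inter> dom (p1 \<zeta>) = R"
  by (rule prep[OF \<theta> big p ch, where lab = lab]) (assumption | rule that)+
 obtain \<xi>0 where \<xi>0: "\<xi>0 \<in> \<Xi>'" using X(2) by fastforce
 have gR: "st (p1 \<xi>) i = fst (g i)" "fs (p1 \<xi>) i = snd (g i)" if "\<xi> \<in> \<Xi>'" "i \<in> R" for \<xi> i
  using g[OF that] sml validD(2)[of "p1 \<xi>" i] p1[OF that(1)] that(2) by blast+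
 show ?thesis
 proof (rule exI[of _ n0], rule exI[of _ k], intro allI impI)
  fix n assume n: "n0 \<le> n"
  let ?r0 = "p1 \<xi>0 |` R"
  obtain q v where q: "valid q" "le q ?r0" "Q n q v" using Q(1) valid_restrict p1[OF \<xi>0] by blast
  have "finite {\<xi> \<in> \<Xi>'. (dom (p1 \<xi>) - R) \<inter> dom q ~= {}}"
  proof -
   have "finite (\<Union>j\<in>dom q. {\<xi> \<in> \<Xi>'. j \<in> dom (p1 \<xi>) - R})"
   proof (rule finite_UN_I[OF validD(1)[OF q(1)]])
    fix j
    have "\<xi> = \<zeta>" if "\<xi> \<in> {\<xi> \<in> \<Xi>'. j \<in> dom (p1 \<xi>) - R}" "\<zeta> \<in> {\<xi> \<in> \<Xi>'. j \<in> dom (p1 \<xi>) - R}" for \<xi> \<zeta>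
     using R[of \<xi> \<zeta>] that by blast
    then show "finite {\<xi> \<in> \<Xi>'. j \<in> dom (p1 \<xi>) - R}" by (metis (no_types, lifting) finite.simps insertI1 subsetI finite_subset)
   qed
   then show ?thesis by (rule rev_finite_subset) blast
  qed
  then obtain \<xi> where \<xi>: "\<xi> \<in> \<Xi>'" "(dom (p1 \<xi>) - R) \<inter> dom q = {}"
   using X(2) by (metis (mono_tags, lifting) finite_subset mem_Collect_eq subsetI)
  let ?c = "ch \<xi>"
  have c: "?c \<in> dom (p1 \<xi>)" "?c \<notin> R" "length (st (p1 \<xi>) ?c) = n0" "valid (p1 \<xi>)" "R \<subseteq> dom (p1 \<xi>)" "le (p1 \<xi>) (p \<xi>)" "lab \<xi> = k"
   using p1[OF \<xi>(1)] by blast+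
  define q1 where "q1 = p1 \<xi> ++ q"
  have "R \<subseteq> dom ?r0" using p1[OF \<xi>0] by auto
  then have Rq: "R \<subseteq> dom q" using leD(1)[OF q(2)] by blast
  have q1q: "q1 j = q j" if "j \<in> dom q" for j using that unfolding q1_def by (auto simp: map_add_def)
  have q1p: "q1 j = p1 \<xi> j" if "j \<notin> dom q" for j using that unfolding q1_def by (auto simp: map_add_def split: option.splits)
  have d1: "dom q1 = dom (p1 \<xi>) \<union> dom q" unfolding q1_def by auto
  have v1: "valid q1"
  proof (rule validI)
   show "finite (dom q1)" using validD(1) q(1) c(4) d1 by auto
   show "good j \<and> finite (fs q1 j) \<and> fs q1 j \<subseteq> idx j \<and> (L j --> card (fs q1 j) \<le> w (length (st q1 j)))"
    if "j \<in> dom q1" for j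
    using that q1q[of j] q1p[of j] validD(2-5)[OF q(1), of j] validD(2-5)[OF c(4), of j] d1
    by (cases "j \<in> dom q") auto
  qed
  have 1: "le q1 q" by (rule le_same) (use q1q d1 in \<open>auto simp del: not_None_eq\<close>)
  \<comment> \<open>On the root the condition has the stems and promises of
    \<open>p1 \<xi>0\<close>, which \<open>q\<close> honours; off the root nothing has
    changed.\<close>
  have 2: "le q1 (p1 \<xi>)"
  proof (intro leI ballI allI impI)
   show "dom (p1 \<xi>) \<subseteq> dom q1" using d1 by blast
   fix j assume j: "j \<in> dom (p1 \<xi>)"
   have le0: "le q1 ?r0" using le_trans[OF q(2) 1] .
   have in0: "j \<in> dom ?r0 \<and> st ?r0 j = st (p1 \<xi>) j \<and> fs ?r0 j = fs (p1 \<xi>) j" if "j \<in> R"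
    using that gR[OF \<xi>0 that] gR[OF \<xi>(1) that] p1[OF \<xi>0] by auto
   have out: "q1 j = p1 \<xi> j" if "j \<notin> R" using q1p[of j] \<xi>(2) j that by blast
   show "fs (p1 \<xi>) j \<subseteq> fs q1 j \<and> take (length (st (p1 \<xi>) j)) (st q1 j) = st (p1 \<xi>) j"
    using leD(2,3)[OF le0, of j] in0 out by (cases "j \<in> R") auto
   fix m \<eta> assume "length (st (p1 \<xi>) j) \<le> m" "m < length (st q1 j)" "\<eta> \<in> fs (p1 \<xi>) j"
   then show "\<exists>m'. \<exists>a\<in>X j \<eta> m m'. le (restr j q1) a \<and> acc j m (st q1 j ! m) m'"
    using leD(4)[OF le0, of j m \<eta>] in0 out by (cases "j \<in> R") auto
  qed
  have "?c \<notin> dom q" using c(1,2) \<xi>(2) by blast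
  then have c1: "?c \<in> dom q1" "idx ?c = {}" "st q1 ?c = st (p1 \<xi>) ?c"
   using c(1) d1 ch(2) \<xi>(1) X(1) q1p[of ?c] by auto
  let ?t = "replicate (n - n0) 0 @ [Suc v]"
  let ?q2 = "q1(?c \<mapsto> (st q1 ?c @ ?t, {}))"
  note q2 = extend_cohen[OF v1 c1(1,2), of ?t]
  have "Q n ?q2 v" by (rule Q(2)[OF Q(2)[OF q(3) v1 1] q2])
  moreover have "le ?q2 (p \<xi>)" using le_trans[OF le_trans[OF c(6) 2] q2(2)] .
  moreover have "n < length (st ?q2 ?c)" "st ?q2 ?c ! n = Suc v"
   using c(3) n c1(3) by (simp_all add: nth_append)
  ultimately show "\<exists>\<xi>\<in>\<Xi>. \<exists>q v. lab \<xi> = k \<and> valid q \<and> le q (p \<xi>) \<and> Q n q v \<and>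
    ch \<xi> \<in> dom q \<and> n < length (st q (ch \<xi>)) \<and> st q (ch \<xi>) ! n = Suc v"
   using \<xi>(1) X(1) c(7) q2(1) by (intro bexI[of _ \<xi>] exI[of _ ?q2] exI[of _ v]) auto
 qed
qed

text \<open>Half of the width is left free, so that two conditions with the same stems can be joined
  although their promises differ.\<close>

definition roomy :: "'u cond => bool" where
 "roomy p \<longleftrightarrow> (\<forall>i\<in>dom p. L i --> 2 * card (fs p i) \<le> w (length (st p i)))"

text \<open>Induction on the top coordinate: lengthening its stem may enlarge the part below, which
  is made roomy afterwards without touching the top coordinate again.\<close>

lemma roomy_below:
 assumes "i \<in> Field r"
 shows "valid p ==> dom p \<subseteq> insert i (underS r i) ==>
  \<exists>q. valid q \<and> roomy q \<and> le q p \<and> dom q \<subseteq> insert i (underS r i)"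
proof -
 have wf: "wf (r - Id)" using WO unfolding well_order_on_def by blast
 show "valid p ==> dom p \<subseteq> insert i (underS r i) ==>
  \<exists>q. valid q \<and> roomy q \<and> le q p \<and> dom q \<subseteq> insert i (underS r i)"
  using wf assms
 proof (induction i arbitrary: p rule: wf_induct_rule)
  case (less i)
  have low: "\<exists>q. valid q \<and> roomy q \<and> le q q0 \<and> dom q \<subseteq> underS r i"
   if q0: "valid q0" "dom q0 \<subseteq> underS r i" for q0
  proof (cases "dom q0 = {}")
   case True
   then show ?thesis using q0 le_refl by (intro exI[of _ q0]) (auto simp: roomy_def)
  next
   case False
   have "dom q0 \<subseteq> Field r" using q0(2) underS_sub[of r i] by blast
   then obtain j where j: "j \<in> dom q0" "\<forall>k\<in>dom q0. k = j \<or> k \<in> underS r j"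
    using max_coord[OF validD(1)[OF q0(1)] False] by blast
   have ji: "j \<in> underS r i" using j q0(2) by blast
   then have "(j, i) \<in> r - Id" "j \<in> Field r" using underS_sub[of r i] by (auto simp: underS_def)
   then obtain q where "valid q" "roomy q" "le q q0" "dom q \<subseteq> insert j (underS r j)"
    using less.IH[of j q0] q0(1) j(2) by blast
   then show ?thesis using ji underS_trans[OF WO _ ji] by (intro exI[of _ q]) blast
  qed
  show ?case
  proof (cases "i \<in> dom p")
   case True
   obtain N where N: "2 * card (fs p i) \<le> w N" using w_unb by blast
   obtain p1 where p1: "valid p1" "le p1 p" "N \<le> length (st p1 i)" "fs p1 i = fs p i" "dom p1 \<subseteq> underS r i \<union> dom p"
    using extend_stem[OF less.prems(1) True] by blast
   have i1: "i \<in> dom p1" using leD(1)[OF p1(2)] True by blast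
   have d1: "dom p1 \<subseteq> insert i (underS r i)" using p1(5) less.prems(2) by blast
   obtain q where q: "valid q" "roomy q" "le q (restr i p1)" "dom q \<subseteq> underS r i"
    using low[OF valid_restr[OF p1(1)], of i] by auto
   let ?q = "upd i q (st p1 i, fs p1 i) p1"
   have "valid ?q"
    by (rule valid_at[OF q(1,4) p1(1) validD(2)[OF p1(1) i1]]) (use validD(3-5)[OF p1(1) i1] in simp_all)
   moreover have "le ?q p1" by (rule le_at_stem[OF q(4,3)]) simp_all
   then have "le ?q p" using le_trans[OF p1(2)] by blast
   moreover have dq: "dom ?q \<subseteq> insert i (underS r i)" using d1 q(4) by (auto simp: dom_at[OF q(4)])
   moreover have "roomy ?q" unfolding roomy_def
   proof (intro ballI impI)
    fix j assume j: "j \<in> dom ?q" "L j"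
    have w1: "2 * card (fs p1 i) \<le> w (length (st p1 i))"
     using N p1(3,4) monoD[OF w_mono p1(3)] by simp
    show "2 * card (fs ?q j) \<le> w (length (st ?q j))"
    proof (cases "j = i")
     case True then show ?thesis using w1 by (simp add: upd_def)
    next
     case False
     then have "j \<in> underS r i" using dq j(1) by blast
     moreover have "j \<in> dom q" using j(1) False calculation by (auto simp: dom_at[OF q(4)])
     ultimately show ?thesis using q(2) j(2) unfolding roomy_def by (simp add: upd_def)
    qed
   qed
   ultimately show ?thesis by blast
  next
   case False
   then have "dom p \<subseteq> underS r i" using less.prems(2) by blast
   then show ?thesis using low[OF less.prems(1)] by blast
  qed
 qed
qed

lemma roomy_dense: assumes "valid p" shows "\<exists>q. valid q \<and> roomy q \<and> le q p"
proof (cases "dom p = {}")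
 case True
 then show ?thesis using assms le_refl by (intro exI[of _ p]) (auto simp: roomy_def)
next
 case False
 have F: "dom p \<subseteq> Field r" using validD(2)[OF assms] good_iff by blast
 then obtain j where "j \<in> dom p" "\<forall>k\<in>dom p. k = j \<or> k \<in> underS r j"
  using max_coord[OF validD(1)[OF assms] False] by blast
 then show ?thesis using roomy_below[of j p] assms F by blast
qed

text \<open>A Delta-system at the first uncountable cardinal fixes the stems on the root for roomy
  conditions below the given ones; any two of these have a join.\<close>

lemma ccc_valid:
 assumes A: "!!p. p \<in> A ==> valid p"
  and anti: "!!p q s. p \<in> A ==> q \<in> A ==> valid s ==> le s p ==> le s q ==> p = q"
 shows "countable A"
proof (rule ccontr)
 assume unc: "uncountable A"
 let ?\<theta> = "cardSuc natLeq"
 have reg: "regular_card ?\<theta>"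
 proof
  show "Card_order ?\<theta>" by (rule cardSuc_Card_order[OF natLeq_Card_order])
  show "natLeq <o ?\<theta>" by (rule cardSuc_greater[OF natLeq_Card_order])
  show "regularCard ?\<theta>" by (rule regularCard_cardSuc[OF natLeq_Cinfinite])
 qed
 interpret regular_card ?\<theta> by (rule reg)
 have "large A" unfolding large_def
 proof
  assume "|A| <o ?\<theta>"
  have "\<not> natLeq <o |A|"
   using cardSuc_ordLess_ordLeq[OF natLeq_Card_order card_of_Card_order, of A] \<open>|A| <o ?\<theta>\<close>
    not_ordLess_ordLeq by blast
  then have "|A| \<le>o natLeq"
   using ordLess_or_ordLeq[OF natLeq_Well_order card_of_Well_order] by blast
  also have "natLeq =o |UNIV :: nat set|" using card_of_nat ordIso_symmetric by blast
  finally obtain f :: "_ => nat" where "inj_on f A" using card_of_ordLeq[of A "UNIV :: nat set"] by blast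
  then show False using unc unfolding countable_def by blast
 qed
 have "\<forall>p\<in>A. \<exists>q. valid q \<and> roomy q \<and> le q p" using roomy_dense A by blast
 then obtain f where f: "\<forall>p\<in>A. valid (f p) \<and> roomy (f p) \<and> le (f p) p" by (rule bchoice[THEN exE])
 have vf: "valid (f p)" if "p \<in> A" for p using f that by blast
 have cl: "countable ((%_. 0 :: nat) ` A)" by simp
 obtain \<Xi> R g k where X0: "\<Xi> \<subseteq> A" "large \<Xi>" "finite R"
  "!!\<xi>. \<xi> \<in> \<Xi> ==> (0 :: nat) = k \<and> R \<subseteq> dom (f \<xi>)"
  "!!\<xi> i. \<xi> \<in> \<Xi> ==> i \<in> R ==> st (f \<xi>) i = fst (g i) \<and> ( |idx i| <o ?\<theta> --> fs (f \<xi>) i = snd (g i))"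
  "!!\<xi> \<zeta>. \<xi> \<in> \<Xi> ==> \<zeta> \<in> \<Xi> ==> \<xi> ~= \<zeta> ==> dom (f \<xi>) \<inter> dom (f \<zeta>) = R"
  by (rule unif[OF reg \<open>large A\<close> vf cl]) (assumption | rule that)+
 have X: "\<Xi> \<subseteq> A" "large \<Xi>" "!!\<xi> i. \<xi> \<in> \<Xi> ==> i \<in> R ==> st (f \<xi>) i = fst (g i)"
  "!!\<xi> \<zeta>. \<xi> \<in> \<Xi> ==> \<zeta> \<in> \<Xi> ==> \<xi> ~= \<zeta> ==> dom (f \<xi>) \<inter> dom (f \<zeta>) = R"
  using X0 by blast+
 obtain a b where ab: "a \<in> \<Xi>" "b \<in> \<Xi>" "a ~= b" using large_two[OF X(2)] .
 have fab: "valid (f x)" "roomy (f x)" "le (f x) x" if "x \<in> {a, b}" for x using that ab X(1) f by auto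
 have s: "st (f x) j = st (f y) j" if "x \<in> {a, b}" "y \<in> {a, b}" "j \<in> dom (f x)" "j \<in> dom (f y)" for x y j
 proof (cases "x = y")
  case False
  then have "j \<in> R" using X(4)[OF ab] that by blast
  then show ?thesis using X(3)[OF ab(1)] X(3)[OF ab(2)] that(1,2) by auto
 qed simp
 let ?q = "join {a, b} f"
 have "valid ?q"
 proof (rule valid_join[OF _ fab(1) s])
  fix x j assume x: "x \<in> {a, b}" "j \<in> dom (f x)" "L j"
  have c: "card (fs (f y) j) \<le> w (length (st (f x) j)) div 2" if "y \<in> {a, b}" "j \<in> dom (f y)" for y
   using fab(2)[OF that(1)] that(2) x(3) s[OF that(1) x(1) that(2) x(2)] unfolding roomy_def by fastforce
  have "card (\<Union>l\<in>{l \<in> {a, b}. j \<in> dom (f l)}. fs (f l) j) \<le> (\<Sum>l\<in>{l \<in> {a, b}. j \<in> dom (f l)}. card (fs (f l) j))"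
   by (rule card_UN_le) simp
  also have "\<dots> \<le> (\<Sum>l\<in>{l \<in> {a, b}. j \<in> dom (f l)}. w (length (st (f x) j)) div 2)"
   by (rule sum_mono) (use c in blast)
  also have "\<dots> \<le> (\<Sum>l\<in>{a, b}. w (length (st (f x) j)) div 2)" by (rule sum_mono2) auto
  also have "\<dots> \<le> w (length (st (f x) j))" using ab(3) by simp
  finally show "card (\<Union>l\<in>{l \<in> {a, b}. j \<in> dom (f l)}. fs (f l) j) \<le> w (length (st (f x) j))" .
 qed auto
 moreover have "le ?q (f x)" if "x \<in> {a, b}" for x by (rule le_join[OF s that])
 ultimately have "a = b"
  using anti[of a b ?q] ab X(1) le_trans[OF fab(3)] by blast
 then show False using ab(3) by blast
qed

end

section \<open>Cardinal arithmetic\<close>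

lemma init_seg:
 assumes "Card_order k" "|H| <o k"
 obtains b where "b \<in> Field k" "|underS k b| =o |H|"
proof -
 have WO: "Well_order k" using assms(1) unfolding card_order_on_def by blast
 obtain b where b: "b \<in> Field k" "|H| =o Restr k (underS k b)"
  using ordLess_iff_ordIso_Restr[OF WO card_of_Well_order, of H] assms(2) by blast
 have "Card_order (Restr k (underS k b))" using Card_order_ordIso2[OF card_of_Card_order b(2)] .
 then have "|Field (Restr k (underS k b))| =o Restr k (underS k b)" by (rule card_of_Field_ordIso)
 moreover have "Refl k" using WO unfolding well_order_on_def linear_order_on_def partial_order_on_def preorder_on_def by blast
 then have "Field (Restr k (underS k b)) = underS k b" using Refl_Field_Restr[of k "underS k b"] underS_sub[of k b] by blast
 ultimately have "|underS k b| =o |H|" using b(2) ordIso_symmetric ordIso_transitive by metis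
 then show ?thesis using that b(1) by blast
qed

locale pow_card =
 fixes \<Lambda> \<kappa> :: "'u rel"
 assumes L: "Card_order \<Lambda>" and k: "Card_order \<kappa>" "natLeq <o \<kappa>" "regularCard \<kappa>"
  and pow: "pow_less \<Lambda> \<kappa> =o \<Lambda>"
begin

definition leq :: "'x set => bool" where "leq A \<longleftrightarrow> |A| \<le>o \<Lambda>"

abbreviation "Sig \<equiv> SIGMA b : Field \<kappa>. Func (underS \<kappa> b) (Field \<Lambda>)"

lemma WOL: "Well_order \<Lambda>" and WOk: "Well_order \<kappa>" using L k(1) unfolding card_order_on_def by blast+

lemma leq_Field: "leq A \<longleftrightarrow> |A| \<le>o |Field \<Lambda>|"
 unfolding leq_def using card_of_Field_ordIso[OF L] ordIso_symmetric ordLeq_ordIso_trans by blast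

lemma leq_Sig: "leq Sig" using pow unfolding leq_def pow_less_def by (rule ordIso_imp_ordLeq)

lemma leq_sub: "leq A ==> B \<subseteq> A ==> leq B"
 unfolding leq_def using card_of_mono1 ordLeq_transitive by blast

lemma leq_image: "leq A ==> leq (f ` A)"
 unfolding leq_def using card_of_image ordLeq_transitive by blast

lemma leq_inj: "leq B ==> inj_on f A ==> f ` A \<subseteq> B ==> leq A"
 unfolding leq_def using card_of_ordLeq[of A B] ordLeq_transitive[of "|A|" "|B|" \<Lambda>] by blast

text \<open>The sequence of length zero exists even over the empty set, so \<open>pow_less\<close>
  is never empty.\<close>

lemma ne: "Field \<Lambda> ~= {}"
proof
 assume e: "Field \<Lambda> = {}"
 have infk: "infinite (Field \<kappa>)" by (rule inf_Field[OF k(1,2)])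
 then obtain x where "x \<in> Field \<kappa>" by fastforce
 moreover have "wf (\<kappa> - Id)" using WOk unfolding well_order_on_def by blast
 ultimately obtain b where b: "b \<in> Field \<kappa>" "!!y. (y, b) \<in> \<kappa> - Id ==> y \<notin> Field \<kappa>"
  by (metis wfE_min)
 have "underS \<kappa> b = {}" using b by (auto simp: underS_def Field_def)
 then have "(b, %_. undefined) \<in> Sig" using b(1) by (simp add: Func_def)
 then have "Sig ~= {}" by blast
 moreover have "|Sig| \<le>o |{} :: 'u set|" using leq_Sig e unfolding leq_Field by simp
 ultimately show False using card_of_empty3 by blast
qed

lemma leq_k: "leq (Field \<kappa>)"
proof -
 obtain l where l: "l \<in> Field \<Lambda>" using ne by blast
 let ?f = "%b. (b, %x. if x \<in> underS \<kappa> b then l else undefined)"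
 show ?thesis by (rule leq_inj[OF leq_Sig, of ?f]) (use l in \<open>auto simp: inj_on_def Func_def\<close>)
qed

lemma infL: "infinite (Field \<Lambda>)"
 using leq_k inf_Field[OF k(1,2)] card_of_ordLeq_infinite unfolding leq_Field by blast

lemma leq_UN: "leq I ==> (!!i. i \<in> I ==> leq (A i)) ==> leq (\<Union>i\<in>I. A i)"
 unfolding leq_def using card_of_UNION_ordLeq_infinite_Field[OF infL L] by blast

lemma leq_countable: assumes "countable A" shows "leq A"
proof -
 have "|A| \<le>o natLeq" by (rule countable_ordLeq_natLeq[OF assms])
 also have "natLeq \<le>o \<kappa>" using k(2) ordLess_imp_ordLeq by blast
 also have "\<kappa> \<le>o |Field \<kappa>|" using card_of_Field_ordIso[OF k(1)] ordIso_symmetric ordIso_imp_ordLeq by blast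
 also have "|Field \<kappa>| \<le>o \<Lambda>" using leq_k unfolding leq_def .
 finally show ?thesis unfolding leq_def .
qed

lemma leq_prod: assumes "leq A" "leq B" shows "leq (A \<times> B)"
proof -
 have "leq (\<Union>a\<in>A. Pair a ` B)" by (intro leq_UN leq_image assms)
 then show ?thesis by (rule leq_sub) blast
qed

lemma leq_FieldL: "leq (Field \<Lambda>)" unfolding leq_Field by (simp add: card_of_refl ordIso_imp_ordLeq)

lemma leq_Fpow: assumes "leq A" shows "leq (Fpow A)"
proof -
 have "leq {F. F \<subseteq> A \<and> finite F \<and> card F = n}" for n
 proof (induction n)
  case 0
  have "{F. F \<subseteq> A \<and> finite F \<and> card F = 0} = {{}}" by auto
  then show ?case by (simp add: leq_countable)
 next
  case (Suc n)
  have "leq (\<Union>a\<in>A. insert a ` {F. F \<subseteq> A \<and> finite F \<and> card F = n})"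
   by (intro leq_UN assms leq_image Suc)
  moreover have "{F. F \<subseteq> A \<and> finite F \<and> card F = Suc n} \<subseteq>
    (\<Union>a\<in>A. insert a ` {F. F \<subseteq> A \<and> finite F \<and> card F = n})"
  proof
   fix F assume F: "F \<in> {F. F \<subseteq> A \<and> finite F \<and> card F = Suc n}"
   then obtain a F' where "F = insert a F'" "a \<notin> F'" "card F' = n" by (auto simp: card_Suc_eq)
   then show "F \<in> (\<Union>a\<in>A. insert a ` {F. F \<subseteq> A \<and> finite F \<and> card F = n})" using F by auto
  qed
  ultimately show ?case by (rule leq_sub)
 qed
 then have "leq (\<Union>n::nat. {F. F \<subseteq> A \<and> finite F \<and> card F = n})"
  by (intro leq_UN leq_countable[of UNIV]) simp_all
 then show ?thesis by (rule leq_sub) (auto simp: Fpow_def)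
qed

lemma leq_Func: "b \<in> Field \<kappa> ==> leq (Func (underS \<kappa> b) (Field \<Lambda>))"
 by (rule leq_inj[OF leq_Sig, of "Pair b"]) (auto simp: inj_on_def)

text \<open>\<omega> is below \<open>\<kappa>\<close>, so sequences of length \<omega> are among
  those counted by \<open>pow_less\<close>.\<close>

lemma leq_seq: assumes "leq A" shows "leq {f :: nat => 'a. range f \<subseteq> A}"
proof -
 have "|UNIV :: nat set| <o \<kappa>" using card_of_nat k(2) ordIso_ordLess_trans by blast
 then obtain b where b: "b \<in> Field \<kappa>" "|underS \<kappa> b| =o |UNIV :: nat set|" by (rule init_seg[OF k(1)])
 obtain \<phi> where \<phi>: "bij_betw \<phi> (underS \<kappa> b) (UNIV :: nat set)" using b(2) card_of_ordIso by blast
 obtain h where h: "inj_on h A" "h ` A \<subseteq> Field \<Lambda>"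
  using assms unfolding leq_Field using card_of_ordLeq by metis
 let ?F = "%f x. if x \<in> underS \<kappa> b then h (f (\<phi> x)) else undefined"
 show ?thesis
 proof (rule leq_inj[OF leq_Func[OF b(1)], of ?F])
  show "inj_on ?F {f. range f \<subseteq> A}"
  proof (rule inj_onI, rule ext)
   fix f g n assume f: "f \<in> {f. range f \<subseteq> A}" "g \<in> {f. range f \<subseteq> A}" and e: "?F f = ?F g"
   have "n \<in> \<phi> ` underS \<kappa> b" using \<phi> unfolding bij_betw_def by simp
   then obtain x where x: "x \<in> underS \<kappa> b" "\<phi> x = n" by blast
   have "h (f n) = h (g n)" using fun_cong[OF e, of x] x by simp
   then show "f n = g n" using h(1) f unfolding inj_on_def by blast
  qed
  show "?F ` {f. range f \<subseteq> A} \<subseteq> Func (underS \<kappa> b) (Field \<Lambda>)"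
  proof (rule image_subsetI)
   fix f assume "f \<in> {f :: nat => 'a. range f \<subseteq> A}"
   then have "h (f n) \<in> Field \<Lambda>" for n using h(2) by blast
   then show "?F f \<in> Func (underS \<kappa> b) (Field \<Lambda>)" by (simp add: Func_def)
  qed
 qed
qed

lemma leq_countable_sets: assumes "leq A" shows "leq {B. B \<subseteq> A \<and> countable B}"
proof -
 have "leq (insert {} (range ` {f :: nat => 'a. range f \<subseteq> A}))"
 proof -
  have "leq ({{}} \<union> range ` {f :: nat => 'a. range f \<subseteq> A})"
  proof -
   have "leq (\<Union>b\<in>{True, False}. if b then {{}} else range ` {f :: nat => 'a. range f \<subseteq> A})"
    by (rule leq_UN) (auto intro: leq_countable leq_image leq_seq[OF assms])
   then show ?thesis by (rule leq_sub) auto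
  qed
  then show ?thesis by simp
 qed
 moreover have "{B. B \<subseteq> A \<and> countable B} \<subseteq> insert {} (range ` {f :: nat => 'a. range f \<subseteq> A})"
 proof
  fix B assume B: "B \<in> {B. B \<subseteq> A \<and> countable B}"
  show "B \<in> insert {} (range ` {f :: nat => 'a. range f \<subseteq> A})"
  proof (cases "B = {}")
   case False
   then have "range (from_nat_into B) = B" using B by (intro range_from_nat_into) auto
   then show ?thesis using B by (intro insertI2 image_eqI[of _ _ "from_nat_into B"]) auto
  qed simp
 qed
 ultimately show ?thesis by (rule leq_sub)
qed

lemma leq_surj: assumes "leq A" "A ~= {}" obtains f where "f ` Field \<Lambda> = A"
 using assms card_of_ordLeq2[of A "Field \<Lambda>"] unfolding leq_Field by blast

text \<open>Koenig's argument: a cofinal set of size less than \<open>\<kappa>\<close> would allow to diagonalize.\<close>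

lemma bounded:
 assumes K: "K \<subseteq> Field \<Lambda>" "|K| <o \<kappa>"
 shows "\<exists>\<beta>\<in>Field \<Lambda>. K \<subseteq> underS \<Lambda> \<beta>"
proof (rule ccontr)
 assume unb': "\<not> ?thesis"
 then have unb: "\<not> K \<subseteq> underS \<Lambda> \<beta>" if "\<beta> \<in> Field \<Lambda>" for \<beta> using that by blast
 obtain b where b: "b \<in> Field \<kappa>" "|underS \<kappa> b| =o |K|" by (rule init_seg[OF k(1) K(2)])
 obtain \<phi> where \<phi>: "bij_betw \<phi> (underS \<kappa> b) K" using b(2) card_of_ordIso by blast
 let ?S = "Func (underS \<kappa> b) (Field \<Lambda>)"
 have "?S ~= {}"
 proof -
  obtain l where "l \<in> Field \<Lambda>" using ne by blast
  then have "(%x. if x \<in> underS \<kappa> b then l else undefined) \<in> ?S" by (simp add: Func_def)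
  then show ?thesis by blast
 qed
 then obtain G where G: "G ` Field \<Lambda> = ?S" using leq_surj[OF leq_Func[OF b(1)]] by metis
 \<comment> \<open>Fewer than \<open>|\<Lambda>|\<close> of the enumerated functions come before
   \<open>\<phi> x\<close>, so their values at \<open>x\<close> do not exhaust
   \<open>\<Lambda>\<close>.\<close>
 have "\<exists>y\<in>Field \<Lambda>. \<forall>i\<in>underS \<Lambda> (\<phi> x). G i x ~= y" if x: "x \<in> underS \<kappa> b" for x
 proof (rule ccontr)
  assume n: "\<not> ?thesis"
  have "\<phi> x \<in> Field \<Lambda>" using \<phi> K(1) x unfolding bij_betw_def by blast
  then have "|underS \<Lambda> (\<phi> x)| <o \<Lambda>" by (rule card_of_underS[OF L])
  then have "|(%i. G i x) ` underS \<Lambda> (\<phi> x)| <o \<Lambda>" using card_of_image ordLeq_ordLess_trans by blast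
  moreover have "Field \<Lambda> \<subseteq> (%i. G i x) ` underS \<Lambda> (\<phi> x)"
  proof
   fix y assume "y \<in> Field \<Lambda>"
   then obtain i where "i \<in> underS \<Lambda> (\<phi> x)" "G i x = y" using n by blast
   then show "y \<in> (%i. G i x) ` underS \<Lambda> (\<phi> x)" by blast
  qed
  ultimately have "|Field \<Lambda>| <o \<Lambda>" using card_of_mono1 ordLeq_ordLess_trans by blast
  then have "\<Lambda> <o \<Lambda>" using card_of_Field_ordIso[OF L] ordIso_symmetric ordIso_ordLess_trans by blast
  then show False using ordLess_irreflexive by blast
 qed
 then obtain y where y: "!!x. x \<in> underS \<kappa> b ==> y x \<in> Field \<Lambda>"
  "!!x i. x \<in> underS \<kappa> b ==> i \<in> underS \<Lambda> (\<phi> x) ==> G i x ~= y x" by metis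
 define f where "f x = (if x \<in> underS \<kappa> b then y x else undefined)" for x
 have "f \<in> ?S" using y(1) by (simp add: f_def Func_def)
 then have "f \<in> G ` Field \<Lambda>" unfolding G .
 then obtain i where i: "i \<in> Field \<Lambda>" "G i = f" by blast
 \<comment> \<open>\<open>i'\<close> lies above the index of the diagonal function; an element of
   \<open>K\<close> not below \<open>i'\<close> gives a place where this function would have to
   avoid its own value.\<close>
 obtain i' where i': "i' \<in> Field \<Lambda>" "i ~= i'" "(i, i') \<in> \<Lambda>"
  using infinite_Card_order_limit[OF L infL i(1)] by blast
 then have ii': "i \<in> underS \<Lambda> i'" by (simp add: underS_def)
 obtain z where z: "z \<in> K" "z \<notin> underS \<Lambda> i'" using unb[OF i'(1)] by blast
 have "z \<in> Field \<Lambda>" using z(1) K(1) by blast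
 then have "z = i' \<or> i' \<in> underS \<Lambda> z" using underS_cases[OF WOL _ i'(1)] z(2) by blast
 then have iz: "i \<in> underS \<Lambda> z" using ii' underS_trans[OF WOL] by blast
 obtain x where x: "x \<in> underS \<kappa> b" "\<phi> x = z" using \<phi> z(1) unfolding bij_betw_def by blast
 have "G i x ~= f x" using y(2)[OF x(1), of i] iz x by (simp add: f_def)
 then show False using i(2) by simp
qed

end

section \<open>Enumeration of the codes and of the tasks at the coordinates\<close>

locale model = pow_card \<Lambda> \<kappa> for \<Lambda> \<kappa> :: "'u rel" +
 fixes \<mu> \<nu> :: "'u rel" and c :: "nat => nat" and a :: "nat => nat set"
 assumes mu: "Card_order \<mu>" "natLeq <o \<mu>" "regularCard \<mu>"
  and nu: "Card_order \<nu>" "natLeq <o \<nu>" "regularCard \<nu>"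
  and mu_nu: "\<mu> \<le>o \<nu>" and nu_k: "\<nu> \<le>o \<kappa>"
  and c2: "!!i. 2 \<le> c i" and c_lim: "filterlim c at_top sequentially"
begin

text \<open>The largest nondecreasing function below \<open>c\<close>; it tends to infinity with
  \<open>c\<close>.\<close>

definition w :: "nat => nat" where "w j = Inf (c ` {j..})"

text \<open>The code of a subset of \<open>a n\<close> is at most that of \<open>a n\<close>, so
  this bounds the reals that list the traces of a set on the blocks.\<close>

definition bd :: "nat => nat" where "bd n = set_encode (a n)"

lemma w_le: "w j \<le> c j" unfolding w_def by (rule cInf_lower) auto

lemma w_mono: "mono w" unfolding w_def by (rule monoI, rule cInf_superset_mono) auto

lemma w_unb: "\<exists>n. k \<le> w n"
proof -
 obtain N where "!!n. N \<le> n ==> k \<le> c n"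
  using c_lim unfolding filterlim_at_top eventually_sequentially by blast
 then have "k \<le> w N" unfolding w_def by (intro cInf_greatest) auto
 then show ?thesis by blast
qed

text \<open>A crude superset of the valid conditions: codes have to be enumerated before validity,
  which depends on them, makes sense.\<close>

definition Cset :: "'u cond set" where
 "Cset = {p. finite (dom p) \<and> dom p \<subseteq> Field \<Lambda> \<and> (\<forall>i\<in>dom p. finite (fs p i) \<and> fs p i \<subseteq> Field \<kappa>)}"

lemma leq_Cset: "leq Cset"
proof -
 let ?g = "%p :: 'u cond. (%i. (i, the (p i))) ` dom p"
 have "leq (Fpow (Field \<Lambda> \<times> (UNIV :: nat list set) \<times> Fpow (Field \<kappa>)))"
  by (intro leq_Fpow leq_prod leq_FieldL leq_k leq_countable) simp
 then show ?thesis
 proof (rule leq_inj[of _ ?g])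
  show "inj_on ?g Cset"
  proof (rule inj_onI, rule ext)
   fix p q :: "'u cond" and i assume e: "?g p = ?g q"
   have d: "fst ` ?g p = dom p" "fst ` ?g q = dom q" by force+
   then have dd: "dom p = dom q" using e by metis
   show "p i = q i"
   proof (cases "i \<in> dom p")
    case True
    then have "(i, the (p i)) \<in> ?g q" using e by blast
    then have "the (p i) = the (q i)" by blast
    then show ?thesis using True dd by (metis domD option.sel)
   next
    case False then show ?thesis using dd by (metis domIff)
   qed
  qed
  show "?g ` Cset \<subseteq> Fpow (Field \<Lambda> \<times> UNIV \<times> Fpow (Field \<kappa>))"
  proof
   fix T assume "T \<in> ?g ` Cset"
   then obtain p where p: "p \<in> Cset" "T = ?g p" by blast
   then have "finite T" unfolding Cset_def by blast
   moreover have "(i, the (p i)) \<in> Field \<Lambda> \<times> UNIV \<times> Fpow (Field \<kappa>)" if "i \<in> dom p" for i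
    using p(1) that unfolding Cset_def Fpow_def by (cases "the (p i)") (force simp: mem_Times_iff)
   ultimately show "T \<in> Fpow (Field \<Lambda> \<times> UNIV \<times> Fpow (Field \<kappa>))" unfolding Fpow_def p(2) by blast
  qed
 qed
qed

definition Codes :: "(nat => nat => 'u cond set) set" where
 "Codes = {x. \<forall>n m. x n m \<subseteq> Cset \<and> countable (x n m)}"

lemma leq_Codes: "leq Codes"
proof -
 let ?g = "%(x :: nat => nat => 'u cond set) j. x (fst (prod_decode j)) (snd (prod_decode j))"
 have "leq {f :: nat => _. range f \<subseteq> {B. B \<subseteq> Cset \<and> countable B}}"
  by (intro leq_seq leq_countable_sets leq_Cset)
 then show ?thesis
 proof (rule leq_inj[of _ ?g])
  show "inj_on ?g Codes"
  proof (rule inj_onI, intro ext)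
   fix x y n m assume "?g x = ?g y"
   from fun_cong[OF this, of "prod_encode (n, m)"] show "x n m = y n m" by simp
  qed
  show "?g ` Codes \<subseteq> {f. range f \<subseteq> {B. B \<subseteq> Cset \<and> countable B}}" unfolding Codes_def by auto
 qed
qed

definition dc :: "'u => nat => nat => 'u cond set" where "dc = (SOME f. f ` Field \<Lambda> = Codes)"

lemma dc: "dc ` Field \<Lambda> = Codes"
proof -
 have "(%n m. {}) \<in> Codes" unfolding Codes_def by simp
 then have "\<exists>f. f ` Field \<Lambda> = Codes" using leq_surj[OF leq_Codes] by blast
 then show ?thesis unfolding dc_def by (rule someI_ex)
qed

lemma Sig_ne: "Sig ~= {}"
proof -
 obtain b where "b \<in> Field \<kappa>" using inf_Field[OF k(1,2)] by fastforce
 moreover obtain l where "l \<in> Field \<Lambda>" using ne by blast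
 ultimately have "(b, %x. if x \<in> underS \<kappa> b then l else undefined) \<in> Sig" by (simp add: Func_def)
 then show ?thesis by blast
qed

text \<open>Each coordinate carries a task, namely the kind of real and a sequence of codes of
  length below \<open>\<kappa>\<close>. The first component repeats every task
  \<open>|\<Lambda>|\<close> many times.\<close>

definition h :: "'u => 'u \<times> bool \<times> 'u \<times> ('u => 'u)" where
 "h = (SOME f. bij_betw f (Field \<Lambda>) (Field \<Lambda> \<times> (UNIV :: bool set) \<times> Sig))"

lemma h: "bij_betw h (Field \<Lambda>) (Field \<Lambda> \<times> (UNIV :: bool set) \<times> Sig)"
proof -
 let ?B = "Field \<Lambda> \<times> (UNIV :: bool set) \<times> Sig"
 have "leq ?B" by (intro leq_prod leq_FieldL leq_Sig leq_countable) simp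
 then have 1: "|?B| \<le>o |Field \<Lambda>|" unfolding leq_Field .
 obtain s where "s \<in> Sig" using Sig_ne by blast
 then have "inj_on (%l. (l, True, s)) (Field \<Lambda>) \<and> (%l. (l, True, s)) ` Field \<Lambda> \<subseteq> ?B"
  by (auto simp: inj_on_def)
 then have "|Field \<Lambda>| \<le>o |?B|" using card_of_ordLeq[of "Field \<Lambda>" ?B] by blast
 then have "|Field \<Lambda>| =o |?B|" using 1 ordIso_iff_ordLeq by blast
 then have "\<exists>f. bij_betw f (Field \<Lambda>) ?B" using card_of_ordIso by blast
 then show ?thesis unfolding h_def by (rule someI_ex)
qed

definition isL :: "'u => bool" where "isL i = fst (snd (h i))"
definition idx :: "'u => 'u set" where "idx i = underS \<kappa> (fst (snd (snd (h i))))"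
definition X :: "'u => 'u => nat => nat => 'u cond set" where
 "X i \<eta> = (if \<eta> \<in> idx i then dc (snd (snd (snd (h i))) \<eta>) else (%n m. {}))"
text \<open>The two alternatives separate the invariants: the first makes the additivity at least
  \<open>\<mu>\<close>, the second handles the ideal up to \<open>\<nu>\<close> without capturing
  arbitrary reals.\<close>

definition pre :: "'u => bool" where
 "pre i \<longleftrightarrow> (isL i --> |idx i| <o \<mu> \<or> |idx i| <o \<nu> \<and> (\<forall>\<eta> n m. X i \<eta> n m ~= {} --> m \<le> bd n))"

lemma h_Field: "i \<in> Field \<Lambda> ==> h i \<in> Field \<Lambda> \<times> (UNIV :: bool set) \<times> Sig"
 using h unfolding bij_betw_def by blast

lemma idx_less: "i \<in> Field \<Lambda> ==> |idx i| <o \<kappa>"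
 using h_Field[of i] card_of_underS[OF k(1)] unfolding idx_def by auto

text \<open>The task occurs at \<open>|\<Lambda>|\<close> many coordinates, but proper initial
  segments have fewer elements, so some occurrence lies above \<open>\<beta>\<close>.\<close>

lemma cofinal_coord:
 assumes "s \<in> (UNIV :: bool set) \<times> Sig" "\<beta> \<in> Field \<Lambda>"
 obtains i where "i \<in> Field \<Lambda>" "snd (h i) = s" "\<beta> \<in> underS \<Lambda> i"
proof -
 let ?g = "%l. inv_into (Field \<Lambda>) h (l, s)"
 have ran: "(l, s) \<in> h ` Field \<Lambda>" if "l \<in> Field \<Lambda>" for l using h assms(1) that unfolding bij_betw_def by blast
 have g: "?g l \<in> Field \<Lambda>" "h (?g l) = (l, s)" if "l \<in> Field \<Lambda>" for l
  using inv_into_into[OF ran[OF that]] f_inv_into_f[OF ran[OF that]] by simp_all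
 have "inj_on ?g (Field \<Lambda>)" by (rule inj_onI) (metis g(2) prod.inject)
 have "\<exists>l\<in>Field \<Lambda>. \<beta> \<in> underS \<Lambda> (?g l)"
 proof (rule ccontr)
  assume n: "\<not> ?thesis"
  obtain \<gamma> where \<gamma>: "\<gamma> \<in> Field \<Lambda>" "\<beta> ~= \<gamma>" "(\<beta>, \<gamma>) \<in> \<Lambda>"
   using infinite_Card_order_limit[OF L infL assms(2)] by blast
  have "?g ` Field \<Lambda> \<subseteq> underS \<Lambda> \<gamma>"
  proof
   fix x assume "x \<in> ?g ` Field \<Lambda>"
   then have x: "x \<in> Field \<Lambda>" "\<beta> \<notin> underS \<Lambda> x" using g(1) n by auto
   have "\<beta> \<in> underS \<Lambda> \<gamma>" using \<gamma> by (simp add: underS_def)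
   moreover have "x = \<beta> \<or> x \<in> underS \<Lambda> \<beta>" using underS_cases[OF WOL x(1) assms(2)] x(2) by blast
   ultimately show "x \<in> underS \<Lambda> \<gamma>" using underS_trans[OF WOL] by blast
  qed
  then have "|Field \<Lambda>| \<le>o |underS \<Lambda> \<gamma>|" using \<open>inj_on ?g (Field \<Lambda>)\<close> card_of_ordLeq[of "Field \<Lambda>" "underS \<Lambda> \<gamma>"] by blast
  also have "|underS \<Lambda> \<gamma>| <o \<Lambda>" by (rule card_of_underS[OF L \<gamma>(1)])
  finally have "\<Lambda> <o \<Lambda>" using card_of_Field_ordIso[OF L] ordIso_symmetric ordIso_ordLess_trans by blast
  then show False using ordLess_irreflexive by blast
 qed
 then obtain l where l: "l \<in> Field \<Lambda>" "\<beta> \<in> underS \<Lambda> (?g l)" by blast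
 show ?thesis by (rule that[of "?g l"]) (simp_all add: g l)
qed

sublocale it: iter \<Lambda> isL idx X w pre
 by unfold_locales (rule WOL w_mono w_unb)+

definition e0 :: "'u cond => 'u" where "e0 = (SOME f. inj_on f Cset \<and> f ` Cset \<subseteq> Field \<Lambda>)"

lemma e0: "inj_on e0 Cset" "e0 ` Cset \<subseteq> Field \<Lambda>"
proof -
 have "\<exists>f. inj_on f Cset \<and> f ` Cset \<subseteq> Field \<Lambda>" using leq_Cset card_of_ordLeq[of Cset "Field \<Lambda>"] unfolding leq_Field by blast
 then have "inj_on e0 Cset \<and> e0 ` Cset \<subseteq> Field \<Lambda>" unfolding e0_def by (rule someI_ex)
 then show "inj_on e0 Cset" "e0 ` Cset \<subseteq> Field \<Lambda>" by blast+
qed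

text \<open>Conditions are injected into the ground type and wrapped as singletons, since the
  forcing is to be an order on sets of its elements.\<close>

definition enc :: "'u cond => 'u set" where "enc p = {e0 p}"

definition P :: "'u set rel" where
 "P = {(enc q, enc p) |q p. it.valid q \<and> it.valid p \<and> it.le q p}"

lemma valid_Cset: assumes "it.valid p" shows "p \<in> Cset"
proof -
 have "idx i \<subseteq> Field \<kappa>" for i unfolding idx_def by (rule underS_sub)
 moreover have "dom p \<subseteq> Field \<Lambda>" using it.validD(2)[OF assms] it.good_iff by blast
 ultimately show ?thesis using it.validD(1,3,4)[OF assms] unfolding Cset_def by blast
qed

lemma enc_inj: "it.valid p ==> it.valid q ==> enc p = enc q ==> p = q"
 using e0(1) valid_Cset unfolding enc_def inj_on_def by blast

lemma P_iff: assumes "it.valid q" "it.valid p" shows "(enc q, enc p) \<in> P \<longleftrightarrow> it.le q p"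
proof
 assume "(enc q, enc p) \<in> P"
 then obtain q' p' where "enc q = enc q'" "enc p = enc p'" "it.valid q'" "it.valid p'" "it.le q' p'"
  unfolding P_def by blast
 then show "it.le q p" using enc_inj assms by metis
qed (use assms in \<open>auto simp: P_def\<close>)

lemma P_cases: assumes "(x, y) \<in> P" obtains q p where "x = enc q" "y = enc p" "it.valid q" "it.valid p" "it.le q p"
 using assms unfolding P_def by blast

lemma Field_P: "Field P = enc ` {p. it.valid p}"
proof
 show "Field P \<subseteq> enc ` {p. it.valid p}" unfolding Field_def P_def by auto
 show "enc ` {p. it.valid p} \<subseteq> Field P" unfolding Field_def using P_iff it.le_refl by auto
qed

lemma P_down: assumes "(x, enc p) \<in> P" "it.valid p" obtains q where "x = enc q" "it.valid q" "it.le q p"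
proof -
 obtain q p' where "x = enc q" "enc p = enc p'" "it.valid q" "it.valid p'" "it.le q p'" using P_cases[OF assms(1)] by metis
 then show ?thesis using that enc_inj[of p p'] assms(2) by auto
qed

lemma po_P: "Partial_order P"
proof -
 have "refl_on (Field P) P" unfolding refl_on_def Field_P using P_iff it.le_refl by auto
 moreover have "trans P"
 proof (rule transI)
  fix x y z assume xy: "(x, y) \<in> P" and yz: "(y, z) \<in> P"
  obtain q p where 1: "y = enc q" "z = enc p" "it.valid q" "it.valid p" "it.le q p" using P_cases[OF yz] by metis
  obtain s where 2: "x = enc s" "it.valid s" "it.le s q" using P_down[OF xy[unfolded 1(1)] 1(3)] by metis
  show "(x, z) \<in> P" unfolding 1(2) 2(1) P_iff[OF 2(2) 1(4)] using it.le_trans[OF 1(5) 2(3)] .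
 qed
 moreover have "antisym P"
 proof (rule antisymI)
  fix x y assume xy: "(x, y) \<in> P" and yx: "(y, x) \<in> P"
  obtain q p where 1: "x = enc q" "y = enc p" "it.valid q" "it.valid p" "it.le q p" using P_cases[OF xy] by metis
  have "it.le p q" using yx unfolding 1(1,2) P_iff[OF 1(4,3)] .
  then show "x = y" using it.le_antisym[OF 1(5)] 1(1,2) by simp
 qed
 ultimately show ?thesis
  unfolding partial_order_on_def preorder_on_def by (auto simp: Field_def)
qed

lemma ccc_P: "ccc P"
 unfolding ccc_def
proof (intro allI impI)
 fix A assume A: "A \<subseteq> Field P" and anti: "\<forall>p\<in>A. \<forall>q\<in>A. p ~= q --> \<not> (\<exists>r. (r, p) \<in> P \<and> (r, q) \<in> P)"
 let ?A = "{p. it.valid p \<and> enc p \<in> A}"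
 have "countable ?A"
 proof (rule it.ccc_valid)
  fix p q s assume "p \<in> ?A" "q \<in> ?A" "it.valid s" "it.le s p" "it.le s q"
  then have "(enc s, enc p) \<in> P" "(enc s, enc q) \<in> P" using P_iff by auto
  then have "enc p = enc q" using anti \<open>p \<in> ?A\<close> \<open>q \<in> ?A\<close> by blast
  then show "p = q" using enc_inj \<open>p \<in> ?A\<close> \<open>q \<in> ?A\<close> by blast
 qed blast
 then have "countable (enc ` ?A)" by (rule countable_image)
 moreover have "A \<subseteq> enc ` ?A" using A unfolding Field_P by blast
 ultimately show "countable A" using countable_subset by blast
qed

section \<open>The generic reals and the families of reals they serve\<close>

sublocale fc: forcing P
proof unfold_locales
 show "Field P ~= {}" unfolding Field_P using it.valid_empty by blast
 have "infinite (UNIV :: 'u set)" using infinite_super[OF subset_UNIV infL] .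
 then show "infinite (UNIV :: 'u set set)" by (simp add: Finite_Set.finite_set)
qed (rule po_P ccc_P)+

abbreviation om :: "'u set name" where "om \<equiv> check_omega"
abbreviation le_P (infix "<<" 50) where "q << p \<equiv> (q, p) \<in> P"
abbreviation "mpred \<equiv> Measurable.pred fc.M"
abbreviation nm :: "nat => 'u set name" where "nm \<equiv> check_nat"
abbreviation gen where "gen p \<equiv> fc.gen p"
abbreviation "ev p \<Phi> \<equiv> eventually \<Phi> (gen p)"

lemma encF [simp]: "it.valid p ==> enc p \<in> Field P" unfolding Field_P by blast

lemma filt_common:
 assumes "fc.filt G" "enc p \<in> G" "enc q \<in> G" "it.valid p" "it.valid q"
 obtains s where "it.valid s" "enc s \<in> G" "it.le s p" "it.le s q"
proof -
 obtain x where x: "x \<in> G" "(x, enc p) \<in> P" "(x, enc q) \<in> P" using assms unfolding fc.filt_def by blast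
 obtain s where s: "x = enc s" "it.valid s" "it.le s p" using P_down[OF x(2) assms(4)] by metis
 have "it.le s q" using x(3) P_iff s assms(5) by blast
 then show ?thesis using that s x(1) by blast
qed

lemma filt_up: "fc.filt G ==> enc p \<in> G ==> it.valid p ==> it.valid q ==> it.le p q ==> enc q \<in> G"
 unfolding fc.filt_def using P_iff by blast

text \<open>The generic real at \<open>i\<close>, read off from conditions with support
  \<open>i\<close> and no promises; as stems are countably many, it is measurable.\<close>

definition cg :: "'u => 'u set set => nat => nat" where
 "cg i G n = (LEAST y. \<exists>s. n < length s \<and> s ! n = y \<and> enc [i \<mapsto> (s, {})] \<in> G)"

lemma mfun_cg: "fc.mfun (cg i)"
 unfolding fc.mfun_def cg_def by measurable

lemma cg_eq:
 assumes G: "fc.filt G" "enc q \<in> G" and q: "it.valid q" "i \<in> dom q" "n < length (st q i)"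
 shows "cg i G n = st q i ! n"
proof -
 have gi: "it.good i" using it.validD(2)[OF q(1,2)] .
 have "enc [i \<mapsto> (st q i, {})] \<in> G"
  by (rule filt_up[OF G q(1) it.valid_single[OF gi] it.le_single[OF q(2)]])
 moreover have u: "y = st q i ! n" if y: "n < length s" "s ! n = y" "enc [i \<mapsto> (s, {})] \<in> G" for y s
 proof -
  obtain t where t: "it.le t q" "it.le t [i \<mapsto> (s, {})]"
   using filt_common[OF G(1,2) y(3) q(1) it.valid_single[OF gi]] by metis
  have "st t i ! n = st q i ! n" using it.le_nth[OF t(1) q(2,3)] .
  moreover have "st t i ! n = s ! n" using it.le_nth[OF t(2), of i n] y(1) by simp
  ultimately show ?thesis using y(2) by simp
 qed
 ultimately show ?thesis
  unfolding cg_def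
 proof (intro Least_equality, goal_cases)
  case 1 then show ?case using q(3) by blast
 next
  case (2 y)
  then obtain s where "n < length s" "s ! n = y" "enc [i \<mapsto> (s, {})] \<in> G" by (elim exE conjE)
  then show ?case using u[of s y] by simp
 qed
qed

lemma ev_cg:
 assumes q: "it.valid q" "i \<in> dom q" "n < length (st q i)"
 shows "ev (enc q) (%G. cg i G n = st q i ! n)"
 using fc.ev_filt[of "enc q"] by eventually_elim (use cg_eq q in blast)

lemma ev_dense:
 assumes "!!p. it.valid p ==> \<exists>q. it.valid q \<and> it.le q p \<and> Q q"
 shows "ev p (%G. \<exists>q. it.valid q \<and> Q q \<and> enc q \<in> G)"
proof -
 have "fc.dns (enc ` {q. it.valid q \<and> Q q})"
  unfolding fc.dns_def
 proof
  fix x assume "x \<in> Field P"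
  then obtain p where p: "x = enc p" "it.valid p" unfolding Field_P by blast
  then obtain q where "it.valid q" "it.le q p" "Q q" using assms by blast
  then show "\<exists>q\<in>enc ` {q. it.valid q \<and> Q q}. q << x" using p P_iff by blast
 qed
 from fc.ev_dns[OF this] show ?thesis by eventually_elim blast
qed

text \<open>A real in the form in which a promise can refer to it: for each argument and value a
  countable maximal antichain of conditions with that decision.\<close>

definition code :: "('u set set => nat => nat) => nat => nat => 'u cond set" where
 "code Z n m = {p. it.valid p \<and> enc p \<in> (SOME A. fc.maxanti {q \<in> Field P. ev q (%G. Z G n = m)} A)}"

lemma code_anti:
 "fc.maxanti {q \<in> Field P. ev q (%G. Z G n = m)} (enc ` code Z n m)"
proof -
 let ?A = "SOME A. fc.maxanti {q \<in> Field P. ev q (%G. Z G n = m)} A"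
 have m: "fc.maxanti {q \<in> Field P. ev q (%G. Z G n = m)} ?A"
  by (rule someI_ex, rule fc.maxanti_ex) blast
 have "enc ` code Z n m = ?A"
  using fc.maxantiD(1)[OF m] unfolding code_def Field_P by auto
 then show ?thesis using m by simp
qed

lemma code_valid: "p \<in> code Z n m ==> it.valid p" unfolding code_def by blast

lemma code_ev: "p \<in> code Z n m ==> ev (enc p) (%G. Z G n = m)"
 using fc.maxantiD(1)[OF code_anti] by blast

lemma code_countable: "countable (code Z n m)"
proof -
 have "inj_on enc (code Z n m)" by (rule inj_onI) (use enc_inj code_valid in blast)
 then show ?thesis using fc.maxantiD(2)[OF code_anti] countable_image_inj_on by blast
qed

lemma code_Codes: "code Z \<in> Codes"
 unfolding Codes_def using code_countable code_valid valid_Cset by blast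

lemma code_dense:
 assumes Z: "fc.mfun Z" and p: "it.valid p"
 shows "\<exists>q. it.valid q \<and> it.le q p \<and> (\<exists>m. \<exists>x\<in>code Z n m. it.le q x)"
proof -
 note [measurable] = fc.mfunD[OF Z]
 have "ev (enc p) (%G. \<exists>m. Z G n = m)" by simp
 then obtain x m where x: "(x, enc p) \<in> P" "ev x (%G. Z G n = m)"
  using fc.ev_ex_nat[of "%m G. Z G n = m" "enc p"] p by auto
 have "x \<in> {q \<in> Field P. ev q (%G. Z G n = m)}" using x fc.le_field(1) by blast
 from fc.maxantiD(4)[OF code_anti[of Z n m] this] obtain y t
  where y: "y \<in> code Z n m" "(t, enc y) \<in> P" "t << x" by blast
 obtain q where q: "t = enc q" "it.valid q" "it.le q y" using P_down[OF y(2) code_valid[OF y(1)]] by metis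
 have "(enc q, enc p) \<in> P" using y(3) x(1) fc.le_trans q(1) by blast
 then show ?thesis using q y(1) P_iff p by blast
qed

lemma regk: "regular_card \<kappa>" and regm: "regular_card \<mu>" and regn: "regular_card \<nu>"
 using k mu nu by (simp_all add: regular_card_def)

text \<open>The antichains of fewer than \<open>\<kappa>\<close> reals mention fewer than
  \<open>\<kappa>\<close> coordinates, which form a bounded set; above its bound the task occurs
  again, and there the codes are total.\<close>

lemma coordinate:
 assumes Z: "!!Z. Z \<in> \<Z> ==> fc.mfun Z" and card: "|\<Z>| <o \<kappa>"
  and l: "l ==> |\<Z>| <o \<mu> \<or> |\<Z>| <o \<nu> \<and> (\<forall>Z\<in>\<Z>. \<forall>G n. Z G n \<le> bd n)"
 obtains i where "it.good i" "isL i = l" "!!Z. Z \<in> \<Z> ==> \<exists>\<eta>\<in>idx i. X i \<eta> = code Z"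
proof -
 interpret rk: regular_card \<kappa> by (rule regk)
 obtain b where b: "b \<in> Field \<kappa>" "|underS \<kappa> b| =o |\<Z>|" by (rule init_seg[OF k(1) card])
 obtain \<phi> where \<phi>: "bij_betw \<phi> (underS \<kappa> b) \<Z>" using b(2) card_of_ordIso by blast
 define dcinv where "dcinv x = (SOME y. y \<in> Field \<Lambda> \<and> dc y = x)" for x
 have dcinv: "dcinv x \<in> Field \<Lambda> \<and> dc (dcinv x) = x" if "x \<in> Codes" for x
 proof -
  have "x \<in> dc ` Field \<Lambda>" unfolding dc by (rule that)
  then have "\<exists>y. y \<in> Field \<Lambda> \<and> dc y = x" by blast
  then show ?thesis unfolding dcinv_def by (rule someI_ex)
 qed
 define g where "g \<eta> = (if \<eta> \<in> underS \<kappa> b then dcinv (code (\<phi> \<eta>)) else undefined)" for \<eta>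
 have "g \<in> Func (underS \<kappa> b) (Field \<Lambda>)" unfolding Func_def g_def using dcinv code_Codes by auto
 then have s: "(l, b, g) \<in> UNIV \<times> Sig" using b(1) by simp
 let ?K = "\<Union>Z\<in>\<Z>. \<Union>n. \<Union>m. \<Union>x\<in>code Z n m. dom x"
 have "countable (\<Union>x\<in>code Z n m. dom x)" for Z n m
  by (rule countable_UN[OF code_countable]) (rule countable_finite[OF it.validD(1)[OF code_valid]])
 then have "|\<Union>n. \<Union>m. \<Union>x\<in>code Z n m. dom x| <o \<kappa>" for Z
  by (intro rk.countable_less countable_UN[of UNIV]) simp_all
 then have K: "|?K| <o \<kappa>" by (intro rk.UNION_less[OF card])
 have KF: "?K \<subseteq> Field \<Lambda>"
  using code_valid it.validD(2) it.good_iff by blast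
 obtain \<beta> where \<beta>: "\<beta> \<in> Field \<Lambda>" "?K \<subseteq> underS \<Lambda> \<beta>" using bounded[OF KF K] by (rule bexE)
 obtain i where i: "i \<in> Field \<Lambda>" "snd (h i) = (l, b, g)" "\<beta> \<in> underS \<Lambda> i" using cofinal_coord[OF s \<beta>(1)] .
 have Ki: "dom x \<subseteq> underS \<Lambda> i" if "x \<in> code Z n m" "Z \<in> \<Z>" for x Z n m
  using that \<beta>(2) underS_trans[OF WOL _ i(3)] by blast
 have idx: "idx i = underS \<kappa> b" and isL: "isL i = l" unfolding idx_def isL_def i(2) by simp_all
 have X: "X i \<eta> = code (\<phi> \<eta>)" if "\<eta> \<in> idx i" for \<eta>
  using that dcinv[OF code_Codes] unfolding X_def i(2) by (simp add: idx g_def)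
 have \<phi>Z: "\<phi> \<eta> \<in> \<Z>" if "\<eta> \<in> idx i" for \<eta> using \<phi> that unfolding idx bij_betw_def by blast
 have "pre i" unfolding pre_def isL
 proof
  assume l
  then consider "|\<Z>| <o \<mu>" | "|\<Z>| <o \<nu>" "\<forall>Z\<in>\<Z>. \<forall>G n. Z G n \<le> bd n" using l by blast
  then show "|idx i| <o \<mu> \<or> |idx i| <o \<nu> \<and> (\<forall>\<eta> n m. X i \<eta> n m ~= {} --> m \<le> bd n)"
  proof cases
   case 1 show ?thesis using ordIso_ordLess_trans[OF b(2) 1] idx by simp
  next
   case 2
   \<comment> \<open>A member of the antichain makes \<open>m\<close> a value of the real, to which
     the pointwise bound applies.\<close>
   have "m \<le> bd n" if ne: "X i \<eta> n m ~= {}" for \<eta> n m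
   proof -
    have \<eta>: "\<eta> \<in> idx i" using ne unfolding X_def by (auto split: if_splits)
    then obtain x where x: "x \<in> code (\<phi> \<eta>) n m" using ne X by auto
    have "ev (enc x) (%G. m \<le> bd n)"
     using code_ev[OF x] by eventually_elim (use 2(2) \<phi>Z[OF \<eta>] in blast)
    then show ?thesis using fc.ev_const[of "enc x"] code_valid[OF x] by simp
   qed
   then show ?thesis using ordIso_ordLess_trans[OF b(2) 2(1)] idx by simp
  qed
 qed
 moreover have "it.total it.good i"
  unfolding it.total_def
 proof (intro ballI allI impI)
  fix \<eta> n p assume \<eta>: "\<eta> \<in> idx i" and p: "it.vld it.good p" "dom p \<subseteq> underS \<Lambda> i"
  have vp: "it.valid p" using p(1) unfolding it.valid_def .
  obtain q m x where q: "it.valid q" "it.le q p" "x \<in> code (\<phi> \<eta>) n m" "it.le q x"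
   using code_dense[OF Z[OF \<phi>Z[OF \<eta>]] vp] by blast
  \<comment> \<open>The deciding condition may be cut off at \<open>i\<close>, because the supports
    of \<open>p\<close> and of the antichain lie below \<open>i\<close>.\<close>
  have "it.le (it.restr i q) p" using it.le_restr[OF q(2), of i] it.restr_id[OF p(2)] by simp
  moreover have "it.le (it.restr i q) x"
   using it.le_restr[OF q(4), of i] it.restr_id[OF Ki[OF q(3) \<phi>Z[OF \<eta>]]] by simp
  ultimately show "\<exists>q. it.vld it.good q \<and> dom q \<subseteq> underS \<Lambda> i \<and> it.le q p \<and> (\<exists>m. \<exists>a\<in>X i \<eta> n m. it.le q a)"
   using it.valid_restr[OF q(1), of i] q(3) X[OF \<eta>] unfolding it.valid_def
   by (intro exI[of _ "it.restr i q"]) auto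
 qed
 ultimately have "it.good i" using i(1) it.good_iff by blast
 moreover have "\<exists>\<eta>\<in>idx i. X i \<eta> = code Z" if "Z \<in> \<Z>" for Z
 proof -
  have "Z \<in> \<phi> ` underS \<kappa> b" using \<phi> that unfolding bij_betw_def by simp
  then obtain \<eta> where "\<eta> \<in> underS \<kappa> b" "\<phi> \<eta> = Z" by blast
  then show ?thesis using X[of \<eta>] idx by auto
 qed
 ultimately show ?thesis using that isL by blast
qed

text \<open>By genericity the promise is made at some point and stems become arbitrarily long; every
  value beyond the stem present at that point accepts the promised one.\<close>

lemma ev_coordinate:
 assumes i: "it.good i" "\<eta> \<in> idx i" "X i \<eta> = code Z"
 shows "ev p (%G. \<exists>m. \<forall>n\<ge>m. it.acc i n (cg i G n) (Z G n))"
proof -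
 have 1: "ev p (%G. \<exists>q. it.valid q \<and> (i \<in> dom q \<and> \<eta> \<in> fs q i) \<and> enc q \<in> G)"
  by (rule ev_dense) (use it.add_promise[OF _ i(1,2)] in blast)
 have 2: "ev p (%G. \<forall>N. \<exists>q. it.valid q \<and> (i \<in> dom q \<and> N \<le> length (st q i)) \<and> enc q \<in> G)"
 proof (intro fc.ev_all ev_dense)
  fix N p assume "it.valid p"
  then obtain q where q: "it.valid q" "it.le q p" "i \<in> dom q" using it.add_promise[OF _ i(1,2)] by blast
  obtain q' where q': "it.valid q'" "it.le q' q" "N \<le> length (st q' i)" using it.extend_stem[OF q(1,3)] by blast
  then show "\<exists>q. it.valid q \<and> it.le q p \<and> i \<in> dom q \<and> N \<le> length (st q i)"
   using it.le_trans[OF q(2) q'(2)] it.leD(1)[OF q'(2)] q(3) by blast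
 qed
 have "ev p (%G. \<forall>n m. \<forall>x\<in>code Z n m. enc x \<in> G --> Z G n = m)"
 proof (intro fc.ev_all fc.ev_all_countable code_countable)
  fix n m x assume "x \<in> code Z n m"
  from code_ev[OF this] show "ev p (%G. enc x \<in> G --> Z G n = m)"
   unfolding fc.eventually_gen by (rule fc.gev_trans)
 qed
 then show ?thesis using 1 2 fc.ev_filt
 proof eventually_elim
  case (elim G)
  obtain q where q: "it.valid q" "i \<in> dom q" "\<eta> \<in> fs q i" "enc q \<in> G" using elim(2) by blast
  have "it.acc i n (cg i G n) (Z G n)" if n: "length (st q i) \<le> n" for n
  proof -
   obtain q' where q': "it.valid q'" "i \<in> dom q'" "Suc n \<le> length (st q' i)" "enc q' \<in> G" using elim(3) by blast
   obtain s where s: "it.valid s" "enc s \<in> G" "it.le s q" "it.le s q'"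
    using filt_common[OF _ q(4) q'(4) q(1) q'(1)] elim(4) by metis
   have d: "i \<in> dom s" "n < length (st s i)" using it.leD(1)[OF s(4)] it.le_length[OF s(4) q'(2)] q'(2,3) by auto
   obtain m x where x: "x \<in> code Z n m" "it.le (it.restr i s) x" "it.acc i n (st s i ! n) m"
    using it.leD(4)[OF s(3) q(2) n d(2) q(3)] i(3) by auto
   have "it.le s x" using it.le_trans[OF x(2) it.le_restr1] .
   then have "enc x \<in> G" using filt_up[OF _ s(2,1) code_valid[OF x(1)]] elim(4) by blast
   then have "Z G n = m" using elim(1) x(1) by blast
   then show ?thesis using x(3) cg_eq[OF _ s(2,1) d] elim(4) by simp
  qed
  then show ?case by blast
 qed
qed

lemma dominating:
 assumes Z: "!!Z. Z \<in> \<Z> ==> fc.mfun Z" and card: "|\<Z>| <o \<kappa>"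
 obtains d where "fc.mfun d"
  "!!Z p. Z \<in> \<Z> ==> ev p (%G. \<exists>m. \<forall>n\<ge>m. Z G n \<le> d G n)"
proof -
 obtain i where i: "it.good i" "isL i = False" "!!Z. Z \<in> \<Z> ==> \<exists>\<eta>\<in>idx i. X i \<eta> = code Z"
  by (rule coordinate[OF Z card, of False]) simp_all
 show ?thesis
 proof (rule that[OF mfun_cg[of i]])
  fix Z p assume "Z \<in> \<Z>"
  then obtain \<eta> where "\<eta> \<in> idx i" "X i \<eta> = code Z" using i(3) by blast
  from ev_coordinate[OF i(1) this] show "ev p (%G. \<exists>m. \<forall>n\<ge>m. Z G n \<le> cg i G n)"
   unfolding it.acc_def i(2) by simp
 qed
qed

lemma slalom:
 assumes Z: "!!Z. Z \<in> \<Z> ==> fc.mfun Z"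
  and card: "|\<Z>| <o \<mu> \<or> |\<Z>| <o \<nu> \<and> (\<forall>Z\<in>\<Z>. \<forall>G n. Z G n \<le> bd n)"
 obtains s where "fc.mfun s"
  "!!Z p. Z \<in> \<Z> ==> ev p (%G. \<exists>m. \<forall>n\<ge>m. Z G n \<in> set_decode (s G n) \<and> card (set_decode (s G n)) \<le> w n)"
proof -
 have ck: "|\<Z>| <o \<kappa>" using card mu_nu nu_k ordLess_ordLeq_trans by blast
 obtain i where i: "it.good i" "isL i = True" "!!Z. Z \<in> \<Z> ==> \<exists>\<eta>\<in>idx i. X i \<eta> = code Z"
  by (rule coordinate[OF Z ck, where l = True]) (use card in simp_all)
 show ?thesis
 proof (rule that[OF mfun_cg[of i]])
  fix Z p assume "Z \<in> \<Z>"
  then obtain \<eta> where "\<eta> \<in> idx i" "X i \<eta> = code Z" using i(3) by blast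
  from ev_coordinate[OF i(1) this]
  show "ev p (%G. \<exists>m. \<forall>n\<ge>m. Z G n \<in> set_decode (cg i G n) \<and> card (set_decode (cg i G n)) \<le> w n)"
   unfolding it.acc_def i(2) by simp
 qed
qed

text \<open>The task with the sequence of length zero makes no promises, so it adds Cohen reals, and
  totality of its codes is vacuous.\<close>

lemma cohen_coords: "\<exists>f. inj_on f (Field \<Lambda>) \<and> (\<forall>l\<in>Field \<Lambda>. it.good (f l) \<and> idx (f l) = {})"
proof -
 obtain x where "x \<in> Field \<kappa>" using inf_Field[OF k(1,2)] by fastforce
 moreover have "wf (\<kappa> - Id)" using WOk unfolding well_order_on_def by blast
 ultimately obtain b where b: "b \<in> Field \<kappa>" "!!y. (y, b) \<in> \<kappa> - Id ==> y \<notin> Field \<kappa>"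
  by (metis wfE_min)
 have e: "underS \<kappa> b = {}" using b by (auto simp: underS_def Field_def)
 define s where "s = (False, b, %_ :: 'u. undefined :: 'u)"
 have "s \<in> UNIV \<times> Sig" using b(1) e by (simp add: s_def Func_def)
 then have ran: "(l, s) \<in> h ` Field \<Lambda>" if "l \<in> Field \<Lambda>" for l using h that unfolding bij_betw_def by simp
 let ?g = "%l. inv_into (Field \<Lambda>) h (l, s)"
 have g: "?g l \<in> Field \<Lambda>" "h (?g l) = (l, s)" if "l \<in> Field \<Lambda>" for l
  using inv_into_into[OF ran[OF that]] f_inv_into_f[OF ran[OF that]] by simp_all
 have "inj_on ?g (Field \<Lambda>)" by (rule inj_onI) (metis g(2) prod.inject)
 moreover have "it.good (?g l) \<and> idx (?g l) = {}" if "l \<in> Field \<Lambda>" for l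
 proof -
  have "idx (?g l) = {}" "\<not> isL (?g l)" using g(2)[OF that] e by (simp_all add: idx_def isL_def s_def)
  then show ?thesis unfolding it.good_iff it.total_def pre_def using g(1)[OF that] by simp
 qed
 ultimately show ?thesis by blast
qed

section \<open>Families of Cohen reals indexed by a cardinal\<close>

definition ch :: "'u rel => 'u => 'u" where
 "ch \<theta> = (SOME f. inj_on f (Field \<theta>) \<and> (\<forall>l\<in>Field \<theta>. it.good (f l) \<and> idx (f l) = {}))"

definition cr :: "'u rel => 'u => 'u set set => nat => nat" where
 "cr \<theta> \<xi> = cg (ch \<theta> \<xi>)"

lemma ch:
 assumes "leq (Field \<theta>)"
 shows "inj_on (ch \<theta>) (Field \<theta>)" "!!l. l \<in> Field \<theta> ==> it.good (ch \<theta> l) \<and> idx (ch \<theta> l) = {}"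
proof -
 obtain f where f: "inj_on f (Field \<Lambda>)" "\<forall>l\<in>Field \<Lambda>. it.good (f l) \<and> idx (f l) = {}" using cohen_coords by blast
 obtain g where g: "inj_on g (Field \<theta>)" "g ` Field \<theta> \<subseteq> Field \<Lambda>"
  using assms card_of_ordLeq[of "Field \<theta>" "Field \<Lambda>"] unfolding leq_Field by blast
 have "inj_on (f \<circ> g) (Field \<theta>)" using comp_inj_on[OF g(1) inj_on_subset[OF f(1) g(2)]] .
 moreover have "\<forall>l\<in>Field \<theta>. it.good ((f \<circ> g) l) \<and> idx ((f \<circ> g) l) = {}" using f(2) g(2) by auto
 ultimately have "\<exists>f. inj_on f (Field \<theta>) \<and> (\<forall>l\<in>Field \<theta>. it.good (f l) \<and> idx (f l) = {})" by blast
 then have "inj_on (ch \<theta>) (Field \<theta>) \<and> (\<forall>l\<in>Field \<theta>. it.good (ch \<theta> l) \<and> idx (ch \<theta> l) = {})"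
  unfolding ch_def by (rule someI_ex)
 then show "inj_on (ch \<theta>) (Field \<theta>)" "!!l. l \<in> Field \<theta> ==> it.good (ch \<theta> l) \<and> idx (ch \<theta> l) = {}" by blast+
qed

lemma mfun_cr: "fc.mfun (cr \<theta> \<xi>)" unfolding cr_def by (rule mfun_cg)

lemma leq_fields: "leq (Field \<kappa>)" "leq (Field \<nu>)" "leq (Field \<mu>)" "leq (Field \<Lambda>)"
proof -
 have k: "\<kappa> \<le>o \<Lambda>" using leq_k k(1) card_of_Field_ordIso ordIso_symmetric ordIso_ordLeq_trans unfolding leq_def by blast
 have *: "leq (Field \<theta>)" if "Card_order \<theta>" "\<theta> \<le>o \<kappa>" for \<theta> :: "'u rel"
  unfolding leq_def using card_of_Field_ordIso[OF that(1)] that(2) k ordIso_ordLeq_trans ordLeq_transitive by blast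
 show "leq (Field \<kappa>)" "leq (Field \<nu>)" "leq (Field \<mu>)" "leq (Field \<Lambda>)"
  using leq_k leq_FieldL *[OF nu(1) nu_k] *[OF mu(1) ordLeq_transitive[OF mu_nu nu_k]] by blast+
qed

lemma large_Field: "regular_card \<theta> ==> regular_card.large \<theta> (Field \<theta>)"
proof -
 assume "regular_card \<theta>"
 then interpret regular_card \<theta> .
 show ?thesis unfolding large_def
  using card_of_Field_ordIso[OF card] ordIso_symmetric ordIso_ordLess_trans ordLess_irreflexive by blast
qed

lemma ub_finite:
 fixes \<theta> :: "'u rel" and lab :: "'u => nat"
 assumes \<theta>: "regular_card \<theta>" "leq (Field \<theta>)" and p: "!!\<xi>. \<xi> \<in> Field \<theta> ==> p \<xi> \<in> Field P"
  and sml: "!!i. it.good i ==> isL i ==> |idx i| <o \<theta> \<or> lossy \<and> (\<forall>\<eta> n m. X i \<eta> n m ~= {} --> m \<le> bd n)"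
 shows "\<exists>n0 k. \<forall>n\<ge>n0. \<forall>M. \<exists>N. (\<not> lossy --> N = M) \<and> (\<forall>v :: nat => nat. \<exists>\<xi> T. inj_on \<xi> {..<N} \<and>
  T \<subseteq> {..<N} \<and> card T = M \<and> (\<exists>q\<in>Field P. \<forall>l\<in>T. \<xi> l \<in> Field \<theta> \<and> lab (\<xi> l) = k \<and> q << p (\<xi> l) \<and>
    ev q (%G. cr \<theta> (\<xi> l) G n = v l)))"
proof -
 have "\<forall>\<xi>\<in>Field \<theta>. \<exists>x. it.valid x \<and> enc x = p \<xi>" using p unfolding Field_P by force
 then obtain x where x: "\<forall>\<xi>\<in>Field \<theta>. it.valid (x \<xi>) \<and> enc (x \<xi>) = p \<xi>" by (rule bchoice[THEN exE])
 have vx: "it.valid (x \<xi>)" if "\<xi> \<in> Field \<theta>" for \<xi> using x that by blast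
 let ?R = "%n0 k. \<forall>n\<ge>n0. \<forall>M. \<exists>N. (\<not> lossy --> N = M) \<and> (\<forall>v :: nat => nat. \<exists>\<xi>. inj_on \<xi> {..<N} \<and>
  (\<exists>T\<subseteq>{..<N}. card T = M \<and> (\<exists>q. it.valid q \<and> (\<forall>l\<in>T. \<xi> l \<in> Field \<theta> \<and> lab (\<xi> l) = k \<and> it.le q (x (\<xi> l)) \<and>
    ch \<theta> (\<xi> l) \<in> dom q \<and> n < length (st q (ch \<theta> (\<xi> l))) \<and> st q (ch \<theta> (\<xi> l)) ! n = v l))))"
 have "\<exists>n0 k. ?R n0 k"
  by (rule it.upper_bound[OF \<theta>(1) large_Field[OF \<theta>(1)]]) (rule vx ch(1)[OF \<theta>(2)] ch(2)[OF \<theta>(2)] sml; assumption)+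
 then obtain n0 k where nk: "?R n0 k"
  by (elim exE)
 show ?thesis
 proof (rule exI[of _ n0], rule exI[of _ k], intro allI impI)
  fix n M assume "n0 \<le> n"
  then obtain N where N: "\<not> lossy --> N = M" "\<forall>v :: nat => nat. \<exists>\<xi>. inj_on \<xi> {..<N} \<and>
  (\<exists>T\<subseteq>{..<N}. card T = M \<and> (\<exists>q. it.valid q \<and> (\<forall>l\<in>T. \<xi> l \<in> Field \<theta> \<and> lab (\<xi> l) = k \<and> it.le q (x (\<xi> l)) \<and>
    ch \<theta> (\<xi> l) \<in> dom q \<and> n < length (st q (ch \<theta> (\<xi> l))) \<and> st q (ch \<theta> (\<xi> l)) ! n = v l)))"
   using nk[rule_format, of n M] by blast
  show "\<exists>N. (\<not> lossy --> N = M) \<and> (\<forall>v :: nat => nat. \<exists>\<xi> T. inj_on \<xi> {..<N} \<and>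
  T \<subseteq> {..<N} \<and> card T = M \<and> (\<exists>q\<in>Field P. \<forall>l\<in>T. \<xi> l \<in> Field \<theta> \<and> lab (\<xi> l) = k \<and> q << p (\<xi> l) \<and>
    ev q (%G. cr \<theta> (\<xi> l) G n = v l)))"
  proof (rule exI[of _ N], intro conjI N(1) allI)
   fix v :: "nat => nat"
   obtain \<xi> T q where q: "inj_on \<xi> {..<N}" "T \<subseteq> {..<N}" "card T = M" "it.valid q"
    "\<forall>l\<in>T. \<xi> l \<in> Field \<theta> \<and> lab (\<xi> l) = k \<and> it.le q (x (\<xi> l)) \<and>
     ch \<theta> (\<xi> l) \<in> dom q \<and> n < length (st q (ch \<theta> (\<xi> l))) \<and> st q (ch \<theta> (\<xi> l)) ! n = v l"
    using spec[OF N(2), of v] by (elim exE conjE)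
   have "\<xi> l \<in> Field \<theta> \<and> lab (\<xi> l) = k \<and> (enc q, p (\<xi> l)) \<in> P \<and>
     ev (enc q) (%G. cr \<theta> (\<xi> l) G n = v l)" if "l \<in> T" for l
   proof -
    have l: "\<xi> l \<in> Field \<theta>" "lab (\<xi> l) = k" "it.le q (x (\<xi> l))" "ch \<theta> (\<xi> l) \<in> dom q"
     "n < length (st q (ch \<theta> (\<xi> l)))" "st q (ch \<theta> (\<xi> l)) ! n = v l" using q(5) that by blast+
    have "(enc q, enc (x (\<xi> l))) \<in> P" using P_iff[OF q(4) vx[OF l(1)]] l(3) by blast
    then show ?thesis using l(1,2) x ev_cg[OF q(4) l(4,5)] l(6) unfolding cr_def by simp
   qed
   then show "\<exists>\<xi> T. inj_on \<xi> {..<N} \<and> T \<subseteq> {..<N} \<and> card T = M \<and> (\<exists>q\<in>Field P. \<forall>l\<in>T. \<xi> l \<in> Field \<theta> \<and>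
     lab (\<xi> l) = k \<and> q << p (\<xi> l) \<and> ev q (%G. cr \<theta> (\<xi> l) G n = v l))"
    using q(1-3) encF[OF q(4)] by (intro exI[of _ \<xi>] exI[of _ T] conjI bexI[of _ "enc q"] ballI; blast)
  qed
 qed
qed

lemma good_small: "it.good i ==> isL i ==> |idx i| <o \<nu>"
 using it.good_iff[of i] mu_nu ordLess_ordLeq_trans unfolding pre_def by blast

text \<open>All slaloms have index sets smaller than \<open>\<nu>\<close>, so no condition is lost
  in the amalgamation.\<close>

lemma ub_nu:
 assumes "!!\<xi>. \<xi> \<in> Field \<nu> ==> p \<xi> \<in> Field P"
 shows "\<exists>n0 k. \<forall>n\<ge>n0. \<forall>M. \<forall>v :: nat => nat. \<exists>\<xi>. \<exists>q\<in>Field P. \<forall>l<M. \<xi> l \<in> Field \<nu> \<and> (lab (\<xi> l) :: nat) = k \<and>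
  q << p (\<xi> l) \<and> ev q (%G. cr \<nu> (\<xi> l) G n = v l)"
proof -
 let ?R = "%n0 k. \<forall>n\<ge>n0. \<forall>M. \<exists>N. (\<not> False --> N = M) \<and> (\<forall>v :: nat => nat. \<exists>\<xi> T. inj_on \<xi> {..<N} \<and>
  T \<subseteq> {..<N} \<and> card T = M \<and> (\<exists>q\<in>Field P. \<forall>l\<in>T. \<xi> l \<in> Field \<nu> \<and> lab (\<xi> l) = k \<and> q << p (\<xi> l) \<and>
    ev q (%G. cr \<nu> (\<xi> l) G n = v l)))"
 have "\<exists>n0 k. ?R n0 k"
  by (rule ub_finite[OF regn leq_fields(2)]) ((rule assms disjI1[OF good_small]; assumption)+)
 then obtain n0 k where nk: "?R n0 k"
  by (elim exE)
 show ?thesis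
 proof (rule exI[of _ n0], rule exI[of _ k], intro allI impI)
  fix n M and v :: "nat => nat" assume "n0 \<le> n"
  then obtain \<xi> T q where q: "T \<subseteq> {..<M}" "card T = M" "q \<in> Field P" "\<forall>l\<in>T. \<xi> l \<in> Field \<nu> \<and> lab (\<xi> l) = k \<and>
    q << p (\<xi> l) \<and> ev q (%G. cr \<nu> (\<xi> l) G n = v l)"
   using nk[rule_format, of n M] by blast
  have "T = {..<M}" using card_subset_eq[OF _ q(1)] q(2) by simp
  then show "\<exists>\<xi>. \<exists>q\<in>Field P. \<forall>l<M. \<xi> l \<in> Field \<nu> \<and> lab (\<xi> l) = k \<and>
   q << p (\<xi> l) \<and> ev q (%G. cr \<nu> (\<xi> l) G n = v l)"
   using q(3,4) by blast
 qed
qed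

text \<open>Some conditions are lost here; prescribing the value \<open>l\<close> for the
  \<open>l\<close>-th one keeps the values of the survivors distinct.\<close>

lemma ub_mu:
 assumes "!!\<xi>. \<xi> \<in> Field \<mu> ==> p \<xi> \<in> Field P"
 shows "\<exists>n0 k. \<forall>n\<ge>n0. \<forall>M. \<exists>\<xi> T. card T = M \<and> finite T \<and> (\<exists>q\<in>Field P. \<forall>l\<in>T. \<xi> l \<in> Field \<mu> \<and>
  (lab (\<xi> l) :: nat) = k \<and> q << p (\<xi> l) \<and> ev q (%G. cr \<mu> (\<xi> l) G n = l))"
proof -
 have "!!i. it.good i ==> isL i ==> |idx i| <o \<mu> \<or> True \<and> (\<forall>\<eta> n m. X i \<eta> n m ~= {} --> m \<le> bd n)"
  using it.good_iff unfolding pre_def by blast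
 note sml = this
 let ?R = "%n0 k. \<forall>n\<ge>n0. \<forall>M. \<exists>N. (\<not> True --> N = M) \<and> (\<forall>v :: nat => nat. \<exists>\<xi> T. inj_on \<xi> {..<N} \<and>
  T \<subseteq> {..<N} \<and> card T = M \<and> (\<exists>q\<in>Field P. \<forall>l\<in>T. \<xi> l \<in> Field \<mu> \<and> lab (\<xi> l) = k \<and> q << p (\<xi> l) \<and>
    ev q (%G. cr \<mu> (\<xi> l) G n = v l)))"
 have "\<exists>n0 k. ?R n0 k"
  by (rule ub_finite[OF regm leq_fields(3)]) (rule assms sml; assumption)+
 then obtain n0 k where nk: "?R n0 k"
  by (elim exE)
 show ?thesis
 proof (rule exI[of _ n0], rule exI[of _ k], intro allI impI)
  fix n M assume "n0 \<le> n"
  then obtain N where "\<forall>v :: nat => nat. \<exists>\<xi> T. inj_on \<xi> {..<N} \<and>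
  T \<subseteq> {..<N} \<and> card T = M \<and> (\<exists>q\<in>Field P. \<forall>l\<in>T. \<xi> l \<in> Field \<mu> \<and> lab (\<xi> l) = k \<and> q << p (\<xi> l) \<and>
    ev q (%G. cr \<mu> (\<xi> l) G n = v l))"
   using nk[rule_format, of n M] by blast
  from spec[OF this, of "%l. l"] show "\<exists>\<xi> T. card T = M \<and> finite T \<and> (\<exists>q\<in>Field P. \<forall>l\<in>T. \<xi> l \<in> Field \<mu> \<and>
   lab (\<xi> l) = k \<and> q << p (\<xi> l) \<and> ev q (%G. cr \<mu> (\<xi> l) G n = l))"
   using finite_subset[OF _ finite_lessThan] by blast
 qed
qed

text \<open>All index sets are smaller than \<open>\<kappa>\<close>, those of dominating reals
  included, so promises on the root are constant and the value of \<open>Z\<close> can be decided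
  there.\<close>

lemma ub_kappa:
 fixes lab :: "'u => nat"
 assumes p: "!!\<xi>. \<xi> \<in> Field \<kappa> ==> p \<xi> \<in> Field P" and Z: "fc.mfun Z"
 shows "\<exists>n0 k. \<forall>n\<ge>n0. \<exists>\<xi>\<in>Field \<kappa>. \<exists>q. lab \<xi> = k \<and> q << p \<xi> \<and>
  ev q (%G. cr \<kappa> \<xi> G n = Suc (Z G n))"
proof -
 have "\<forall>\<xi>\<in>Field \<kappa>. \<exists>x. it.valid x \<and> enc x = p \<xi>" using p unfolding Field_P by force
 then obtain x where x: "\<forall>\<xi>\<in>Field \<kappa>. it.valid (x \<xi>) \<and> enc (x \<xi>) = p \<xi>" by (rule bchoice[THEN exE])
 have vx: "it.valid (x \<xi>)" if "\<xi> \<in> Field \<kappa>" for \<xi> using x that by blast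
 have sm: "|idx i| <o \<kappa>" if "it.good i" for i using idx_less it.good_iff that by blast
 define Q where "Q n q v \<longleftrightarrow> (\<exists>y\<in>code Z n v. it.le q y)" for n q v
 have Q1: "\<exists>q' v. it.valid q' \<and> it.le q' q \<and> Q n q' v" if "it.valid q" for n q
  using code_dense[OF Z that, of n] unfolding Q_def by blast
 have Q2: "Q n q' v" if "Q n q v" "it.valid q'" "it.le q' q" for n q q' v
  using that it.le_trans unfolding Q_def by blast
 let ?R = "%n0 k. \<forall>n\<ge>n0. \<exists>\<xi>\<in>Field \<kappa>. \<exists>q v. lab \<xi> = k \<and> it.valid q \<and> it.le q (x \<xi>) \<and> Q n q v \<and>
  ch \<kappa> \<xi> \<in> dom q \<and> n < length (st q (ch \<kappa> \<xi>)) \<and> st q (ch \<kappa> \<xi>) ! n = Suc v"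
 have "\<exists>n0 k. ?R n0 k"
  by (rule it.upper_bound_decide[OF regk large_Field[OF regk]]) (rule vx ch(1)[OF leq_fields(1)] ch(2)[OF leq_fields(1)] sm Q1 Q2; assumption)+
 then obtain n0 k where nk: "?R n0 k"
  by (elim exE)
 show ?thesis
 proof (rule exI[of _ n0], rule exI[of _ k], intro allI impI)
  fix n assume "n0 \<le> n"
  then obtain \<xi> q v where q: "\<xi> \<in> Field \<kappa>" "lab \<xi> = k" "it.valid q" "it.le q (x \<xi>)" "Q n q v"
   "ch \<kappa> \<xi> \<in> dom q" "n < length (st q (ch \<kappa> \<xi>))" "st q (ch \<kappa> \<xi>) ! n = Suc v" using nk by blast
  obtain y where y: "y \<in> code Z n v" "it.le q y" using q(5) unfolding Q_def by blast
  have "(enc q, enc y) \<in> P" using P_iff[OF q(3) code_valid[OF y(1)]] y(2) by blast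
  then have "ev (enc q) (%G. Z G n = v)" using fc.ev_gen_le[OF code_ev[OF y(1)]] by blast
  then have "ev (enc q) (%G. cr \<kappa> \<xi> G n = Suc (Z G n))"
   using ev_cg[OF q(3,6,7)] unfolding cr_def by eventually_elim (simp add: q(8))
  moreover have "(enc q, p \<xi>) \<in> P" using P_iff[OF q(3) vx[OF q(1)]] q(4) x q(1) by auto
  ultimately show "\<exists>\<xi>\<in>Field \<kappa>. \<exists>q. lab \<xi> = k \<and> q << p \<xi> \<and>
   ev q (%G. cr \<kappa> \<xi> G n = Suc (Z G n))" using q(1,2) by blast
 qed
qed

lemma cr_distinct:
 assumes \<theta>: "leq (Field \<theta>)" and \<xi>: "\<xi> \<in> Field \<theta>" "\<zeta> \<in> Field \<theta>" "\<xi> ~= \<zeta>" and p: "p \<in> Field P"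
 shows "\<exists>q n. q << p \<and> ev q (%G. cr \<theta> \<xi> G n = 1 \<and> cr \<theta> \<zeta> G n = 0)"
proof -
 obtain x where x: "p = enc x" "it.valid x" using p unfolding Field_P by blast
 let ?i = "ch \<theta> \<xi>" and ?j = "ch \<theta> \<zeta>"
 have ij: "it.good ?i" "idx ?i = {}" "it.good ?j" "idx ?j = {}" "?i ~= ?j"
  using ch[OF \<theta>] \<xi> by (auto dest: inj_onD)
 have ex: "\<exists>q. it.valid q \<and> it.le q x \<and> i \<in> dom q" if "it.good i" "it.valid x" for i x
  using it.add_coord[OF that(2,1), of "[]"] that(2) it.le_refl[of x] by (cases "i \<in> dom x") (auto simp del: not_None_eq)
 obtain x1 where x1: "it.valid x1" "it.le x1 x" "?i \<in> dom x1" using ex[OF ij(1) x(2)] by blast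
 obtain x2 where x2: "it.valid x2" "it.le x2 x1" "?j \<in> dom x2" using ex[OF ij(3) x1(1)] by blast
 have i2: "?i \<in> dom x2" using it.leD(1)[OF x2(2)] x1(3) by blast
 define n where "n = max (length (st x2 ?i)) (length (st x2 ?j))"
 let ?t = "%i v. replicate (n - length (st x2 i)) 0 @ [v]"
 let ?x3 = "x2(?i \<mapsto> (st x2 ?i @ ?t ?i 1, {}))"
 note x3 = it.extend_cohen[OF x2(1) i2 ij(2), of "?t ?i 1"]
 have j3: "?j \<in> dom ?x3" "st ?x3 ?j = st x2 ?j" using x2(3) ij(5) by auto
 let ?x4 = "?x3(?j \<mapsto> (st ?x3 ?j @ ?t ?j 0, {}))"
 note x4 = it.extend_cohen[OF x3(1) j3(1) ij(4), of "?t ?j 0"]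
 have n: "length (st x2 ?i) \<le> n" "length (st x2 ?j) \<le> n" by (simp_all add: n_def)
 have si: "?i \<in> dom ?x4" "st ?x4 ?i = st x2 ?i @ ?t ?i 1" using ij(5) by auto
 have sj: "?j \<in> dom ?x4" "st ?x4 ?j = st x2 ?j @ ?t ?j 0" using j3(2) by auto
 have "ev (enc ?x4) (%G. cg ?i G n = st ?x4 ?i ! n)"
  by (rule ev_cg[OF x4(1) si(1)]) (use n si(2) in simp)
 moreover have "ev (enc ?x4) (%G. cg ?j G n = st ?x4 ?j ! n)"
  by (rule ev_cg[OF x4(1) sj(1)]) (use n sj(2) in simp)
 ultimately have "ev (enc ?x4) (%G. cr \<theta> \<xi> G n = 1 \<and> cr \<theta> \<zeta> G n = 0)"
 proof eventually_elim
  case (elim G)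
  have "st ?x4 ?i ! n = 1" unfolding si(2) using n(1) by (simp add: nth_append)
  moreover have "st ?x4 ?j ! n = 0" unfolding sj(2) using n(2) by (simp add: nth_append)
  ultimately show ?case using elim unfolding cr_def by simp
 qed
 moreover have "it.le ?x4 x"
  using it.le_trans[OF it.le_trans[OF it.le_trans[OF x1(2) x2(2)] x3(2)] x4(2)] .
 then have "(enc ?x4, p) \<in> P" unfolding x(1) P_iff[OF x4(1) x(2)] .
 ultimately show ?thesis by blast
qed

lemma leq_Field_P: "leq (Field P)"
proof -
 have "leq {p. it.valid p}" by (rule leq_sub[OF leq_Cset]) (use valid_Cset in blast)
 then show ?thesis unfolding Field_P by (rule leq_image)
qed

lemma small_leq: "leq A ==> fc.small A"
proof -
 assume "leq A"
 then have "|A| \<le>o |Field \<Lambda>|" unfolding leq_Field .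
 also have "|Field \<Lambda>| \<le>o |UNIV :: 'u set|" by (rule card_of_mono1) simp
 also have "|UNIV :: 'u set| \<le>o |UNIV :: 'u set set|" using card_of_Pow[of "UNIV :: 'u set"] ordLess_imp_ordLeq by auto
 also have "|UNIV :: 'u set set| \<le>o |fc.big|" by (rule fc.big_ordLeq(1))
 finally show ?thesis unfolding fc.small_def .
qed

end

section \<open>The continuum and the bounding number\<close>

context forcing
begin

lemma sub_om_eqI:
 assumes x: "fo p (Subset x om)" and y: "fo p (Subset y om)"
  and e: "!!q n. q << p ==> fmem q (nm n) x \<longleftrightarrow> fmem q (nm n) y"
 shows "feq p x y"
proof (rule feq_ext)
 fix z q assume q: "q << p"
 have "fmem s (nm n) x \<longleftrightarrow> fmem s (nm n) y" if "s << q" for s n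
  using e le_trans[OF that q] by blast
 then show "fmem q z x = fmem q z y"
  unfolding fmem_sub_om[OF x q] fmem_sub_om[OF y q] using le_trans by meson
qed

text \<open>Elements of a set are known only densely and up to forced equality; for a formula that
  respects equality this is enough.\<close>

lemma fo_ball_dense:
 assumes c: "cong \<phi>" and A: "!!q x. q << p ==> fmem q x A ==> \<exists>r y. r << q \<and> feq r x y \<and> fo r (\<phi> y)"
 shows "fo p (BAll A \<phi>)"
 unfolding fo_ball
proof (intro allI impI, rule fo_dense)
 fix x q s assume q: "q << p" "fmem q x A" and s: "s << q"
 obtain r y where r: "r << s" "feq r x y" "fo r (\<phi> y)" using A[OF le_trans[OF s q(1)] fmem_mono[OF q(2) s]] by blast
 then have "fo r (\<phi> x)" using cong_fo[OF c r(2) le_field(1)[OF r(1)]] by blast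
 then show "\<exists>r. r << s \<and> fo r (\<phi> x)" using r(1) by blast
qed

lemma fo_ball_check_set:
 assumes "cong \<phi>" "small S" "!!\<sigma> q. \<sigma> \<in> S ==> q << p ==> fo q (\<phi> \<sigma>)"
 shows "fo p (BAll (check_set S) \<phi>)"
proof (rule fo_ball_dense[OF assms(1)])
 fix q x assume q: "q << p" "fmem q x (check_set S)"
 then obtain r \<sigma> where r: "r << q" "\<sigma> \<in> S" "feq r x \<sigma>"
  unfolding fmem_check_set[OF assms(2)] using le_refl1(1) by blast
 then show "\<exists>r y. r << q \<and> feq r x y \<and> fo r (\<phi> y)" using assms(3) le_trans[OF r(1) q(1)] by blast
qed

lemma ex_om:
 assumes h: "fo q (Ex \<phi>)" and u: "!!r x. r << q ==> fo r (\<phi> x) ==> fmem r u om"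
 shows "fmem q u om"
proof (rule fmem_dense)
 fix r assume r: "r << q"
 then obtain s x where "s << r" "fo s (\<phi> x)" using h unfolding fo_ex by blast
 then show "\<exists>s. s << r \<and> fmem s u om" using u le_trans r by blast
qed

lemma pred_nat2:
 fixes f g :: "'p set => nat"
 assumes "f \<in> measurable M (count_space UNIV)" "g \<in> measurable M (count_space UNIV)"
 shows "mpred (%G. R (f G) (g G))"
proof (rule measurable_compose_countable[where f = "%k G. R k (g G)", OF _ assms(1)])
 show "mpred (%G. R k (g G))" for k
  by (rule measurable_compose[OF assms(2)]) simp
qed

lemma pred_mfun_le: "mfun Z ==> mfun Z' ==> mpred (%G. \<forall>n\<ge>m. Z G n \<le> Z' G n)"
 by (intro pred_intros_countable pred_intros_logic pred_nat2 mfunD; simp)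

lemma ev_shift: "(\<exists>m::nat. \<forall>n>m. Q n) \<longleftrightarrow> (\<exists>m. \<forall>n\<ge>m. Q n)"
 by (meson less_imp_le_nat Suc_le_lessD order_less_le_trans lessI)

lemma cong_le_star: "cong (%f. le_star f g)" "cong (%g. le_star f g)"
 unfolding le_star_def by (intro congs)+

lemma Tr_le_star:
 assumes f: "fo p (is_fun f om om)" and g: "fo p (is_fun g om om)"
  and p: "p \<in> Field P"
 shows "Tr p (le_star f g) (%G. \<exists>m. \<forall>n\<ge>m. val f G n \<le> val g G n)"
proof -
 have ug: "fmem q v om" if "q << p" "fo q (rel2 g n v)" for q n v
  using rel2_fun_om[OF g that] .
 have uf: "fmem q v om" if "q << p" "fo q (rel2 f n v)" for q n v
  using rel2_fun_om[OF f that] .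
 have "Tr p (le_star f g) (%G. \<exists>m. \<forall>n. m < n -->
   (\<exists>u v. val f G n = u \<and> val g G n = v \<and> (u < v \<or> u = v)))"
  unfolding le_star_def
 proof (intro Tr_bex_om Tr_ball_om Tr_imp Tr_nat_mem p)
  fix m n
  show "Tr p (Ex (%u. Ex (%v. Conj (rel2 f (nm n) u) (Conj (rel2 g (nm n) v) (Disj (Mem u v) (Eq u v))))))
     (%G. \<exists>u v. val f G n = u \<and> val g G n = v \<and> (u < v \<or> u = v))"
  proof (intro Tr_ex Tr_conj Tr_disj Tr_val[OF f p] Tr_val[OF g p] Tr_nat_mem Tr_nat_eq p)
   fix q u assume q: "q << p"
    and h: "fo q (Ex (%v. Conj (rel2 f (nm n) u) (Conj (rel2 g (nm n) v) (Disj (Mem u v) (Eq u v)))))"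
   show "fmem q u om"
    by (rule ex_om[OF h]) (use uf le_trans q in \<open>unfold fo_conj, blast\<close>)
  next
   fix u q v assume "q << p" "fo q (Conj (rel2 f (nm n) (nm u))
     (Conj (rel2 g (nm n) v) (Disj (Mem (nm u) v) (Eq (nm u) v))))"
   then show "fmem q v om" unfolding fo_conj using ug by blast
  qed (intro congs)+
 qed (intro congs)+
 then show ?thesis
 proof (rule Tr_cong)
  fix G
  have "(\<exists>u v. val f G n = u \<and> val g G n = v \<and> (u < v \<or> u = v)) \<longleftrightarrow> val f G n \<le> val g G n" for n by auto
  then show "(\<exists>m. \<forall>n. m < n --> (\<exists>u v. val f G n = u \<and> val g G n = v \<and> (u < v \<or> u = v))) \<longleftrightarrow>
    (\<exists>m. \<forall>n\<ge>m. val f G n \<le> val g G n)" using ev_shift[of "%n. val f G n \<le> val g G n"] by simp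
 qed
qed

end

section \<open>Values of the continuum and of the bounding number\<close>

context model
begin

lemma natLeq_L: "natLeq <o \<Lambda>"
proof -
 have "\<kappa> \<le>o \<Lambda>" using leq_k k(1) card_of_Field_ordIso ordIso_symmetric ordIso_ordLeq_trans unfolding leq_def by blast
 then show ?thesis using k(2) ordLess_ordLeq_trans by blast
qed

lemma small_fields: "fc.small (Field \<kappa>)" "fc.small (Field \<nu>)" "fc.small (Field \<mu>)" "fc.small (Field \<Lambda>)"
 using leq_fields small_leq by blast+

text \<open>Every subset of \<open>\<omega>\<close> in the extension has a name that is coded by countably many conditions.\<close>

definition nice :: "(nat => 'u set set) => 'u set name" where
 "nice A = fc.coll UNIV nm (%n q. \<exists>x\<in>A n. q << x)"

lemma fmem_nice: "fc.fmem p x (nice A) \<longleftrightarrow> (\<forall>q. q << p -->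
  (\<exists>r. r << q \<and> (\<exists>n. (\<exists>y\<in>A n. r << y) \<and> fc.feq r x (nm n))))"
 unfolding nice_def by (subst fc.fmem_coll) (auto intro: fc.small_nat fc.le_trans)

lemma nice_sub: "fc.fo p (Subset (nice A) om)"
 unfolding fc.fo_subset fmem_nice fc.fmem_om by blast

lemma nice_ex:
 assumes x: "fc.fo p (Subset x om)"
 shows "\<exists>A. (\<forall>n. A n \<subseteq> Field P \<and> countable (A n)) \<and> fc.feq p x (nice A)"
proof (intro exI conjI allI)
 let ?A = "%n. fc.wit (Mem (nm n) x)"
 show "?A n \<subseteq> Field P" "countable (?A n)" for n
  using fc.maxantiD(1,2)[OF fc.maxanti_wit[of "Mem (nm n) x"]] by blast+
 show "fc.feq p x (nice ?A)"
 proof (rule fc.sub_om_eqI[OF x nice_sub])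
  fix q n assume q: "q << p"
  note m = fc.maxantiD[OF fc.maxanti_wit[of "Mem (nm n) x"]]
  show "fc.fmem q (nm n) x \<longleftrightarrow> fc.fmem q (nm n) (nice ?A)"
  proof
   assume h: "fc.fmem q (nm n) x"
   show "fc.fmem q (nm n) (nice ?A)" unfolding fmem_nice
   proof (intro allI impI)
    fix r assume r: "r << q"
    then have "r \<in> {q \<in> Field P. fc.fo q (Mem (nm n) x)}" using h fc.fmem_mono fc.le_field(1) by simp
    then obtain y s where y: "y \<in> ?A n" "s << y" "s << r" using m(4) by blast
    then show "\<exists>r'. r' << r \<and> (\<exists>n'. (\<exists>y\<in>?A n'. r' << y) \<and> fc.feq r' (nm n) (nm n'))"
     using fc.feq_refl by blast
   qed
  next
   assume h: "fc.fmem q (nm n) (nice ?A)"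
   show "fc.fmem q (nm n) x"
   proof (rule fc.fmem_dense)
    fix r assume "r << q"
    then obtain s n' y where s: "s << r" "y \<in> ?A n'" "s << y" "fc.feq s (nm n) (nm n')"
     using h unfolding fmem_nice by blast
    have "n = n'" using fc.nat_feq[OF fc.le_field(1)[OF s(1)]] s(4) by blast
    then have "fc.fmem y (nm n) x" using m(1) s(2) by auto
    then show "\<exists>s. s << r \<and> fc.fmem s (nm n) x" using s(1,3) fc.fmem_mono by blast
   qed
  qed
 qed
qed

definition nice_codes :: "(nat => 'u set set) set" where
 "nice_codes = {A. range A \<subseteq> {B. B \<subseteq> Field P \<and> countable B}}"

definition nice_enum :: "'u => nat => 'u set set" where
 "nice_enum = (SOME f. f ` Field \<Lambda> = nice_codes)"

lemma nice_enum: "nice_enum ` Field \<Lambda> = nice_codes"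
proof -
 have "leq nice_codes" unfolding nice_codes_def by (intro leq_seq leq_countable_sets leq_Field_P)
 moreover have "(%n. {}) \<in> nice_codes" unfolding nice_codes_def by auto
 ultimately have "\<exists>f. f ` Field \<Lambda> = nice_codes" using leq_surj[of nice_codes] by blast
 then show ?thesis unfolding nice_enum_def by (rule someI_ex)
qed

lemma nice_enum_ex:
 assumes "fc.fo p (Subset x om)"
 shows "\<exists>\<xi>\<in>Field \<Lambda>. fc.feq p x (nice (nice_enum \<xi>))"
proof -
 obtain A where A: "\<forall>n. A n \<subseteq> Field P \<and> countable (A n)" "fc.feq p x (nice A)" using nice_ex[OF assms] by blast
 have "A \<in> nice_enum ` Field \<Lambda>" unfolding nice_enum nice_codes_def using A(1) by auto
 then show ?thesis using A(2) by auto
qed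

lemma fo_is_Pow: "fc.fo p (is_Pow Y A) \<longleftrightarrow> (\<forall>x q. q << p --> fc.fmem q x Y \<longleftrightarrow> fc.fo q (Subset x A))"
 unfolding is_Pow_def forces.simps(5) fc.fo_iff by simp

lemma fname_vals:
 assumes "fc.mfun Z" "fc.mfun Z'" "p \<in> Field P" "fc.feq p (fc.sname (%G. {n. Z G n = 1})) (fc.sname (%G. {n. Z' G n = 1}))"
 shows "ev p (%G. \<forall>n. Z G n = 1 \<longleftrightarrow> Z' G n = 1)"
proof -
 have m: "fc.mset (%G. {n. Y G n = 1})" if "fc.mfun Y" for Y
 proof -
  note [measurable] = fc.mfunD[OF that]
  show ?thesis unfolding fc.mset_def by simp
 qed
 show ?thesis
  using fc.sub_om_ev[OF assms(4,3)] fc.sval_sname[OF m[OF assms(1)] assms(3)] fc.sval_sname[OF m[OF assms(2)] assms(3)]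
  by eventually_elim blast
qed

text \<open>Nice names are enumerated by \<open>\<Lambda>\<close>, which bounds the continuum from
  above. An enumeration of length \<open>b\<close> below \<open>\<Lambda>\<close> would assign to
  the distinct Cohen reals values below \<open>b\<close>, a collapse.\<close>

lemma continuum: "p \<in> Field P ==> fc.fo p (continuum_eq (check_ord \<Lambda>))"
 unfolding continuum_eq_def
proof (rule fc.least_card_forced[OF L natLeq_L small_fields(4)])
 fix p assume p: "p \<in> Field P"
 let ?y = "%\<xi>. nice (nice_enum \<xi>)"
 have s: "fc.small (?y ` Field \<Lambda>)" by (rule fc.small_image[OF small_fields(4)])
 show "fc.fo p (is_Pow (check_set (?y ` Field \<Lambda>)) om)" unfolding fo_is_Pow
 proof (intro allI impI iffI)
  fix x q assume q: "q << p" and h: "fc.fmem q x (check_set (?y ` Field \<Lambda>))"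
  show "fc.fo q (Subset x om)"
  proof (rule fc.fo_dense)
   fix r assume "r << q"
   then obtain s \<xi> where s: "s << r" "fc.feq s x (?y \<xi>)" using h unfolding fc.fmem_check_set[OF s] by blast
   then have "fc.fo s (Subset x om)"
    using fc.cong_fo[OF fc.cong_subset1 s(2) fc.le_field(1)[OF s(1)]] nice_sub by blast
   then show "\<exists>s. s << r \<and> fc.fo s (Subset x om)" using s(1) by blast
  qed
 next
  fix x q assume q: "q << p" and h: "fc.fo q (Subset x om)"
  obtain \<xi> where \<xi>: "\<xi> \<in> Field \<Lambda>" "fc.feq q x (?y \<xi>)" using nice_enum_ex[OF h] by blast
  have "fc.fmem q (?y \<xi>) (check_set (?y ` Field \<Lambda>))" by (intro fc.fmem_check_setI s imageI \<xi>(1))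
  then show "fc.fmem q x (check_set (?y ` Field \<Lambda>))" using \<xi>(2) fc.fmem_cong1 fc.feq_sym by blast
 qed
next
 fix b p X assume b: "b \<in> Field \<Lambda>" and p: "p \<in> Field P" and X: "fc.fo p (is_Pow X om)"
 have wo: "fc.smallwo \<Lambda>" using WOL small_fields(4) unfolding fc.smallwo_def by blast
 show "\<not> fc.fo p (equinumerous X (check_elt \<Lambda> b))"
 proof
  assume "fc.fo p (equinumerous X (check_elt \<Lambda> b))"
  then have e: "fc.fo p (equinumerous X (check_set (check_elt \<Lambda> ` underS \<Lambda> b)))"
   using fc.check_elt_unfold[OF WOL, of b] by simp
  obtain x where x: "!!z q. q << p ==> fc.fmem q z X ==> \<exists>r. r << q \<and> (\<exists>a\<in>underS \<Lambda> b. fc.feq r z (x a))"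
   by (rule fc.bij_unpack[OF fc.smallwoD(3)[OF wo] e p], rule that)
  let ?c = "%\<xi>. fc.sname (%G. {n. cr \<Lambda> \<xi> G n = 1})"
  show False
  proof (rule fc.no_ccc_collapse[OF L natLeq_L b, where R = "%\<xi> a q. q \<in> Field P \<and> fc.feq q (?c \<xi>) (x a)"])
   fix \<xi> assume "\<xi> \<in> Field \<Lambda>"
   have "fc.fmem p (?c \<xi>) X" using X p fc.sname_sub unfolding fo_is_Pow by simp
   then obtain r a where "r << p" "a \<in> underS \<Lambda> b" "fc.feq r (?c \<xi>) (x a)" using x p fc.le_refl by blast
   then show "\<exists>q\<in>Field P. \<exists>\<beta>\<in>underS \<Lambda> b. q \<in> Field P \<and> fc.feq q (?c \<xi>) (x \<beta>)" using fc.le_field(1) by blast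
  next
   fix \<xi> \<zeta> a q q' r assume xi: "\<xi> \<in> Field \<Lambda>" "\<zeta> \<in> Field \<Lambda>" and h: "q \<in> Field P \<and> fc.feq q (?c \<xi>) (x a)"
    "q' \<in> Field P \<and> fc.feq q' (?c \<zeta>) (x a)" "r << q" "r << q'"
   have "fc.feq r (?c \<xi>) (?c \<zeta>)" using h fc.feq_mono fc.feq_trans fc.feq_sym by meson
   then have ev: "ev r (%G. \<forall>n. cr \<Lambda> \<xi> G n = 1 \<longleftrightarrow> cr \<Lambda> \<zeta> G n = 1)"
    using fname_vals[OF mfun_cr mfun_cr fc.le_field(1)[OF h(3)]] by blast
   show "\<xi> = \<zeta>"
   proof (rule ccontr)
    assume "\<xi> ~= \<zeta>"
    then obtain s n where s: "s << r" "ev s (%G. cr \<Lambda> \<xi> G n = 1 \<and> cr \<Lambda> \<zeta> G n = 0)"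
     using cr_distinct[OF leq_fields(4) xi _ fc.le_field(1)[OF h(3)]] by blast
    have "ev s (%G. False)"
     using s(2) fc.ev_gen_le[OF ev s(1)] by eventually_elim (metis zero_neq_one)
    then show False using fc.gen_nontriv fc.le_field(1)[OF s(1)] by blast
   qed
  qed
 qed
qed

lemma wo_fields: "fc.smallwo \<kappa>" "fc.smallwo \<nu>" "fc.smallwo \<mu>"
 using k(1) nu(1) mu(1) small_fields unfolding fc.smallwo_def card_order_on_def by blast+

lemma unpack_elt:
 assumes wo: "fc.smallwo \<theta>" and e: "fc.fo p (equinumerous Y (check_elt \<theta> b))" and p: "p \<in> Field P"
 obtains x where "!!a. a \<in> underS \<theta> b ==> fc.fmem p (x a) Y"
  "!!z q. q << p ==> fc.fmem q z Y ==> \<exists>r. r << q \<and> (\<exists>a\<in>underS \<theta> b. fc.feq r z (x a))"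
proof -
 have e': "fc.fo p (equinumerous Y (check_set (check_elt \<theta> ` underS \<theta> b)))"
  using e fc.check_elt_unfold[OF fc.smallwoD(1)[OF wo], of b] by simp
 show ?thesis by (rule fc.bij_unpack[OF fc.smallwoD(3)[OF wo] e' p], rule that)
qed

text \<open>A function \<open>g\<close> dominating all Cohen reals does so from places that serve as
  labels; with the label fixed, one of the reals can exceed the decided value of \<open>g\<close> at
  a later place. Fewer than \<open>\<kappa>\<close> functions are dominated by the real of one
  coordinate.\<close>

lemma bounding: "p \<in> Field P ==> fc.fo p (bounding_eq (check_ord \<kappa>))"
 unfolding bounding_eq_def
proof (rule fc.least_card_forced[OF k(1,2) small_fields(1)])
 fix p assume p: "p \<in> Field P"
 let ?y = "%\<xi>. fc.fname (cr \<kappa> \<xi>)"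
 have s: "fc.small (?y ` Field \<kappa>)" by (rule fc.small_image[OF small_fields(1)])
 show "fc.fo p (unbounded (check_set (?y ` Field \<kappa>)))"
  unfolding unbounded_def fc.fo_conj
 proof
  show "fc.fo p (BAll (check_set (?y ` Field \<kappa>)) (%f. is_fun f om om))"
   by (rule fc.fo_ball_check_set[OF fc.cong_is_fun(1) s]) (use fc.fname_fun[OF mfun_cr] in blast)
  show "fc.fo p (Neg (Ex (%g. Conj (is_fun g om om) (BAll (check_set (?y ` Field \<kappa>)) (%f. le_star f g)))))"
   unfolding fc.fo_neg
  proof (intro allI impI notI)
   fix q assume q: "q << p" and h: "fc.fo q (Ex (%g. Conj (is_fun g om om)
     (BAll (check_set (?y ` Field \<kappa>)) (%f. le_star f g))))"
   obtain r g where r: "r << q" "fc.fo r (is_fun g om om)"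
    "fc.fo r (BAll (check_set (?y ` Field \<kappa>)) (%f. le_star f g))"
    using h fc.le_refl1(1)[OF q] unfolding fc.fo_ex fc.fo_conj by blast
   have rF: "r \<in> Field P" using fc.le_field(1)[OF r(1)] .
   have "\<exists>s m. s << r \<and> ev s (%G. \<forall>n\<ge>m. cr \<kappa> \<xi> G n \<le> fc.val g G n)"
    if \<xi>: "\<xi> \<in> Field \<kappa>" for \<xi>
   proof -
    have "fc.fmem r (?y \<xi>) (check_set (?y ` Field \<kappa>))" by (intro fc.fmem_check_setI s imageI \<xi>)
    then have "fc.fo r (le_star (?y \<xi>) g)" using r(3) fc.le_refl[OF rF] unfolding fc.fo_ball by blast
    then have "ev r (%G. \<exists>m. \<forall>n\<ge>m. fc.val (?y \<xi>) G n \<le> fc.val g G n)"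
     using fc.TrD'[OF fc.Tr_le_star[OF fc.fname_fun[OF mfun_cr] r(2) rF] rF] by blast
    then have "ev r (%G. \<exists>m. \<forall>n\<ge>m. cr \<kappa> \<xi> G n \<le> fc.val g G n)"
     using fc.val_fname[OF mfun_cr[of \<kappa> \<xi>] rF] by eventually_elim simp
    moreover have "mpred (%G. \<forall>n\<ge>m. cr \<kappa> \<xi> G n \<le> fc.val g G n)" for m
     by (rule fc.pred_mfun_le[OF mfun_cr fc.mfun_val])
    ultimately show ?thesis using fc.ev_ex_nat[of "%m G. \<forall>n\<ge>m. cr \<kappa> \<xi> G n \<le> fc.val g G n" r] rF by blast
   qed
   then have "\<forall>\<xi>\<in>Field \<kappa>. \<exists>t. (fst t, r) \<in> P \<and> ev (fst t) (%G. \<forall>n\<ge>snd t. cr \<kappa> \<xi> G n \<le> fc.val g G n)"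
    by force
   from bchoice[OF this] obtain t where t: "\<forall>\<xi>\<in>Field \<kappa>. fst (t \<xi>) << r \<and>
    ev (fst (t \<xi>)) (%G. \<forall>n\<ge>snd (t \<xi>). cr \<kappa> \<xi> G n \<le> fc.val g G n)" by (elim exE)
   define ps m where "ps \<xi> = fst (t \<xi>)" and "m \<xi> = snd (t \<xi>)" for \<xi>
   have ps: "ps \<xi> << r" "ev (ps \<xi>) (%G. \<forall>n\<ge>m \<xi>. cr \<kappa> \<xi> G n \<le> fc.val g G n)"
    if "\<xi> \<in> Field \<kappa>" for \<xi> using t that unfolding ps_def m_def by blast+
   have "ps \<xi> \<in> Field P" if "\<xi> \<in> Field \<kappa>" for \<xi> using fc.le_field(1)[OF ps(1)[OF that]] .
   from ub_kappa[of ps "fc.val g" m, OF this fc.mfun_val] obtain n0 l where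
    "\<forall>n\<ge>n0. \<exists>\<xi>\<in>Field \<kappa>. \<exists>q. m \<xi> = l \<and> q << ps \<xi> \<and> ev q (%G. cr \<kappa> \<xi> G n = Suc (fc.val g G n))"
    by blast
   then obtain \<xi> t where t: "\<xi> \<in> Field \<kappa>" "m \<xi> = l" "t << ps \<xi>"
    "ev t (%G. cr \<kappa> \<xi> G (max n0 l) = Suc (fc.val g G (max n0 l)))"
    by (meson max.cobounded1)
   have "ev t (%G. False)"
    using t(4) fc.ev_gen_le[OF ps(2)[OF t(1)] t(3)]
   proof eventually_elim
    case (elim G)
    have "m \<xi> \<le> max n0 l" using t(2) by simp
    then have "cr \<kappa> \<xi> G (max n0 l) \<le> fc.val g G (max n0 l)" using elim(2) by blast
    then show ?case using elim(1) by simp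
   qed
   then show False using fc.gen_nontriv fc.le_field(1)[OF t(3)] by blast
  qed
 qed
next
 fix b p X assume b: "b \<in> Field \<kappa>" and p: "p \<in> Field P" and X: "fc.fo p (unbounded X)"
 show "\<not> fc.fo p (equinumerous X (check_elt \<kappa> b))"
 proof
  assume e: "fc.fo p (equinumerous X (check_elt \<kappa> b))"
  obtain x where x: "!!a. a \<in> underS \<kappa> b ==> fc.fmem p (x a) X"
   "!!z q. q << p ==> fc.fmem q z X ==> \<exists>r. r << q \<and> (\<exists>a\<in>underS \<kappa> b. fc.feq r z (x a))"
   by (rule unpack_elt[OF wo_fields(1) e p], rule that)
  have fn: "fc.fo p (is_fun (x a) om om)" if "a \<in> underS \<kappa> b" for a
   using X x(1)[OF that] fc.le_refl[OF p] unfolding unbounded_def fc.fo_conj fc.fo_ball by blast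
  have "|(%a. fc.val (x a)) ` underS \<kappa> b| <o \<kappa>"
   using card_of_image card_of_underS[OF k(1) b] ordLeq_ordLess_trans by blast
  then obtain d where d: "fc.mfun d"
   "!!Z p. Z \<in> (%a. fc.val (x a)) ` underS \<kappa> b ==> ev p (%G. \<exists>m. \<forall>n\<ge>m. Z G n \<le> d G n)"
   by (rule dominating[rotated]) (use fc.mfun_val in auto)
  have "fc.fo p (BAll X (%f. le_star f (fc.fname d)))"
  proof (rule fc.fo_ball_dense[OF fc.cong_le_star(1)])
   fix q z assume q: "q << p" "fc.fmem q z X"
   obtain r a where r: "r << q" "a \<in> underS \<kappa> b" "fc.feq r z (x a)" using x(2)[OF q] by blast
   have rF: "r \<in> Field P" using fc.le_field(1)[OF r(1)] .
   have rp: "r << p" using fc.le_trans[OF r(1) q(1)] .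
   have "ev r (%G. \<exists>m. \<forall>n\<ge>m. fc.val (x a) G n \<le> d G n)" using d(2) r(2) by blast
   then have "ev r (%G. \<exists>m. \<forall>n\<ge>m. fc.val (x a) G n \<le> fc.val (fc.fname d) G n)"
    using fc.val_fname[OF d(1) rF] by eventually_elim simp
   then have "fc.fo r (le_star (x a) (fc.fname d))"
    using fc.TrD'[OF fc.Tr_le_star[OF fc.fo_mono[OF fn[OF r(2)] rp] fc.fname_fun[OF d(1)] rF] rF] by blast
   then show "\<exists>r y. r << q \<and> fc.feq r z y \<and> fc.fo r (le_star y (fc.fname d))" using r by blast
  qed
  then have "fc.fo p (Ex (%g. Conj (is_fun g om om) (BAll X (%f. le_star f g))))"
   by (intro fc.fo_exI[of _ "fc.fname d"]) (simp only: fc.fo_conj fc.fname_fun[OF d(1)] simp_thms)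
  then show False using X fc.le_refl[OF p] unfolding unbounded_def fc.fo_conj fc.fo_neg by blast
 qed
qed

end

section \<open>The ideal in the extension\<close>

lemma Ic_card:
 assumes c: "!!i. 2 \<le> c i"
 shows "x \<in> Ic c a \<longleftrightarrow> (\<exists>k. \<forall>i. card (x \<inter> a i) < c i ^ k)"
proof -
 have "log (real (c i)) (real m + 1) \<le> real k \<longleftrightarrow> m < c i ^ k" for i m k
 proof -
  have "log (real (c i)) (real m + 1) \<le> real k \<longleftrightarrow> real m + 1 \<le> real (c i) powr real k"
   using c[of i] by (subst log_le_iff) auto
  also have "\<dots> \<longleftrightarrow> real (m + 1) \<le> real (c i ^ k)"
   using c[of i] by (subst powr_realpow) auto
  finally show ?thesis unfolding of_nat_le_iff by auto
 qed
 then show ?thesis using Ic_iff[OF c] by simp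
qed

lemma Ic_sub:
 assumes "index_partition a" "x \<in> Ic c a" "y \<subseteq> x" "!!i. 2 \<le> c i" shows "y \<in> Ic c a"
proof -
 obtain k where k: "!!i. card (x \<inter> a i) < c i ^ k" using assms(2) Ic_card[of c, OF assms(4)] by blast
 have "card (y \<inter> a i) \<le> card (x \<inter> a i)" for i
  using assms(1,3) unfolding index_partition_def by (intro card_mono) auto
 then show ?thesis using k Ic_card[of c, OF assms(4)] le_less_trans by blast
qed

text \<open>Infinitely many blocks are distributed among the \<open>A k\<close>, those of
  \<open>A k\<close> containing disjoint pieces of size \<open>c i ^ k\<close>. A set with one piece
  per block meets each \<open>A k\<close> in a member of the ideal, while on suitable blocks there
  are \<open>c i ^ g\<close> pieces to choose from, for every \<open>g\<close>.\<close>

lemma gap_sets: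
 assumes c: "!!i. 2 \<le> (c i :: nat)" and a: "index_partition a" and nt: "Ic_nontrivial c a"
 obtains A :: "nat => nat set" and Y :: "nat => nat => nat set"
 where "inj A" "!!i l. Y i l \<subseteq> a i" "!!i l l'. l ~= l' ==> Y i l \<inter> Y i l' = {}"
  "!!k i l. card (A k \<inter> Y i l) \<le> c i ^ k"
  "!!k g n. \<exists>i\<ge>n. \<forall>l<c i ^ g. Y i l \<subseteq> A k \<and> card (Y i l) = c i ^ k"
proof -
 have dis: "x \<in> a i ==> x \<in> a j ==> i = j" for x i j
  using a unfolding index_partition_def disjoint_family_on_def by auto
 have fin: "finite (a i)" "a i ~= {}" for i using a unfolding index_partition_def by blast+
 have "\<forall>e j. \<exists>i>j. c i ^ e \<le> card (a i)" using nt unfolding Ic_nontrivial_def INFM_nat by blast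
 then obtain h where h: "!!e j. h e j > j" "!!e j. c (h e j) ^ e \<le> card (a (h e j))" by metis
 \<comment> \<open>An increasing sequence of blocks, the \<open>e\<close>-th having at least
   \<open>c i ^ e\<close> elements; the pairing function will assign infinitely many of them to each
   \<open>k\<close>.\<close>
 define I where "I = rec_nat (h 0 0) (%e i. h (Suc e) i)"
 have mono: "strict_mono I" unfolding strict_mono_Suc_iff by (simp add: I_def h(1))
 have I_card: "c (I e) ^ e \<le> card (a (I e))" for e
  using h(2)[of 0 0] by (cases e) (simp_all add: I_def h(2) del: power_Suc)
 have "\<forall>i. \<exists>f. bij_betw f {0..<card (a i)} (a i)" using ex_bij_betw_nat_finite[OF fin(1)] by blast
 then obtain f where f: "!!i. bij_betw (f i) {0..<card (a i)} (a i)" by metis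
 have f_inj: "inj_on (f i) {0..<card (a i)}" for i using bij_betw_imp_inj_on[OF f] .
 have f_im: "f i ` {0..<card (a i)} = a i" for i using bij_betw_imp_surj_on[OF f] .
 define K where "K i = fst (prod_decode (inv I i))" for i
 have K: "K (I e) = fst (prod_decode e)" for e
  unfolding K_def using inv_f_f[OF strict_mono_imp_inj_on[OF mono]] by simp
 define A where "A k = (\<Union>i\<in>{i \<in> range I. K i = k}. a i)" for k
 define L where "L i l = {l * c i ^ K i..<(l + 1) * c i ^ K i}" for i l
 define Y where "Y i l = (if i \<in> range I \<and> (l + 1) * c i ^ K i \<le> card (a i) then f i ` L i l else {})" for i l
 have L: "L i l \<subseteq> {0..<card (a i)}" if "(l + 1) * c i ^ K i \<le> card (a i)" for i l
  using that unfolding L_def by auto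
 have Y_card: "card (Y i l) = c i ^ K i" if "Y i l ~= {}" for i l
  using that card_image[OF inj_on_subset[OF f_inj L]] unfolding Y_def by (auto simp: L_def split: if_splits)
 have Y_sub: "Y i l \<subseteq> a i" for i l
  using image_mono[OF L, of l i "f i"] f_im[of i] unfolding Y_def by auto
 have L_dis: "L i l \<inter> L i l' = {}" if "l < l'" for i l l'
 proof -
  have "(l + 1) * c i ^ K i \<le> l' * c i ^ K i" using that by (intro mult_right_mono) auto
  then show ?thesis unfolding L_def by auto
 qed
 have Y_dis: "Y i l \<inter> Y i l' = {}" if "l ~= l'" for i l l'
 proof (cases "Y i l ~= {} \<and> Y i l' ~= {}")
  case True
  then have *: "(l + 1) * c i ^ K i \<le> card (a i)" "(l' + 1) * c i ^ K i \<le> card (a i)"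
   and Y: "Y i l = f i ` L i l" "Y i l' = f i ` L i l'" unfolding Y_def by (auto split: if_splits)
  have "L i l \<inter> L i l' = {}" using L_dis[of l l' i] L_dis[of l' l i] that by (cases "l < l'") auto
  then show ?thesis unfolding Y inj_on_image_Int[OF f_inj L[OF *(1)] L[OF *(2)], symmetric] by simp
 qed auto
 have A_Y: "card (A k \<inter> Y i l) \<le> c i ^ k" for k i l
 proof (cases "Y i l ~= {} \<and> K i = k")
  case True
  have "card (A k \<inter> Y i l) \<le> card (Y i l)" using finite_subset[OF Y_sub fin(1)] by (intro card_mono) auto
  then show ?thesis using Y_card True by simp
 next
  case False
  then have "A k \<inter> Y i l = {}" using Y_sub[of i l] dis unfolding A_def by blast
  then show ?thesis by simp
 qed
 have big: "\<exists>i\<ge>n. \<forall>l<c i ^ g. Y i l \<subseteq> A k \<and> card (Y i l) = c i ^ k" for k g n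
 proof -
  \<comment> \<open>The second component makes \<open>e\<close> at least \<open>k + g + n\<close>:
    the block has space for \<open>c i ^ g\<close> pieces of size \<open>c i ^ k\<close> and does
    not come before \<open>n\<close>.\<close>
  define e where "e = prod_encode (k, k + g + n)"
  have e: "k + g + n \<le> e" unfolding e_def by (rule le_prod_encode_2)
  have i: "e \<le> I e" by (rule strict_mono_imp_increasing[OF mono])
  have Ke: "K (I e) = k" unfolding K e_def by simp
  have "Y (I e) l \<subseteq> A k \<and> card (Y (I e) l) = c (I e) ^ k" if l: "l < c (I e) ^ g" for l
  proof -
   have "(l + 1) * c (I e) ^ k \<le> c (I e) ^ g * c (I e) ^ k" using l by (intro mult_right_mono) auto
   also have "\<dots> = c (I e) ^ (g + k)" by (simp add: power_add)
   also have "\<dots> \<le> c (I e) ^ e" using c[of "I e"] e by (intro power_increasing) auto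
   also note I_card
   finally have le: "(l + 1) * c (I e) ^ K (I e) \<le> card (a (I e))" unfolding Ke .
   then have Y: "Y (I e) l = f (I e) ` L (I e) l" unfolding Y_def by simp
   have "card (f (I e) ` L (I e) l) = card (L (I e) l)"
    by (rule card_image[OF inj_on_subset[OF f_inj L[OF le]]])
   then have "card (Y (I e) l) = c (I e) ^ k" unfolding Y by (simp add: L_def Ke)
   moreover have "Y (I e) l \<subseteq> A k" using Y_sub Ke unfolding A_def by blast
   ultimately show ?thesis by blast
  qed
  then show ?thesis using e i by (intro exI[of _ "I e"]) auto
 qed
 have "inj A"
 proof (rule injI)
  fix k k' assume e: "A k = A k'"
  let ?i = "I (prod_encode (k, 0))"
  obtain x where x: "x \<in> a ?i" using fin(2) by blast
  have "K ?i = k" unfolding K by simp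
  then have "x \<in> A k" using x unfolding A_def by blast
  then have "x \<in> A k'" unfolding e .
  then obtain j where j: "x \<in> a j" "K j = k'" unfolding A_def by blast
  have "?i = j" by (rule dis[OF x j(1)])
  then show "k = k'" using j(2) \<open>K ?i = k\<close> by simp
 qed
 then show thesis by (rule that[OF _ Y_sub Y_dis A_Y big])
qed

section \<open>Set comprehension, finite cardinalities and the ideal under forcing\<close>

context forcing
begin

lemma Tr_dense:
 assumes m: "mpred \<Phi>" and d: "!!q. q << p ==> \<exists>r. r << q \<and> Tr r \<phi> \<Phi>"
 shows "Tr p \<phi> \<Phi>"
proof -
 have "fo q \<phi> \<longleftrightarrow> ev q \<Phi>" if q: "q << p" for q
 proof
  assume h: "fo q \<phi>"
  show "ev q \<Phi>"
  proof (rule ev_gen_dense[OF le_field(1)[OF q]])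
   fix s assume s: "s << q"
   obtain r where r: "r << s" "Tr r \<phi> \<Phi>" using d[OF le_trans[OF s q]] by blast
   have "fo r \<phi>" using fo_mono[OF h le_trans[OF r(1) s]] .
   then have "ev r \<Phi>" using TrD'[OF r(2) le_field(1)[OF r(1)]] by blast
   then show "\<exists>r. r << s \<and> ev r \<Phi>" using r(1) by blast
  qed
 next
  assume h: "ev q \<Phi>"
  show "fo q \<phi>"
  proof (rule fo_dense)
   fix s assume s: "s << q"
   obtain r where r: "r << s" "Tr r \<phi> \<Phi>" using d[OF le_trans[OF s q]] by blast
   have "ev r \<Phi>" using ev_gen_le[OF h le_trans[OF r(1) s]] .
   then have "fo r \<phi>" using TrD'[OF r(2) le_field(1)[OF r(1)]] by blast
   then show "\<exists>r. r << s \<and> fo r \<phi>" using r(1) by blast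
  qed
 qed
 then show ?thesis unfolding Tr_def using m by blast
qed

lemma om_agree:
 assumes c: "cong \<phi>" "cong \<psi>"
  and om: "!!r x. r << p ==> fo r (\<phi> x) ==> fmem r x om" "!!r x. r << p ==> fo r (\<psi> x) ==> fmem r x om"
  and n: "!!r n. r << p ==> fo r (\<phi> (nm n)) \<longleftrightarrow> fo r (\<psi> (nm n))" and q: "q << p"
 shows "fo q (\<phi> x) \<longleftrightarrow> fo q (\<psi> x)"
proof -
 have "fo q (\<psi> x)" if c: "cong \<phi>" "cong \<psi>" and om: "fmem q x om" and f: "fo q (\<phi> x)"
  and n: "!!r n. r << p ==> fo r (\<phi> (nm n)) \<longleftrightarrow> fo r (\<psi> (nm n))" for \<phi> \<psi>
 proof (rule fo_dense)
  fix r assume r: "r << q"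
  then obtain s n where s: "s << r" "feq s x (nm n)" using om unfolding fmem_om by blast
  have sF: "s \<in> Field P" and sq: "s << q" "s << p" using le_field(1)[OF s(1)] le_trans[OF s(1) r] le_trans q by blast+
  have "fo s (\<psi> x)"
   using fo_mono[OF f sq(1)] n[OF sq(2), of n] cong_fo[OF c(1) s(2) sF] cong_fo[OF c(2) s(2) sF] by blast
  then show "\<exists>s. s << r \<and> fo s (\<psi> x)" using s(1) by blast
 qed
 from this[OF c(1,2)] this[OF c(2,1)] show ?thesis using om[OF q] n by blast
qed

lemma sname_char:
 assumes Z: "mset Z" and c: "cong \<psi>" and om: "!!r x. r << p ==> fo r (\<psi> x) ==> fmem r x om"
  and tr: "!!n. Tr p (\<psi> (nm n)) (%G. n \<in> Z G)" and q: "q << p"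
 shows "fo q (All (%x. Iff (Mem x z) (\<psi> x))) \<longleftrightarrow> feq q z (sname Z)"
proof -
 have ag: "fo r (Mem x (sname Z)) \<longleftrightarrow> fo r (\<psi> x)" if r: "r << p" for r x
 proof (rule om_agree[OF cong_mem1 c _ om _ r])
  show "fo s (Mem x (sname Z)) ==> fmem s x om" for s x
   unfolding forces.simps fmem_sname fmem_om by blast
  show "fo s (Mem (nm n) (sname Z)) = fo s (\<psi> (nm n))" if "s << p" for s n
   using TrD[OF Tr_sname[OF Z] that] TrD[OF tr that] by blast
 qed
 have "fo q (All (%x. Iff (Mem x z) (\<psi> x))) \<longleftrightarrow> (\<forall>x r. r << q --> fmem r x z = fmem r x (sname Z))"
  unfolding forces.simps(5) fo_iff using ag le_trans[OF _ q] by auto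
 also have "\<dots> \<longleftrightarrow> feq q z (sname Z)" using feq_ext fmem_cong2 feq_mono feq_sym by metis
 finally show ?thesis .
qed

text \<open>Extensionality leaves no choice for \<open>z\<close>: it is forced to equal the name of
  the set described, so the quantifier disappears.\<close>

lemma Tr_ex_set:
 assumes Z: "mset Z" and c: "cong \<psi>" and om: "!!r x. r << p ==> fo r (\<psi> x) ==> fmem r x om"
  and tr: "!!n. Tr p (\<psi> (nm n)) (%G. n \<in> Z G)" and c': "cong \<phi>" and \<Phi>: "Tr p (\<phi> (sname Z)) \<Phi>"
 shows "Tr p (Ex (%z. Conj (All (%x. Iff (Mem x z) (\<psi> x))) (\<phi> z))) \<Phi>"
proof -
 note ch = sname_char[OF Z c om tr]
 have "fo q (Ex (%z. Conj (All (%x. Iff (Mem x z) (\<psi> x))) (\<phi> z))) \<longleftrightarrow> fo q (\<phi> (sname Z))" if q: "q << p" for q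
 proof
  assume h: "fo q (Ex (%z. Conj (All (%x. Iff (Mem x z) (\<psi> x))) (\<phi> z)))"
  show "fo q (\<phi> (sname Z))"
  proof (rule fo_exE[OF h])
   fix r z assume r: "r << q" and "fo r (Conj (All (%x. Iff (Mem x z) (\<psi> x))) (\<phi> z))"
   then have "feq r z (sname Z)" "fo r (\<phi> z)" unfolding fo_conj using ch le_trans[OF r q] by blast+
   then show "fo r (\<phi> (sname Z))" using cong_fo[OF c' _ le_field(1)[OF r]] by blast
  qed
 next
  assume h: "fo q (\<phi> (sname Z))"
  have "fo q (All (%x. Iff (Mem x (sname Z)) (\<psi> x)))" using ch q feq_refl by blast
  then have "fo q (Conj (All (%x. Iff (Mem x (sname Z)) (\<psi> x))) (\<phi> (sname Z)))" using h unfolding fo_conj by blast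
  then show "fo q (Ex (%z. Conj (All (%x. Iff (Mem x z) (\<psi> x))) (\<phi> z)))" by (rule fo_exI)
 qed
 then show ?thesis using \<Phi> unfolding Tr_def by blast
qed

lemma pred_slice:
 assumes Z: "mset Z" and F: "finite F"
 shows "mpred (%G. R (Z G \<inter> F))"
proof -
 have "mpred (%G. \<exists>X\<in>Pow F. R X \<and> (\<forall>n\<in>F. n \<in> X \<longleftrightarrow> n \<in> Z G))"
  using F by (intro pred_intros_finite pred_intros_logic msetD[OF Z]) auto
 moreover have "(\<exists>X\<in>Pow F. R X \<and> (\<forall>n\<in>F. n \<in> X \<longleftrightarrow> n \<in> Z G)) \<longleftrightarrow> R (Z G \<inter> F)" for G
 proof
  assume "\<exists>X\<in>Pow F. R X \<and> (\<forall>n\<in>F. n \<in> X \<longleftrightarrow> n \<in> Z G)"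
  then obtain X where "X \<subseteq> F" "R X" "\<forall>n\<in>F. n \<in> X \<longleftrightarrow> n \<in> Z G" by blast
  moreover have "X = Z G \<inter> F" using calculation by blast
  ultimately show "R (Z G \<inter> F)" by simp
 qed blast
 ultimately show ?thesis by simp
qed

lemma nat_measurableI:
 fixes f :: "'p set => nat"
 assumes "!!k. mpred (%G. f G = k)"
 shows "f \<in> measurable M (count_space UNIV)"
 unfolding measurable_count_space_eq2_countable
 using assms by (auto simp: pred_def vimage_def Int_def)

lemma fmem_check_nats:
 assumes "p \<in> Field P"
 shows "fmem p (nm n) (check_set (nm ` X)) \<longleftrightarrow> n \<in> X"
proof -
 note m = fmem_check_set[OF small_image[OF small_countable[OF countableI_type]]]
 have "n \<in> X" if h: "fmem p (nm n) (check_set (nm ` X))"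
 proof -
  obtain r k where r: "r << p" "k \<in> X" "feq r (nm n) (nm k)"
   using h le_refl[OF assms] unfolding m by blast
  then show ?thesis using nat_feq[OF le_field(1)[OF r(1)], of n k] by blast
 qed
 then show ?thesis using fmem_check_setI[OF small_image[OF small_countable[OF countableI_type]] imageI] by blast
qed

lemma check_nats_sub: "fo p (Subset (check_set (nm ` X)) om)"
 unfolding fo_subset fmem_om fmem_check_set[OF small_image[OF small_countable[OF countableI_type]]] by blast

text \<open>A forced bijection of finite sets is decided on all elements by finitely many steps to
  stronger conditions, and then gives injections both ways in the ground model.\<close>

lemma fin_equi:
 assumes X: "finite X" and r: "r \<in> Field P"
 shows "fo r (equinumerous (check_set (nm ` X)) (nm m)) \<longleftrightarrow> card X = m"
proof
 have un: "(nm m :: 'p name) = check_set (nm ` {..<m})" for m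
  using check_elt_unfold[OF natLeq_Well_order, of m] by simp
 assume "card X = m"
 then obtain g where g: "bij_betw g X {..<m}" using X by (metis atLeast0LessThan ex_bij_betw_finite_nat)
 have "fo r (equinumerous (check_set (nm ` X)) (check_set ((%n. nm (g n)) ` X)))"
 proof (rule bij_name)
  show "small X" by (rule small_finite[OF X])
  show "n = m" if "q << r" "feq q (nm n) (nm m)" for n m q
   using that nat_feq[OF le_field(1)[OF that(1)]] by blast
  show "n = m" if "n \<in> X" "m \<in> X" "q << r" "feq q (nm (g n)) (nm (g m))" for n m q
   using that nat_feq[OF le_field(1)[OF that(3)]] bij_betw_imp_inj_on[OF g] inj_onD by metis
 qed
 moreover have "(%n. nm (g n) :: 'p name) ` X = nm ` {..<m}"
  using bij_betw_imp_surj_on[OF g] by (metis image_image)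
 ultimately show "fo r (equinumerous (check_set (nm ` X)) (nm m))" using un[of m] by simp
next
 have un: "(nm m :: 'p name) = check_set (nm ` {..<m})" for m
  using check_elt_unfold[OF natLeq_Well_order, of m] by simp
 assume "fo r (equinumerous (check_set (nm ` X)) (nm m))"
 then have e: "fo r (equinumerous (check_set (nm ` X)) (check_set (nm ` {..<m})))" using un[of m] by simp
 obtain x where x: "!!a. a \<in> {..<m} ==> fmem r (x a) (check_set (nm ` X))"
  "!!z q. q << r ==> fmem q z (check_set (nm ` X)) ==> \<exists>s. s << q \<and> (\<exists>a\<in>{..<m}. feq s z (x a))"
  "!!a b q. a \<in> {..<m} ==> b \<in> {..<m} ==> q << r ==> feq q (x a) (x b) ==> feq q (nm a) (nm b)"
  by (rule bij_unpack[OF small_finite[OF finite_lessThan] e r], rule that)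
 have "\<exists>s. s << r \<and> (\<forall>n\<in>Y. \<exists>a\<in>{..<m}. feq s (nm n) (x a))" if "finite Y" "Y \<subseteq> X" for Y
  using that
 proof (induction Y)
  case empty then show ?case using le_refl[OF r] by blast
 next
  case (insert n Y)
  obtain s where s: "s << r" "\<forall>n\<in>Y. \<exists>a\<in>{..<m}. feq s (nm n) (x a)" using insert by blast
  have "fmem s (nm n) (check_set (nm ` X))"
   using fmem_check_nats[OF le_field(1)[OF s(1)]] insert.prems by blast
  then obtain t a where t: "t << s" "a \<in> {..<m}" "feq t (nm n) (x a)" using x(2)[OF s(1)] by blast
  have "\<forall>n\<in>insert n Y. \<exists>a\<in>{..<m}. feq t (nm n) (x a)" using s(2) t feq_mono by blast
  then show ?case using le_trans[OF t(1) s(1)] by blast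
 qed
 from this[OF X] obtain s where s: "s << r" "\<forall>n\<in>X. \<exists>a\<in>{..<m}. feq s (nm n) (x a)" by blast
 have "\<exists>t. t << s \<and> (\<forall>a\<in>Y. \<exists>n\<in>X. feq t (x a) (nm n))" if "finite Y" "Y \<subseteq> {..<m}" for Y
  using that
 proof (induction Y)
  case empty then show ?case using le_refl le_field(1)[OF s(1)] by blast
 next
  case (insert a Y)
  obtain t where t: "t << s" "\<forall>a\<in>Y. \<exists>n\<in>X. feq t (x a) (nm n)" using insert by blast
  have "fmem t (x a) (check_set (nm ` X))"
   using fmem_mono[OF x(1)] le_trans[OF t(1) s(1)] insert.prems by blast
  then obtain u n where u: "u << t" "n \<in> X" "feq u (x a) (nm n)"
   unfolding fmem_check_set[OF small_image[OF small_finite[OF X]]] using le_refl1(1)[OF t(1)] by blast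
  have "\<forall>a\<in>insert a Y. \<exists>n\<in>X. feq u (x a) (nm n)" using t(2) u feq_mono by blast
  then show ?case using le_trans[OF u(1) t(1)] by blast
 qed
 from this[OF finite_lessThan order_refl] obtain t where
  t: "t << s" "\<forall>a\<in>{..<m}. \<exists>n\<in>X. feq t (x a) (nm n)" by blast
 have tF: "t \<in> Field P" and tr: "t << r" using le_field(1)[OF t(1)] le_trans[OF t(1) s(1)] by blast+
 have s2: "\<forall>n\<in>X. \<exists>a. a \<in> {..<m} \<and> feq t (nm n) (x a)" using s(2) feq_mono t(1) by blast
 from bchoice[OF this] obtain f where f: "\<forall>n\<in>X. f n \<in> {..<m} \<and> feq t (nm n) (x (f n))" by (elim exE)
 have "inj_on f X"
 proof (rule inj_onI)
  fix n n' assume "n \<in> X" "n' \<in> X" "f n = f n'"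
  then have "feq t (nm n) (nm n')" using f feq_trans feq_sym by metis
  then show "n = n'" using nat_feq[OF tF] by blast
 qed
 then have 1: "card X \<le> m" using card_inj_on_le[of f X "{..<m}"] f by auto
 have "\<forall>a\<in>{..<m}. \<exists>n. n \<in> X \<and> feq t (x a) (nm n)" using t(2) by blast
 from bchoice[OF this] obtain g where g: "\<forall>a\<in>{..<m}. g a \<in> X \<and> feq t (x a) (nm (g a))" by (elim exE)
 have "inj_on g {..<m}"
 proof (rule inj_onI)
  fix a b assume ab: "a \<in> {..<m}" "b \<in> {..<m}" "g a = g b"
  then have "feq t (x a) (x b)" using g feq_trans feq_sym by metis
  then show "a = b" using x(3)[OF ab(1,2) tr] nat_feq[OF tF] by blast
 qed
 then have "m \<le> card X" using card_inj_on_le[of g "{..<m}" X] g X by auto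
 then show "card X = m" using 1 by simp
qed

text \<open>\<open>Z G\<close> has finitely many possible values, so densely it is a fixed finite
  set, whose size is that of the ground model.\<close>

lemma Tr_equi:
 assumes Z: "mset Z" and F: "!!G. Z G \<subseteq> F" "finite F"
 shows "Tr p (equinumerous (sname Z) (nm m)) (%G. card (Z G) = m)"
proof (rule Tr_dense)
 have zf: "Z G \<inter> F = Z G" for G using F(1) by blast
 have pr: "mpred (%G. R (Z G))" for R using pred_slice[OF Z F(2), of R] unfolding zf .
 show "mpred (%G. card (Z G) = m)" by (rule pr)
 fix q assume q: "q << p"
 have "ev q (%G. \<exists>k. set_encode (Z G) = k)" by simp
 then obtain r k where r: "r << q" "ev r (%G. set_encode (Z G) = k)"
  using ev_ex_nat[of "%k G. set_encode (Z G) = k", OF pr le_field(1)[OF q]] by blast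
 let ?X = "set_decode k"
 have e: "ev r (%G. Z G = ?X)" using r(2)
  by eventually_elim (metis F finite_subset set_encode_inverse)
 have rF: "r \<in> Field P" using le_field(1)[OF r(1)] .
 have eq: "feq r (sname Z) (check_set (nm ` ?X))"
 proof (rule sub_om_eqI[OF sname_sub check_nats_sub])
  fix s n assume s: "s << r"
  have sF: "s \<in> Field P" using le_field(1)[OF s] .
  have "ev s (%G. n \<in> Z G) \<longleftrightarrow> ev s (%G. n \<in> ?X)"
   using ev_gen_le[OF e s] by (intro eventually_subst) (erule eventually_mono, simp)
  then show "fmem s (nm n) (sname Z) \<longleftrightarrow> fmem s (nm n) (check_set (nm ` ?X))"
   using TrD'[OF Tr_sname[OF Z] sF, of n] ev_const[OF sF] fmem_check_nats[OF sF] by simp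
 qed
 have "fo s (equinumerous (sname Z) (nm m)) \<longleftrightarrow> card ?X = m" if "s << r" for s
  using cong_fo[OF cong_equinumerous(1) feq_mono[OF eq that] le_field(1)[OF that]]
   fin_equi[OF finite_set_decode le_field(1)[OF that]] by blast
 then have "Tr r (equinumerous (sname Z) (nm m)) (%G. card ?X = m)"
  using le_refl[OF rF] by (intro Tr_const rF) (auto simp: fo_neg)
 then have "Tr r (equinumerous (sname Z) (nm m)) (%G. card (Z G) = m)"
  by (rule Tr_ev_cong[OF _ _ pr]) (use e in \<open>eventually_elim, simp\<close>)
 then show "\<exists>r. r << q \<and> Tr r (equinumerous (sname Z) (nm m)) (%G. card (Z G) = m)" using r(1) by blast
qed

text \<open>The definition of the ideal describes \<open>y\<close> inside the quantifier over
  \<open>m\<close>; with the description moved out, \<open>y\<close> can be eliminated.\<close>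

lemma fo_bex_conj: "fo p (BEx A (%m. Conj \<phi> (\<psi> m))) \<longleftrightarrow> fo p (Conj \<phi> (BEx A \<psi>))"
proof
 assume h: "fo p (BEx A (%m. Conj \<phi> (\<psi> m)))"
 have "fo p \<phi>" by (rule fo_dense) (use h in \<open>unfold fo_bex fo_conj, blast\<close>)
 then show "fo p (Conj \<phi> (BEx A \<psi>))" using h unfolding fo_bex fo_conj by blast
next
 assume "fo p (Conj \<phi> (BEx A \<psi>))"
 then have h: "fo p \<phi>" "fo p (BEx A \<psi>)" unfolding fo_conj by blast+
 show "fo p (BEx A (%m. Conj \<phi> (\<psi> m)))" unfolding fo_bex fo_conj
 proof (intro allI impI)
  fix q assume q: "q << p"
  then obtain r x where r: "r << q" "fmem r x A" "fo r (\<psi> x)" using h(2) unfolding fo_bex by blast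
  then show "\<exists>r x. r << q \<and> fmem r x A \<and> fo r \<phi> \<and> fo r (\<psi> x)" using fo_mono[OF h(1) le_trans[OF r(1) q]] by blast
 qed
qed

lemma mset_ops:
 "mset A ==> mset B ==> mset (%G. A G \<inter> B G)" "mset A ==> mset B ==> mset (%G. A G - B G)" "mset (%G. X)"
 "(!!i :: nat. mset (C i)) ==> mset (%G. \<Union>i\<le>n. C i G)"
 unfolding mset_def by (auto intro!: pred_intros_logic pred_intros_finite)

lemma cong_in_Ic: "cong (in_Ic c a)"
 unfolding in_Ic_def by (intro congs cong_equinumerous)

lemma Tr_in_Ic:
 assumes x: "fo p (Subset x om)" and p: "p \<in> Field P" and a: "index_partition a" and c: "!!i. 2 \<le> c i"
 shows "Tr p (in_Ic c a x) (%G. sval x G \<in> Ic c a)"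
proof -
 let ?R = "check_rel {(i, n). n \<in> a i}" and ?S = "check_rel3 {(i, k, m). log (real (c i)) (real m + 1) \<le> real k}"
 have fa: "finite (a i)" for i using a unfolding index_partition_def by blast
 have xom: "fmem q n om" if "q << p" "fmem q n x" for q n using x that unfolding fo_subset by blast
 have 1: "Tr p (Ex (%y. BEx om (%m. Conj (All (%n. Iff (Mem n y) (Conj (Mem n x) (rel2 ?R (nm i) n))))
   (Conj (equinumerous y m) (rel3 ?S (nm i) (nm k) m)))))
  (%G. log (real (c i)) (real (card (sval x G \<inter> a i)) + 1) \<le> real k)" for i k
 proof -
  let ?Z = "%G. sval x G \<inter> a i"
  have Z: "mset ?Z" by (intro mset_ops mset_sval)
  have "Tr p (Ex (%y. Conj (All (%n. Iff (Mem n y) (Conj (Mem n x) (rel2 ?R (nm i) n))))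
   (BEx om (%m. Conj (equinumerous y m) (rel3 ?S (nm i) (nm k) m)))))
   (%G. \<exists>m. card (?Z G) = m \<and> (i, k, m) \<in> {(i, k, m). log (real (c i)) (real m + 1) \<le> real k})"
  proof (rule Tr_ex_set[OF Z])
   show "cong (%n. Conj (Mem n x) (rel2 ?R (nm i) n))" by (intro congs)
   show "fmem r n om" if "r << p" "fo r (Conj (Mem n x) (rel2 ?R (nm i) n))" for r n
    using that xom unfolding fo_conj forces.simps by blast
   show "Tr p (Conj (Mem (nm n) x) (rel2 ?R (nm i) (nm n))) (%G. n \<in> ?Z G)" for n
    using Tr_conj[OF Tr_sval[of p n x] Tr_rel2_check[OF p, of "{(i, n). n \<in> a i}" i n]] by simp
   show "cong (%y. BEx om (%m. Conj (equinumerous y m) (rel3 ?S (nm i) (nm k) m)))"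
    by (intro congs cong_equinumerous)
   show "Tr p (BEx om (%m. Conj (equinumerous (sname ?Z) m) (rel3 ?S (nm i) (nm k) m)))
    (%G. \<exists>m. card (?Z G) = m \<and> (i, k, m) \<in> {(i, k, m). log (real (c i)) (real m + 1) \<le> real k})"
    by (intro Tr_bex_om Tr_conj Tr_equi[OF Z _ fa] Tr_rel3_check p congs cong_equinumerous) auto
  qed
  moreover have "fo q (Ex (%y. Conj (All (%n. Iff (Mem n y) (\<psi> n))) (BEx om (\<chi>' y)))) \<longleftrightarrow>
   fo q (Ex (%y. BEx om (%m. Conj (All (%n. Iff (Mem n y) (\<psi> n))) (\<chi>' y m))))" for q \<psi> \<chi>'
   unfolding fo_ex fo_bex_conj ..
  ultimately show ?thesis unfolding Tr_def by simp
 qed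
 have "Tr p (in_Ic c a x) (%G. True \<and> (\<exists>k. \<forall>i. log (real (c i)) (real (card (sval x G \<inter> a i)) + 1) \<le> real k))"
  unfolding in_Ic_def
  by (intro Tr_conj Tr_const[OF p x] Tr_bex_om Tr_ball_om 1 congs cong_equinumerous) auto
 then show ?thesis using Ic_iff[of c, OF c] by simp
qed

lemma Tr_inter_Ic:
 assumes x: "fo p (Subset A om)" "fo p (Subset B om)" and p: "p \<in> Field P" and a: "index_partition a" and c: "!!i. 2 \<le> c i"
 shows "Tr p (Ex (%z. Conj (is_inter z A B) (in_Ic c a z))) (%G. sval A G \<inter> sval B G \<in> Ic c a)"
  and "Tr p (Ex (%z. Conj (is_diff z A B) (in_Ic c a z))) (%G. sval A G - sval B G \<in> Ic c a)"
proof -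
 have *: "Tr p (Ex (%z. Conj (All (%x. Iff (Mem x z) (Conj (Mem x A) (\<psi> x)))) (in_Ic c a z))) (%G. Z G \<in> Ic c a)"
  if Z: "mset Z" and \<psi>: "cong \<psi>" "!!n. Tr p (Conj (Mem (nm n) A) (\<psi> (nm n))) (%G. n \<in> Z G)" for \<psi> Z
 proof (rule Tr_ex_set[OF Z _ _ \<psi>(2) cong_in_Ic])
  show "cong (%x. Conj (Mem x A) (\<psi> x))" by (intro congs \<psi>(1))
  show "fmem r z om" if "r << p" "fo r (Conj (Mem z A) (\<psi> z))" for r z
   using that x(1) unfolding fo_conj forces.simps fo_subset by blast
  have tr: "Tr p (in_Ic c a (sname Z)) (%G. sval (sname Z) G \<in> Ic c a)" by (rule Tr_in_Ic[OF sname_sub p a c])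
  have "ev p (%G. sval (sname Z) G \<in> Ic c a \<longleftrightarrow> Z G \<in> Ic c a)"
   using sval_sname[OF Z p] by eventually_elim simp
  moreover have "mpred (%G. Z G \<in> Ic c a)"
   unfolding Ic_card[of c, OF c] using a unfolding index_partition_def
   by (intro pred_intros_countable pred_slice[OF Z]) blast
  ultimately show "Tr p (in_Ic c a (sname Z)) (%G. Z G \<in> Ic c a)" by (rule Tr_ev_cong[OF tr])
 qed
 show "Tr p (Ex (%z. Conj (is_inter z A B) (in_Ic c a z))) (%G. sval A G \<inter> sval B G \<in> Ic c a)"
  unfolding is_inter_def
  by (rule *) (intro mset_ops mset_sval, intro congs, use Tr_conj[OF Tr_sval Tr_sval] in simp)
 show "Tr p (Ex (%z. Conj (is_diff z A B) (in_Ic c a z))) (%G. sval A G - sval B G \<in> Ic c a)"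
  unfolding is_diff_def
  by (rule *) (intro mset_ops mset_sval, intro congs, use Tr_conj[OF Tr_sval Tr_neg[OF Tr_sval]] in simp)
qed

end

text \<open>Finitely many exceptional blocks are absorbed by the exponent: the sum of their sizes is
  less than that power of \<open>2\<close>, hence of \<open>c j\<close>.\<close>

lemma Ic_almost:
 assumes c: "!!i. 2 \<le> c i" and a: "index_partition a" and x: "!!j. N \<le> j ==> card (x \<inter> a j) < c j ^ k"
 shows "x \<in> Ic c a"
 unfolding Ic_card[of c, OF c]
proof (intro exI allI)
 fix j
 have fin: "finite (a j)" using a unfolding index_partition_def by blast
 let ?S = "\<Sum>j<N. card (a j)"
 show "card (x \<inter> a j) < c j ^ (k + ?S)"
 proof (cases "N \<le> j")
  case True
  have "card (x \<inter> a j) < c j ^ k" by (rule x[OF True])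
  also have "\<dots> \<le> c j ^ (k + ?S)" using c[of j] by (intro power_increasing) auto
  finally show ?thesis .
 next
  case False
  have "card (x \<inter> a j) \<le> card (a j)" by (intro card_mono fin) blast
  also have "\<dots> \<le> ?S" using False by (intro member_le_sum) auto
  also have "\<dots> < 2 ^ ?S" by (rule less_exp)
  also have "\<dots> \<le> c j ^ ?S" by (intro power_mono c) simp
  also have "\<dots> \<le> c j ^ (k + ?S)" using c[of j] by (intro power_increasing) auto
  finally show ?thesis .
 qed
qed

lemma Ic_UN:
 assumes c: "!!i. 2 \<le> c i" and x: "!!k. x (k :: nat) \<in> Ic c a"
 shows "(\<Union>k\<le>n. x k) \<in> Ic c a"
proof (induction n)
 case 0 then show ?case using x by simp
next
 case (Suc n)
 obtain k where k: "!!i. card ((\<Union>k\<le>n. x k) \<inter> a i) < c i ^ k" using Suc unfolding Ic_card[of c, OF c] by blast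
 obtain l where l: "!!i. card (x (Suc n) \<inter> a i) < c i ^ l" using x[of "Suc n"] unfolding Ic_card[of c, OF c] by blast
 have "card ((\<Union>k\<le>Suc n. x k) \<inter> a i) < c i ^ Suc (k + l)" for i
 proof -
  have "(\<Union>k\<le>Suc n. x k) \<inter> a i = (\<Union>k\<le>n. x k) \<inter> a i \<union> x (Suc n) \<inter> a i" by (auto simp: le_Suc_eq)
  then have "card ((\<Union>k\<le>Suc n. x k) \<inter> a i) \<le> card ((\<Union>k\<le>n. x k) \<inter> a i) + card (x (Suc n) \<inter> a i)"
   by (metis card_Un_le)
  also have "\<dots> < c i ^ k + c i ^ l" using k l by (rule add_strict_mono)
  also have "\<dots> \<le> c i ^ (k + l) + c i ^ (k + l)" using c[of i] by (intro add_mono power_increasing) auto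
  also have "\<dots> = 2 * c i ^ (k + l)" by simp
  also have "\<dots> \<le> c i ^ Suc (k + l)" using c[of i] by simp
  finally show ?thesis .
 qed
 then show ?case unfolding Ic_card[of c, OF c] by blast
qed

text \<open>
  Inside \<open>a j\<close> the separating set collects those candidates of the slalom that are small on \<open>A n\<close> for all \<open>n \<le> j\<close>;
  as the width is at most \<open>c j\<close>, their union is small on \<open>A n\<close>, too.
\<close>

definition sepset :: "(nat => nat set) => (nat => nat) => (nat => nat) => (nat => nat set) => (nat => nat) => (nat => nat) => nat set"
 where "sepset a c w A g s = {x. \<exists>j. \<exists>X\<in>Pow (a j). x \<in> X \<and> set_encode X \<in> set_decode (s j) \<and>
  card (set_decode (s j)) \<le> w j \<and> (\<forall>n\<in>{..j}. card (A n \<inter> X) \<le> c j ^ g n)}"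

lemma sepset_small:
 assumes c: "!!i. 2 \<le> c i" and a: "index_partition a" and w: "!!j. w j \<le> c j"
 shows "A n \<inter> sepset a c w A g s \<in> Ic c a"
proof (rule Ic_almost[of c a n, OF c a])
 fix j assume j: "n \<le> j"
 have dis: "x \<in> a i ==> x \<in> a j ==> i = j" for x i j
  using a unfolding index_partition_def disjoint_family_on_def by auto
 have fin: "finite (a j)" using a unfolding index_partition_def by blast
 let ?E = "{e \<in> set_decode (s j). card (set_decode (s j)) \<le> w j \<and> card (A n \<inter> set_decode e) \<le> c j ^ g n}"
 have "A n \<inter> sepset a c w A g s \<inter> a j \<subseteq> (\<Union>e\<in>?E. A n \<inter> set_decode e)"
 proof
  fix x assume x: "x \<in> A n \<inter> sepset a c w A g s \<inter> a j"
  then obtain i X where X: "X \<subseteq> a i" "x \<in> X" "set_encode X \<in> set_decode (s i)"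
   "card (set_decode (s i)) \<le> w i" "\<forall>n\<in>{..i}. card (A n \<inter> X) \<le> c i ^ g n" unfolding sepset_def by blast
  have [simp]: "i = j" using dis[of x i j] X(1,2) x by blast
  have "set_decode (set_encode X) = X" using X(1) fin finite_subset by (intro set_encode_inverse) auto
  then have "set_encode X \<in> ?E" "x \<in> A n \<inter> set_decode (set_encode X)" using X x j by auto
  then show "x \<in> (\<Union>e\<in>?E. A n \<inter> set_decode e)" by blast
 qed
 then have "card (A n \<inter> sepset a c w A g s \<inter> a j) \<le> card (\<Union>e\<in>?E. A n \<inter> set_decode e)"
  by (intro card_mono) auto
 also have "\<dots> \<le> (\<Sum>e\<in>?E. card (A n \<inter> set_decode e))" by (intro card_UN_le) auto
 also have "\<dots> \<le> (\<Sum>e\<in>?E. c j ^ g n)" by (intro sum_mono) auto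
 also have "\<dots> = card ?E * c j ^ g n" by simp
 also have "\<dots> \<le> c j * c j ^ g n"
 proof (intro mult_right_mono)
  show "card ?E \<le> c j"
  proof (cases "?E = {}")
   case False
   then have "card (set_decode (s j)) \<le> w j" by blast
   moreover have "card ?E \<le> card (set_decode (s j))" by (intro card_mono) auto
   ultimately show ?thesis using w[of j] by linarith
  next
   case True then show ?thesis by (simp only: card.empty le0)
  qed
 qed simp
 \<comment> \<open>One factor \<open>c j\<close> counts the candidates, a second one makes the
   inequality strict.\<close>
 also have "\<dots> < c j ^ (g n + 2)" using c[of j] by (simp add: power_add power2_eq_square)
 finally show "card (A n \<inter> sepset a c w A g s \<inter> a j) < c j ^ (g n + 2)" .
qed

text \<open>On late blocks the part of \<open>B\<close> outside \<open>A m\<close> is itself a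
  captured candidate: on \<open>A n\<close> it is small by the choice of \<open>g\<close> if
  \<open>n\<close> is at least \<open>m\<close>, and empty by monotonicity otherwise. What remains
  of \<open>B\<close> lies in \<open>A m\<close>.\<close>

lemma sepset_large:
 assumes c: "!!i. 2 \<le> c i" and a: "index_partition a" and A: "mono A"
  and g: "!!n j. m \<le> n ==> card (B \<inter> A n \<inter> a j) < c j ^ g n"
  and s: "!!j. m' \<le> j ==> set_encode ((B - A m) \<inter> a j) \<in> set_decode (s j) \<and> card (set_decode (s j)) \<le> w j"
 shows "B - sepset a c w A g s \<in> Ic c a"
proof (rule Ic_almost[of c a m', OF c a])
 fix j assume j: "m' \<le> j"
 have fin: "finite (a j)" using a unfolding index_partition_def by blast
 have le: "card (A n \<inter> ((B - A m) \<inter> a j)) \<le> c j ^ g n" for n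
 proof (cases "m \<le> n")
  case True
  have "card (A n \<inter> ((B - A m) \<inter> a j)) \<le> card (B \<inter> A n \<inter> a j)" using fin by (intro card_mono) auto
  then show ?thesis using g[OF True, of j] by simp
 next
  case False
  then have "A n \<subseteq> A m" using A unfolding mono_def by simp
  then have "A n \<inter> ((B - A m) \<inter> a j) = {}" by blast
  then show ?thesis by simp
 qed
 have "(B - A m) \<inter> a j \<in> Pow (a j)" by blast
 moreover have "set_encode ((B - A m) \<inter> a j) \<in> set_decode (s j)" "card (set_decode (s j)) \<le> w j" using s[OF j] by auto
 ultimately have "(B - A m) \<inter> a j \<subseteq> sepset a c w A g s" unfolding sepset_def mem_Collect_eq
  by (intro subsetI CollectI exI[of _ j] bexI[of _ "(B - A m) \<inter> a j"] conjI ballI le)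
 then have "(B - sepset a c w A g s) \<inter> a j \<subseteq> B \<inter> A m \<inter> a j" by blast
 then have "card ((B - sepset a c w A g s) \<inter> a j) \<le> card (B \<inter> A m \<inter> a j)" using fin by (intro card_mono) auto
 then show "card ((B - sepset a c w A g s) \<inter> a j) < c j ^ g m" using g[of m j] by simp
qed

section \<open>Gaps and separation in the extension\<close>

context model
begin

text \<open>
  A common extension of \<open>c i ^ g\<close> conditions with different values of the Cohen reals at \<open>i\<close> would make \<open>D\<close> meet as
  many disjoint subsets of \<open>a i\<close> inside \<open>A m\<close>.
\<close>

lemma no_separation:
 assumes a: "index_partition a" and D: "fc.mset D" and r: "r \<in> Field P" and Y: "!!i l. Y i l \<subseteq> a i"
  "!!i l l'. l ~= l' ==> Y i l \<inter> Y i l' = {}"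
  "!!k g n. \<exists>i\<ge>n. \<forall>l<c i ^ g. Y i l \<subseteq> A k \<and> card (Y i l) = c i ^ k"
  and A: "!!k. ev r (%G. A k \<inter> D G \<in> Ic c a)"
  and B: "!!\<xi>. fc.mset (B \<xi>)" "!!\<xi> i G. Y i (cr \<nu> \<xi> G i) \<subseteq> B \<xi> G"
   "!!\<xi>. \<xi> \<in> Field \<nu> ==> ev r (%G. B \<xi> G - D G \<in> Ic c a)"
 shows False
proof -
 have fa: "finite (a i)" for i using a unfolding index_partition_def by blast
 have pr: "mpred (%G. \<forall>i. card (Z G \<inter> a i) < c i ^ k)" if "fc.mset Z" for Z k
  by (intro pred_intros_countable fc.pred_slice[OF that] fa)
 let ?\<Phi> = "%\<xi> m g G. (\<forall>i. card ((B \<xi> G - D G) \<inter> a i) < c i ^ m) \<and> (\<forall>i. card (A m \<inter> D G \<inter> a i) < c i ^ g)"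
 have "\<exists>t. (fst t, r) \<in> P \<and> ev (fst t) (?\<Phi> \<xi> (fst (snd t)) (snd (snd t)))" if \<xi>: "\<xi> \<in> Field \<nu>" for \<xi>
 proof -
  have "ev r (%G. \<exists>m. \<forall>i. card ((B \<xi> G - D G) \<inter> a i) < c i ^ m)"
   using B(3)[OF \<xi>] unfolding Ic_card[of c, OF c2] .
  then obtain q m where q: "q << r" "ev q (%G. \<forall>i. card ((B \<xi> G - D G) \<inter> a i) < c i ^ m)"
   using fc.ev_ex_nat[of "%m G. \<forall>i. card ((B \<xi> G - D G) \<inter> a i) < c i ^ m", OF pr[OF fc.mset_ops(2)[OF B(1) D]] r] by blast
  have "ev q (%G. \<exists>g. \<forall>i. card (A m \<inter> D G \<inter> a i) < c i ^ g)"
   using fc.ev_gen_le[OF A q(1)] unfolding Ic_card[of c, OF c2] .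
  then obtain q' g where q': "q' << q" "ev q' (%G. \<forall>i. card (A m \<inter> D G \<inter> a i) < c i ^ g)"
   using fc.ev_ex_nat[of "%g G. \<forall>i. card (A m \<inter> D G \<inter> a i) < c i ^ g", OF pr[OF fc.mset_ops(1)[OF fc.mset_ops(3) D]]
     fc.le_field(1)[OF q(1)]] by blast
  have "ev q' (?\<Phi> \<xi> m g)" using eventually_conj[OF fc.ev_gen_le[OF q(2) q'(1)] q'(2)] .
  then show ?thesis using fc.le_trans[OF q'(1) q(1)] by (intro exI[of _ "(q', m, g)"]) simp
 qed
 then have "\<forall>\<xi>\<in>Field \<nu>. \<exists>t. (fst t, r) \<in> P \<and> ev (fst t) (?\<Phi> \<xi> (fst (snd t)) (snd (snd t)))" by blast
 from bchoice[OF this] obtain t where t: "\<forall>\<xi>\<in>Field \<nu>. fst (t \<xi>) << r \<and>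
  ev (fst (t \<xi>)) (?\<Phi> \<xi> (fst (snd (t \<xi>))) (snd (snd (t \<xi>))))" by (elim exE)
 have tF: "fst (t \<xi>) \<in> Field P" if "\<xi> \<in> Field \<nu>" for \<xi> using fc.le_field(1) t that by blast
 \<comment> \<open>The two exponents decided for each \<open>\<xi>\<close> are coded as its label,
   so they become common to all amalgamated conditions.\<close>
 obtain n0 k where nk: "\<forall>n\<ge>n0. \<forall>M. \<forall>v :: nat => nat. \<exists>\<xi>. \<exists>q\<in>Field P. \<forall>l<M. \<xi> l \<in> Field \<nu> \<and>
  prod_encode (snd (t (\<xi> l))) = k \<and> q << fst (t (\<xi> l)) \<and> ev q (%G. cr \<nu> (\<xi> l) G n = v l)"
  by (rule exE[OF ub_nu[of "%\<xi>. fst (t \<xi>)" "%\<xi>. prod_encode (snd (t \<xi>))"]], rule tF, assumption, elim exE)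
 obtain m g where mg: "prod_decode k = (m, g)" by (cases "prod_decode k")
 obtain i where i: "i \<ge> n0" "!!l. l < c i ^ g ==> Y i l \<subseteq> A m \<and> card (Y i l) = c i ^ m" using Y(3)[of n0 g m] by blast
 obtain \<xi> q where q: "q \<in> Field P" "!!l. l < c i ^ g ==> \<xi> l \<in> Field \<nu> \<and>
  prod_encode (snd (t (\<xi> l))) = k \<and> q << fst (t (\<xi> l)) \<and> ev q (%G. cr \<nu> (\<xi> l) G i = l)"
  using nk[rule_format, OF i(1), of "c i ^ g" "%l. l"] by blast
 have ev: "ev q (%G. cr \<nu> (\<xi> l) G i = l \<and> ?\<Phi> (\<xi> l) m g G)" if l: "l \<in> {..<c i ^ g}" for l
 proof -
  have 1: "\<xi> l \<in> Field \<nu>" "q << fst (t (\<xi> l))" "ev q (%G. cr \<nu> (\<xi> l) G i = l)" using q(2) l by blast+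
  have "prod_encode (snd (t (\<xi> l))) = k" using q(2) l by blast
  then have "snd (t (\<xi> l)) = (m, g)" using mg by (metis prod_encode_inverse)
  then have "ev (fst (t (\<xi> l))) (?\<Phi> (\<xi> l) m g)" using bspec[OF t 1(1)] by simp
  then show ?thesis using eventually_conj[OF 1(3) fc.ev_gen_le[OF _ 1(2)]] by blast
 qed
 have "ev q (%G. \<forall>l\<in>{..<c i ^ g}. cr \<nu> (\<xi> l) G i = l \<and> ?\<Phi> (\<xi> l) m g G)"
  by (rule fc.ev_all_countable[OF ev]) auto
 then have "ev q (%G. False)"
 proof eventually_elim
  case (elim G)
  have "\<exists>x. x \<in> Y i l \<inter> D G" if l: "l < c i ^ g" for l
  proof (rule ccontr)
   assume n: "\<nexists>x. x \<in> Y i l \<inter> D G"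
   have e: "cr \<nu> (\<xi> l) G i = l" "card ((B (\<xi> l) G - D G) \<inter> a i) < c i ^ m" using elim l by blast+
   have "Y i l \<subseteq> B (\<xi> l) G" using B(2)[of i "\<xi> l" G] unfolding e(1) .
   then have "Y i l \<subseteq> (B (\<xi> l) G - D G) \<inter> a i" using n Y(1)[of i l] by blast
   then have "card (Y i l) \<le> card ((B (\<xi> l) G - D G) \<inter> a i)" using fa by (intro card_mono) auto
   then show False using i(2)[OF l] e(2) by simp
  qed
  then have "\<forall>l\<in>{..<c i ^ g}. \<exists>x. x \<in> Y i l \<inter> D G" by blast
  from bchoice[OF this] obtain f where f: "\<forall>l\<in>{..<c i ^ g}. f l \<in> Y i l \<inter> D G" by (elim exE)
  have "inj_on f {..<c i ^ g}"
  proof (rule inj_onI, rule ccontr)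
   fix l l' assume l: "l \<in> {..<c i ^ g}" "l' \<in> {..<c i ^ g}" "f l = f l'" "l ~= l'"
   have "f l \<in> Y i l" "f l \<in> Y i l'" using bspec[OF f l(1)] bspec[OF f l(2)] unfolding l(3) by blast+
   then show False using Y(2)[OF l(4), of i] by blast
  qed
  moreover have "f ` {..<c i ^ g} \<subseteq> A m \<inter> D G \<inter> a i"
  proof
   fix x assume "x \<in> f ` {..<c i ^ g}"
   then obtain l where l: "l < c i ^ g" "x = f l" by blast
   then show "x \<in> A m \<inter> D G \<inter> a i" using bspec[OF f, of l] i(2)[OF l(1)] Y(1)[of i l] by blast
  qed
  ultimately have "c i ^ g \<le> card (A m \<inter> D G \<inter> a i)" using card_inj_on_le[of f "{..<c i ^ g}"] fa by simp
  moreover have "0 < c i ^ g" using c2[of i] by simp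
  then have "card (A m \<inter> D G \<inter> a i) < c i ^ g" using elim by blast
  ultimately show False by simp
 qed
 then show False using fc.gen_nontriv q(1) by blast
qed

lemma cong_Ic_ops:
 "fc.cong (%A. Ex (%z. Conj (is_inter z A B) (in_Ic c a z)))" "fc.cong (%B. Ex (%z. Conj (is_inter z A B) (in_Ic c a z)))"
 "fc.cong (%A. Ex (%z. Conj (is_diff z A B) (in_Ic c a z)))"
 unfolding is_inter_def is_diff_def by (intro fc.congs)+

lemma fo_ops_Ic:
 assumes "index_partition a" "fc.fo q (Subset A om)" "fc.fo q (Subset B om)" "q \<in> Field P"
 shows "fc.fo q (Ex (%z. Conj (is_inter z A B) (in_Ic c a z))) \<longleftrightarrow> ev q (%G. fc.sval A G \<inter> fc.sval B G \<in> Ic c a)"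
  "fc.fo q (Ex (%z. Conj (is_diff z A B) (in_Ic c a z))) \<longleftrightarrow> ev q (%G. fc.sval A G - fc.sval B G \<in> Ic c a)"
 by (rule fc.TrD'[OF fc.Tr_inter_Ic(1)[where c = c and a = a]] fc.TrD'[OF fc.Tr_inter_Ic(2)[where c = c and a = a]]; (rule assms c2))+

lemma om_eq: "(om :: 'u set name) = check_set (nm ` UNIV)"
 unfolding check_ord_def by simp

text \<open>Each Cohen real selects one piece per block. The trace of the resulting set on
  \<open>A k\<close> has at most \<open>c i ^ k\<close> points in the \<open>i\<close>-th block
  whatever the real is, so orthogonality holds for every filter; genericity acts against
  separation.\<close>

lemma gap_ex:
 assumes a: "index_partition a" and nt: "Ic_nontrivial c a"
 shows "\<exists>y. \<forall>p\<in>Field P. fc.fo p (Ex (%\<A>. Conj (equinumerous \<A> om) (gap (in_Ic c a) \<A> (check_set (y ` Field \<nu>)))))"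
proof -
 obtain A :: "nat => nat set" and Y :: "nat => nat => nat set"
 where A: "inj A" and Y: "!!i l. Y i l \<subseteq> a i" "!!i l l'. l ~= l' ==> Y i l \<inter> Y i l' = {}"
  "!!k i l. card (A k \<inter> Y i l) \<le> c i ^ k"
  "!!k g n. \<exists>i\<ge>n. \<forall>l<c i ^ g. Y i l \<subseteq> A k \<and> card (Y i l) = c i ^ k"
  by (rule gap_sets[OF c2 a nt], rule that)
 define B where "B \<xi> G = (\<Union>i. Y i (cr \<nu> \<xi> G i))" for \<xi> G
 have "mpred (%G. n \<in> Y i (cr \<nu> \<xi> G i))" for \<xi> n i
  using fc.pred_nat2[OF fc.mfunD[OF mfun_cr[of \<nu> \<xi>]] fc.mfunD[OF mfun_cr[of \<nu> \<xi>]], of "%u v. n \<in> Y i u" i i] .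
 then have mB: "fc.mset (B \<xi>)" for \<xi>
  unfolding fc.mset_def B_def UN_iff bex_UNIV by (intro allI pred_intros_countable)
 let ?x = "%k. fc.sname (%_. A k)" and ?y = "%\<xi>. fc.sname (B \<xi>)"
 let ?A = "check_set (range ?x)" and ?B = "check_set (?y ` Field \<nu>)"
 have sA: "fc.small (range ?x)" by (intro fc.small_image fc.small_countable) simp
 have sB: "fc.small (?y ` Field \<nu>)" by (intro fc.small_image small_fields(2))
 have mA: "fc.mset (%_. A k)" for k by (rule fc.mset_ops(3))
 have "fc.fo p (Conj (equinumerous ?A om) (gap (in_Ic c a) ?A ?B))" if p: "p \<in> Field P" for p
  unfolding gap_def orthogonal_def fc.fo_conj
 proof (intro conjI)
  show "fc.fo p (equinumerous ?A om)" unfolding om_eq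
  proof (rule fc.bij_name)
   show "fc.small (UNIV :: nat set)" by (rule fc.small_countable) simp
   fix k l q assume q: "q << p"
   have qF: "q \<in> Field P" using fc.le_field(1)[OF q] .
   show "k = l" if "fc.feq q (nm k) (nm l)" using fc.nat_feq[OF qF] that by blast
   show "k = l" if "fc.feq q (?x k) (?x l)"
   proof -
    have "ev q (%G. A k = A l)"
     using fc.sub_om_ev[OF that qF] fc.sval_sname[OF mA[of k] qF] fc.sval_sname[OF mA[of l] qF]
     by eventually_elim simp
    then have "A k = A l" using fc.ev_const[OF qF, of "A k = A l"] by simp
    then show ?thesis using A by (simp add: inj_eq)
   qed
  qed
  show "fc.fo p (BAll ?A (%A. Subset A om))" "fc.fo p (BAll ?B (%A. Subset A om))"
   by (rule fc.fo_ball_check_set[OF fc.cong_subset1 sA] fc.fo_ball_check_set[OF fc.cong_subset1 sB];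
    use fc.sname_sub in blast)+
  show "fc.fo p (BAll ?A (%A. BAll ?B (%B. Ex (%z. Conj (is_inter z A B) (in_Ic c a z)))))"
  proof (rule fc.fo_ball_check_set[OF fc.cong_ball[OF cong_Ic_ops(1)] sA], elim imageE, hypsubst,
    rule fc.fo_ball_check_set[OF cong_Ic_ops(2) sB], elim imageE, hypsubst)
   fix k \<xi> q q' assume "q' << q"
   then have qF: "q' \<in> Field P" using fc.le_field(1) by blast
   have all: "A k \<inter> B \<xi> G \<in> Ic c a" for G unfolding Ic_card[of c, OF c2]
   proof (intro exI[of _ "Suc k"] allI)
    fix i
    have dis: "x \<in> a i ==> x \<in> a j ==> i = j" for x j
     using a unfolding index_partition_def disjoint_family_on_def by auto
    have "A k \<inter> B \<xi> G \<inter> a i \<subseteq> A k \<inter> Y i (cr \<nu> \<xi> G i)"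
    proof
     fix x assume x: "x \<in> A k \<inter> B \<xi> G \<inter> a i"
     then obtain j where j: "x \<in> Y j (cr \<nu> \<xi> G j)" unfolding B_def by blast
     have "i = j" by (rule dis[of x]) (use x j Y(1)[of j "cr \<nu> \<xi> G j"] in blast)+
     then show "x \<in> A k \<inter> Y i (cr \<nu> \<xi> G i)" using x j by simp
    qed
    moreover have "finite (A k \<inter> Y i (cr \<nu> \<xi> G i))"
     using finite_subset[OF Y(1)[of i "cr \<nu> \<xi> G i"]] a unfolding index_partition_def by simp
    ultimately have "card (A k \<inter> B \<xi> G \<inter> a i) \<le> c i ^ k"
     using Y(3)[of k i "cr \<nu> \<xi> G i"] by (meson card_mono order_trans)
    also have "\<dots> < c i ^ Suc k" using c2[of i] by simp
    finally show "card (A k \<inter> B \<xi> G \<inter> a i) < c i ^ Suc k" .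
   qed
   have "ev q' (%G. fc.sval (?x k) G \<inter> fc.sval (?y \<xi>) G \<in> Ic c a)"
    using fc.sval_sname[OF mA[of k] qF] fc.sval_sname[OF mB[of \<xi>] qF] by eventually_elim (simp add: all)
   then show "fc.fo q' (Ex (%z. Conj (is_inter z (?x k) (?y \<xi>)) (in_Ic c a z)))"
    using fo_ops_Ic(1)[OF a fc.sname_sub fc.sname_sub qF] by blast
  qed
  show "fc.fo p (Neg (Ex (%C. separates (in_Ic c a) C ?A ?B)))"
   unfolding fc.fo_neg
  proof (intro allI impI notI)
   fix q assume q: "q << p" and h: "fc.fo q (Ex (%C. separates (in_Ic c a) C ?A ?B))"
   obtain r C where r: "r << q" and C: "fc.fo r (separates (in_Ic c a) C ?A ?B)"
    using h fc.le_refl1(1)[OF q] unfolding fc.fo_ex by blast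
   have rF: "r \<in> Field P" using fc.le_field(1)[OF r] .
   have C: "fc.fo r (Subset C om)" "fc.fo r (BAll ?A (%A. Ex (%z. Conj (is_inter z A C) (in_Ic c a z))))"
    "fc.fo r (BAll ?B (%B. Ex (%z. Conj (is_diff z B C) (in_Ic c a z))))"
    using C unfolding separates_def fc.fo_conj by blast+
   show False
   proof (rule no_separation[OF a fc.mset_sval[of C] rF Y(1,2,4) _ mB])
    show "Y i (cr \<nu> \<xi> G i) \<subseteq> B \<xi> G" for \<xi> i G unfolding B_def by blast
    show "ev r (%G. A k \<inter> fc.sval C G \<in> Ic c a)" for k
    proof -
     have "fc.fmem r (?x k) ?A" by (intro fc.fmem_check_setI sA rangeI)
     then have "fc.fo r (Ex (%z. Conj (is_inter z (?x k) C) (in_Ic c a z)))"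
      using C(2) fc.le_refl[OF rF] unfolding fc.fo_ball by blast
     then have "ev r (%G. fc.sval (?x k) G \<inter> fc.sval C G \<in> Ic c a)"
      using fo_ops_Ic(1)[OF a fc.sname_sub C(1) rF] by blast
     then show ?thesis using fc.sval_sname[OF mA[of k] rF] by eventually_elim simp
    qed
    show "ev r (%G. B \<xi> G - fc.sval C G \<in> Ic c a)" if "\<xi> \<in> Field \<nu>" for \<xi>
    proof -
     have "fc.fmem r (?y \<xi>) ?B" by (intro fc.fmem_check_setI sB imageI that)
     then have "fc.fo r (Ex (%z. Conj (is_diff z (?y \<xi>) C) (in_Ic c a z)))"
      using C(3) fc.le_refl[OF rF] unfolding fc.fo_ball by blast
     then have "ev r (%G. fc.sval (?y \<xi>) G - fc.sval C G \<in> Ic c a)"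
      using fo_ops_Ic(2)[OF a fc.sname_sub C(1) rF] by blast
     then show ?thesis using fc.sval_sname[OF mB[of \<xi>] rF] by eventually_elim simp
    qed
   qed
  qed
 qed
 then show ?thesis by (intro exI[of _ ?y] ballI) (rule fc.fo_exI)
qed

text \<open>The countable family is made increasing. A dominating real then bounds the exponents of
  all \<open>B \<beta>\<close> on its members, and a bounded slalom guesses the traces on the blocks
  of each \<open>B \<beta>\<close> outside each member; \<open>sepset\<close> combines the
  two.\<close>

lemma separation:
 assumes a: "index_partition a" and p: "p \<in> Field P" and b: "b \<in> Field \<nu>"
  and m: "!!n :: nat. fc.mset (A n)" "!!\<beta>. fc.mset (B \<beta>)"
  and o: "!!n \<beta>. \<beta> \<in> underS \<nu> b ==> ev p (%G. A n G \<inter> B \<beta> G \<in> Ic c a)"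
 obtains C where "fc.mset C" "!!n. ev p (%G. A n G \<inter> C G \<in> Ic c a)"
  "!!\<beta>. \<beta> \<in> underS \<nu> b ==> ev p (%G. B \<beta> G - C G \<in> Ic c a)"
proof -
 have fa: "finite (a i)" for i using a unfolding index_partition_def by blast
 define A' where "A' n G = (\<Union>k\<le>n. A k G)" for n G
 have mA': "fc.mset (A' n)" for n unfolding A'_def by (intro fc.mset_ops m(1))
 have mono: "mono (%n. A' n G)" for G unfolding A'_def by (rule monoI) force
 define f where "f \<beta> G n = (LEAST k. \<forall>j. card (B \<beta> G \<inter> A' n G \<inter> a j) < c j ^ k)" for \<beta> G n
 have mf: "fc.mfun (f \<beta>)" for \<beta> unfolding fc.mfun_def f_def
  by (intro allI measurable_Least pred_intros_countable fc.pred_slice[OF fc.mset_ops(1)[OF m(2) mA']] fa)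
 define Z where "Z \<beta> m G j = set_encode ((B \<beta> G - A' m G) \<inter> a j)" for \<beta> m G j
 have mZ: "fc.mfun (Z \<beta> m)" for \<beta> m unfolding fc.mfun_def Z_def
  by (intro allI fc.nat_measurableI fc.pred_slice[OF fc.mset_ops(2)[OF m(2) mA']] fa)
 have Zbd: "Z \<beta> m G j \<le> bd j" for \<beta> m G j
  unfolding Z_def bd_def set_encode_def by (intro sum_mono2 fa) auto
 have cu: "|underS \<nu> b| <o \<nu>" using card_of_underS[OF nu(1) b] .
 have "|f ` underS \<nu> b| <o \<kappa>" using ordLeq_ordLess_trans[OF card_of_image ordLess_ordLeq_trans[OF cu nu_k]] .
 then obtain g where g: "fc.mfun g" "!!Z p. Z \<in> f ` underS \<nu> b ==> ev p (%G. \<exists>m. \<forall>n\<ge>m. Z G n \<le> g G n)"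
  by (rule dominating[rotated]) (use mf in auto)
 have "|underS \<nu> b \<times> (UNIV :: nat set)| <o \<nu>"
 proof (cases "finite (underS \<nu> b)")
  case True
  then have "countable (underS \<nu> b \<times> (UNIV :: nat set))" by (intro countable_SIGMA countable_finite[OF True]) auto
  then show ?thesis using ordLeq_ordLess_trans[OF countable_ordLeq_natLeq nu(2)] by blast
 next
  case False
  have "|underS \<nu> b \<times> (UNIV :: nat set)| \<le>o |underS \<nu> b|"
   using card_of_Times_infinite[OF False UNIV_not_empty] False infinite_iff_card_of_nat[of "underS \<nu> b"] ordIso_iff_ordLeq by blast
  then show ?thesis using ordLeq_ordLess_trans cu by blast
 qed
 then have "|(%(\<beta>, m). Z \<beta> m) ` (underS \<nu> b \<times> UNIV)| <o \<nu>"
  using ordLeq_ordLess_trans[OF card_of_image] by blast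
 moreover have "\<forall>Y\<in>(%(\<beta>, m). Z \<beta> m) ` (underS \<nu> b \<times> UNIV). \<forall>G n. Y G n \<le> bd n" using Zbd by auto
 ultimately obtain s where s: "fc.mfun s"
  "!!Y p. Y \<in> (%(\<beta>, m). Z \<beta> m) ` (underS \<nu> b \<times> UNIV) ==>
   ev p (%G. \<exists>m. \<forall>n\<ge>m. Y G n \<in> set_decode (s G n) \<and> card (set_decode (s G n)) \<le> w n)"
  by (rule slalom[rotated, OF disjI2[OF conjI]]) (use mZ in auto)
 let ?C = "%G. sepset a c w (%n. A' n G) (g G) (s G)"
 show thesis
 proof (rule that[of ?C])
  have "mpred (%G. card (A' n G \<inter> X) \<le> c j ^ g G n)" if "finite X" for n j X
   by (rule measurable_compose_countable[where f = "%k G. card (A' n G \<inter> X) \<le> c j ^ k" and g = "%G. g G n"])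
    (intro fc.pred_slice[OF mA' that], rule fc.mfunD[OF g(1)])
  moreover have "mpred (%G. R (s G j))" for R j
   using fc.pred_nat2[OF fc.mfunD[OF s(1)] fc.mfunD[OF s(1)], of "%u v. R u" j j] .
  ultimately show "fc.mset ?C" unfolding fc.mset_def sepset_def mem_Collect_eq
   by (intro allI pred_intros_countable pred_intros_finite pred_intros_logic) (auto intro: finite_subset[OF _ fa])
  show "ev p (%G. A n G \<inter> ?C G \<in> Ic c a)" for n
  proof (rule always_eventually, rule allI)
   fix G show "A n G \<inter> ?C G \<in> Ic c a"
    by (rule Ic_sub[OF a sepset_small[of c a w "%n. A' n G" n, OF c2 a w_le] _ c2]) (auto simp: A'_def)
  qed
  fix \<beta> assume \<beta>: "\<beta> \<in> underS \<nu> b"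
  have "ev p (%G. \<forall>n. A n G \<inter> B \<beta> G \<in> Ic c a)" by (rule fc.ev_all[OF o[OF \<beta>]])
  moreover have "ev p (%G. \<forall>m. \<exists>m'. \<forall>n\<ge>m'. Z \<beta> m G n \<in> set_decode (s G n) \<and> card (set_decode (s G n)) \<le> w n)"
   by (intro fc.ev_all s(2)) (use \<beta> in force)
  moreover have "ev p (%G. \<exists>m. \<forall>n\<ge>m. f \<beta> G n \<le> g G n)" by (rule g(2)[OF imageI[OF \<beta>]])
  ultimately show "ev p (%G. B \<beta> G - ?C G \<in> Ic c a)"
  proof eventually_elim
   case (elim G)
   obtain m where m: "!!n. n \<ge> m ==> f \<beta> G n \<le> g G n" using elim(3) by blast
   obtain m' where m': "!!j. j \<ge> m' ==> Z \<beta> m G j \<in> set_decode (s G j) \<and> card (set_decode (s G j)) \<le> w j" using elim(2) by blast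
   show ?case
   proof (rule sepset_large[of c a "%n. A' n G" m, OF c2 a mono])
    fix n j assume n: "m \<le> n"
    have "(\<Union>k\<le>n. A k G \<inter> B \<beta> G) \<in> Ic c a" using Ic_UN[of c "%k. A k G \<inter> B \<beta> G", OF c2] elim(1) by blast
    then have "B \<beta> G \<inter> A' n G \<in> Ic c a" by (rule Ic_sub[OF a _ _ c2]) (auto simp: A'_def)
    then have "\<exists>k. \<forall>j. card (B \<beta> G \<inter> A' n G \<inter> a j) < c j ^ k" unfolding Ic_card[of c, OF c2] .
    then have "card (B \<beta> G \<inter> A' n G \<inter> a j) < c j ^ f \<beta> G n" unfolding f_def by (rule LeastI2_ex) blast
    also have "\<dots> \<le> c j ^ g G n" using c2[of j] m[OF n] by (intro power_increasing) auto
    finally show "card (B \<beta> G \<inter> A' n G \<inter> a j) < c j ^ g G n" .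
   next
    fix j assume "m' \<le> j"
    then show "set_encode ((B \<beta> G - A' m G) \<inter> a j) \<in> set_decode (s G j) \<and> card (set_decode (s G j)) \<le> w j"
     using m' unfolding Z_def by blast
   qed
  qed
 qed
qed

lemma b_ideal:
 assumes a: "index_partition a" and nt: "Ic_nontrivial c a" and p: "p \<in> Field P"
 shows "fc.fo p (b_ideal_eq (in_Ic c a) (check_ord \<nu>))"
proof -
 obtain y where y: "\<forall>p\<in>Field P. fc.fo p (Ex (%\<A>. Conj (equinumerous \<A> om) (gap (in_Ic c a) \<A> (check_set (y ` Field \<nu>)))))"
  using gap_ex[OF a nt] by blast
 show ?thesis unfolding b_ideal_eq_def
 proof (rule fc.least_card_forced[OF nu(1,2) small_fields(2) notI _ p])
  show "fc.fo p (Ex (%\<A>. Conj (equinumerous \<A> om) (gap (in_Ic c a) \<A> (check_set (y ` Field \<nu>)))))" if "p \<in> Field P" for p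
   using bspec[OF y that] .
 next
  fix b p \<B> assume b: "b \<in> Field \<nu>" and p: "p \<in> Field P"
   and h: "fc.fo p (Ex (%\<A>. Conj (equinumerous \<A> om) (gap (in_Ic c a) \<A> \<B>)))"
   and e: "fc.fo p (equinumerous \<B> (check_elt \<nu> b))"
  obtain r \<A> where r: "r << p" and eA: "fc.fo r (equinumerous \<A> om)" and "fc.fo r (gap (in_Ic c a) \<A> \<B>)"
   using h fc.le_refl[OF p] unfolding fc.fo_ex fc.fo_conj by blast
  then have g: "fc.fo r (BAll \<A> (%A. Subset A om))" "fc.fo r (BAll \<B> (%A. Subset A om))"
   "fc.fo r (BAll \<A> (%A. BAll \<B> (%B. Ex (%z. Conj (is_inter z A B) (in_Ic c a z)))))"
   "fc.fo r (Neg (Ex (%C. separates (in_Ic c a) C \<A> \<B>)))" unfolding gap_def orthogonal_def fc.fo_conj by blast+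
  have rF: "r \<in> Field P" using fc.le_field(1)[OF r] .
  note rr = fc.le_refl[OF rF]
  have su: "fc.small (UNIV :: nat set)" by (rule fc.small_countable) simp
  obtain A where A: "!!n :: nat. fc.fmem r (A n) \<A>"
   "!!z q. q << r ==> fc.fmem q z \<A> ==> \<exists>s. s << q \<and> (\<exists>n. fc.feq s z (A n))"
   by (rule fc.bij_unpack[OF su eA[unfolded om_eq] rF]) (use that in blast)
  obtain B where B: "!!\<beta>. \<beta> \<in> underS \<nu> b ==> fc.fmem r (B \<beta>) \<B>"
   "!!z q. q << r ==> fc.fmem q z \<B> ==> \<exists>s. s << q \<and> (\<exists>\<beta>\<in>underS \<nu> b. fc.feq s z (B \<beta>))"
   by (rule unpack_elt[OF wo_fields(2) fc.fo_mono[OF e r] rF], rule that)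
  have As: "fc.fo r (Subset (A n) om)" for n using g(1) A(1) rr unfolding fc.fo_ball by blast
  have Bs: "fc.fo r (Subset (B \<beta>) om)" if "\<beta> \<in> underS \<nu> b" for \<beta> using g(2) B(1)[OF that] rr unfolding fc.fo_ball by blast
  have o: "ev r (%G. fc.sval (A n) G \<inter> fc.sval (B \<beta>) G \<in> Ic c a)" if \<beta>: "\<beta> \<in> underS \<nu> b" for n \<beta>
  proof -
   have "fc.fo r (Ex (%z. Conj (is_inter z (A n) (B \<beta>)) (in_Ic c a z)))"
    using g(3) A(1)[of n] B(1)[OF \<beta>] rr unfolding fc.fo_ball by blast
   then show ?thesis using fo_ops_Ic(1)[OF a As Bs[OF \<beta>] rF] by blast
  qed
  obtain C where C: "fc.mset C" "!!n. ev r (%G. fc.sval (A n) G \<inter> C G \<in> Ic c a)"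
   "!!\<beta>. \<beta> \<in> underS \<nu> b ==> ev r (%G. fc.sval (B \<beta>) G - C G \<in> Ic c a)"
   by (rule separation[OF a rF b, where A = "%n. fc.sval (A n)" and B = "%\<beta>. fc.sval (B \<beta>)"])
    (rule fc.mset_sval, rule fc.mset_sval, rule o, assumption, rule that)
  let ?C = "fc.sname C"
  note sC = fc.sval_sname[OF C(1)]
  have "fc.fo r (separates (in_Ic c a) ?C \<A> \<B>)"
   unfolding separates_def fc.fo_conj
  proof (intro conjI fc.sname_sub fc.fo_ball_dense cong_Ic_ops)
   fix q x assume q: "q << r" "fc.fmem q x \<A>"
   obtain s n where s: "s << q" "fc.feq s x (A n)" using A(2)[OF q] by blast
   have sF: "s \<in> Field P" and sr: "s << r" using fc.le_field(1)[OF s(1)] fc.le_trans[OF s(1) q(1)] by blast+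
   have "ev s (%G. fc.sval (A n) G \<inter> fc.sval ?C G \<in> Ic c a)"
    using fc.ev_gen_le[OF C(2)[of n] sr] sC[OF sF] by eventually_elim simp
   then have "fc.fo s (Ex (%z. Conj (is_inter z (A n) ?C) (in_Ic c a z)))"
    using fo_ops_Ic(1)[OF a fc.fo_mono[OF As sr] fc.sname_sub sF] by blast
   then show "\<exists>s y. s << q \<and> fc.feq s x y \<and> fc.fo s (Ex (%z. Conj (is_inter z y ?C) (in_Ic c a z)))" using s by blast
  next
   fix q x assume q: "q << r" "fc.fmem q x \<B>"
   obtain s \<beta> where s: "s << q" "\<beta> \<in> underS \<nu> b" "fc.feq s x (B \<beta>)" using B(2)[OF q] by blast
   have sF: "s \<in> Field P" and sr: "s << r" using fc.le_field(1)[OF s(1)] fc.le_trans[OF s(1) q(1)] by blast+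
   have "ev s (%G. fc.sval (B \<beta>) G - fc.sval ?C G \<in> Ic c a)"
    using fc.ev_gen_le[OF C(3)[OF s(2)] sr] sC[OF sF] by eventually_elim simp
   then have "fc.fo s (Ex (%z. Conj (is_diff z (B \<beta>) ?C) (in_Ic c a z)))"
    using fo_ops_Ic(2)[OF a fc.fo_mono[OF Bs[OF s(2)] sr] fc.sname_sub sF] by blast
   then show "\<exists>s y. s << q \<and> fc.feq s x y \<and> fc.fo s (Ex (%z. Conj (is_diff z y ?C) (in_Ic c a z)))" using s by blast
  qed
  then have "fc.fo r (Ex (%C. separates (in_Ic c a) C \<A> \<B>))" by (rule fc.fo_exI)
  then show False using g(4) rr unfolding fc.fo_neg by blast
 qed
qed

end

section \<open>Intervals, cuts and small sets\<close>

abbreviation "lo j \<equiv> fst (ival_of j)"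
abbreviation "hi j \<equiv> snd (ival_of j)"

definition ilen :: "nat => rat" where "ilen j = max 0 (hi j - lo j)"

definition cut :: "nat set => bool" where
 "cut Z \<longleftrightarrow> (\<exists>m. m \<in> Z) \<and> (\<exists>m. m \<notin> Z) \<and> (\<forall>m. m \<in> Z --> (\<forall>n. rat_of n < rat_of m --> n \<in> Z)) \<and>
  (\<forall>m. m \<in> Z --> (\<exists>n. n \<in> Z \<and> rat_of m < rat_of n))"

definition incut :: "nat set => nat => bool" where
 "incut Z j \<longleftrightarrow> (\<exists>m. m \<in> Z \<and> lo j < rat_of m) \<and> (\<exists>m. m \<notin> Z \<and> rat_of m < hi j)"

lemma ilen_nonneg: "0 \<le> ilen j" unfolding ilen_def by simp

lemma rat_ex: "\<exists>m. rat_of m = q" using rat_of_to_nat by blast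

text \<open>Otherwise disjoint stretches with sum above \<open>d\<close> could be found without end,
  and together they would exceed \<open>b\<close>.\<close>

lemma tail_small:
 fixes u :: "nat => rat"
 assumes u: "!!i. 0 \<le> u i" and b: "!!n. sum u {..<n} \<le> b" and d: "0 < d"
 shows "\<exists>n\<ge>t. \<forall>N. sum u {n..<N} \<le> d"
proof (rule ccontr)
 assume "\<not> ?thesis"
 then have n: "!!n. n \<ge> t ==> \<exists>N. d < sum u {n..<N}" by (meson not_le)
 have "\<exists>n\<ge>t. of_nat k * d \<le> sum u {..<n}" for k
 proof (induction k)
  case 0 then show ?case using u by (intro exI[of _ t]) (simp add: sum_nonneg)
 next
  case (Suc k)
  then obtain n where n1: "n \<ge> t" "of_nat k * d \<le> sum u {..<n}" by blast
  obtain N where N: "d < sum u {n..<N}" using n[OF n1(1)] by blast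
  then have "n \<le> N" using d by (cases "n \<le> N") auto
  then have "sum u {..<N} = sum u {..<n} + sum u {n..<N}"
   by (simp add: lessThan_atLeast0 sum.atLeastLessThan_concat)
  then show ?case using n1 N \<open>n \<le> N\<close> by (intro exI[of _ N]) (simp add: algebra_simps)
 qed
 moreover obtain k where "b / d < of_nat k" using reals_Archimedean2 by blast
 then have "b < of_nat k * d" using d by (simp add: divide_less_eq)
 ultimately show False using b by (meson not_le order_trans)
qed

lemma sum_prod_decode:
 fixes u :: "nat => nat => rat"
 assumes u: "!!t k. 0 \<le> u t k" and v: "!!t n. (\<Sum>k<n. u t k) \<le> v t"
 shows "(\<Sum>i<n. u (fst (prod_decode i)) (snd (prod_decode i))) \<le> (\<Sum>t<n. v t)"
proof -
 have inj: "inj_on prod_decode {..<n}" using inj_on_subset[OF inj_prod_decode] by blast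
 have sub: "prod_decode ` {..<n} \<subseteq> {..<n} \<times> {..<n}"
 proof
  fix y assume "y \<in> prod_decode ` {..<n}"
  then obtain i where i: "i < n" "y = prod_decode i" by blast
  then have "i = prod_encode (fst y, snd y)" by simp
  then show "y \<in> {..<n} \<times> {..<n}" using i(1) le_prod_encode_1[of "fst y" "snd y"] le_prod_encode_2[of "snd y" "fst y"]
   by (simp add: mem_Times_iff)
 qed
 have "(\<Sum>i<n. u (fst (prod_decode i)) (snd (prod_decode i))) = (\<Sum>y\<in>prod_decode ` {..<n}. u (fst y) (snd y))"
  by (simp add: sum.reindex[OF inj])
 also have "\<dots> \<le> (\<Sum>y\<in>{..<n} \<times> {..<n}. u (fst y) (snd y))" by (rule sum_mono2[OF _ sub]) (auto simp: u)
 also have "\<dots> = (\<Sum>t<n. \<Sum>k<n. u t k)" by (simp add: sum.cartesian_product split_def)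
 also have "\<dots> \<le> (\<Sum>t<n. v t)" by (rule sum_mono) (rule v)
 finally show ?thesis .
qed

lemma geo_le: "(\<Sum>t<n. (1/2::rat) ^ t) \<le> 2"
proof -
 have "(\<Sum>t<n. (1/2::rat) ^ t) = 2 - 2 * (1/2) ^ n" by (induction n) (auto simp: field_simps)
 then show ?thesis by simp
qed

text \<open>Places beyond the end of a list get the degenerate interval from \<open>0\<close> to
  \<open>0\<close>, so that one sequence runs through all lists without additional length.\<close>

definition enumL :: "(nat => nat list) => nat => nat" where
 "enumL L i = (let t = fst (prod_decode i); k = snd (prod_decode i) in
   if k < length (L t) then L t ! k else to_nat (0 :: rat, 0 :: rat))"

lemma enumL_mem: assumes "j \<in> set (L t)" shows "\<exists>i. enumL L i = j"
proof -
 obtain k where "k < length (L t)" "L t ! k = j" using assms by (auto simp: in_set_conv_nth)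
 then have "enumL L (prod_encode (t, k)) = j" by (simp add: enumL_def)
 then show ?thesis by blast
qed

lemma enumL_sum:
 assumes "!!t. sum_list (map ilen (L t)) \<le> (1/2) ^ (T + t)"
 shows "(\<Sum>i<n. ilen (enumL L i)) \<le> 2 * (1/2) ^ T"
proof -
 let ?u = "%t k. if k < length (L t) then ilen (L t ! k) else 0"
 have "ilen (enumL L i) = ?u (fst (prod_decode i)) (snd (prod_decode i))" for i
  by (simp add: enumL_def Let_def ilen_def ival_of_def)
 then have "(\<Sum>i<n. ilen (enumL L i)) = (\<Sum>i<n. ?u (fst (prod_decode i)) (snd (prod_decode i)))" by simp
 also have "\<dots> \<le> (\<Sum>t<n. (1/2) ^ (T + t))"
 proof (rule sum_prod_decode)
  fix t n
  have "(\<Sum>k<n. ?u t k) \<le> (\<Sum>k<n + length (L t). ?u t k)" by (rule sum_mono2) (auto simp: ilen_nonneg)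
  also have "\<dots> = (\<Sum>k<length (L t). ?u t k)" by (rule sum.mono_neutral_right) auto
  also have "\<dots> = sum_list (map ilen (L t))" by (simp add: sum_list_sum_nth lessThan_atLeast0)
  also note assms
  finally show "(\<Sum>k<n. ?u t k) \<le> (1/2) ^ (T + t)" .
 qed (simp add: ilen_nonneg)
 also have "\<dots> = (1/2) ^ T * (\<Sum>t<n. (1/2) ^ t)" by (simp add: power_add sum_distrib_left)
 also have "\<dots> \<le> (1/2) ^ T * 2" by (rule mult_left_mono[OF geo_le]) simp
 finally show ?thesis by simp
qed

text \<open>For bounded total length there are such break points, after which sums are at most
  \<open>d t\<close>; consecutive ones delimit a block.\<close>

definition brk :: "(nat => rat) => (nat => nat) => nat => nat" where
 "brk d g t = (LEAST n. t \<le> n \<and> (\<forall>N. sum (%i. ilen (g i)) {n..<N} \<le> d t))"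

definition blk :: "(nat => rat) => (nat => nat) => nat => nat list" where
 "blk d g t = map g [brk d g t..<brk d g (Suc t)]"

text \<open>A point met infinitely often is met after every break point, hence in blocks of
  arbitrarily large index. Being finite, a block has a code that a slalom can capture.\<close>

lemma blk:
 assumes d: "!!t. 0 < d t" "!!t. d (Suc t) \<le> d t" and g: "!!n. (\<Sum>i<n. ilen (g i)) \<le> b"
 shows "sum_list (map ilen (blk d g t)) \<le> d t"
  and "(!!m. \<exists>i\<ge>m. R (g i)) ==> \<exists>t\<ge>T. \<exists>j\<in>set (blk d g t). R j"
proof -
 let ?b = "brk d g"
 have b: "t \<le> ?b t \<and> (\<forall>N. sum (%i. ilen (g i)) {?b t..<N} \<le> d t)" for t
  unfolding brk_def by (rule LeastI_ex) (rule tail_small[OF ilen_nonneg g d(1)])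
 have mono: "?b t \<le> ?b (Suc t)" for t
  unfolding brk_def[of d g t] by (rule Least_le) (use b[of "Suc t"] d(2)[of t] in \<open>auto intro: order_trans\<close>)
 show "sum_list (map ilen (blk d g t)) \<le> d t"
  using b[of t] unfolding blk_def by (simp add: comp_def interv_sum_list_conv_sum_set_nat)
 assume R: "!!m. \<exists>i\<ge>m. R (g i)"
 obtain i where i: "i \<ge> ?b T" "R (g i)" using R by blast
 have ex: "\<exists>t. i < ?b t" using b[of "Suc i"] by (intro exI[of _ "Suc i"]) simp
 define t where "t = (LEAST t. i < ?b t)"
 have t: "i < ?b t" unfolding t_def by (rule LeastI_ex[OF ex])
 have mm: "mono ?b" using mono by (simp add: mono_iff_le_Suc)
 have "T < t" using i(1) t monoD[OF mm, of t T] by (cases "T < t") auto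
 then obtain t' where t': "t = Suc t'" "T \<le> t'" by (cases t) auto
 have "\<not> i < ?b t'" by (rule not_less_Least) (simp add: t_def[symmetric] t'(1))
 then have "g i \<in> set (blk d g t')" using t unfolding t'(1) blk_def by auto
 then show "\<exists>t\<ge>T. \<exists>j\<in>set (blk d g t). R j" using t'(2) i(2) by blast
qed

text \<open>Candidates that are too long are dropped, so the total length is bounded whatever the
  slalom contains.\<close>

definition catL :: "nat => rat => nat => nat list" where
 "catL k d s = (if card (set_decode s) \<le> k then
   concat (filter (%L. sum_list (map ilen L) \<le> d) (map from_nat (sorted_list_of_set (set_decode s)))) else [])"

lemma catL_sum: assumes "0 \<le> d" shows "sum_list (map ilen (catL k d s)) \<le> of_nat k * d"
proof -
 have *: "sum_list (map ilen (concat (filter (%L. sum_list (map ilen L) \<le> d) xs))) \<le> of_nat (length xs) * d" for xs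
  by (induction xs) (use assms in \<open>auto simp: algebra_simps\<close>)
 show ?thesis
 proof (cases "card (set_decode s) \<le> k")
  case True
  then have "of_nat (card (set_decode s)) * d \<le> of_nat k * d" using assms by (intro mult_right_mono) auto
  then show ?thesis using True *[of "map from_nat (sorted_list_of_set (set_decode s))"]
   unfolding catL_def by simp
 qed (simp add: catL_def assms)
qed

lemma catL_mem:
 assumes "to_nat L \<in> set_decode s" "card (set_decode s) \<le> k" "sum_list (map ilen L) \<le> d" "j \<in> set L"
 shows "j \<in> set (catL k d s)"
proof -
 have "L \<in> from_nat ` set_decode s" using assms(1) by (intro image_eqI[of _ _ "to_nat L"]) simp_all
 then show ?thesis using assms(2-4) unfolding catL_def by auto
qed

definition Iv :: "nat => real set" where "Iv j = {of_rat (lo j)<..<of_rat (hi j)}"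

text \<open>
  Up to finitely many points, \<open>Hs n k\<close> is the set of all reals in the unit interval whose \<open>k\<close>-th digit to the base
  \<open>2 ^ n\<close> is \<open>0\<close>. So for fixed \<open>n\<close> these sets are independent and have measure \<open>1 / 2 ^ n\<close>.
\<close>

definition Hl :: "nat => nat => nat list" where
 "Hl n k = map (%j. to_nat (of_nat j / of_nat ((2 ^ n) ^ k) :: rat,
   (of_nat j + 1 / of_nat (2 ^ n)) / of_nat ((2 ^ n) ^ k) :: rat)) [0..<(2 ^ n) ^ k]"

definition Hs :: "nat => nat => real set" where "Hs n k = (\<Union>j\<in>set (Hl n k). Iv j)"

lemma Iv_sets [simp]: "Iv j \<in> sets lborel" "open (Iv j)" unfolding Iv_def by simp_all

lemma Hs_sets [simp]: "Hs n k \<in> sets lborel" unfolding Hs_def by (intro sets.finite_UN) auto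

lemma emeasure_Iv: "emeasure lborel (Iv j) = ennreal (of_rat (ilen j))"
 unfolding Iv_def ilen_def by (cases "lo j \<le> hi j") (auto simp: of_rat_diff of_rat_less_eq max_def ennreal_neg)

lemma Hl_sum: "sum_list (map ilen (Hl n k)) = (1/2) ^ n"
proof -
 let ?N = "(2 ^ n) ^ k :: nat"
 have "map ilen (Hl n k) = map (%_. (1/2) ^ n / of_nat ?N) [0..<?N]"
  unfolding Hl_def by (simp add: comp_def ilen_def ival_of_def diff_divide_distrib[symmetric] power_one_over max_def)
 then show ?thesis by (simp add: sum_list_triv)
qed

lemma Hs_eq: "Hs n k = (\<Union>j<(2 ^ n) ^ k. {real j / (2 ^ n) ^ k<..<(real j + 1 / 2 ^ n) / (2 ^ n) ^ k})"
 unfolding Hs_def Hl_def Iv_def by (auto simp: ival_of_def of_rat_divide of_rat_add of_rat_power)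

text \<open>The numbers with \<open>k\<close> digits to the base \<open>B\<close> whose digits at
  places in \<open>T\<close> are not zero, where the leading digit has place
  \<open>0\<close>.\<close>

primrec Dg :: "nat => nat set => nat => nat set" where
 "Dg B T 0 = {0}"
| "Dg B T (Suc k) = (%(j, d). B * j + d) ` (Dg B T k \<times> {d. d < B \<and> (k \<in> T --> d ~= 0)})"

lemma finite_Dg: "finite (Dg B T k)" by (induction k) auto

lemma card_Dg:
 assumes B: "0 < B"
 shows "real (card (Dg B T K)) \<le> real B ^ K * (1 - 1 / real B) ^ card (T \<inter> {..<K})"
proof (induction K)
 case (Suc K)
 let ?D = "{d. d < B \<and> (K \<in> T --> d ~= 0)}"
 let ?e = "if K \<in> T then 1 - 1 / real B else 1"
 have e: "T \<inter> {..<Suc K} = (if K \<in> T then insert K (T \<inter> {..<K}) else T \<inter> {..<K})" by (auto simp: less_Suc_eq)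
 have c: "(1 - 1 / real B) ^ card (T \<inter> {..<Suc K}) = ?e * (1 - 1 / real B) ^ card (T \<inter> {..<K})" unfolding e by simp
 have "?D = (if K \<in> T then {..<B} - {0} else {..<B})" by auto
 then have D: "real (card ?D) = real B * ?e" using B by (simp add: field_simps of_nat_diff)
 have "card (Dg B T (Suc K)) \<le> card (Dg B T K \<times> ?D)" unfolding Dg.simps by (rule card_image_le) (simp add: finite_Dg)
 then have "real (card (Dg B T (Suc K))) \<le> real (card (Dg B T K)) * real (card ?D)"
  by (simp add: card_cartesian_product flip: of_nat_mult)
 also have "\<dots> \<le> real B ^ K * (1 - 1 / real B) ^ card (T \<inter> {..<K}) * (real B * ?e)"
  unfolding D by (intro mult_right_mono Suc.IH) (use B in auto)
 finally show ?case unfolding c by (simp only: power_Suc mult_ac)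
qed simp

lemma Dg_cover:
 assumes x: "0 < x" "x < 1" "x \<notin> \<rat>" and H: "!!k. k \<in> T ==> x \<notin> Hs n k"
 shows "\<exists>j\<in>Dg (2 ^ n) T K. real j / (2 ^ n) ^ K < x \<and> x < real (Suc j) / (2 ^ n) ^ K"
proof (induction K)
 case 0 then show ?case using x by simp
next
 case (Suc K)
 let ?B = "2 ^ n :: nat"
 obtain j where j: "j \<in> Dg ?B T K" "real j / (2 ^ n) ^ K < x" "x < real (Suc j) / (2 ^ n) ^ K" using Suc by blast
 \<comment> \<open>\<open>y\<close> locates \<open>x\<close> within its interval, and
   \<open>d\<close> is the next digit; irrationality keeps \<open>x\<close> off the
   endpoints.\<close>
 define y where "y = x * (2 ^ n) ^ K - real j"
 have y: "0 < y" "y < 1" using j(2,3) by (simp_all add: y_def field_simps)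
 define d where "d = nat \<lfloor>2 ^ n * y\<rfloor>"
 have dy: "real d = of_int \<lfloor>2 ^ n * y\<rfloor>" unfolding d_def using y by simp
 have d1: "real d \<le> 2 ^ n * y" "2 ^ n * y < real d + 1" unfolding dy by linarith+
 have xe: "x = (y + real j) / (2 ^ n) ^ K" unfolding y_def by simp
 have "real d ~= 2 ^ n * y"
 proof
  assume "real d = 2 ^ n * y"
  then have "y = real d / 2 ^ n" by simp
  then have "x \<in> \<rat>" unfolding xe by simp
  then show False using x(3) by blast
 qed
 then have d2: "real d < 2 ^ n * y" using d1 by simp
 have "real d < 2 ^ n * 1" by (rule less_trans[OF d2 mult_strict_left_mono[OF y(2)]]) simp
 then have "real d < real ?B" by simp
 then have dB: "d < ?B" using of_nat_less_iff by blast
 have "d ~= 0" if "K \<in> T"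
 proof
  assume "d = 0"
  then have "2 ^ n * y < 1" using d1 by simp
  then have "y < 1 / 2 ^ n" by (simp add: field_simps)
  then have 1: "x \<in> {real j / (2 ^ n) ^ K<..<(real j + 1 / 2 ^ n) / (2 ^ n) ^ K}"
   using j(2) unfolding xe by (simp add: divide_strict_right_mono)
  have "real j / (2 ^ n) ^ K < 1" using j(2) x(2) by linarith
  then have "real j < (2 ^ n) ^ K" by (simp add: divide_less_eq)
  then have "real j < real (?B ^ K)" by simp
  then have "j < ?B ^ K" using of_nat_less_iff by blast
  then have "x \<in> Hs n K" using 1 unfolding Hs_eq by blast
  then show False using H that by blast
 qed
 then have m: "?B * j + d \<in> Dg ?B T (Suc K)" using j(1) dB by auto
 have e: "x = (2 ^ n * y + 2 ^ n * real j) / (2 ^ n) ^ Suc K" unfolding xe by (simp add: field_simps)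
 have "real (?B * j + d) / (2 ^ n) ^ Suc K < x" "x < real (Suc (?B * j + d)) / (2 ^ n) ^ Suc K"
  unfolding e using d1 d2 by (auto intro!: divide_strict_right_mono)
 then show ?case using m by blast
qed

text \<open>Up to a null set the points of \<open>E\<close> have nonzero digits at all places in
  \<open>T\<close>; the intervals with such digits cover them and are counted by
  \<open>card_Dg\<close>.\<close>

lemma H_independent:
 assumes E: "E \<in> sets lborel" "E \<subseteq> {0<..<1}" and T: "finite T" and null: "!!k. k \<in> T ==> emeasure lborel (E \<inter> Hs n k) = 0"
 shows "emeasure lborel E \<le> ennreal ((1 - 1 / 2 ^ n) ^ card T)"
proof -
 obtain K where K: "T \<subseteq> {..<K}" using finite_nat_iff_bounded[of T] T by blast
 let ?J = "%j. {real j / (2 ^ n) ^ K<..<real (Suc j) / (2 ^ n) ^ K}"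
 let ?N = "\<rat> \<union> (\<Union>k\<in>T. E \<inter> Hs n k)"
 have q: "(\<rat> :: real set) \<in> null_sets lborel" using countable_imp_null_set_lborel[OF countable_rat] .
 have "(\<Union>k\<in>T. E \<inter> Hs n k) \<in> null_sets lborel"
  using T E null by (intro null_sets_UN' countable_finite) (auto intro!: null_setsI sets.Int simp del: sets_lborel)
 then have N: "?N \<in> null_sets lborel" using q null_sets.Un by blast
 have sub: "E \<subseteq> ?N \<union> (\<Union>j\<in>Dg (2 ^ n) T K. ?J j)"
 proof
  fix x assume x: "x \<in> E"
  show "x \<in> ?N \<union> (\<Union>j\<in>Dg (2 ^ n) T K. ?J j)"
  proof (cases "x \<in> ?N")
   case False
   then have "\<exists>j\<in>Dg (2 ^ n) T K. real j / (2 ^ n) ^ K < x \<and> x < real (Suc j) / (2 ^ n) ^ K"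
    using x E(2) by (intro Dg_cover) auto
   then show ?thesis by auto
  qed blast
 qed
 have "emeasure lborel E \<le> emeasure lborel (?N \<union> (\<Union>j\<in>Dg (2 ^ n) T K. ?J j))"
  by (rule emeasure_mono[OF sub]) (intro sets.Un[OF null_setsD2[OF N]] sets.finite_UN finite_Dg, simp)
 also have "\<dots> = emeasure lborel (\<Union>j\<in>Dg (2 ^ n) T K. ?J j)"
  by (subst Un_commute, rule emeasure_Un_null_set[OF _ N]) (intro sets.finite_UN finite_Dg, auto)
 also have "\<dots> \<le> (\<Sum>j\<in>Dg (2 ^ n) T K. emeasure lborel (?J j))"
  by (rule emeasure_subadditive_finite[OF finite_Dg]) auto
 also have "\<dots> = (\<Sum>j\<in>Dg (2 ^ n) T K. ennreal (1 / (2 ^ n) ^ K))"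
  by (intro sum.cong refl) (simp add: divide_right_mono diff_divide_distrib[symmetric])
 also have "\<dots> = ennreal (real (card (Dg (2 ^ n) T K)) * (1 / (2 ^ n) ^ K))"
  by (simp add: ennreal_of_nat_eq_real_of_nat ennreal_mult[symmetric])
 also have "\<dots> \<le> ennreal ((1 - 1 / 2 ^ n) ^ card T)"
 proof (rule ennreal_leI)
  have "real (card (Dg (2 ^ n) T K)) \<le> (2 ^ n) ^ K * (1 - 1 / 2 ^ n) ^ card T"
   using card_Dg[of "2 ^ n" T K] K by (simp add: Int_absorb2)
  then show "real (card (Dg (2 ^ n) T K)) * (1 / (2 ^ n) ^ K) \<le> (1 - 1 / 2 ^ n) ^ card T"
   by (simp add: divide_le_eq mult.commute)
 qed
 finally show ?thesis .
qed

section \<open>Positive measure outside a cover\<close>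

definition pos :: "(nat => nat) => real set => bool" where
 "pos f A \<longleftrightarrow> emeasure lborel (A - (\<Union>i. Iv (f i))) ~= 0"

text \<open>Continuity from above reduces the infinite union to finite ones, and positivity to
  countably many bounds; in this form positivity is measurable in \<open>f\<close>.\<close>

lemma pos_iff:
 assumes A: "A \<in> sets lborel" "emeasure lborel A ~= \<infinity>"
 shows "ennreal e \<le> emeasure lborel (A - (\<Union>i. Iv (f i))) \<longleftrightarrow> (\<forall>k. ennreal e \<le> emeasure lborel (A - (\<Union>i<k. Iv (f i))))"
  and "pos f A \<longleftrightarrow> (\<exists>d. ennreal (1 / real (Suc d)) \<le> emeasure lborel (A - (\<Union>i. Iv (f i))))"
proof -
 let ?A = "%k. A - (\<Union>i<k. Iv (f i))"
 have s: "?A k \<in> sets lborel" for k using A(1) by (intro sets.Diff sets.finite_UN) auto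
 have "(\<Inter>k. ?A k) = A - (\<Union>i. Iv (f i))" by auto
 moreover have "emeasure lborel (\<Inter>k. ?A k) = (INF k. emeasure lborel (?A k))"
 proof (rule INF_emeasure_decseq[symmetric])
  show "range ?A \<subseteq> sets lborel" using s by blast
  show "decseq ?A" unfolding decseq_def by force
  show "emeasure lborel (?A k) ~= \<infinity>" for k
   using emeasure_mono[of "?A k" A lborel] A by (auto simp: top_unique)
 qed
 ultimately show "ennreal e \<le> emeasure lborel (A - (\<Union>i. Iv (f i))) \<longleftrightarrow> (\<forall>k. ennreal e \<le> emeasure lborel (?A k))"
  by (simp add: le_INF_iff)
 let ?x = "emeasure lborel (A - (\<Union>i. Iv (f i)))"
 show "pos f A \<longleftrightarrow> (\<exists>d. ennreal (1 / real (Suc d)) \<le> ?x)"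
 proof
  assume "pos f A"
  then have "0 < ?x" unfolding pos_def by (simp add: zero_less_iff_neq_zero)
  then obtain e where e: "0 < e" "ennreal e \<le> ?x"
  proof (cases ?x rule: ennreal_cases)
   case (real r)
   then have "0 < r" using \<open>0 < ?x\<close> by simp
   then show thesis using that[of r] real by simp
  next
   case top then show thesis using that[of 1] by simp
  qed
  obtain d where "1 / real (Suc d) < e" using e(1) reals_Archimedean[of e] by (auto simp: inverse_eq_divide)
  then have "ennreal (1 / real (Suc d)) \<le> ?x" using e(2) ennreal_leI[OF less_imp_le] by (meson order_trans)
  then show "\<exists>d. ennreal (1 / real (Suc d)) \<le> ?x" by blast
 next
  assume "\<exists>d. ennreal (1 / real (Suc d)) \<le> ?x"
  then obtain d where "ennreal (1 / real (Suc d)) \<le> ?x" by blast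
  then show "pos f A" unfolding pos_def by (auto simp: ennreal_eq_0_iff)
 qed
qed

lemma pos_UN:
 assumes "pos f A" "A \<subseteq> (\<Union>j\<in>J. C j)" "countable J" "!!j. j \<in> J ==> C j \<in> sets lborel"
 shows "\<exists>j\<in>J. pos f (C j)"
proof (rule ccontr)
 assume "\<not> ?thesis"
 then have "C j - (\<Union>i. Iv (f i)) \<in> null_sets lborel" if "j \<in> J" for j
  using that assms(4) unfolding pos_def by (intro null_setsI sets.Diff sets.countable_UN) auto
 then have "(\<Union>j\<in>J. C j - (\<Union>i. Iv (f i))) \<in> null_sets lborel" by (intro null_sets_UN' assms(3))
 then have "A - (\<Union>i. Iv (f i)) \<in> null_sets lborel \<or> emeasure lborel (A - (\<Union>i. Iv (f i))) = 0"
  using emeasure_mono[of "A - (\<Union>i. Iv (f i))" "\<Union>j\<in>J. C j - (\<Union>i. Iv (f i))" lborel] assms(2) by force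
 then show False using assms(1) unfolding pos_def by auto
qed

text \<open>
  A Baire category argument with sets of positive measure. Taking least codes makes the point that it produces a
  measurable function of \<open>f\<close> and \<open>c\<close>.
\<close>

definition nxt :: "(nat => nat) => (nat => nat) => nat => nat => nat => bool" where
 "nxt f c k s j \<longleftrightarrow> (lo s < lo j \<and> hi j < hi s \<and> lo j < hi j \<and> hi j - lo j \<le> (1/2) ^ k) \<and> pos f (Iv j) \<and>
   (\<exists>n. k \<le> n \<and> (\<exists>i\<in>set (Hl n (c n)). lo i \<le> lo j \<and> hi j \<le> hi i))"

primrec nest :: "(nat => nat) => (nat => nat) => nat => nat" where
 "nest f c 0 = to_nat (0 :: rat, 1 :: rat)"
| "nest f c (Suc k) = (LEAST j. nxt f c k (nest f c k) j)"

text \<open>For nested intervals with lengths tending to zero, this is the cut of their common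
  point.\<close>

definition Zc :: "(nat => nat) => (nat => nat) => nat set" where
 "Zc f c = {m. \<exists>k. rat_of m < lo (nest f c k)}"

text \<open>The way the construction gets stuck: a part of \<open>Iv s\<close> of measure at least
  \<open>1 / (d + 1)\<close> escapes the cover, yet from \<open>m\<close> on the digit sets miss it
  almost everywhere. The three parameters are natural numbers and can serve as a label.\<close>

definition somewhere_null :: "(nat => nat) => (nat => nat) => nat => nat => nat => bool" where
 "somewhere_null f c s m d \<longleftrightarrow> 0 \<le> lo s \<and> hi s \<le> 1 \<and> ennreal (1 / real (Suc d)) \<le> emeasure lborel (Iv s - (\<Union>i. Iv (f i))) \<and>
   (\<forall>n. m \<le> n --> \<not> pos f (Iv s \<inter> Hs n (c n)))"

lemma Iv_fin: "emeasure lborel (Iv s) ~= \<infinity>" by (simp add: emeasure_Iv)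

text \<open>Some late digit set keeps positive measure in \<open>Iv s\<close> outside the cover. It
  is a finite union of intervals, and the short rational intervals strictly inside one of them are a
  countable cover, so one of these keeps positive measure as well.\<close>

lemma nxt_ex:
 assumes n: "!!s m d. \<not> somewhere_null f c s m d" and s: "0 \<le> lo s" "hi s \<le> 1" "pos f (Iv s)"
 shows "\<exists>j. nxt f c k s j"
proof -
 obtain d where "ennreal (1 / real (Suc d)) \<le> emeasure lborel (Iv s - (\<Union>i. Iv (f i)))"
  using s(3) unfolding pos_iff(2)[OF Iv_sets(1) Iv_fin] by blast
 then obtain n where n: "k \<le> n" "pos f (Iv s \<inter> Hs n (c n))" using n[of s k d] s unfolding somewhere_null_def by blast
 have "Iv s \<inter> Hs n (c n) \<subseteq> (\<Union>i\<in>set (Hl n (c n)). Iv s \<inter> Iv i)" unfolding Hs_def by blast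
 then obtain i where i: "i \<in> set (Hl n (c n))" "pos f (Iv s \<inter> Iv i)"
  using pos_UN[OF n(2), where J = "set (Hl n (c n))" and C = "%i. Iv s \<inter> Iv i"] by (auto intro: countable_finite)
 define a b where "a = max (lo s) (lo i)" and "b = min (hi s) (hi i)"
 let ?J = "{j. a < lo j \<and> hi j < b \<and> lo j < hi j \<and> hi j - lo j \<le> (1/2) ^ k}"
 have "Iv s \<inter> Iv i \<subseteq> (\<Union>j\<in>?J. Iv j)"
 proof
  fix x assume "x \<in> Iv s \<inter> Iv i"
  moreover have "(of_rat a :: real) = max (of_rat (lo s)) (of_rat (lo i))" "(of_rat b :: real) = min (of_rat (hi s)) (of_rat (hi i))"
   by (simp_all add: a_def b_def max_def min_def of_rat_less_eq)
  ultimately have x: "of_rat a < x" "x < of_rat b" unfolding Iv_def by auto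
  let ?e = "(1/2) ^ k / 2 :: real"
  obtain p where p: "max (of_rat a) (x - ?e) < of_rat p" "of_rat p < x"
   using of_rat_dense[of "max (of_rat a) (x - ?e)" x] x(1) by auto
  obtain q where q: "x < of_rat q" "of_rat q < min (of_rat b) (x + ?e)"
   using of_rat_dense[of x "min (of_rat b) (x + ?e)"] x(2) by auto
  have "of_rat (q - p) < (of_rat ((1/2) ^ k) :: real)" using p(1) q(2) by (simp add: of_rat_diff of_rat_power of_rat_divide)
  then have "q - p < (1/2) ^ k" unfolding of_rat_less .
  moreover have "a < p" "q < b" "p < q" using p q less_trans[OF p(2) q(1)] by (simp_all add: of_rat_less)
  ultimately have "to_nat (p, q) \<in> ?J" by (simp add: ival_of_def)
  moreover have "x \<in> Iv (to_nat (p, q))" using p q by (simp add: Iv_def ival_of_def)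
  ultimately show "x \<in> (\<Union>j\<in>?J. Iv j)" by blast
 qed
 then obtain j where j: "j \<in> ?J" "pos f (Iv j)" using pos_UN[OF i(2), where J = ?J and C = Iv] by auto
 then have "nxt f c k s j" unfolding nxt_def a_def b_def using n(1) i(1) by (auto intro!: exI[of _ n] bexI[of _ i])
 then show ?thesis by blast
qed

text \<open>A cover of total length at most \<open>1/2\<close> does not exhaust the unit interval,
  so the construction starts. Were the common point in \<open>Iv (f i)\<close>, some nested interval
  would lie inside and have nothing left outside the cover.\<close>

lemma Zc:
 assumes n: "!!s m d. \<not> somewhere_null f c s m d" and f: "!!n. (\<Sum>i<n. ilen (f i)) \<le> 1/2"
 shows "cut (Zc f c)" "\<exists>n\<ge>T. \<exists>i\<in>set (Hl n (c n)). incut (Zc f c) i" "\<not> incut (Zc f c) (f i)"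
proof -
 let ?s = "nest f c" and ?U = "\<Union>i. Iv (f i)"
 have "emeasure lborel ?U \<le> (\<Sum>i. emeasure lborel (Iv (f i)))" by (intro emeasure_subadditive_countably) auto
 also have "\<dots> \<le> ennreal (1/2)"
 proof (rule suminf_le_const)
  fix N
  have "(\<Sum>i<N. emeasure lborel (Iv (f i))) = ennreal (of_rat (\<Sum>i<N. ilen (f i)))"
   by (simp add: emeasure_Iv of_rat_sum sum_ennreal ilen_nonneg)
  also have "\<dots> \<le> ennreal (of_rat (1/2))" by (intro ennreal_leI) (simp only: of_rat_less_eq f)
  finally show "(\<Sum>i<N. emeasure lborel (Iv (f i))) \<le> ennreal (1/2)" by (simp add: of_rat_divide)
 qed simp
 finally have U: "emeasure lborel ?U \<le> ennreal (1/2)" .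
 have s0: "pos f (Iv (?s 0))" unfolding pos_def
 proof
  assume z: "emeasure lborel (Iv (?s 0) - ?U) = 0"
  have e1: "emeasure lborel (Iv (?s 0)) = ennreal 1" by (simp add: emeasure_Iv ilen_def ival_of_def)
  have "emeasure lborel (Iv (?s 0)) \<le> emeasure lborel ((Iv (?s 0) - ?U) \<union> ?U)" by (intro emeasure_mono sets.Un sets.Diff sets.countable_UN) auto
  also have "\<dots> \<le> emeasure lborel (Iv (?s 0) - ?U) + emeasure lborel ?U" by (intro emeasure_subadditive sets.Diff sets.countable_UN) auto
  also have "\<dots> \<le> ennreal (1/2)" using z U by simp
  finally have "ennreal 1 \<le> ennreal (1/2)" unfolding e1 .
  then have "(1::real) \<le> 1/2" by (subst (asm) ennreal_le_iff) auto
  then show False by simp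
 qed
 have st: "pos f (Iv (?s k)) \<and> 0 \<le> lo (?s k) \<and> hi (?s k) \<le> 1 \<and> nxt f c k (?s k) (?s (Suc k))" for k
 proof (induction k)
  case 0
  have "0 \<le> lo (?s 0) \<and> hi (?s 0) \<le> 1" by (simp add: ival_of_def)
  then show ?case using s0 LeastI_ex[OF nxt_ex[OF n _ _ s0]] by simp
 next
  case (Suc k)
  then have "pos f (Iv (?s (Suc k)))" "0 \<le> lo (?s (Suc k))" "hi (?s (Suc k)) \<le> 1" unfolding nxt_def by (auto simp del: nest.simps)
  moreover from nxt_ex[OF n this(2,3,1)] have "nxt f c (Suc k) (?s (Suc k)) (?s (Suc (Suc k)))"
   unfolding nest.simps(2)[of f c "Suc k"] by (rule LeastI_ex)
  ultimately show ?case by blast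
 qed
 have nx: "lo (?s k) < lo (?s (Suc k))" "hi (?s (Suc k)) < hi (?s k)" "hi (?s (Suc k)) - lo (?s (Suc k)) \<le> (1/2) ^ k" "lo (?s k) < hi (?s k)" for k
  using st[of k] unfolding nxt_def by (auto simp del: nest.simps)
 have li: "lo (?s k) \<le> lo (?s l)" if "k \<le> l" for k l by (rule lift_Suc_mono_le[of "%k. lo (?s k)", OF less_imp_le[OF nx(1)] that])
 have hd: "hi (?s l) \<le> hi (?s k)" if "k \<le> l" for k l by (rule lift_Suc_antimono_le[of "%k. hi (?s k)", OF less_imp_le[OF nx(2)] that])
 have lh: "lo (?s k) < hi (?s l)" for k l
  using li[of k "max k l"] hd[of l "max k l"] nx(4)[of "max k l"] by simp
 have Zi: "m \<in> Zc f c \<longleftrightarrow> (\<exists>k. rat_of m < lo (?s k))" for m unfolding Zc_def by simp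
 have Zn: "m \<notin> Zc f c" if "hi (?s k) \<le> rat_of m" for m k unfolding Zi using lh[of _ k] that by (meson less_le_trans not_less_iff_gr_or_eq)
 obtain m0 m1 where m: "rat_of m0 = lo (?s 0)" "rat_of m1 = hi (?s 0)" using rat_ex by metis
 show "cut (Zc f c)" unfolding cut_def
 proof (intro conjI allI impI)
  show "\<exists>m. m \<in> Zc f c" unfolding Zi using m(1) nx(1)[of 0] by metis
  show "\<exists>m. m \<notin> Zc f c" using Zn[of 0 m1] m(2) by auto
  show "n \<in> Zc f c" if "m \<in> Zc f c" "rat_of n < rat_of m" for m n using that unfolding Zi by (meson less_trans)
  show "\<exists>n. n \<in> Zc f c \<and> rat_of m < rat_of n" if h: "m \<in> Zc f c" for m
  proof -
   obtain k where k: "rat_of m < lo (?s k)" using h unfolding Zi by blast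
   obtain n where n: "rat_of n = lo (?s k)" using rat_ex by blast
   then have "n \<in> Zc f c" unfolding Zi using nx(1)[of k] by (intro exI[of _ "Suc k"]) (simp del: nest.simps)
   then show ?thesis using k n by (intro exI[of _ n]) simp
  qed
 qed
 obtain n h where ni: "T \<le> n" "h \<in> set (Hl n (c n))" "lo h \<le> lo (?s (Suc T))" "hi (?s (Suc T)) \<le> hi h"
  using st[of T] unfolding nxt_def by blast
 have "incut (Zc f c) h"
 proof -
  let ?k = "Suc T"
  obtain m where m: "lo (?s ?k) < rat_of m" "rat_of m < lo (?s (Suc ?k))" using dense[OF nx(1)[of ?k]] rat_ex by metis
  obtain m' where m': "rat_of m' = hi (?s (Suc ?k))" using rat_ex by blast
  have "m \<in> Zc f c" "lo h < rat_of m" using m ni(3) unfolding Zi by (blast, linarith)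
  moreover have "m' \<notin> Zc f c" "rat_of m' < hi h" using Zn[of "Suc ?k" m'] m' nx(2)[of ?k] ni(4) by (simp_all del: nest.simps)
  ultimately show ?thesis unfolding incut_def by blast
 qed
 then show "\<exists>n\<ge>T. \<exists>i\<in>set (Hl n (c n)). incut (Zc f c) i" using ni(1,2) by blast
 show "\<not> incut (Zc f c) (f i)"
 proof
  assume "incut (Zc f c) (f i)"
  then obtain m m' where m: "m \<in> Zc f c" "lo (f i) < rat_of m" "m' \<notin> Zc f c" "rat_of m' < hi (f i)" unfolding incut_def by blast
  obtain k where k: "rat_of m < lo (?s k)" using m(1) unfolding Zi by blast
  obtain l where "1 / (hi (f i) - rat_of m') < of_nat l" using reals_Archimedean2 by blast
  then have "1 / (hi (f i) - rat_of m') < 2 ^ l" using of_nat_less_two_power[of l] less_trans by blast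
  then have l: "(1/2) ^ l < hi (f i) - rat_of m'" using m(4) by (simp add: field_simps)
  let ?t = "Suc (max k l)"
  have "(1/2 :: rat) ^ max k l \<le> (1/2) ^ l" by (intro power_decreasing) auto
  moreover have "lo (?s ?t) \<le> rat_of m'" using m(3) unfolding Zi by (meson not_le)
  ultimately have "hi (?s ?t) < hi (f i)" using nx(3)[of "max k l"] l by linarith
  moreover have "lo (f i) < lo (?s ?t)" using m(2) k li[OF le_SucI[OF max.cobounded1[of k l]]] by linarith
  ultimately have "Iv (?s ?t) \<subseteq> Iv (f i)" unfolding Iv_def
   by (intro greaterThanLessThan_subseteq_greaterThanLessThan[THEN iffD2]) (simp add: of_rat_less_eq del: nest.simps)
  then have e: "Iv (?s ?t) - ?U = {}" by blast
  show False using st[of ?t] unfolding pos_def e by simp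
 qed
qed

section \<open>Null sets in the extension\<close>

context forcing
begin

text \<open>A property of the first \<open>n\<close> values is a countable union over the lists of
  these values.\<close>

lemma pred_fin:
 assumes g: "mfun g" and R: "!!h h'. (!!i. i < n ==> h i = h' i) ==> R h \<longleftrightarrow> R h'"
 shows "mpred (%G. R (g G))"
proof -
 have 1: "mpred (%G. \<exists>L :: nat list. (length L = n \<and> R (%i. L ! i)) \<and> (\<forall>i. i < n --> g G i = L ! i))"
  by (intro pred_intros_countable pred_intros_logic pred_nat2[OF mfunD[OF g] mfunD[OF g], where R = "%u v. u = _"]) simp_all
 have e: "(\<exists>L :: nat list. (length L = n \<and> R (%i. L ! i)) \<and> (\<forall>i. i < n --> g G i = L ! i)) \<longleftrightarrow> R (g G)" for G
 proof
  assume "\<exists>L :: nat list. (length L = n \<and> R (%i. L ! i)) \<and> (\<forall>i. i < n --> g G i = L ! i)"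
  then obtain L :: "nat list" where "R (%i. L ! i)" "!!i. i < n ==> g G i = L ! i" by blast
  then show "R (g G)" using R[of "%i. L ! i" "g G"] by simp
 next
  assume "R (g G)"
  then have "R (%i. map (g G) [0..<n] ! i)" using R[of "%i. map (g G) [0..<n] ! i" "g G"] by simp
  then show "\<exists>L :: nat list. (length L = n \<and> R (%i. L ! i)) \<and> (\<forall>i. i < n --> g G i = L ! i)"
   by (intro exI[of _ "map (g G) [0..<n]"]) simp
 qed
 show ?thesis using 1 unfolding e .
qed

lemma Tr_true: "fo p \<phi> ==> p \<in> Field P ==> Tr p \<phi> (%G. True)"
 by (rule Tr_const) simp_all

lemma fo_not_not: "fo p (Neg (Neg \<phi>)) \<longleftrightarrow> fo p \<phi>"
proof
 assume "fo p (Neg (Neg \<phi>))"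
 then show "fo p \<phi>" unfolding fo_neg by (intro fo_dense) blast
next
 assume "fo p \<phi>"
 then show "fo p (Neg (Neg \<phi>))" unfolding fo_neg using fo_mono le_refl1(1) by blast
qed

lemma Tr_bex_sub:
 assumes x: "fo p (Subset x om)" and c: "cong \<phi>" and tr: "!!n. Tr p (\<phi> (nm n)) (\<Phi> n)"
 shows "Tr p (BEx x \<phi>) (%G. \<exists>n. n \<in> sval x G \<and> \<Phi> n G)"
 unfolding BEx_def
proof (rule Tr_ex)
 show "cong (%y. Conj (Mem y x) (\<phi> y))" by (intro congs c)
 show "Tr p (Conj (Mem (nm n) x) (\<phi> (nm n))) (%G. n \<in> sval x G \<and> \<Phi> n G)" for n by (intro Tr_conj Tr_sval tr)
 show "fmem q y om" if "q << p" "fo q (Conj (Mem y x) (\<phi> y))" for q y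
  using that x unfolding fo_subset fo_conj forces.simps by blast
qed

lemma Tr_ball_sub:
 assumes x: "fo p (Subset x om)" and c: "cong \<phi>" and tr: "!!n. Tr p (\<phi> (nm n)) (\<Phi> n)"
 shows "Tr p (BAll x \<phi>) (%G. \<forall>n. n \<in> sval x G --> \<Phi> n G)"
proof -
 have "Tr p (Neg (BEx x (%y. Neg (\<phi> y)))) (%G. \<not> (\<exists>n. n \<in> sval x G \<and> \<not> \<Phi> n G))"
  by (intro Tr_neg Tr_bex_sub x cong_neg c tr)
 moreover have "fo q (Neg (BEx x (%y. Neg (\<phi> y)))) \<longleftrightarrow> fo q (BAll x \<phi>)" for q
  unfolding BEx_def BAll_def Ex_def fo_not_not ..
 ultimately show ?thesis unfolding Tr_def by simp
qed

lemma Tr_is_real: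
 assumes x: "fo p (Subset x om)" and p: "p \<in> Field P"
 shows "Tr p (is_real x) (%G. cut (sval x G))"
proof -
 note r = Tr_rel2_check[OF p, of "{(m, n). rat_of m < rat_of n}", unfolded mem_Collect_eq prod.case]
 have "Tr p (is_real x) (%G. True \<and> (\<exists>m. m \<in> sval x G) \<and> (\<exists>m. m \<notin> sval x G) \<and>
  (\<forall>m. m \<in> sval x G --> (\<forall>n. rat_of n < rat_of m --> n \<in> sval x G)) \<and>
  (\<forall>m. m \<in> sval x G --> (\<exists>n. n \<in> sval x G \<and> rat_of m < rat_of n)))"
  unfolding is_real_def rat_less_def
 proof (intro Tr_conj Tr_true[OF x p] Tr_ball_sub[OF x] Tr_bex_sub[OF x] Tr_ball_om Tr_bex_om Tr_neg Tr_imp Tr_sval r)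
  show "Tr p (Ex (%m. Mem m x)) (%G. \<exists>m. m \<in> sval x G)"
   by (rule Tr_ex[OF cong_mem1 _ Tr_sval]) (use x in \<open>unfold fo_subset forces.simps, blast\<close>)
 qed (intro congs)+
 then show ?thesis unfolding cut_def by simp
qed

lemma is_real_sub: "fo p (is_real x) ==> fo p (Subset x om)" unfolding is_real_def fo_conj by blast

lemma Tr_in_interval:
 assumes x: "fo p (Subset x om)" and p: "p \<in> Field P"
 shows "Tr p (in_interval x (nm j)) (%G. incut (sval x G) j)"
 unfolding in_interval_def left_end_less_def right_end_greater_def incut_def
proof (intro Tr_conj Tr_bex_sub[OF x] Tr_bex_om Tr_neg Tr_sval)
 show "Tr p (rel2 (check_rel {(j, m). lo j < rat_of m}) (nm j) (nm n)) (%G. lo j < rat_of n)" for n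
  using Tr_rel2_check[OF p, of "{(j, m). lo j < rat_of m}" j n] by simp
 show "Tr p (rel2 (check_rel {(j, m). rat_of m < hi j}) (nm j) (nm n)) (%G. rat_of n < hi j)" for n
  using Tr_rel2_check[OF p, of "{(j, m). rat_of m < hi j}" j n] by simp
qed (intro congs)+

lemma Tr_partial_sums:
 assumes f: "fo p (is_fun f om om)" and s: "fo p (is_fun s om om)" and p: "p \<in> Field P"
 shows "Tr p (partial_sums s f) (%G. val s G 0 = to_nat (0 :: rat) \<and>
  (\<forall>n. rat_of (val s G (Suc n)) = rat_of (val s G n) + ilen (val f G n)))"
proof -
 let ?S = "{(m, n). n = Suc m}" and ?A = "{(u, j, v). rat_of v = rat_of u + max 0 (hi j - lo j)}"
 have 1: "Tr p (Ex (%n'. Ex (%u. Ex (%j. Ex (%v. Conj (rel2 (check_rel ?S) (nm n) n') (Conj (rel2 s (nm n) u)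
   (Conj (rel2 f (nm n) j) (Conj (rel2 s n' v) (rel3 (check_rel3 ?A) u j v)))))))))
  (%G. \<exists>n' u j v. (n, n') \<in> ?S \<and> val s G n = u \<and> val f G n = j \<and> val s G n' = v \<and> (u, j, v) \<in> ?A)" for n
 proof (intro Tr_ex Tr_conj Tr_rel2_check Tr_rel3_check Tr_val[OF f p] Tr_val[OF s p] p)
  fix q n' assume h: "fo q (Ex (%u. Ex (%j. Ex (%v. Conj (rel2 (check_rel ?S) (nm n) n') (Conj (rel2 s (nm n) u)
   (Conj (rel2 f (nm n) j) (Conj (rel2 s n' v) (rel3 (check_rel3 ?A) u j v))))))))"
  show "fmem q n' om"
   by (rule ex_om[OF h], erule ex_om, erule ex_om) (unfold fo_conj, blast dest: rel2_check_om(2))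
 next
  fix n' q u assume h: "fo q (Ex (%j. Ex (%v. Conj (rel2 (check_rel ?S) (nm n) (nm n')) (Conj (rel2 s (nm n) u)
   (Conj (rel2 f (nm n) j) (Conj (rel2 s (nm n') v) (rel3 (check_rel3 ?A) u j v)))))))"
  show "fmem q u om"
   by (rule ex_om[OF h], erule ex_om) (unfold fo_conj, blast dest: rel3_check_om(1))
 next
  fix n' u q j assume h: "fo q (Ex (%v. Conj (rel2 (check_rel ?S) (nm n) (nm n')) (Conj (rel2 s (nm n) (nm u))
   (Conj (rel2 f (nm n) j) (Conj (rel2 s (nm n') v) (rel3 (check_rel3 ?A) (nm u) j v))))))"
  show "fmem q j om" by (rule ex_om[OF h]) (unfold fo_conj, blast dest: rel3_check_om(2))
 next
  fix n' u j q v assume "fo q (Conj (rel2 (check_rel ?S) (nm n) (nm n')) (Conj (rel2 s (nm n) (nm u))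
   (Conj (rel2 f (nm n) (nm j)) (Conj (rel2 s (nm n') v) (rel3 (check_rel3 ?A) (nm u) (nm j) v)))))"
  then show "fmem q v om" unfolding fo_conj by (blast dest: rel3_check_om(3))
 qed (intro congs)+
 have "Tr p (partial_sums s f) (%G. True \<and> val s G 0 = to_nat (0 :: rat) \<and>
  (\<forall>n. \<exists>n' u j v. (n, n') \<in> ?S \<and> val s G n = u \<and> val f G n = j \<and> val s G n' = v \<and> (u, j, v) \<in> ?A))"
  unfolding partial_sums_def check_rat_def is_suc_def add_length_def
  by (intro Tr_conj Tr_true[OF s p] Tr_val[OF s p] Tr_ball_om 1) (intro congs)
 then show ?thesis by (simp add: ilen_def)
qed

abbreviation "covered f x \<equiv> BEx om (%n. Ex (%j. Conj (rel2 f n j) (in_interval x j)))"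
abbreviation "bounded_by s e \<equiv> BAll om (%n. Ex (%v. Conj (rel2 s n v) (rat_le v e)))"

lemma Tr_bounded_by:
 assumes s: "fo p (is_fun s om om)" and p: "p \<in> Field P"
 shows "Tr p (bounded_by s (nm e)) (%G. \<forall>n. rat_of (val s G n) \<le> rat_of e)"
proof -
 have "Tr p (bounded_by s (nm e))
  (%G. \<forall>n. \<exists>v. val s G n = v \<and> (v, e) \<in> {(m, n). rat_of m \<le> rat_of n})"
  unfolding rat_le_def
  by (intro Tr_ball_om Tr_ex Tr_conj Tr_val[OF s p] Tr_rel2_check p congs) (unfold fo_conj, blast intro: rel2_check_om)
 then show ?thesis by simp
qed

lemma Tr_covered:
 assumes f: "fo p (is_fun f om om)" and x: "fo p (Subset x om)" and p: "p \<in> Field P"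
 shows "Tr p (covered f x) (%G. \<exists>n. incut (sval x G) (val f G n))"
proof -
 have c: "cong (%j. in_interval x j)" unfolding in_interval_def left_end_less_def right_end_greater_def by (intro congs)
 have "Tr p (covered f x) (%G. \<exists>n j. val f G n = j \<and> incut (sval x G) j)"
  by (intro Tr_bex_om Tr_ex Tr_conj Tr_val[OF f p] Tr_in_interval[OF x p] congs c)
   (unfold fo_conj, blast intro: rel2_fun_om[OF f])
 then show ?thesis by simp
qed

lemma null_real: "fo p (is_null X) ==> q << p ==> fmem q x X ==> fo q (is_real x)"
 unfolding is_null_def fo_conj fo_ball by blast

lemma cong_is_null: "cong is_null" unfolding is_null_def by (intro congs)

lemma cong_sums: "cong (%s. partial_sums s f)" "cong (%f. partial_sums s f)"
 unfolding partial_sums_def by (intro congs cong_is_fun)+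

text \<open>The maximal principle turns the forced existence of covers into one measurable sequence
  for all elements of the set.\<close>

lemma null_elim:
 assumes n: "fo p (is_null X)" and p: "p \<in> Field P" and e: "0 < rat_of e"
 shows "\<exists>f. mfun f \<and> ev p (%G. \<forall>n. (\<Sum>i<n. ilen (f G i)) \<le> rat_of e) \<and>
  (\<forall>q x. q << p --> fmem q x X --> ev q (%G. \<exists>n. incut (sval x G) (f G n)))"
proof -
 let ?\<psi> = "%f s. Conj (is_fun f om om) (Conj (partial_sums s f)
  (Conj (bounded_by s (nm e))
   (BAll X (%x. covered f x))))"
 have "fo p (rat_less (check_rat 0) (nm e))"
  using TrD'[OF Tr_rel2_check[OF p, of "{(m, n). rat_of m < rat_of n}" "to_nat (0 :: rat)" e] p] e
  unfolding rat_less_def check_rat_def by (simp add: rat_of_to_nat)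
 moreover have "fo p (BAll om (%e. Imp (rat_less (check_rat 0) e) (Ex (%f. Ex (%s. Conj (is_fun f om om) (Conj (partial_sums s f)
  (Conj (bounded_by s e)
   (BAll X (%x. covered f x)))))))))"
  using n unfolding is_null_def fo_conj by blast
 ultimately have h: "fo p (Ex (%f. Ex (?\<psi> f)))"
  using le_refl[OF p] fmem_omI[of p e] unfolding fo_ball[of "om"] fo_imp by blast
 have c1: "cong (%f. Ex (?\<psi> f))" by (intro congs cong_is_fun cong_sums)
 have c2: "cong (?\<psi> f)" for f unfolding rat_le_def by (intro congs cong_sums)
 obtain f where "fo p (Ex (?\<psi> f))" by (rule fo_ex_witness[OF h c1])
 then obtain s where "fo p (?\<psi> f s)" by (rule fo_ex_witness[OF _ c2])
 then have f: "fo p (is_fun f om om)" "fo p (partial_sums s f)"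
  "fo p (bounded_by s (nm e))"
  "fo p (BAll X (%x. covered f x))"
  unfolding fo_conj by blast+
 have s: "fo p (is_fun s om om)" using f(2) unfolding partial_sums_def fo_conj by blast
 show ?thesis
 proof (intro exI[of _ "val f"] conjI allI impI mfun_val)
  show "ev p (%G. \<forall>n. (\<Sum>i<n. ilen (val f G i)) \<le> rat_of e)"
   using f(2)[unfolded TrD'[OF Tr_partial_sums[OF f(1) s p] p]] f(3)[unfolded TrD'[OF Tr_bounded_by[OF s p] p]]
  proof eventually_elim
   case (elim G)
   have "rat_of (val s G n) = (\<Sum>i<n. ilen (val f G i))" for n
    using elim(1) by (induction n) (simp_all add: rat_of_to_nat)
   then show ?case using elim(2) by simp
  qed
  fix q x assume q: "q << p" "fmem q x X"
  then have qF: "q \<in> Field P" using le_field(1) by blast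
  have "fo q (covered f x)" using f(4) q unfolding fo_ball by blast
  then show "ev q (%G. \<exists>n. incut (sval x G) (val f G n))"
   using TrD'[OF Tr_covered[OF fo_mono[OF f(1) q(1)] is_real_sub[OF null_real[OF n q]] qF] qF] by blast
 qed
qed

lemma null_intro:
 assumes real: "!!q x. q << p ==> fmem q x X ==> fo q (is_real x)"
  and ex: "!!e. 0 < rat_of e ==> \<exists>f. mfun f \<and> (\<forall>G n. (\<Sum>i<n. ilen (f G i)) \<le> rat_of e) \<and>
   (\<forall>q x. q << p --> fmem q x X --> ev q (%G. \<exists>n. incut (sval x G) (f G n)))"
 shows "fo p (is_null X)"
 unfolding is_null_def fo_conj
proof
 show "fo p (BAll X is_real)" unfolding fo_ball using real by blast
 show "fo p (BAll om (%e. Imp (rat_less (check_rat 0) e) (Ex (%f. Ex (%s. Conj (is_fun f om om) (Conj (partial_sums s f)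
  (Conj (bounded_by s e)
   (BAll X (%x. covered f x)))))))))"
 proof (subst fo_ball_check[OF smallwo_nat], unfold rat_less_def rat_le_def, intro congs, fold rat_less_def rat_le_def,
   unfold fo_imp, intro ballI allI impI)
  fix e q r assume q: "q << p" "r << q" and e: "fo r (rat_less (check_rat 0) (nm e))"
  have rF: "r \<in> Field P" and rp: "r << p" using le_field(1)[OF q(2)] le_trans[OF q(2,1)] by blast+
  have "0 < rat_of e"
   using TrD'[OF Tr_rel2_check[OF rF, of "{(m, n). rat_of m < rat_of n}" "to_nat (0 :: rat)" e] rF] e ev_const[OF rF]
   unfolding rat_less_def check_rat_def by (simp add: rat_of_to_nat)
  then obtain f where f: "mfun f" "!!G n. (\<Sum>i<n. ilen (f G i)) \<le> rat_of e"
   "!!q x. q << p ==> fmem q x X ==> ev q (%G. \<exists>n. incut (sval x G) (f G n))" using ex by meson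
  define s where "s G n = to_nat (\<Sum>i<n. ilen (f G i))" for G n
  have s: "mfun s" unfolding mfun_def
  proof (intro allI nat_measurableI)
   fix n k show "mpred (%G. s G n = k)" unfolding s_def
    by (rule pred_fin[OF f(1), of n "%h. to_nat (\<Sum>i<n. ilen (h i)) = k"]) (metis (mono_tags, lifting) lessThan_iff sum.cong)
  qed
  note ff = fname_fun[OF f(1)] and sf = fname_fun[OF s] and vf = val_fname[OF f(1)] and vs = val_fname[OF s]
  show "fo r (Ex (%f. Ex (%s. Conj (is_fun f om om) (Conj (partial_sums s f)
   (Conj (bounded_by s (nm e))
   (BAll X (%x. covered f x)))))))"
  proof (rule fo_exI[of _ "fname f"], rule fo_exI[of _ "fname s"], unfold fo_conj, intro conjI ff)
   show "fo r (partial_sums (fname s) (fname f))" unfolding TrD'[OF Tr_partial_sums[OF ff sf rF] rF]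
    using vf[OF rF] vs[OF rF] by eventually_elim (simp add: s_def rat_of_to_nat)
   show "fo r (bounded_by (fname s) (nm e))"
    unfolding TrD'[OF Tr_bounded_by[OF sf rF] rF]
    using vs[OF rF] by eventually_elim (simp add: s_def rat_of_to_nat f(2))
   show "fo r (BAll X (%x. covered (fname f) x))"
    unfolding fo_ball
   proof (intro allI impI)
    fix x t assume t: "t << r" "fmem t x X"
    have tF: "t \<in> Field P" and tp: "t << p" using le_field(1)[OF t(1)] le_trans[OF t(1) rp] by blast+
    show "fo t (covered (fname f) x)"
     unfolding TrD'[OF Tr_covered[OF ff is_real_sub[OF real[OF tp t(2)]] tF] tF]
     using f(3)[OF tp t(2)] vf[OF tF] by eventually_elim simp
   qed
  qed
 qed
qed

text \<open>The blocks from \<open>T\<close> on have total length at most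
  \<open>2 * (1/2) ^ T\<close> and still contain every element of the set, so each tail is a
  cover.\<close>

lemma null_blocks:
 assumes L: "mfun (%G t. to_nat (L G t :: nat list))"
  "!!G t. sum_list (map ilen (L G t)) \<le> (1/2) ^ t"
  and real: "!!q x. q << p ==> fmem q x X ==> fo q (is_real x)"
  and cov: "!!q x T. q << p ==> fmem q x X ==> ev q (%G. \<exists>t\<ge>T. \<exists>j\<in>set (L G t). incut (sval x G) j)"
 shows "fo p (is_null X)"
proof (rule null_intro[OF real])
 fix e assume e: "0 < rat_of e"
 obtain T where "2 / rat_of e < of_nat T" using reals_Archimedean2 by blast
 then have "2 / rat_of e < 2 ^ T" using of_nat_less_two_power[of T] less_trans by blast
 then have T: "2 * (1/2) ^ T \<le> rat_of e" using e by (simp add: field_simps)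
 let ?f = "%G. enumL (%t. L G (T + t))"
 have "mfun ?f" unfolding mfun_def
 proof
  fix i
  let ?t = "fst (prod_decode i)"
  have "?f G i = enumL (%_. from_nat (to_nat (L G (T + ?t)))) i" for G unfolding enumL_def Let_def by simp
  then show "(%G. ?f G i) \<in> measurable M (count_space UNIV)"
   using measurable_compose[OF mfunD[OF L(1), of "T + ?t"], of "%u. enumL (%_. from_nat u) i" "count_space UNIV"] by simp
 qed
 moreover have "(\<Sum>i<n. ilen (?f G i)) \<le> rat_of e" for G n
  using enumL_sum[of "%t. L G (T + t)" T n] L(2) T by (meson order_trans)
 moreover have "ev q (%G. \<exists>n. incut (sval x G) (?f G n))" if "q << p" "fmem q x X" for q x
  using cov[OF that, of T]
 proof eventually_elim
  case (elim G)
  then obtain t j where t: "T \<le> t" "j \<in> set (L G t)" "incut (sval x G) j" by blast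
  have "j \<in> set (L G (T + (t - T)))" using t by simp
  from enumL_mem[of j "%t. L G (T + t)", OF this] show ?case using t(3) by blast
 qed
 ultimately show "\<exists>f. mfun f \<and> (\<forall>G n. (\<Sum>i<n. ilen (f G i)) \<le> rat_of e) \<and>
   (\<forall>q x. q << p --> fmem q x X --> ev q (%G. \<exists>n. incut (sval x G) (f G n)))"
  by (intro exI[of _ ?f]) blast
qed

text \<open>Covers of length \<open>(1/2) ^ j\<close> for all \<open>j\<close> are merged by the
  pairing function; the \<open>m\<close>-th one uses indices from \<open>m\<close> on, which gives
  coverage beyond every place.\<close>

lemma null_limsup:
 assumes n: "fo p (is_null X)" and p: "p \<in> Field P"
 shows "\<exists>g. mfun g \<and> ev p (%G. \<forall>n. (\<Sum>i<n. ilen (g G i)) \<le> 2) \<and>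
  (\<forall>q x m. q << p --> fmem q x X --> ev q (%G. \<exists>i\<ge>m. incut (sval x G) (g G i)))"
proof -
 have "\<forall>j. \<exists>f. mfun f \<and> ev p (%G. \<forall>n. (\<Sum>i<n. ilen (f G i)) \<le> (1/2) ^ j) \<and>
  (\<forall>q x. q << p --> fmem q x X --> ev q (%G. \<exists>n. incut (sval x G) (f G n)))"
  using null_elim[OF n p, of "to_nat ((1/2 :: rat) ^ _)"] by (simp add: rat_of_to_nat)
 from choice[OF this] obtain f where f: "!!j. mfun (f j)" "!!j. ev p (%G. \<forall>n. (\<Sum>i<n. ilen (f j G i)) \<le> (1/2) ^ j)"
  "!!j q x. q << p ==> fmem q x X ==> ev q (%G. \<exists>n. incut (sval x G) (f j G n))" by blast
 let ?g = "%G i. f (fst (prod_decode i)) G (snd (prod_decode i))"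
 show ?thesis
 proof (intro exI[of _ ?g] conjI allI impI)
  show "mfun ?g" unfolding mfun_def using mfunD[OF f(1)] by blast
  have "ev p (%G. \<forall>j n. (\<Sum>i<n. ilen (f j G i)) \<le> (1/2) ^ j)" by (rule ev_all[OF f(2)])
  then show "ev p (%G. \<forall>n. (\<Sum>i<n. ilen (?g G i)) \<le> 2)"
  proof eventually_elim
   case (elim G)
   show ?case using sum_prod_decode[of "%j k. ilen (f j G k)" "%j. (1/2) ^ j"] elim geo_le ilen_nonneg by (meson order_trans)
  qed
  fix q x m assume q: "q << p" "fmem q x X"
  show "ev q (%G. \<exists>i\<ge>m. incut (sval x G) (?g G i))"
   using f(3)[OF q, of m]
  proof eventually_elim
   case (elim G)
   then obtain k where "incut (sval x G) (f m G k)" by blast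
   then show ?case using le_prod_encode_1[of m k] by (intro exI[of _ "prod_encode (m, k)"]) simp
  qed
 qed
qed

lemma pred_pos:
 assumes f: "mfun f" and A: "A \<in> sets lborel" "emeasure lborel A ~= \<infinity>"
 shows "mpred (%G. ennreal e \<le> emeasure lborel (A - (\<Union>i. Iv (f G i))))" "mpred (%G. pos (f G) A)"
proof -
 have "mpred (%G. ennreal e \<le> emeasure lborel (A - (\<Union>i<k. Iv (f G i))))" for k e
 proof (rule pred_fin[OF f, of k "%h. ennreal e \<le> emeasure lborel (A - (\<Union>i<k. Iv (h i)))"])
  fix h h' :: "nat => nat" assume "!!i. i < k ==> h i = h' i"
  then have "(\<Union>i<k. Iv (h i)) = (\<Union>i<k. Iv (h' i))" by simp
  then show "ennreal e \<le> emeasure lborel (A - (\<Union>i<k. Iv (h i))) \<longleftrightarrow> ennreal e \<le> emeasure lborel (A - (\<Union>i<k. Iv (h' i)))"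
   by simp
 qed
 then show 1: "mpred (%G. ennreal e \<le> emeasure lborel (A - (\<Union>i. Iv (f G i))))" for e
  unfolding pos_iff(1)[OF A] by (intro pred_intros_countable)
 show "mpred (%G. pos (f G) A)" unfolding pos_iff(2)[OF A] by (intro pred_intros_countable 1)
qed

lemma mfun_nest:
 assumes f: "mfun f" and c: "mfun c"
 shows "(%G. nest (f G) (c G) k) \<in> measurable M (count_space UNIV)"
proof (induction k)
 case (Suc k)
 have "mpred (%G. nxt (f G) (c G) k s j)" for s j
 proof -
  have "mpred (%G. R (c G n))" for R n using pred_nat2[OF mfunD[OF c] mfunD[OF c], of "%u v. R u" n n] .
  then show ?thesis unfolding nxt_def
   by (intro pred_intros_logic pred_intros_countable pred_pos(2)[OF f Iv_sets(1) Iv_fin]) simp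
 qed
 then have "mpred (%G. nxt (f G) (c G) k (nest (f G) (c G) k) j)" for j
  by (rule measurable_compose_countable[where f = "%s G. nxt (f G) (c G) k s j", OF _ Suc])
 then show ?case unfolding nest.simps by (rule measurable_Least)
qed simp

lemma pred_somewhere_null:
 assumes f: "mfun f" and c: "mfun c"
 shows "mpred (%G. somewhere_null (f G) (c G) s m d)"
proof -
 have "mpred (%G. pos (f G) (Iv s \<inter> Hs n (c G n)))" for n
 proof (rule measurable_compose_countable[where f = "%k G. pos (f G) (Iv s \<inter> Hs n k)", OF _ mfunD[OF c]])
  fix k
  have "emeasure lborel (Iv s \<inter> Hs n k) \<le> emeasure lborel (Iv s)" by (rule emeasure_mono) auto
  then show "mpred (%G. pos (f G) (Iv s \<inter> Hs n k))"
   using Iv_fin[of s] by (intro pred_pos(2)[OF f] sets.Int Iv_sets Hs_sets) (auto simp: top_unique)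
 qed
 then show ?thesis unfolding somewhere_null_def
  by (intro pred_intros_logic pred_intros_countable pred_pos(1)[OF f Iv_sets(1) Iv_fin]) simp_all
qed

lemma mset_Zc: assumes "mfun f" "mfun c" shows "mset (%G. Zc (f G) (c G))"
 unfolding mset_def Zc_def mem_Collect_eq
 by (intro allI pred_intros_countable pred_nat2[OF mfun_nest[OF assms] mfun_nest[OF assms], where R = "%u v. _ < lo u"])

lemma mfun_blk:
 assumes g: "mfun g"
 shows "mfun (%G t. to_nat (blk d (g G) t))"
proof -
 have b: "(%G. brk d (g G) t) \<in> measurable M (count_space UNIV)" for t
  unfolding brk_def
 proof (intro measurable_Least pred_intros_logic pred_intros_countable)
  fix n N
  show "mpred (%G. (\<Sum>i\<in>{n..<N}. ilen (g G i)) \<le> d t)"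
   by (rule pred_fin[OF g, of N "%h. (\<Sum>i\<in>{n..<N}. ilen (h i)) \<le> d t"]) (metis (mono_tags, lifting) atLeastLessThan_iff sum.cong)
 qed simp
 have 1: "mpred (%G. to_nat (map (g G) [u..<v]) = k)" for u v k
 proof (rule pred_fin[OF g, of v "%h. to_nat (map h [u..<v]) = k"])
  fix h h' :: "nat => nat" assume "!!i. i < v ==> h i = h' i"
  then have "map h [u..<v] = map h' [u..<v]" by simp
  then show "to_nat (map h [u..<v]) = k \<longleftrightarrow> to_nat (map h' [u..<v]) = k" by (simp only:)
 qed
 have 2: "mpred (%G. to_nat (map (g G) [brk d (g G) t..<v]) = k)" for t v k
  by (rule measurable_compose_countable[where f = "%u G. to_nat (map (g G) [u..<v]) = k", OF 1 b])
 have "mpred (%G. to_nat (map (g G) [brk d (g G) t..<brk d (g G) (Suc t)]) = k)" for t k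
  by (rule measurable_compose_countable[where f = "%v G. to_nat (map (g G) [brk d (g G) t..<v]) = k", OF 2 b])
 then show ?thesis unfolding mfun_def blk_def by (intro allI nat_measurableI)
qed

end

section \<open>Unions of null sets\<close>

context model
begin

lemma nice_mem:
 assumes "fc.fo q (Subset x om)"
 obtains \<zeta> where "\<zeta> \<in> Field \<Lambda>" "fc.feq q x (nice (nice_enum \<zeta>))"
 using nice_enum_ex[OF assms] by blast

text \<open>Each null set is covered infinitely often by a sequence cut into short blocks. One
  slalom captures the blocks of all these sequences, and the unions of its candidates form a single
  sequence of blocks for all the sets.\<close>

lemma null_union:
 assumes b: "b \<in> Field \<mu>" and p: "p \<in> Field P" and F: "fc.fo p (BAll F is_null)"
  and e: "fc.fo p (equinumerous F (check_elt \<mu> b))"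
 shows "fc.fo p (Ex (%U. Conj (is_Union U F) (is_null U)))"
proof -
 note pp = fc.le_refl[OF p]
 obtain x where x: "!!\<beta>. \<beta> \<in> underS \<mu> b ==> fc.fmem p (x \<beta>) F"
  "!!z q. q << p ==> fc.fmem q z F ==> \<exists>r. r << q \<and> (\<exists>\<beta>\<in>underS \<mu> b. fc.feq r z (x \<beta>))"
  by (rule unpack_elt[OF wo_fields(3) e p], rule that)
 have nx: "fc.fo p (is_null (x \<beta>))" if "\<beta> \<in> underS \<mu> b" for \<beta> using F x(1)[OF that] pp unfolding fc.fo_ball by blast
 let ?\<Psi> = "%\<beta> g. fc.mfun g \<and> ev p (%G. \<forall>n. (\<Sum>i<n. ilen (g G i)) \<le> 2) \<and>
  (\<forall>q z m. q << p --> fc.fmem q z (x \<beta>) --> ev q (%G. \<exists>i\<ge>m. incut (fc.sval z G) (g G i)))"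
 have "\<forall>\<beta>\<in>underS \<mu> b. \<exists>g. ?\<Psi> \<beta> g" using fc.null_limsup[OF nx p] by blast
 from bchoice[OF this] obtain g where g: "\<forall>\<beta>\<in>underS \<mu> b. ?\<Psi> \<beta> (g \<beta>)" by (elim exE)
 \<comment> \<open>With at most \<open>w t\<close> candidates of length at most \<open>d t\<close>,
   the \<open>t\<close>-th union has length at most \<open>(1/2) ^ t\<close>.\<close>
 define d :: "nat => rat" where "d t = (1/2) ^ t / (of_nat (w t) + 1)" for t
 have d: "0 < d t" "d (Suc t) \<le> d t" "of_nat (w t) * d t \<le> (1/2) ^ t" for t
 proof -
  show "0 < d t" unfolding d_def by (intro divide_pos_pos) (simp_all add: add_nonneg_pos)
  have "w t \<le> w (Suc t)" using monoD[OF w_mono, of t "Suc t"] by simp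
  then show "d (Suc t) \<le> d t" unfolding d_def by (intro frac_le) (simp_all add: add_nonneg_pos)
  have "of_nat (w t) / (of_nat (w t) + 1) * (1/2) ^ t \<le> 1 * (1/2 :: rat) ^ t"
   by (intro mult_right_mono) (simp_all add: divide_le_eq add_nonneg_pos)
  then show "of_nat (w t) * d t \<le> (1/2) ^ t" unfolding d_def by simp
 qed
 let ?Z = "%\<beta> G t. to_nat (blk d (g \<beta> G) t)"
 have "|?Z ` underS \<mu> b| <o \<mu>" using ordLeq_ordLess_trans[OF card_of_image card_of_underS[OF mu(1) b]] .
 then obtain s where s: "fc.mfun s" "!!Y p. Y \<in> ?Z ` underS \<mu> b ==>
   ev p (%G. \<exists>m. \<forall>n\<ge>m. Y G n \<in> set_decode (s G n) \<and> card (set_decode (s G n)) \<le> w n)"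
  by (rule slalom[rotated, OF disjI1]) (use g fc.mfun_blk in auto)
 let ?L = "%G t. catL (w t) (d t) (s G t)"
 \<comment> \<open>Elements are taken from the enumerated nice names, which keeps the index set
   within the bound; every real is forced to equal one of these.\<close>
 define U where "U = fc.coll (Field \<Lambda>) (%\<zeta>. nice (nice_enum \<zeta>)) (%\<zeta> r. \<exists>\<beta>\<in>underS \<mu> b. fc.fmem r (nice (nice_enum \<zeta>)) (x \<beta>))"
 have U: "fc.fmem q z U \<longleftrightarrow> (\<forall>q'. q' << q --> (\<exists>r. r << q' \<and> (\<exists>\<zeta>\<in>Field \<Lambda>.
  (\<exists>\<beta>\<in>underS \<mu> b. fc.fmem r (nice (nice_enum \<zeta>)) (x \<beta>)) \<and> fc.feq r z (nice (nice_enum \<zeta>)))))" for q z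
  unfolding U_def by (rule fc.fmem_coll[OF small_fields(4)]) (use fc.fmem_mono in blast)
 have Ux: "\<exists>r \<beta>. r << q' \<and> \<beta> \<in> underS \<mu> b \<and> fc.fmem r z (x \<beta>)" if "fc.fmem q z U" "q' << q" for q z q'
  using that unfolding U using fc.fmem_cong1 fc.feq_sym by meson
 have "fc.fo p (is_Union U F)" unfolding is_Union_def forces.simps(5) fc.fo_iff
 proof (intro allI impI iffI)
  fix z q assume q: "q << p" and h: "fc.fo q (Mem z U)"
  show "fc.fo q (BEx F (%X. Mem z X))" unfolding fc.fo_bex
  proof (intro allI impI)
   fix q' assume q': "q' << q"
   obtain r \<beta> where r: "r << q'" "\<beta> \<in> underS \<mu> b" "fc.fmem r z (x \<beta>)" using Ux[OF h[unfolded forces.simps] q'] by blast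
   have "r << p" using fc.le_trans[OF r(1) fc.le_trans[OF q' q]] .
   then show "\<exists>r y. r << q' \<and> fc.fmem r y F \<and> fc.fo r (Mem z y)" using r fc.fmem_mono[OF x(1)[OF r(2)]] by auto
  qed
 next
  fix z q assume q: "q << p" and h: "fc.fo q (BEx F (%X. Mem z X))"
  have "\<exists>r. r << q' \<and> (\<exists>\<zeta>\<in>Field \<Lambda>. (\<exists>\<beta>\<in>underS \<mu> b. fc.fmem r (nice (nice_enum \<zeta>)) (x \<beta>)) \<and> fc.feq r z (nice (nice_enum \<zeta>)))"
   if q': "q' << q" for q'
  proof -
   obtain r y where r: "r << q'" "fc.fmem r y F" "fc.fmem r z y" using h q' unfolding fc.fo_bex forces.simps by blast
   have rp: "r << p" using fc.le_trans[OF r(1) fc.le_trans[OF q' q]] .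
   obtain r' \<beta> where r': "r' << r" "\<beta> \<in> underS \<mu> b" "fc.feq r' y (x \<beta>)" using x(2)[OF rp r(2)] by blast
   have zx: "fc.fmem r' z (x \<beta>)" using fc.fmem_cong2[OF r'(3) fc.fmem_mono[OF r(3) r'(1)]] .
   have "fc.fo r' (Subset z om)"
    using fc.is_real_sub[OF fc.null_real[OF nx[OF r'(2)] fc.le_trans[OF r'(1) rp] zx]] .
   then obtain \<zeta> where \<zeta>: "\<zeta> \<in> Field \<Lambda>" "fc.feq r' z (nice (nice_enum \<zeta>))" by (rule nice_mem)
   have "fc.fmem r' (nice (nice_enum \<zeta>)) (x \<beta>)" using fc.fmem_cong1[OF \<zeta>(2) zx] .
   then show ?thesis using fc.le_trans[OF r'(1) r(1)] r'(2) \<zeta> by blast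
  qed
  then show "fc.fo q (Mem z U)" unfolding forces.simps U by blast
 qed
 moreover have "fc.fo p (is_null U)"
 proof (rule fc.null_blocks[where L = ?L])
  have "(%G. to_nat (?L G t)) \<in> measurable fc.M (count_space UNIV)" for t
   using measurable_compose[OF fc.mfunD[OF s(1)], of "%u. to_nat (catL (w t) (d t) u)" "count_space UNIV" t] by simp
  then show "fc.mfun (%G t. to_nat (?L G t))" unfolding fc.mfun_def by blast
  show "sum_list (map ilen (?L G t)) \<le> (1/2) ^ t" for G t
   using catL_sum[of "d t" "w t" "s G t"] d(1,3)[of t] by (meson less_imp_le order_trans)
  show "fc.fo q (is_real z)" if q: "q << p" "fc.fmem q z U" for q z
  proof (rule fc.fo_dense)
   fix q' assume q': "q' << q"
   obtain r \<beta> where r: "r << q'" "\<beta> \<in> underS \<mu> b" "fc.fmem r z (x \<beta>)" using Ux[OF q(2) q'] by blast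
   have "r << p" using fc.le_trans[OF r(1) fc.le_trans[OF q' q(1)]] .
   then show "\<exists>r. r << q' \<and> fc.fo r (is_real z)" using fc.null_real[OF nx[OF r(2)] _ r(3)] r(1) by blast
  qed
  show "ev q (%G. \<exists>t\<ge>T. \<exists>j\<in>set (?L G t). incut (fc.sval z G) j)" if q: "q << p" "fc.fmem q z U" for q z T
  proof (rule fc.ev_gen_dense[OF fc.le_field(1)[OF q(1)]])
   fix q' assume q': "q' << q"
   obtain r \<beta> where r: "r << q'" "\<beta> \<in> underS \<mu> b" "fc.fmem r z (x \<beta>)" using Ux[OF q(2) q'] by blast
   have rp: "r << p" using fc.le_trans[OF r(1) fc.le_trans[OF q' q(1)]] .
   have 1: "ev r (%G. \<forall>n. (\<Sum>i<n. ilen (g \<beta> G i)) \<le> 2)" using g r(2) fc.ev_gen_le[OF _ rp] by blast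
   have 2: "ev r (%G. \<forall>m. \<exists>i\<ge>m. incut (fc.sval z G) (g \<beta> G i))"
    using g r(2,3) rp by (intro fc.ev_all) blast
   have "ev r (%G. \<exists>m. \<forall>n\<ge>m. ?Z \<beta> G n \<in> set_decode (s G n) \<and> card (set_decode (s G n)) \<le> w n)"
    by (rule s(2)) (use r(2) in blast)
   with 1 2 have "ev r (%G. \<exists>t\<ge>T. \<exists>j\<in>set (?L G t). incut (fc.sval z G) j)"
   proof eventually_elim
    case (elim G)
    obtain m where m: "!!n. n \<ge> m ==> ?Z \<beta> G n \<in> set_decode (s G n) \<and> card (set_decode (s G n)) \<le> w n" using elim(3) by blast
    note bl = blk[of d "g \<beta> G" 2, OF d(1,2) spec[OF elim(1)]]
    obtain t j where t: "t \<ge> max m T" "j \<in> set (blk d (g \<beta> G) t)" "incut (fc.sval z G) j"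
     using bl(2)[of "incut (fc.sval z G)" "max m T", OF spec[OF elim(2)]] by blast
    have "j \<in> set (?L G t)" by (rule catL_mem[OF _ _ bl(1) t(2)]) (use m[of t] t(1) in auto)
    then show ?case using t(1,3) by (intro exI[of _ t]) auto
   qed
   then show "\<exists>r. r << q' \<and> ev r (%G. \<exists>t\<ge>T. \<exists>j\<in>set (?L G t). incut (fc.sval z G) j)" using r(1) by blast
  qed
 qed
 ultimately have "fc.fo p (Conj (is_Union U F) (is_null U))" unfolding fc.fo_conj ..
 then show ?thesis by (rule fc.fo_exI)
qed

text \<open>The label fixes where the construction gets stuck. The amalgamated Cohen reals take
  \<open>M\<close> different values at one place \<open>n\<close>, so \<open>M\<close> independent
  digit sets of measure \<open>1 / 2 ^ n\<close> miss the same set almost everywhere, which makes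
  its measure less than \<open>1 / (d + 1)\<close>.\<close>

lemma no_cover:
 assumes r: "r \<in> Field P" and f: "fc.mfun f"
  and h: "!!\<xi>. \<xi> \<in> Field \<mu> ==> ev r (%G. \<exists>s m d. somewhere_null (f G) (cr \<mu> \<xi> G) s m d)"
 shows False
proof -
 let ?\<Phi> = "%\<xi> k G. somewhere_null (f G) (cr \<mu> \<xi> G) (fst (from_nat k :: nat \<times> nat \<times> nat)) (fst (snd (from_nat k :: nat \<times> nat \<times> nat))) (snd (snd (from_nat k :: nat \<times> nat \<times> nat)))"
 have "\<exists>t. (fst t, r) \<in> P \<and> ev (fst t) (?\<Phi> \<xi> (snd t))" if \<xi>: "\<xi> \<in> Field \<mu>" for \<xi>
 proof -
  have "ev r (%G. \<exists>k. ?\<Phi> \<xi> k G)" using h[OF \<xi>]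
  proof eventually_elim
   case (elim G)
   then obtain s m d where "somewhere_null (f G) (cr \<mu> \<xi> G) s m d" by blast
   then show ?case by (intro exI[of _ "to_nat (s, m, d)"]) simp
  qed
  then obtain q k where "q << r" "ev q (?\<Phi> \<xi> k)"
   using fc.ev_ex_nat[of "?\<Phi> \<xi>", OF fc.pred_somewhere_null[OF f mfun_cr] r] by blast
  then show ?thesis by (intro exI[of _ "(q, k)"]) simp
 qed
 then have "\<forall>\<xi>\<in>Field \<mu>. \<exists>t. (fst t, r) \<in> P \<and> ev (fst t) (?\<Phi> \<xi> (snd t))" by blast
 from bchoice[OF this] obtain t where t: "\<forall>\<xi>\<in>Field \<mu>. fst (t \<xi>) << r \<and> ev (fst (t \<xi>)) (?\<Phi> \<xi> (snd (t \<xi>)))"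
  by (elim exE)
 have tF: "fst (t \<xi>) \<in> Field P" if "\<xi> \<in> Field \<mu>" for \<xi> using fc.le_field(1) t that by blast
 obtain n0 k where nk: "\<forall>n\<ge>n0. \<forall>M. \<exists>\<xi> T. card T = M \<and> finite T \<and> (\<exists>q\<in>Field P. \<forall>l\<in>T. \<xi> l \<in> Field \<mu> \<and>
  snd (t (\<xi> l)) = k \<and> q << fst (t (\<xi> l)) \<and> ev q (%G. cr \<mu> (\<xi> l) G n = l))"
  by (rule exE[OF ub_mu[of "%\<xi>. fst (t \<xi>)" "%\<xi>. snd (t \<xi>)"]], rule tF, assumption, elim exE)
 obtain s m d where smd: "(from_nat k :: nat \<times> nat \<times> nat) = (s, m, d)" by (rule prod_cases3)
 \<comment> \<open>The place must be late enough both for the amalgamation and for the digit sets to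
   be missed there.\<close>
 let ?n = "max n0 m"
 obtain M where M: "(1 - 1 / 2 ^ ?n :: real) ^ M < 1 / real (Suc d)"
  using real_arch_pow_inv[of "1 / real (Suc d)" "1 - 1 / 2 ^ ?n"] by auto
 obtain \<xi> T q where T: "card T = M" "finite T" and q: "q \<in> Field P" and l: "!!l. l \<in> T ==> \<xi> l \<in> Field \<mu> \<and>
  snd (t (\<xi> l)) = k \<and> q << fst (t (\<xi> l)) \<and> ev q (%G. cr \<mu> (\<xi> l) G ?n = l)"
  using nk[rule_format, of ?n M] by auto
 have "ev q (%G. cr \<mu> (\<xi> l) G ?n = l \<and> somewhere_null (f G) (cr \<mu> (\<xi> l) G) s m d)" if "l \<in> T" for l
 proof -
  have 1: "\<xi> l \<in> Field \<mu>" "snd (t (\<xi> l)) = k" "q << fst (t (\<xi> l))" "ev q (%G. cr \<mu> (\<xi> l) G ?n = l)"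
   using l[OF that] by blast+
  have "ev (fst (t (\<xi> l))) (?\<Phi> (\<xi> l) (snd (t (\<xi> l))))" using bspec[OF t 1(1)] by blast
  from fc.ev_gen_le[OF this 1(3)] have "ev q (?\<Phi> (\<xi> l) k)" unfolding 1(2) .
  then show ?thesis using 1(4) unfolding smd by (simp add: eventually_conj_iff)
 qed
 then have "ev q (%G. \<forall>l\<in>T. cr \<mu> (\<xi> l) G ?n = l \<and> somewhere_null (f G) (cr \<mu> (\<xi> l) G) s m d)"
  by (rule fc.ev_all_countable) (assumption, rule countable_finite[OF T(2)])
 then have "ev q (%G. False)"
 proof eventually_elim
  case (elim G)
  let ?E = "Iv s - (\<Union>i. Iv (f G i))"
  have "T ~= {}" using M T(1) by (auto simp: divide_less_eq)
  then obtain l0 where "l0 \<in> T" by blast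
  then have s: "0 \<le> lo s" "hi s \<le> 1" "ennreal (1 / real (Suc d)) \<le> emeasure lborel ?E"
   using elim unfolding somewhere_null_def by blast+
  have "emeasure lborel ?E \<le> ennreal ((1 - 1 / 2 ^ ?n) ^ card T)"
  proof (rule H_independent[OF _ _ T(2)])
   show "?E \<in> sets lborel" by (intro sets.Diff sets.countable_UN) auto
   show "?E \<subseteq> {0<..<1}"
   proof
    fix x assume "x \<in> ?E"
    then have x: "of_rat (lo s) < x" "x < of_rat (hi s)" unfolding Iv_def by auto
    have "0 \<le> (of_rat (lo s) :: real)" "(of_rat (hi s) :: real) \<le> 1" using s(1,2) by simp_all
    from le_less_trans[OF this(1) x(1)] less_le_trans[OF x(2) this(2)] show "x \<in> {0<..<1}" by simp
   qed
   fix l assume "l \<in> T"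
   then have "\<not> pos (f G) (Iv s \<inter> Hs ?n l)" using elim unfolding somewhere_null_def by (metis max.cobounded2)
   moreover have "?E \<inter> Hs ?n l = Iv s \<inter> Hs ?n l - (\<Union>i. Iv (f G i))" by blast
   ultimately show "emeasure lborel (?E \<inter> Hs ?n l) = 0" unfolding pos_def by simp
  qed
  also have "\<dots> < ennreal (1 / real (Suc d))" unfolding T(1) by (rule ennreal_lessI[OF _ M]) simp
  finally show False using s(3) by simp
 qed
 then show False using fc.gen_nontriv q by blast
qed

text \<open>The null set of \<open>\<xi>\<close> consists of the reals that lie, for infinitely many
  \<open>t\<close>, in the digit set chosen by the Cohen real at \<open>t\<close>. By
  \<open>no_cover\<close> the construction is not stuck for every \<open>\<xi>\<close>, and where it
  is not, it yields an element that a cover of total length at most \<open>1/2\<close> leaves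
  out.\<close>

lemma non_null_union:
 "\<exists>y. \<forall>p\<in>Field P. fc.fo p (Conj (BAll (check_set (y ` Field \<mu>)) is_null)
   (Neg (Ex (%U. Conj (is_Union U (check_set (y ` Field \<mu>))) (is_null U)))))"
proof -
 let ?\<tau> = "%\<zeta>. nice (nice_enum \<zeta>)"
 define Q where "Q \<xi> \<zeta> r \<longleftrightarrow> r \<in> Field P \<and> fc.fo r (is_real (?\<tau> \<zeta>)) \<and>
  ev r (%G. \<forall>T. \<exists>t\<ge>T. \<exists>j\<in>set (Hl t (cr \<mu> \<xi> G t)). incut (fc.sval (?\<tau> \<zeta>) G) j)" for \<xi> \<zeta> r
 define N where "N \<xi> = fc.coll (Field \<Lambda>) ?\<tau> (Q \<xi>)" for \<xi>
 have Q: "Q \<xi> \<zeta> r'" if "Q \<xi> \<zeta> r" "r' << r" for \<xi> \<zeta> r r'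
  using that fc.le_field(1)[OF that(2)] fc.fo_mono[OF _ that(2)] fc.ev_gen_le[OF _ that(2)] unfolding Q_def by blast
 have N: "fc.fmem q z (N \<xi>) \<longleftrightarrow> (\<forall>q'. q' << q --> (\<exists>r. r << q' \<and> (\<exists>\<zeta>\<in>Field \<Lambda>. Q \<xi> \<zeta> r \<and> fc.feq r z (?\<tau> \<zeta>))))" for q z \<xi>
  unfolding N_def by (rule fc.fmem_coll[OF small_fields(4)]) (rule Q)
 have cr: "fc.cong is_real" unfolding is_real_def rat_less_def BAll_def BEx_def by (intro fc.congs)
 let ?F = "check_set (N ` Field \<mu>)"
 have sF: "fc.small (N ` Field \<mu>)" by (intro fc.small_image small_fields(3))
 have null: "fc.fo p (is_null (N \<xi>))" for p \<xi>
 proof (rule fc.null_blocks[where L = "%G t. Hl t (cr \<mu> \<xi> G t)"])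
  show "fc.mfun (%G t. to_nat (Hl t (cr \<mu> \<xi> G t)))" unfolding fc.mfun_def
   using measurable_compose[OF fc.mfunD[OF mfun_cr], of "%u. to_nat (Hl _ u)" "count_space UNIV"] by simp
  show "sum_list (map ilen (Hl t (cr \<mu> \<xi> G t))) \<le> (1/2) ^ t" for G t unfolding Hl_sum ..
  show "fc.fo q (is_real z)" if h: "fc.fmem q z (N \<xi>)" for q z
  proof (rule fc.fo_dense)
   fix q' assume "q' << q"
   then obtain r' \<zeta> where "r' << q'" "Q \<xi> \<zeta> r'" "fc.feq r' z (?\<tau> \<zeta>)" using h unfolding N by blast
   then show "\<exists>r. r << q' \<and> fc.fo r (is_real z)" using fc.cong_fo[OF cr, of r' z "?\<tau> \<zeta>"] unfolding Q_def by blast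
  qed
  show "ev q (%G. \<exists>t\<ge>T. \<exists>j\<in>set (Hl t (cr \<mu> \<xi> G t)). incut (fc.sval z G) j)"
   if qp: "q << p" and h: "fc.fmem q z (N \<xi>)" for q z T
  proof (rule fc.ev_gen_dense[OF fc.le_field(1)[OF qp]])
   fix q' assume "q' << q"
   then obtain r' \<zeta> where r': "r' << q'" "Q \<xi> \<zeta> r'" "fc.feq r' z (?\<tau> \<zeta>)" using h unfolding N by blast
   have "ev r' (%G. \<forall>T. \<exists>t\<ge>T. \<exists>j\<in>set (Hl t (cr \<mu> \<xi> G t)). incut (fc.sval (?\<tau> \<zeta>) G) j)"
    using r'(2) unfolding Q_def by blast
   then have "ev r' (%G. \<exists>t\<ge>T. \<exists>j\<in>set (Hl t (cr \<mu> \<xi> G t)). incut (fc.sval z G) j)"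
    using fc.sub_om_ev[OF r'(3) fc.le_field(1)[OF r'(1)]] by eventually_elim simp
   then show "\<exists>r. r << q' \<and> ev r (%G. \<exists>t\<ge>T. \<exists>j\<in>set (Hl t (cr \<mu> \<xi> G t)). incut (fc.sval z G) j)"
    using r'(1) by blast
  qed
 qed
 have "fc.fo p (Neg (Ex (%U. Conj (is_Union U ?F) (is_null U))))" for p
  unfolding fc.fo_neg
 proof (intro allI impI notI)
  fix q assume q: "q << p" and h: "fc.fo q (Ex (%U. Conj (is_Union U ?F) (is_null U)))"
  obtain r U where r: "r << q" "fc.fo r (is_Union U ?F)" "fc.fo r (is_null U)"
   using h fc.le_refl1(1)[OF q] unfolding fc.fo_ex fc.fo_conj by blast
  have rF: "r \<in> Field P" using fc.le_field(1)[OF r(1)] .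
  have "0 < rat_of (to_nat (1/2 :: rat))" by (simp add: rat_of_to_nat)
  from fc.null_elim[OF r(3) rF this] obtain f where f: "fc.mfun f" "ev r (%G. \<forall>n. (\<Sum>i<n. ilen (f G i)) \<le> 1/2)"
   "!!q x. q << r ==> fc.fmem q x U ==> ev q (%G. \<exists>n. incut (fc.sval x G) (f G n))"
   unfolding rat_of_to_nat by blast
  show False
  proof (rule no_cover[OF rF f(1)], rule ccontr)
   fix \<xi> assume \<xi>: "\<xi> \<in> Field \<mu>" and n: "\<not> ev r (%G. \<exists>s m d. somewhere_null (f G) (cr \<mu> \<xi> G) s m d)"
   have "mpred (%G. \<exists>s m d. somewhere_null (f G) (cr \<mu> \<xi> G) s m d)"
    by (intro pred_intros_countable fc.pred_somewhere_null[OF f(1) mfun_cr])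
   then obtain u where u: "u << r" "ev u (%G. \<not> (\<exists>s m d. somewhere_null (f G) (cr \<mu> \<xi> G) s m d))"
    using fc.ev_refute[OF _ rF n] by blast
   have uF: "u \<in> Field P" using fc.le_field(1)[OF u(1)] .
   let ?z = "fc.sname (%G. Zc (f G) (cr \<mu> \<xi> G))"
   note zv = fc.sval_sname[OF fc.mset_Zc[OF f(1) mfun_cr[of \<mu> \<xi>]] uF]
   have Z: "ev u (%G. cut (fc.sval ?z G) \<and> (\<forall>T. \<exists>t\<ge>T. \<exists>j\<in>set (Hl t (cr \<mu> \<xi> G t)). incut (fc.sval ?z G) j) \<and>
    (\<forall>i. \<not> incut (fc.sval ?z G) (f G i)))"
    using u(2) zv fc.ev_gen_le[OF f(2) u(1)]
   proof eventually_elim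
    case (elim G)
    have 1: "!!s m d. \<not> somewhere_null (f G) (cr \<mu> \<xi> G) s m d" using elim(1) by blast
    show ?case unfolding elim(2) using Zc[OF 1 spec[OF elim(3)]] by blast
   qed
   have "ev u (%G. cut (fc.sval ?z G))" using Z by eventually_elim blast
   then have real: "fc.fo u (is_real ?z)" using fc.TrD'[OF fc.Tr_is_real[OF fc.sname_sub uF] uF] by blast
   obtain \<zeta> where \<zeta>: "\<zeta> \<in> Field \<Lambda>" "fc.feq u ?z (?\<tau> \<zeta>)" by (rule nice_mem[OF fc.sname_sub])
   have "fc.fo u (is_real (?\<tau> \<zeta>))" using fc.cong_fo[OF cr \<zeta>(2) uF] real by blast
   moreover have "ev u (%G. \<forall>T. \<exists>t\<ge>T. \<exists>j\<in>set (Hl t (cr \<mu> \<xi> G t)). incut (fc.sval (?\<tau> \<zeta>) G) j)"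
    using Z fc.sub_om_ev[OF \<zeta>(2) uF] by eventually_elim simp
   ultimately have "Q \<xi> \<zeta> u" using uF unfolding Q_def by blast
   then have zN: "fc.fmem u ?z (N \<xi>)" unfolding N using Q \<zeta> fc.feq_mono fc.le_refl1(1) by blast
   have NF: "fc.fmem u (N \<xi>) ?F" by (intro fc.fmem_check_setI sF imageI \<xi>)
   have "fc.fo u (BEx ?F (%X. Mem ?z X))" unfolding fc.fo_bex forces.simps
    using zN NF fc.fmem_mono fc.le_refl1(1) by blast
   then have "fc.fmem u ?z U" using r(2) u(1) unfolding is_Union_def forces.simps(5) fc.fo_iff by auto
   then have "ev u (%G. \<exists>n. incut (fc.sval ?z G) (f G n))" using f(3)[OF u(1)] by blast
   then have "ev u (%G. False)" using Z by eventually_elim blast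
   then show False using fc.gen_nontriv uF by blast
  qed
 qed
 moreover have "fc.fo p (BAll ?F is_null)" for p
  by (rule fc.fo_ball_check_set[OF fc.cong_is_null sF]) (use null in blast)
 ultimately show ?thesis unfolding fc.fo_conj by (intro exI[of _ N]) blast
qed

lemma add_null:
 assumes p: "p \<in> Field P"
 shows "fc.fo p (add_null_eq (check_ord \<mu>))"
proof -
 obtain y where y: "\<forall>p\<in>Field P. fc.fo p (Conj (BAll (check_set (y ` Field \<mu>)) is_null)
   (Neg (Ex (%U. Conj (is_Union U (check_set (y ` Field \<mu>))) (is_null U)))))"
  using non_null_union by blast
 show ?thesis unfolding add_null_eq_def
 proof (rule fc.least_card_forced[OF mu(1,2) small_fields(3) notI _ p])
  show "fc.fo p (Conj (BAll (check_set (y ` Field \<mu>)) is_null)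
   (Neg (Ex (%U. Conj (is_Union U (check_set (y ` Field \<mu>))) (is_null U)))))" if "p \<in> Field P" for p
   using bspec[OF y that] .
 next
  fix b p F assume b: "b \<in> Field \<mu>" and p: "p \<in> Field P"
   and h: "fc.fo p (Conj (BAll F is_null) (Neg (Ex (%U. Conj (is_Union U F) (is_null U)))))"
   and e: "fc.fo p (equinumerous F (check_elt \<mu> b))"
  have "fc.fo p (BAll F is_null)" using h unfolding fc.fo_conj by blast
  from null_union[OF b p this e] show False using h fc.le_refl[OF p] unfolding fc.fo_conj fc.fo_neg by blast
 qed
qed

end

section \<open>The theorem\<close>

theorem theorem6p2:
  fixes \<mu> \<nu> \<kappa> \<Lambda> :: "'u rel"
    and c :: "nat \<Rightarrow> nat" and a :: "nat \<Rightarrow> nat set"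
  assumes "Card_order \<mu>" "Card_order \<nu>" "Card_order \<kappa>" "Card_order \<Lambda>"
    and "natLeq <o \<mu>" "natLeq <o \<nu>" "natLeq <o \<kappa>"
    and "regularCard \<mu>" "regularCard \<nu>" "regularCard \<kappa>"
    and "\<mu> \<le>o \<nu>" "\<nu> \<le>o \<kappa>"
    and "pow_less \<Lambda> \<kappa> =o \<Lambda>"
    and "\<And>i. 2 \<le> c i" "filterlim c at_top sequentially"
    and "index_partition a"
    and "Ic_nontrivial c a"
  shows "\<exists>P :: 'u set rel. Field P \<noteq> {} \<and> Partial_order P \<and> ccc P \<and>
    P \<tturnstile> (add_null_eq (check_ord \<mu>) \<^bold>\<and> b_ideal_eq (in_Ic c a) (check_ord \<nu>) \<^bold>\<and>
        bounding_eq (check_ord \<kappa>) \<^bold>\<and> continuum_eq (check_ord \<Lambda>))"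
proof -
  interpret m: model \<Lambda> \<kappa> \<mu> \<nu> c a by unfold_locales (fact assms)+
  have "m.P \<tturnstile> (add_null_eq (check_ord \<mu>) \<^bold>\<and> b_ideal_eq (in_Ic c a) (check_ord \<nu>) \<^bold>\<and>
        bounding_eq (check_ord \<kappa>) \<^bold>\<and> continuum_eq (check_ord \<Lambda>))"
    unfolding all_force_def m.fc.fo_conj
    using m.add_null m.b_ideal[OF assms(16,17)] m.bounding m.continuum by blast
  moreover have "Field m.P \<noteq> {}" using m.fc.ne .
  ultimately show ?thesis using m.po_P m.ccc_P by blast
qed

end
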